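(* Let $k$ be an algebraically closed field of characteristic zero and let $H$ be a semisimple Hopf algebra over $k$ of dimension $60$. Suppose $H$ is of type $(1,12;4,3)$ as a coalgebra, that is, $H\simeq k^{(12)}\oplus M_4(k)^{(3)}$ as a coalgebra, where $M_4(k)$ denotes the full $4\times 4$ matrix coalgebra. If $H$ is simple as a Hopf algebra, then $H\simeq\mathcal A_0$, where $\mathcal A_0=(k\mathbb A_5)^J$ is the twisted group algebra described in the context.
   Context: A Hopf subalgebra $K\subseteq H$ is normal if it is stable under the left adjoint action of $H$. $H$ is simple (as a Hopf algebra) if it contains no normal Hopf subalgebra other than $k1$ and $H$. $\mathbb A_5$ is the alternating group on five letters. For an invertible twist $J\in L\otimes L$ of a Hopf algebra $L$, $L^J$ is the Hopf algebra with the same algebra and counit as $L$ and comultiplication $\Delta^J(h)=J^{-1}\Delta(h)J$. Let $V\subseteq\mathbb A_5$ be a subgroup isomorphic to $\mathbb Z_2\times\mathbb Z_2$, with character group $\widehat V$, and let $\alpha:\widehat V\times\widehat V\to k^\times$ be a (normalized) $2$-cocycle which is nondegenerate, i.e. the bicharacter $\alpha(\chi,\psi)\alpha(\psi,\chi)^{-1}$ is nondegenerate. Then $\mathcal A_0=(k\mathbb A_5)^J$ with $J=\sum_{\chi,\psi\in\widehat V}\alpha(\chi,\psi)\,e_\chi\otimes e_\psi\in kV\otimes kV\subseteq k\mathbb A_5\otimes k\mathbb A_5$, where $e_\chi\in kV$ is the primitive idempotent of $\chi$. *)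

theory Defs
  imports
    "HOL-Computational_Algebra.Polynomial"
    "HOL-Library.Function_Algebras"
    "HOL-Library.Numeral_Type"
    "HOL-Library.Poly_Mapping"
    "HOL-Library.Product_Plus"
    "HOL-Analysis.Finite_Cartesian_Product"
    "HOL-Algebra.Elementary_Groups"
    "HOL-Algebra.Sym_Groups"
begin

section \<open>Tensor products of vector spaces\<close>

text \<open>
  The tensor product of two vector spaces \<open>A\<close> and \<open>B\<close> over a field \<open>k\<close> is realised inside the
  space of functionals on bilinear forms: \<open>v \<otimes> w\<close> is evaluation at \<open>(v, w)\<close>, and \<open>A \<otimes> B\<close> consists
  of the finite sums of such evaluations.  Over a field this is the usual tensor product; lemma
  \<open>tens_lift_sum\<close> below is its universal property.  The value \<open>0\<close> on functions that are not
  bilinear only serves to make \<open>tens\<close> total.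
\<close>

type_synonym ('k, 'a, 'b) tensor = "('a \<Rightarrow> 'b \<Rightarrow> 'k) \<Rightarrow> 'k"

definition bilinear_map ::
  "('k::field \<Rightarrow> 'a::ab_group_add \<Rightarrow> 'a) \<Rightarrow> ('k \<Rightarrow> 'b::ab_group_add \<Rightarrow> 'b) \<Rightarrow>
   ('k \<Rightarrow> 'c::ab_group_add \<Rightarrow> 'c) \<Rightarrow> ('a \<Rightarrow> 'b \<Rightarrow> 'c) \<Rightarrow> bool"
  where "bilinear_map sa sb sc f \<longleftrightarrow>
    (\<forall>v. Vector_Spaces.linear sb sc (f v)) \<and> (\<forall>w. Vector_Spaces.linear sa sc (\<lambda>v. f v w))"

definition tens ::
  "('k::field \<Rightarrow> 'a::ab_group_add \<Rightarrow> 'a) \<Rightarrow> ('k \<Rightarrow> 'b::ab_group_add \<Rightarrow> 'b) \<Rightarrow>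
   'a \<Rightarrow> 'b \<Rightarrow> ('k, 'a, 'b) tensor"
  where "tens sa sb v w = (\<lambda>B. if bilinear_map sa sb (*) B then B v w else 0)"

definition tens_scale :: "'k::field \<Rightarrow> ('k, 'a, 'b) tensor \<Rightarrow> ('k, 'a, 'b) tensor"
  where "tens_scale c t = (\<lambda>B. c * t B)"

text \<open>For subspaces \<open>X\<close> and \<open>Y\<close>, the subspace \<open>X \<otimes> Y\<close> of the ambient tensor product.\<close>

definition tens_space ::
  "('k::field \<Rightarrow> 'a::ab_group_add \<Rightarrow> 'a) \<Rightarrow> ('k \<Rightarrow> 'b::ab_group_add \<Rightarrow> 'b) \<Rightarrow>
   'a set \<Rightarrow> 'b set \<Rightarrow> ('k, 'a, 'b) tensor set"
  where "tens_space sa sb X Y = {(\<Sum>(v, w)\<leftarrow>xs. tens sa sb v w) | xs. set xs \<subseteq> X \<times> Y}"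

definition tens_lift ::
  "('k::field \<Rightarrow> 'a::ab_group_add \<Rightarrow> 'a) \<Rightarrow> ('k \<Rightarrow> 'b::ab_group_add \<Rightarrow> 'b) \<Rightarrow>
   ('a \<Rightarrow> 'b \<Rightarrow> 'c::ab_group_add) \<Rightarrow> ('k, 'a, 'b) tensor \<Rightarrow> 'c"
  where "tens_lift sa sb f t =
    (THE y. \<exists>xs. t = (\<Sum>(v, w)\<leftarrow>xs. tens sa sb v w) \<and> y = (\<Sum>(v, w)\<leftarrow>xs. f v w))"

lemma ex_linear_functional:
  fixes sc :: "'k::field \<Rightarrow> 'c::ab_group_add \<Rightarrow> 'c"
  assumes "vector_space sc" "d \<noteq> 0"
  shows "\<exists>\<phi>. Vector_Spaces.linear sc (*) \<phi> \<and> \<phi> d = 1"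
proof -
  interpret c: vector_space sc by fact
  have k: "vector_space ((*) :: 'k \<Rightarrow> 'k \<Rightarrow> 'k)"
    by unfold_locales (simp_all add: algebra_simps)
  interpret p: vector_space_pair sc "(*) :: 'k \<Rightarrow> 'k \<Rightarrow> 'k"
    using k assms(1) by (simp add: vector_space_pair_def)
  have "c.independent {d}" using assms(2) by (simp add: c.dependent_single)
  from p.linear_independent_extend[OF this, of "\<lambda>_. 1"] show ?thesis by auto
qed

lemma tens_lift_sum:
  fixes sc :: "'k::field \<Rightarrow> 'c::ab_group_add \<Rightarrow> 'c"
  assumes "vector_space sc" and f: "bilinear_map sa sb sc f"
  shows "tens_lift sa sb f (\<Sum>(v, w)\<leftarrow>xs. tens sa sb v w) = (\<Sum>(v, w)\<leftarrow>xs. f v w)"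
  unfolding tens_lift_def
proof (rule the_equality)
  fix y
  assume "\<exists>ys. (\<Sum>(v, w)\<leftarrow>xs. tens sa sb v w) = (\<Sum>(v, w)\<leftarrow>ys. tens sa sb v w)
                \<and> y = (\<Sum>(v, w)\<leftarrow>ys. f v w)"
  then obtain ys where ys: "(\<Sum>(v, w)\<leftarrow>xs. tens sa sb v w) = (\<Sum>(v, w)\<leftarrow>ys. tens sa sb v w)"
    and y: "y = (\<Sum>(v, w)\<leftarrow>ys. f v w)" by blast
  show "y = (\<Sum>(v, w)\<leftarrow>xs. f v w)"
  proof (rule ccontr)
    let ?d = "(\<Sum>(v, w)\<leftarrow>ys. f v w) - (\<Sum>(v, w)\<leftarrow>xs. f v w)"
    assume "y \<noteq> (\<Sum>(v, w)\<leftarrow>xs. f v w)"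
    then have "?d \<noteq> 0" using y by simp
    then obtain \<phi> where \<phi>: "Vector_Spaces.linear sc (*) \<phi>" "\<phi> ?d = 1"
      using ex_linear_functional[OF assms(1)] by blast
    interpret \<phi>: Vector_Spaces.linear sc "(*)" \<phi> by fact
    have \<phi>sum: "\<phi> (\<Sum>(v, w)\<leftarrow>zs. f v w) = (\<Sum>(v, w)\<leftarrow>zs. \<phi> (f v w))" for zs
      by (induction zs) (auto simp: \<phi>.add \<phi>.zero)
    let ?B = "\<lambda>v w. \<phi> (f v w)"
    have "Vector_Spaces.linear sb (*) (?B v)" "Vector_Spaces.linear sa (*) (\<lambda>v. ?B v w)" for v w
    proof -
      have "Vector_Spaces.linear sb sc (f v)" "Vector_Spaces.linear sa sc (\<lambda>v. f v w)"
        using f by (simp_all add: bilinear_map_def)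
      from this[THEN Vector_Spaces.linear_compose[OF _ \<phi>(1)]]
      show "Vector_Spaces.linear sb (*) (?B v)" "Vector_Spaces.linear sa (*) (\<lambda>v. ?B v w)"
        by (simp_all only: comp_def)
    qed
    then have B: "bilinear_map sa sb (*) ?B"
      by (simp add: bilinear_map_def)
    have ev: "(\<Sum>(v, w)\<leftarrow>zs. tens sa sb v w) ?B = (\<Sum>(v, w)\<leftarrow>zs. \<phi> (f v w))" for zs
      by (induction zs) (use B in \<open>auto simp: tens_def\<close>)
    have "\<phi> (\<Sum>(v, w)\<leftarrow>xs. f v w) = \<phi> (\<Sum>(v, w)\<leftarrow>ys. f v w)"
      using fun_cong[OF ys, of ?B] by (simp only: \<phi>sum ev)
    then show False using \<phi>(2) by (simp add: \<phi>.diff)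
  qed
qed blast


section \<open>Coalgebras\<close>

record ('k, 'c) coalg =
  scal :: "'k \<Rightarrow> 'c \<Rightarrow> 'c"
  comult :: "'c \<Rightarrow> ('k, 'c, 'c) tensor"
  counit :: "'c \<Rightarrow> 'k"

abbreviation "tens2 C \<equiv> tens (scal C) (scal C)"

abbreviation "tens2_lift C \<equiv> tens_lift (scal C) (scal C)"

abbreviation "tens2_space C X \<equiv> tens_space (scal C) (scal C) X X"

definition tens3 ::
  "('k::field, 'c::ab_group_add) coalg \<Rightarrow> 'c \<Rightarrow> 'c \<Rightarrow> 'c \<Rightarrow> ('k, 'c, ('k, 'c, 'c) tensor) tensor"
  where "tens3 C x y z = tens (scal C) tens_scale x (tens2 C y z)"

definition tens2_map ::
  "('k::field, 'c::ab_group_add) coalg \<Rightarrow> ('k, 'd::ab_group_add) coalg \<Rightarrow>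
   ('c \<Rightarrow> 'd) \<Rightarrow> ('k, 'c, 'c) tensor \<Rightarrow> ('k, 'd, 'd) tensor"
  where "tens2_map C D f = tens2_lift C (\<lambda>x y. tens2 D (f x) (f y))"

text \<open>
  Coassociativity is stated in \<open>C \<otimes> (C \<otimes> C)\<close>; the left-hand side is \<open>\<Delta> \<otimes> id\<close> applied to \<open>\<Delta> x\<close>,
  followed by the associativity isomorphism.
\<close>

locale coalgebra = vector_space "scal C" for C :: "('k::field, 'c::ab_group_add) coalg" +
  assumes comult_in: "comult C x \<in> tens2_space C UNIV"
    and comult_linear: "Vector_Spaces.linear (scal C) tens_scale (comult C)"
    and counit_linear: "Vector_Spaces.linear (scal C) (*) (counit C)"
    and coassoc: "tens2_lift C (\<lambda>v z. tens2_lift C (\<lambda>x y. tens3 C x y z) (comult C v)) (comult C x) =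
                  tens2_lift C (\<lambda>x v. tens2_lift C (\<lambda>y z. tens3 C x y z) (comult C v)) (comult C x)"
    and counit_left: "tens2_lift C (\<lambda>y z. scal C (counit C y) z) (comult C x) = x"
    and counit_right: "tens2_lift C (\<lambda>y z. scal C (counit C z) y) (comult C x) = x"

definition coalg_iso ::
  "('k::field, 'c::ab_group_add) coalg \<Rightarrow> ('k, 'd::ab_group_add) coalg \<Rightarrow> ('c \<Rightarrow> 'd) \<Rightarrow> bool"
  where "coalg_iso C D f \<longleftrightarrow>
    Vector_Spaces.linear (scal C) (scal D) f \<and> bij f \<and>
    (\<forall>x. comult D (f x) = tens2_map C D f (comult C x)) \<and>
    (\<forall>x. counit D (f x) = counit C x)"

definition coalg_isomorphic ::
  "('k::field, 'c::ab_group_add) coalg \<Rightarrow> ('k, 'd::ab_group_add) coalg \<Rightarrow> bool"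
  where "coalg_isomorphic C D \<longleftrightarrow> (\<exists>f. coalg_iso C D f)"

definition ground_coalg :: "('k::field, 'k) coalg"
  where "ground_coalg =
    \<lparr>scal = (*), comult = (\<lambda>c. tens_scale c (tens (*) (*) 1 1)), counit = (\<lambda>c. c)\<rparr>"

text \<open>The matrix coalgebra: \<open>\<Delta> e\<^sub>i\<^sub>j = \<Sum>\<^sub>l e\<^sub>i\<^sub>l \<otimes> e\<^sub>l\<^sub>j\<close> and \<open>\<epsilon> e\<^sub>i\<^sub>j = \<delta>\<^sub>i\<^sub>j\<close>.\<close>

definition matrix_scale :: "'k::field \<Rightarrow> 'k ^ 'n ^ 'n \<Rightarrow> 'k ^ 'n ^ 'n::finite"
  where "matrix_scale c A = (\<chi> i j. c * A $ i $ j)"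

definition matrix_unit :: "'n \<Rightarrow> 'n \<Rightarrow> 'k::field ^ 'n ^ 'n::finite"
  where "matrix_unit i j = axis i (axis j 1)"

definition matrix_coalg :: "('k::field, 'k ^ 'n ^ 'n::finite) coalg"
  where "matrix_coalg =
    \<lparr>scal = matrix_scale,
     comult = (\<lambda>A. \<Sum>i\<in>UNIV. \<Sum>j\<in>UNIV. tens_scale (A $ i $ j)
       (\<Sum>l\<in>UNIV. tens matrix_scale matrix_scale (matrix_unit i l) (matrix_unit l j))),
     counit = (\<lambda>A. \<Sum>i\<in>UNIV. A $ i $ i)\<rparr>"

definition sum_scale ::
  "('k \<Rightarrow> 'c \<Rightarrow> 'c) \<Rightarrow> ('k \<Rightarrow> 'd \<Rightarrow> 'd) \<Rightarrow> 'k \<Rightarrow> 'c \<times> 'd \<Rightarrow> 'c \<times> 'd"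
  where "sum_scale s t c = map_prod (s c) (t c)"

definition coalg_sum ::
  "('k::field, 'c::ab_group_add) coalg \<Rightarrow> ('k, 'd::ab_group_add) coalg \<Rightarrow> ('k, 'c \<times> 'd) coalg"
  where "coalg_sum C D =
    (let s = sum_scale (scal C) (scal D) in
    \<lparr>scal = s,
     comult = (\<lambda>(x, y).
       tens2_lift C (\<lambda>a b. tens s s (a, 0) (b, 0)) (comult C x) +
       tens2_lift D (\<lambda>a b. tens s s (0, a) (0, b)) (comult D y)),
     counit = (\<lambda>(x, y). counit C x + counit D y)\<rparr>)"

definition copies_scale :: "('k \<Rightarrow> 'c \<Rightarrow> 'c) \<Rightarrow> 'k \<Rightarrow> 'c ^ 'n \<Rightarrow> 'c ^ 'n::finite"
  where "copies_scale s c x = (\<chi> i. s c (x $ i))"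

definition coalg_copies ::
  "('k::field, 'c::ab_group_add) coalg \<Rightarrow> ('k, 'c ^ 'n::finite) coalg"
  where "coalg_copies C =
    (let s = copies_scale (scal C) in
    \<lparr>scal = s,
     comult = (\<lambda>x. \<Sum>i\<in>UNIV. tens2_lift C (\<lambda>a b. tens s s (axis i a) (axis i b)) (comult C (x $ i))),
     counit = (\<lambda>x. \<Sum>i\<in>UNIV. counit C (x $ i))\<rparr>)"


section \<open>Hopf algebras\<close>

text \<open>
  The multiplication and unit of a bialgebra are those of the type class \<^class>\<open>ring_1\<close>; the
  remaining structure is a \<^typ>\<open>('k, 'h) coalg\<close>.
\<close>

definition tens_mult ::
  "('k::field, 'h::ring_1) coalg \<Rightarrow> ('k, 'h, 'h) tensor \<Rightarrow> ('k, 'h, 'h) tensor \<Rightarrow> ('k, 'h, 'h) tensor"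
  where "tens_mult H t u =
    tens2_lift H (\<lambda>a b. tens2_lift H (\<lambda>c d. tens2 H (a * c) (b * d)) u) t"

locale bialgebra = coalgebra H for H :: "('k::field, 'h::ring_1) coalg" +
  assumes scal_mult_left: "scal H c x * y = scal H c (x * y)"
    and scal_mult_right: "x * scal H c y = scal H c (x * y)"
    and comult_mult: "comult H (x * y) = tens_mult H (comult H x) (comult H y)"
    and comult_one: "comult H 1 = tens2 H 1 1"
    and counit_mult: "counit H (x * y) = counit H x * counit H y"
    and counit_one: "counit H 1 = 1"

locale hopf_algebra = bialgebra H
  for H :: "('k::field, 'h::ring_1) coalg" and S :: "'h \<Rightarrow> 'h" +
  assumes antipode_linear: "Vector_Spaces.linear (scal H) (scal H) S"
    and antipode_left: "tens2_lift H (\<lambda>a b. S a * b) (comult H x) = scal H (counit H x) 1"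
    and antipode_right: "tens2_lift H (\<lambda>a b. a * S b) (comult H x) = scal H (counit H x) 1"

text \<open>
  An isomorphism of Hopf algebras is an isomorphism of bialgebras: antipodes are determined by the
  bialgebra structure and automatically preserved.
\<close>

definition hopf_isomorphic ::
  "('k::field, 'h::ring_1) coalg \<Rightarrow> ('k, 'l::ring_1) coalg \<Rightarrow> bool"
  where "hopf_isomorphic H L \<longleftrightarrow>
    (\<exists>f. coalg_iso H L f \<and> (\<forall>x y. f (x * y) = f x * f y) \<and> f 1 = 1)"

definition hopf_subalgebra :: "('k::field, 'h::ring_1) coalg \<Rightarrow> ('h \<Rightarrow> 'h) \<Rightarrow> 'h set \<Rightarrow> bool"
  where "hopf_subalgebra H S K \<longleftrightarrow>
    module.subspace (scal H) K \<and> 1 \<in> K \<and> (\<forall>x\<in>K. \<forall>y\<in>K. x * y \<in> K) \<and>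
    (\<forall>x\<in>K. comult H x \<in> tens2_space H K) \<and> (\<forall>x\<in>K. S x \<in> K)"

text \<open>The left adjoint action \<open>h . x = h\<^sub>1 x S(h\<^sub>2)\<close>.\<close>

definition left_adjoint :: "('k::field, 'h::ring_1) coalg \<Rightarrow> ('h \<Rightarrow> 'h) \<Rightarrow> 'h \<Rightarrow> 'h \<Rightarrow> 'h"
  where "left_adjoint H S h x = tens2_lift H (\<lambda>a b. a * x * S b) (comult H h)"

definition normal_hopf_subalgebra :: "('k::field, 'h::ring_1) coalg \<Rightarrow> ('h \<Rightarrow> 'h) \<Rightarrow> 'h set \<Rightarrow> bool"
  where "normal_hopf_subalgebra H S K \<longleftrightarrow>
    hopf_subalgebra H S K \<and> (\<forall>h. \<forall>x\<in>K. left_adjoint H S h x \<in> K)"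

definition simple_hopf_algebra :: "('k::field, 'h::ring_1) coalg \<Rightarrow> ('h \<Rightarrow> 'h) \<Rightarrow> bool"
  where "simple_hopf_algebra H S \<longleftrightarrow>
    (\<forall>K. normal_hopf_subalgebra H S K \<longrightarrow> K = {scal H c 1 | c. True} \<or> K = UNIV)"

definition left_ideal :: "'h::ring_1 set \<Rightarrow> bool"
  where "left_ideal L \<longleftrightarrow> 0 \<in> L \<and> (\<forall>x\<in>L. \<forall>y\<in>L. x + y \<in> L) \<and> (\<forall>r. \<forall>x\<in>L. r * x \<in> L)"

text \<open>Semisimplicity as a ring: every submodule of the left regular module is a direct summand.\<close>

definition semisimple :: "'h::ring_1 itself \<Rightarrow> bool"
  where "semisimple _ \<longleftrightarrow>
    (\<forall>L::'h set. left_ideal L \<longrightarrow>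
      (\<exists>M. left_ideal M \<and> L \<inter> M = {0} \<and> (\<forall>x. \<exists>l\<in>L. \<exists>m\<in>M. x = l + m)))"


section \<open>Twists\<close>

definition tens_inverse :: "('k::field, 'h::ring_1) coalg \<Rightarrow> ('k, 'h, 'h) tensor \<Rightarrow> ('k, 'h, 'h) tensor"
  where "tens_inverse H J =
    (THE J'. J' \<in> tens2_space H UNIV \<and>
      tens_mult H J J' = tens2 H 1 1 \<and> tens_mult H J' J = tens2 H 1 1)"

definition twisted :: "('k::field, 'h::ring_1) coalg \<Rightarrow> ('k, 'h, 'h) tensor \<Rightarrow> ('k, 'h) coalg"
  where "twisted H J =
    H\<lparr>comult := \<lambda>h. tens_mult H (tens_mult H (tens_inverse H J) (comult H h)) J\<rparr>"


section \<open>The group algebra of the alternating group on five letters\<close>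

text \<open>
  \<^typ>\<open>'g \<Rightarrow>\<^sub>0 'k\<close> is the group algebra of a (not necessarily commutative) group \<open>'g\<close> that is written
  additively; the basis element of \<open>g\<close> is \<open>single g 1\<close>.
\<close>

definition group_algebra :: "('k::field, 'g::group_add \<Rightarrow>\<^sub>0 'k) coalg"
  where "group_algebra =
    (let s = (\<lambda>c. Poly_Mapping.map ((*) c)) in
    \<lparr>scal = s,
     comult = (\<lambda>x. \<Sum>g\<in>Poly_Mapping.keys x. tens_scale (Poly_Mapping.lookup x g) (tens s s (Poly_Mapping.single g 1) (Poly_Mapping.single g 1))),
     counit = (\<lambda>x. \<Sum>g\<in>Poly_Mapping.keys x. Poly_Mapping.lookup x g)\<rparr>)"

text \<open>The group \<^term>\<open>alt_group 5\<close> as a type, written additively.\<close>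

typedef alt5 = "carrier (alt_group 5)"
  using group.is_monoid[OF alt_group_is_group] monoid.one_closed by blast

instantiation alt5 :: group_add
begin

definition "0 = Abs_alt5 \<one>\<^bsub>alt_group 5\<^esub>"
definition "p + q = Abs_alt5 (Rep_alt5 p \<otimes>\<^bsub>alt_group 5\<^esub> Rep_alt5 q)"
definition "- p = Abs_alt5 (inv\<^bsub>alt_group 5\<^esub> Rep_alt5 p)"
definition "p - q = p + - (q :: alt5)"

instance
proof
  interpret group "alt_group 5" by (rule alt_group_is_group)
  fix p q r :: alt5
  note mem = Rep_alt5 m_closed inv_closed one_closed
  note simps = zero_alt5_def plus_alt5_def uminus_alt5_def Abs_alt5_inverse Rep_alt5_inverse mem
  show "p + q + r = p + (q + r)" by (simp only: simps m_assoc)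
  show "0 + p = p" by (simp only: simps l_one)
  show "p + 0 = p" by (simp only: simps r_one)
  show "- p + p = 0" by (simp only: simps l_inv)
  show "p + - q = p - q" by (simp only: minus_alt5_def)
qed

end

definition field_units :: "'k::field monoid"
  where "field_units = \<lparr>carrier = UNIV - {0}, mult = (*), one = 1\<rparr>"

definition character_group :: "('g, 'x) monoid_scheme \<Rightarrow> ('g \<Rightarrow> 'k::field) monoid"
  where "character_group G =
    \<lparr>carrier = hom G field_units \<inter> extensional (carrier G),
     mult = (\<lambda>\<phi> \<psi>. \<lambda>g\<in>carrier G. \<phi> g * \<psi> g),
     one = (\<lambda>g\<in>carrier G. 1)\<rparr>"

definition normalized_2cocycle :: "('a, 'x) monoid_scheme \<Rightarrow> ('a \<Rightarrow> 'a \<Rightarrow> 'k::field) \<Rightarrow> bool"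
  where "normalized_2cocycle A \<alpha> \<longleftrightarrow>
    (\<forall>x\<in>carrier A. \<forall>y\<in>carrier A. \<alpha> x y \<noteq> 0) \<and>
    (\<forall>x\<in>carrier A. \<forall>y\<in>carrier A. \<forall>z\<in>carrier A.
      \<alpha> x y * \<alpha> (x \<otimes>\<^bsub>A\<^esub> y) z = \<alpha> y z * \<alpha> x (y \<otimes>\<^bsub>A\<^esub> z)) \<and>
    (\<forall>x\<in>carrier A. \<alpha> x \<one>\<^bsub>A\<^esub> = 1 \<and> \<alpha> \<one>\<^bsub>A\<^esub> x = 1)"

definition nondegenerate_bicharacter :: "('a, 'x) monoid_scheme \<Rightarrow> ('a \<Rightarrow> 'a \<Rightarrow> 'k::field) \<Rightarrow> bool"
  where "nondegenerate_bicharacter A b \<longleftrightarrow>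
    (\<forall>x\<in>carrier A. (\<forall>y\<in>carrier A. b x y = 1) \<longrightarrow> x = \<one>\<^bsub>A\<^esub>) \<and>
    (\<forall>y\<in>carrier A. (\<forall>x\<in>carrier A. b x y = 1) \<longrightarrow> y = \<one>\<^bsub>A\<^esub>)"

definition nondegenerate_2cocycle :: "('a, 'x) monoid_scheme \<Rightarrow> ('a \<Rightarrow> 'a \<Rightarrow> 'k::field) \<Rightarrow> bool"
  where "nondegenerate_2cocycle A \<alpha> \<longleftrightarrow>
    normalized_2cocycle A \<alpha> \<and> nondegenerate_bicharacter A (\<lambda>x y. \<alpha> x y * inverse (\<alpha> y x))"

abbreviation alt5_sub :: "(nat \<Rightarrow> nat) set \<Rightarrow> (nat \<Rightarrow> nat) monoid"
  where "alt5_sub V \<equiv> (alt_group 5)\<lparr>carrier := V\<rparr>"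

text \<open>The primitive idempotent \<open>e\<^sub>\<phi> = |V|\<^sup>-\<^sup>1 \<Sum>\<^sub>g \<phi>(g\<^sup>-\<^sup>1) g\<close>, so that \<open>g e\<^sub>\<phi> = \<phi>(g) e\<^sub>\<phi>\<close>.\<close>

definition char_idem :: "(nat \<Rightarrow> nat) set \<Rightarrow> ((nat \<Rightarrow> nat) \<Rightarrow> 'k::field) \<Rightarrow> alt5 \<Rightarrow>\<^sub>0 'k"
  where "char_idem V \<phi> =
    (\<Sum>g\<in>V. Poly_Mapping.single (Abs_alt5 g) (\<phi> (inv\<^bsub>alt_group 5\<^esub> g) / of_nat (card V)))"

definition cocycle_twist ::
  "(nat \<Rightarrow> nat) set \<Rightarrow> (((nat \<Rightarrow> nat) \<Rightarrow> 'k) \<Rightarrow> ((nat \<Rightarrow> nat) \<Rightarrow> 'k) \<Rightarrow> 'k::field) \<Rightarrow>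
   ('k, alt5 \<Rightarrow>\<^sub>0 'k, alt5 \<Rightarrow>\<^sub>0 'k) tensor"
  where "cocycle_twist V \<alpha> =
    (\<Sum>\<phi>\<in>carrier (character_group (alt5_sub V)). \<Sum>\<psi>\<in>carrier (character_group (alt5_sub V)).
      tens_scale (\<alpha> \<phi> \<psi>) (tens2 group_algebra (char_idem V \<phi>) (char_idem V \<psi>)))"

definition twisted_alt5_algebra ::
  "(nat \<Rightarrow> nat) set \<Rightarrow> (((nat \<Rightarrow> nat) \<Rightarrow> 'k) \<Rightarrow> ((nat \<Rightarrow> nat) \<Rightarrow> 'k) \<Rightarrow> 'k::field) \<Rightarrow>
   ('k, alt5 \<Rightarrow>\<^sub>0 'k) coalg"
  where "twisted_alt5_algebra V \<alpha> = twisted group_algebra (cocycle_twist V \<alpha>)"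

end

theory Submission
  imports
    Defs
    "HOL-Analysis.Cartesian_Space"
    "HOL-Algebra.Sylow"
    "HOL-Algebra.Multiplicative_Group"
begin

text \<open>
  The proof is elementary.  In a basis of group-like elements and three comatrices the relations of
  \<open>H\<close> become matrix identities over \<open>H\<close>.  The trace of the regular representation shows that a
  group-like element of order 3 fixes none of the three blocks under translation, so the
  stabiliser \<open>\<Gamma>\<close> of a block in the group \<open>G\<close> of group-like elements is a normal subgroup of order 4.
  Left and right translation by \<open>\<Gamma>\<close> conjugate a comatrix \<open>c\<close> by two projective representations; these
  commute, and simplicity of \<open>H\<close> forces each of them to be the irreducible representation of the
  Klein four-group by Pauli-type matrices.  Hence \<open>c\<close> is generated, as a \<open>k\<Gamma>\<close>-bimodule, by a single
  element \<open>x\<close> with \<open>\<Delta> x = J\<^sup>-\<^sup>1 (x \<otimes> x) J\<close>.  All solutions \<open>x\<close> of this equation with \<open>\<epsilon> x = 1\<close> form a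
  group \<open>F\<close> of order 60 which is a basis of \<open>H\<close>; those in \<open>kG\<close> form a subgroup of index 5, and \<open>F\<close> acts
  faithfully and by even permutations on its cosets, because an element of order 3 of \<open>G\<close> does not
  centralise \<open>\<Gamma>\<close>.  So \<open>F\<close> is the alternating group, and \<open>\<Gamma>\<close> can be matched with the given \<open>V\<close>.
\<close>

section \<open>Square matrices over a ring\<close>

text \<open>The equation for \<open>x\<close> is dictated by the goal: in a twisted Hopf algebra
  \<open>L^J\<close> the group-like elements of \<open>L\<close> are exactly the solutions of
  \<Delta> x = J^-1 (x \<otimes> x) J with counit 1, so the group must appear inside
  \<open>H\<close> as this set. \<open>J\<close> can be taken from the given \<alpha> at once: on
  the Klein four-group all nondegenerate cocycles have the same commutator, hence are cohomologous
  over an algebraically closed field, and any Pauli-type representation that turns up can be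
  rescaled to the prescribed multiplier. The obstacle is that Schur's lemma makes the left and right
  representations commute only up to roots of unity; removing these needs the exact decomposition 16
  = 4 * 3 + 4 of the comodule c \<otimes> c. Simplicity is invoked twice. If the left matrices
  commuted with each other, they would span their own commutant, which contains the right matrices,
  and the group algebra of \<Gamma> would be normal. If \<open>a\<close> centralised \<Gamma>, its
  intertwiner would be scalar and the powers of \<open>a\<close> would span a normal Hopf
  subalgebra. The exclusion of order 3 from stabilisers rests on 3 not dividing the matrix size
  4.\<close>

typedef ('a, 'n) sqmat = "UNIV :: ('n::finite \<Rightarrow> 'n \<Rightarrow> 'a) set"
  morphisms ent Mat by simp

lemma ent_Mat [simp]: "ent (Mat f) i j = f i j"
  by (simp add: Mat_inverse)

lemma sqmat_eqI: "(\<And>i j. ent A i j = ent B i j) \<Longrightarrow> A = B"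
  by (metis ent_inverse ext)

text \<open>Matrices over \<open>k\<close> and over the noncommutative ring \<open>H\<close> both
  occur, so entries come from any unital ring. The product on \<open>'a ^ 'n ^ 'n\<close> is
  componentwise; a separate type lets the class \<open>ring_1\<close> carry the matrix
  product.\<close>

instantiation sqmat :: (ring_1, finite) ring_1
begin

definition "0 = Mat (\<lambda>i j. 0)"
definition "1 = Mat (\<lambda>i j. if i = j then 1 else 0)"
definition "A + B = Mat (\<lambda>i j. ent A i j + ent B i j)"
definition "A - B = Mat (\<lambda>i j. ent A i j - ent B i j)"
definition "- A = Mat (\<lambda>i j. - ent A i j)"
definition "A * B = Mat (\<lambda>i j. \<Sum>l\<in>UNIV. ent A i l * ent B l j)"

lemma ent_zero [simp]: "ent 0 i j = 0" by (simp add: zero_sqmat_def)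
lemma ent_one: "ent 1 i j = (if i = j then 1 else 0)" by (simp add: one_sqmat_def)
lemma ent_add [simp]: "ent (A + B) i j = ent A i j + ent B i j" by (simp add: plus_sqmat_def)
lemma ent_diff [simp]: "ent (A - B) i j = ent A i j - ent B i j" by (simp add: minus_sqmat_def)
lemma ent_minus [simp]: "ent (- A) i j = - ent A i j" by (simp add: uminus_sqmat_def)
lemma ent_mult: "ent (A * B) i j = (\<Sum>l\<in>UNIV. ent A i l * ent B l j)" by (simp add: times_sqmat_def)

instance
proof
  fix A B C :: "('a, 'b) sqmat"
  show "A * B * C = A * (B * C)"
    by (rule sqmat_eqI)
      (simp add: ent_mult sum_distrib_left sum_distrib_right mult.assoc, rule sum.swap)
  show "1 * A = A"
    by (rule sqmat_eqI) (simp add: ent_mult ent_one if_distrib[of "\<lambda>x. x * _"] cong: if_cong)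
  show "A * 1 = A"
    by (rule sqmat_eqI) (simp add: ent_mult ent_one if_distrib[of "\<lambda>x. _ * x"] cong: if_cong)
  show "(0 :: ('a, 'b) sqmat) \<noteq> 1"
    by (metis ent_one ent_zero zero_neq_one)
qed (auto intro!: sqmat_eqI simp: ent_mult algebra_simps sum.distrib)

end

lemma ent_sum: "ent (\<Sum>x\<in>I. A x) i j = (\<Sum>x\<in>I. ent (A x) i j)"
  by (induction I rule: infinite_finite_induct) auto

text \<open>Over a noncommutative ring \<open>sc x * A\<close> and \<open>A * sc x\<close> differ;
  they express left and right translation of a comatrix by an element of \<open>H\<close>.\<close>

definition sc :: "'a::ring_1 \<Rightarrow> ('a, 'n::finite) sqmat"
  where "sc x = Mat (\<lambda>i j. if i = j then x else 0)"

lemma ent_sc: "ent (sc x) i j = (if i = j then x else 0)"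
  by (simp add: sc_def)

lemma ent_sc_mult: "ent (sc x * A) i j = x * ent A i j"
  by (simp add: ent_mult ent_sc if_distrib[of "\<lambda>x. x * _"] cong: if_cong)

lemma ent_mult_sc: "ent (A * sc x) i j = ent A i j * x"
  by (simp add: ent_mult ent_sc if_distrib[of "\<lambda>x. _ * x"] cong: if_cong)

lemma sc_simps: "sc 0 = 0" "sc 1 = 1" "sc (x + y) = sc x + sc y" "sc (x - y) = sc x - sc y"
  "sc (- x) = - sc x" "sc (x * y) = sc x * sc y"
  by (auto intro!: sqmat_eqI simp: ent_sc ent_one ent_sc_mult)

lemma sc_inject [simp]: "sc x = (sc y :: ('a::ring_1, 'n::finite) sqmat) \<longleftrightarrow> x = y"
  by (metis ent_sc)

lemma sc_commute: "sc (x::'a::comm_ring_1) * A = A * sc x"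
  by (rule sqmat_eqI) (simp add: ent_sc_mult ent_mult_sc mult.commute)

definition munit :: "'n \<Rightarrow> 'n \<Rightarrow> ('a::ring_1, 'n::finite) sqmat"
  where "munit p q = Mat (\<lambda>i j. if i = p \<and> j = q then 1 else 0)"

lemma ent_munit: "ent (munit p q) i j = (if i = p \<and> j = q then 1 else 0)"
  by (simp add: munit_def)

lemma ent_munit_mult: "ent (munit p q * A) i j = (if i = p then ent A q j else 0)"
proof -
  have "ent (munit p q * A) i j = (\<Sum>l\<in>UNIV. if l = q then (if i = p then ent A q j else 0) else 0)"
    unfolding ent_mult ent_munit by (rule sum.cong) auto
  then show ?thesis by simp
qed

lemma ent_mult_munit: "ent (A * munit p q) i j = (if j = q then ent A i p else 0)"
proof -
  have "ent (A * munit p q) i j = (\<Sum>l\<in>UNIV. if l = p then (if j = q then ent A i p else 0) else 0)"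
    unfolding ent_mult ent_munit by (rule sum.cong) auto
  then show ?thesis by simp
qed

lemma munit_mult: "munit p q * munit r s = (if q = r then munit p s else 0)"
  by (auto intro!: sqmat_eqI simp: ent_munit_mult ent_munit)

lemma commutes_munits_scalar:
  fixes A :: "('a::ring_1, 'n::finite) sqmat"
  assumes "\<And>p q. munit p q * A = A * munit p q"
  shows "\<exists>s. A = sc s"
proof -
  fix p0 :: 'n
  have "ent A i j = ent (sc (ent A p0 p0)) i j" for i j
  proof -
    have "ent (munit p0 i * A) p0 j = ent (A * munit p0 i) p0 j" using assms by simp
    then have "ent A i j = (if j = i then ent A p0 p0 else 0)"
      by (simp add: ent_munit_mult ent_mult_munit)
    then show ?thesis by (simp add: ent_sc)
  qed
  then show ?thesis by (intro exI[of _ "ent A p0 p0"] sqmat_eqI)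
qed

definition tr :: "('a::ring_1, 'n::finite) sqmat \<Rightarrow> 'a"
  where "tr A = (\<Sum>i\<in>UNIV. ent A i i)"

lemma tr_mult_commute: "tr (A * B) = tr (B * (A :: ('a::comm_ring_1, 'n::finite) sqmat))"
  unfolding tr_def ent_mult by (subst sum.swap) (simp add: mult.commute)

lemma tr_simps: "tr 0 = 0" "tr (A + B) = tr A + tr B" "tr (A - B) = tr A - tr B" "tr (- A) = - tr A"
  by (simp_all add: tr_def sum.distrib sum_subtractf sum_negf)

lemma tr_one: "tr (1 :: ('a::ring_1, 'n::finite) sqmat) = of_nat CARD('n)"
  by (simp add: tr_def ent_one)

lemma tr_sc_mult: "tr (sc x * A) = x * tr A"
  by (simp add: tr_def ent_sc_mult sum_distrib_left)

lemma tr_sum: "tr (\<Sum>i\<in>I. A i) = (\<Sum>i\<in>I. tr (A i))"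
  by (induction I rule: infinite_finite_induct) (auto simp: tr_simps)

lemma tr_munit: "tr (munit p q) = (if p = q then 1 else 0)"
proof -
  have "tr (munit p q) = (\<Sum>i\<in>UNIV. if i = p then (if p = q then 1 else 0) else 0)"
    unfolding tr_def ent_munit by (rule sum.cong) auto
  then show ?thesis by simp
qed

definition mtransp :: "('a, 'n::finite) sqmat \<Rightarrow> ('a, 'n) sqmat"
  where "mtransp A = Mat (\<lambda>i j. ent A j i)"

lemma ent_mtransp [simp]: "ent (mtransp A) i j = ent A j i"
  by (simp add: mtransp_def)

lemma mtransp_mult: "mtransp (A * B) = mtransp B * mtransp (A :: ('a::comm_ring_1, 'n::finite) sqmat)"
  by (rule sqmat_eqI) (simp add: ent_mult mult.commute)

lemma mtransp_mtransp [simp]: "mtransp (mtransp A) = A"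
  by (rule sqmat_eqI) simp

lemma sqmat_left_right_inverse:
  fixes A B :: "('a::field, 'n::finite) sqmat"
  assumes "A * B = 1"
  shows "B * A = 1"
proof -
  let ?c = "\<lambda>M. (\<chi> i j. ent M i j) :: 'a^'n^'n"
  have m: "?c (M * N) = ?c M ** ?c N" for M N
    by (simp add: matrix_matrix_mult_def ent_mult vec_eq_iff)
  have o: "?c 1 = mat 1" by (simp add: mat_def ent_one vec_eq_iff)
  have "?c A ** ?c B = mat 1" using assms by (metis m o)
  then have "?c B ** ?c A = mat 1" by (metis matrix_left_right_inverse)
  then have "?c (B * A) = ?c 1" by (simp only: m o)
  then show ?thesis by (auto intro!: sqmat_eqI simp: vec_eq_iff)
qed

text \<open>In a basis \<open>B\<close> of the range the sum becomes the trace of \<open>P\<close>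
  on its range, where \<open>P\<close> is the identity. The family \<open>bas\<close> enters only
  through an expansion formula, so the lemma covers both matrices and the regular representation of
  \<open>H\<close>.\<close>

lemma (in vector_space) idempotent_trace:
  assumes fin: "finite I"
    and exp: "\<And>x. x = (\<Sum>i\<in>I. scale (cor i x) (bas i))"
    and cor: "\<And>i. Vector_Spaces.linear scale (*) (cor i)"
    and P: "Vector_Spaces.linear scale scale P" and PP: "\<And>x. P (P x) = P x"
  shows "(\<Sum>i\<in>I. cor i (P (bas i))) = of_nat (dim (range P))"
proof -
  interpret P: Vector_Spaces.linear scale scale P by (rule P)
  obtain B where B: "B \<subseteq> range P" "independent B" "range P \<subseteq> span B" "card B = dim (range P)"
    using basis_exists by blast
  have "span (P ` bas ` I) = range P"
  proof
    show "span (P ` bas ` I) \<subseteq> range P"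
      by (rule span_minimal) (auto simp: P.subspace_image)
    show "range P \<subseteq> span (P ` bas ` I)"
    proof
      fix y assume "y \<in> range P"
      then obtain x where "y = P x" by blast
      then have "y = (\<Sum>i\<in>I. scale (cor i x) (P (bas i)))"
        by (subst (asm) exp[of x]) (simp add: P.sum P.scale)
      moreover have "(\<Sum>i\<in>I. scale (cor i x) (P (bas i))) \<in> span (P ` bas ` I)"
        by (intro span_sum span_scale span_base) auto
      ultimately show "y \<in> span (P ` bas ` I)" by simp
    qed
  qed
  then have finB: "finite B"
    using independent_span_bound[of "P ` bas ` I" B] B fin by auto
  have PB: "P b = b" if "b \<in> B" for b using that B(1) PP by blast
  have rep: "(\<Sum>b\<in>B. scale (representation B (P x) b) b) = P x" for x
    by (rule sum_representation_eq[OF B(2) _ finB order_refl]) (use B(3) in blast)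
  have lin: "representation B (P (x + y)) b = representation B (P x) b + representation B (P y) b"
    "representation B (P (scale r x)) b = r * representation B (P x) b" for x y r b
    using B(3) by (simp_all add: P.add P.scale representation_add[OF B(2)] representation_scale[OF B(2)] subset_iff)
  have lin0: "representation B (P 0) b = 0" for b
    by (simp add: P.zero representation_zero)
  have lsum: "representation B (P (\<Sum>i\<in>J. f i)) b = (\<Sum>i\<in>J. representation B (P (f i)) b)" for J :: "'d set" and f b
    by (induction J rule: infinite_finite_induct) (auto simp: lin lin0[unfolded P.zero] P.zero)
  have corlin: "cor i (\<Sum>b\<in>B. scale (r b) b) = (\<Sum>b\<in>B. r b * cor i b)" for i r
  proof -
    interpret c: Vector_Spaces.linear scale "(*)" "cor i" by (rule cor)
    show ?thesis by (simp add: c.sum c.scale)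
  qed
  \<comment> \<open>Expand \<open>P (bas i)\<close> in \<open>B\<close>, swap the sums and move
    \<open>cor i b\<close> inside: the inner sum over \<open>I\<close> reassembles \<open>b\<close>
    itself.\<close>
  have "(\<Sum>i\<in>I. cor i (P (bas i))) = (\<Sum>i\<in>I. \<Sum>b\<in>B. representation B (P (bas i)) b * cor i b)"
    by (intro sum.cong refl) (metis corlin rep)
  also have "\<dots> = (\<Sum>b\<in>B. \<Sum>i\<in>I. representation B (P (scale (cor i b) (bas i))) b)"
    by (subst sum.swap) (simp add: lin mult.commute)
  also have "\<dots> = (\<Sum>b\<in>B. representation B (P (\<Sum>i\<in>I. scale (cor i b) (bas i))) b)"
    by (intro sum.cong refl lsum[symmetric])
  also have "\<dots> = (\<Sum>b\<in>B. representation B (P b) b)"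
    by (simp only: exp[symmetric])
  also have "\<dots> = (\<Sum>b\<in>B. 1)"
    by (intro sum.cong refl) (simp add: PB representation_basis[OF B(2)])
  finally show ?thesis using B(4) by simp
qed

definition mact :: "('a::field, 'n::finite) sqmat \<Rightarrow> 'a^'n \<Rightarrow> 'a^'n"
  where "mact A x = (\<chi> i. \<Sum>j\<in>UNIV. ent A i j * x $ j)"

lemma mact_nth [simp]: "mact A x $ i = (\<Sum>j\<in>UNIV. ent A i j * x $ j)"
  by (simp add: mact_def)

lemma mact_linear: "Vector_Spaces.linear (*s) (*s) (mact A)"
  by unfold_locales (auto simp: vec_eq_iff algebra_simps sum.distrib sum_distrib_left)

lemma mact_mult: "mact (A * B) x = mact A (mact B x)"
  by (simp add: vec_eq_iff ent_mult sum_distrib_left sum_distrib_right mult.assoc, safe, rule sum.swap)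

lemma mact_axis: "mact A (axis j 1) $ i = ent A i j"
  by (simp add: axis_def if_distrib[of "\<lambda>x. _ * x"] cong: if_cong)

lemma mact_eqI: "(\<And>x. mact A x = mact B x) \<Longrightarrow> A = B"
  by (metis mact_axis sqmat_eqI)

lemma idempotent_tr_dim:
  fixes P :: "('k::field, 'n::finite) sqmat"
  assumes "P * P = P"
  shows "tr P = of_nat (vec.dim (range (mact P)))"
proof -
  have "(\<Sum>i\<in>UNIV. (mact P (axis i 1)) $ i) = of_nat (vec.dim (range (mact P)))"
  proof (rule vec.idempotent_trace)
    show "x = (\<Sum>i\<in>UNIV. x $ i *s axis i 1)" for x :: "'k^'n"
      by (simp add: basis_expansion)
    show "Vector_Spaces.linear (*s) (*) (\<lambda>x :: 'k^'n. x $ i)" for i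
      by unfold_locales (auto simp: algebra_simps)
    show "mact P (mact P x) = mact P x" for x using assms by (metis mact_mult)
  qed (auto simp: mact_linear)
  then show ?thesis by (simp only: mact_axis tr_def)
qed

text \<open>In characteristic zero this integrality is what yields the contradictions in
  \<open>tr_order3_ne_0\<close> and \<open>no_anticommute\<close>.\<close>

lemma idempotent_tr_nat:
  fixes P :: "('k::field, 'n::finite) sqmat"
  assumes "P * P = P"
  obtains n where "tr P = of_nat n"
  using idempotent_tr_dim[OF assms] by blast

section \<open>Tensors over an algebra\<close>

declare plus_fun_apply [simp del] zero_fun_apply [simp del]

lemma linearI:
  assumes "vector_space s" "vector_space t" "\<And>x y. f (x + y) = f x + f y" "\<And>c x. f (s c x) = t c (f x)"
  shows "Vector_Spaces.linear s t f"
  using assms by (simp add: Vector_Spaces.linear_def Modules.module_hom_def vector_space_def Modules.module_def Modules.module_hom_axioms_def)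

lemma field_vector_space: "vector_space ((*) :: 'k::field \<Rightarrow> 'k \<Rightarrow> 'k)"
  by unfold_locales (simp_all add: algebra_simps)

lemma tens_scale_vector_space: "vector_space (tens_scale :: 'k::field \<Rightarrow> ('k, 'a, 'b) tensor \<Rightarrow> _)"
  by unfold_locales (auto simp: tens_scale_def fun_eq_iff algebra_simps plus_fun_apply)

text \<open>Only the algebra structure is assumed, so that one tensor calculus serves
  \<open>H\<close> and the target group algebra alike.\<close>

locale tensor_algebra = vector_space "scal H" for H :: "('k::field, 'h::ring_1) coalg" +
  assumes scal_mult_left': "scal H c x * y = scal H c (x * y)"
    and scal_mult_right': "x * scal H c y = scal H c (x * y)"
begin

abbreviation "bilin \<equiv> bilinear_map (scal H) (scal H)"
abbreviation "T \<equiv> tens2_space H UNIV"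
abbreviation ten (infixr "\<boxtimes>" 72) where "x \<boxtimes> y \<equiv> tens2 H x y"
abbreviation "lin \<equiv> Vector_Spaces.linear (scal H) ((*) :: 'k \<Rightarrow> 'k \<Rightarrow> 'k)"
abbreviation "hscal \<equiv> scal H"

lemma bilinI:
  assumes "vector_space s"
    "\<And>x y z. f (x + y) z = f x z + f y z" "\<And>x y z. f x (y + z) = f x y + f x z"
    "\<And>c x y. f (scal H c x) y = s c (f x y)" "\<And>c x y. f x (scal H c y) = s c (f x y)"
  shows "bilin s f"
  unfolding bilinear_map_def
  by (intro conjI allI linearI assms vector_space_axioms)

lemma bilinD:
  assumes "bilin s f"
  shows "f (x + y) z = f x z + f y z" "f x (y + z) = f x y + f x z"
    "f (scal H c x) y = s c (f x y)" "f x (scal H c y) = s c (f x y)"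
    "f 0 y = 0" "f x 0 = 0"
proof -
  interpret l: Vector_Spaces.linear "scal H" s "f v" for v using assms by (simp add: bilinear_map_def)
  interpret r: Vector_Spaces.linear "scal H" s "\<lambda>v. f v w" for w using assms by (simp add: bilinear_map_def)
  show "f (x + y) z = f x z + f y z" "f x (y + z) = f x y + f x z"
    "f (scal H c x) y = s c (f x y)" "f x (scal H c y) = s c (f x y)"
    "f 0 y = 0" "f x 0 = 0"
    by (simp_all add: l.add r.add l.scale r.scale l.zero r.zero)
qed

lemma lin_simps:
  assumes "Vector_Spaces.linear (scal H) s f"
  shows "f (x + y) = f x + f y" "f (x - y) = f x - f y" "f (- x) = - f x" "f (scal H c x) = s c (f x)"
    "f 0 = 0" "f (sum g A) = (\<Sum>a\<in>A. f (g a))"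
proof -
  interpret l: Vector_Spaces.linear "scal H" s f by fact
  show "f (x + y) = f x + f y" "f (x - y) = f x - f y" "f (- x) = - f x" "f (scal H c x) = s c (f x)"
    "f 0 = 0" "f (sum g A) = (\<Sum>a\<in>A. f (g a))"
    by (simp_all add: l.add l.diff l.neg l.scale l.zero l.sum)
qed

lemma ten_app: "(x \<boxtimes> y) B = (if bilin (*) B then B x y else 0)"
  by (simp add: tens_def)

lemma ten_simps:
  "(x + y) \<boxtimes> z = x \<boxtimes> z + y \<boxtimes> z" "x \<boxtimes> (y + z) = x \<boxtimes> y + x \<boxtimes> z"
  "(scal H c x) \<boxtimes> y = tens_scale c (x \<boxtimes> y)" "x \<boxtimes> (scal H c y) = tens_scale c (x \<boxtimes> y)"
  "0 \<boxtimes> y = 0" "x \<boxtimes> 0 = 0"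
  by (auto simp: ten_app fun_eq_iff tens_scale_def bilinD plus_fun_apply zero_fun_apply)

lemma ten_sum: "(\<Sum>i\<in>I. f i) \<boxtimes> y = (\<Sum>i\<in>I. f i \<boxtimes> y)" "x \<boxtimes> (\<Sum>i\<in>I. f i) = (\<Sum>i\<in>I. x \<boxtimes> f i)"
  by (induction I rule: infinite_finite_induct; simp add: ten_simps)+

lemma T_iff: "t \<in> T \<longleftrightarrow> (\<exists>xs. t = (\<Sum>(v, w)\<leftarrow>xs. v \<boxtimes> w))"
  by (auto simp: tens_space_def)

lemma T_induct [consumes 1, case_names zero add]:
  assumes "t \<in> T" "P 0" "\<And>x y t. t \<in> T \<Longrightarrow> P t \<Longrightarrow> P (x \<boxtimes> y + t)"
  shows "P t"
proof -
  obtain xs where "t = (\<Sum>(v, w)\<leftarrow>xs. v \<boxtimes> w)" using assms(1) T_iff by blast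
  moreover have "P (\<Sum>(v, w)\<leftarrow>xs. v \<boxtimes> w)" for xs
    by (induction xs) (use assms(2,3) T_iff in auto)
  ultimately show ?thesis by simp
qed

lemma T_zero [simp, intro]: "0 \<in> T"
  unfolding T_iff by (intro exI[of _ "[]"]) simp

lemma T_ten [simp, intro]: "x \<boxtimes> y \<in> T"
  unfolding T_iff by (intro exI[of _ "[(x, y)]"]) simp

lemma T_add [simp, intro]:
  assumes "t \<in> T" "u \<in> T"
  shows "t + u \<in> T"
proof -
  obtain xs ys where "t = (\<Sum>(v, w)\<leftarrow>xs. v \<boxtimes> w)" "u = (\<Sum>(v, w)\<leftarrow>ys. v \<boxtimes> w)"
    using assms T_iff by blast
  then show ?thesis unfolding T_iff by (intro exI[of _ "xs @ ys"]) simp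
qed

lemma tens_scale_simps:
  "tens_scale c (t + u) = tens_scale c t + tens_scale c u" "tens_scale c 0 = 0"
  "tens_scale c (tens_scale d t) = tens_scale (c * d) t" "tens_scale 1 t = t" "tens_scale 0 t = 0"
  "tens_scale (c + d) t = tens_scale c t + tens_scale d t"
  by (auto simp: tens_scale_def fun_eq_iff algebra_simps plus_fun_apply zero_fun_apply)

lemma tens_scale_sum: "tens_scale c (\<Sum>i\<in>I. f i) = (\<Sum>i\<in>I. tens_scale c (f i))"
  "tens_scale (\<Sum>i\<in>I. d i) t = (\<Sum>i\<in>I. tens_scale (d i) t)"
  by (induction I rule: infinite_finite_induct; simp add: tens_scale_simps)+

lemma T_scale [simp, intro]: "t \<in> T \<Longrightarrow> tens_scale c t \<in> T"
  by (induction rule: T_induct) (auto simp: tens_scale_simps simp flip: ten_simps)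

lemma T_sum [simp, intro]: "(\<And>i. i \<in> I \<Longrightarrow> f i \<in> T) \<Longrightarrow> (\<Sum>i\<in>I. f i) \<in> T"
  by (induction I rule: infinite_finite_induct) auto

context
  fixes sc :: "'k \<Rightarrow> 'c::ab_group_add \<Rightarrow> 'c" and f
  assumes sc: "vector_space sc" and f: "bilin sc f"
begin

lemma lift_list: "tens2_lift H f (\<Sum>(v, w)\<leftarrow>xs. v \<boxtimes> w) = (\<Sum>(v, w)\<leftarrow>xs. f v w)"
  by (rule tens_lift_sum[OF sc f])

lemma lift_zero: "tens2_lift H f 0 = 0"
  using lift_list[of "[]"] by simp

lemma lift_ten: "tens2_lift H f (x \<boxtimes> y) = f x y"
  using lift_list[of "[(x, y)]"] by simp

lemma lift_add:
  assumes "t \<in> T" "u \<in> T"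
  shows "tens2_lift H f (t + u) = tens2_lift H f t + tens2_lift H f u"
proof -
  obtain xs ys where "t = (\<Sum>(v, w)\<leftarrow>xs. v \<boxtimes> w)" "u = (\<Sum>(v, w)\<leftarrow>ys. v \<boxtimes> w)"
    using assms T_iff by blast
  then show ?thesis using lift_list[of "xs @ ys"] by (simp add: lift_list)
qed

lemma lift_scale:
  assumes "t \<in> T"
  shows "tens2_lift H f (tens_scale c t) = sc c (tens2_lift H f t)"
proof -
  interpret sc: vector_space sc by (rule sc)
  show ?thesis using assms
  proof (induction rule: T_induct)
    case zero then show ?case by (simp add: tens_scale_simps lift_zero)
  next
    case (add x y t)
    then show ?case
      by (simp add: tens_scale_simps lift_add sc.scale_right_distrib)
        (simp add: lift_ten bilinD[OF f] flip: ten_simps)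
  qed
qed

lemma lift_sum:
  assumes "\<And>i. i \<in> I \<Longrightarrow> t i \<in> T"
  shows "tens2_lift H f (\<Sum>i\<in>I. t i) = (\<Sum>i\<in>I. tens2_lift H f (t i))"
  using assms by (induction I rule: infinite_finite_induct) (auto simp: lift_zero lift_add)

lemma lift_sum_ten: "tens2_lift H f (\<Sum>i\<in>I. x i \<boxtimes> y i) = (\<Sum>i\<in>I. f (x i) (y i))"
  by (simp add: lift_sum lift_ten)

end

lemma mult_bilin: "bilin tens_scale (\<lambda>c d. (a * c) \<boxtimes> (b * d))"
  by (intro bilinI tens_scale_vector_space) (simp_all add: ten_simps algebra_simps scal_mult_right')

text \<open>\<open>tens_mult\<close> nests two lifts; before the outer one can be evaluated, the
  inner one must be known to be bilinear in \<open>a\<close> and \<open>b\<close>.\<close>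

lemma mult_bilin2:
  assumes "u \<in> T"
  shows "bilin tens_scale (\<lambda>a b. tens2_lift H (\<lambda>c d. (a * c) \<boxtimes> (b * d)) u)"
proof -
  note l = lift_zero[OF tens_scale_vector_space mult_bilin] lift_ten[OF tens_scale_vector_space mult_bilin]
    lift_add[OF tens_scale_vector_space mult_bilin]
  show ?thesis using assms
  proof (induction rule: T_induct)
    case zero
    then show ?case by (intro bilinI tens_scale_vector_space) (simp_all add: l tens_scale_simps)
  next
    case (add x y t)
    show ?case
      by (intro bilinI tens_scale_vector_space)
        (simp_all only: l T_ten add.hyps bilinD[OF add.IH],
          simp_all add: ten_simps algebra_simps scal_mult_left' tens_scale_simps)
  qed
qed

lemma tmult_ten_left:
  "u \<in> T \<Longrightarrow> tens_mult H (x \<boxtimes> y) u = tens2_lift H (\<lambda>c d. (x * c) \<boxtimes> (y * d)) u"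
  unfolding tens_mult_def by (rule lift_ten[OF tens_scale_vector_space mult_bilin2])

lemma tmult_ten: "tens_mult H (a \<boxtimes> b) (c \<boxtimes> d) = (a * c) \<boxtimes> (b * d)"
  by (simp add: tmult_ten_left lift_ten[OF tens_scale_vector_space mult_bilin])

lemma tmult_add_left: "t \<in> T \<Longrightarrow> u \<in> T \<Longrightarrow> w \<in> T \<Longrightarrow> tens_mult H (t + u) w = tens_mult H t w + tens_mult H u w"
  unfolding tens_mult_def by (simp add: lift_add[OF tens_scale_vector_space mult_bilin2])

lemma tmult_scale_left: "t \<in> T \<Longrightarrow> w \<in> T \<Longrightarrow> tens_mult H (tens_scale c t) w = tens_scale c (tens_mult H t w)"
  unfolding tens_mult_def by (simp add: lift_scale[OF tens_scale_vector_space mult_bilin2])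

lemma tmult_zero_left: "w \<in> T \<Longrightarrow> tens_mult H 0 w = 0"
  unfolding tens_mult_def by (simp add: lift_zero[OF tens_scale_vector_space mult_bilin2])

lemma tmult_zero_right: "t \<in> T \<Longrightarrow> tens_mult H t 0 = 0"
proof (induction rule: T_induct)
  case (add x y t)
  then show ?case
    by (simp add: tmult_add_left tmult_ten_left lift_zero[OF tens_scale_vector_space mult_bilin])
qed (simp add: tmult_zero_left)

lemma tmult_add_right:
  assumes "t \<in> T" "u \<in> T" "w \<in> T"
  shows "tens_mult H t (u + w) = tens_mult H t u + tens_mult H t w"
  using assms(1)
proof (induction rule: T_induct)
  case (add x y t)
  have "tens_mult H (x \<boxtimes> y) (u + w) = tens_mult H (x \<boxtimes> y) u + tens_mult H (x \<boxtimes> y) w"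
    using assms by (simp add: tmult_ten_left lift_add[OF tens_scale_vector_space mult_bilin])
  then show ?case using add assms by (simp add: tmult_add_left)
qed (simp add: tmult_zero_left assms)

lemma tmult_scale_right:
  assumes "t \<in> T" "w \<in> T"
  shows "tens_mult H t (tens_scale c w) = tens_scale c (tens_mult H t w)"
  using assms(1)
proof (induction rule: T_induct)
  case (add x y t)
  have "tens_mult H (x \<boxtimes> y) (tens_scale c w) = tens_scale c (tens_mult H (x \<boxtimes> y) w)"
    using assms by (simp add: tmult_ten_left lift_scale[OF tens_scale_vector_space mult_bilin])
  then show ?case using add assms by (simp add: tmult_add_left tens_scale_simps)
qed (simp add: tmult_zero_left tens_scale_simps assms)

lemma tmult_in [simp, intro]:
  assumes "t \<in> T" "u \<in> T"
  shows "tens_mult H t u \<in> T"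
  using assms(1)
proof (induction rule: T_induct)
  case (add x y t)
  have "tens_mult H (x \<boxtimes> y) u \<in> T" using assms(2)
    by (induction rule: T_induct) (auto simp: tmult_zero_right tmult_add_right tmult_ten)
  with add show ?case by (simp add: tmult_add_left assms)
qed (simp add: tmult_zero_left assms)

lemma tmult_sum_left:
  assumes "\<And>i. i \<in> I \<Longrightarrow> t i \<in> T" "w \<in> T"
  shows "tens_mult H (\<Sum>i\<in>I. t i) w = (\<Sum>i\<in>I. tens_mult H (t i) w)"
  using assms by (induction I rule: infinite_finite_induct) (auto simp: tmult_zero_left tmult_add_left)

lemma tmult_sum_right:
  assumes "\<And>i. i \<in> I \<Longrightarrow> t i \<in> T" "w \<in> T"
  shows "tens_mult H w (\<Sum>i\<in>I. t i) = (\<Sum>i\<in>I. tens_mult H w (t i))"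
  using assms by (induction I rule: infinite_finite_induct) (auto simp: tmult_zero_right tmult_add_right)

lemma tmult_assoc:
  assumes "t \<in> T" "u \<in> T" "w \<in> T"
  shows "tens_mult H (tens_mult H t u) w = tens_mult H t (tens_mult H u w)"
proof -
  have 1: "tens_mult H (tens_mult H (a \<boxtimes> b) (c \<boxtimes> d)) w = tens_mult H (a \<boxtimes> b) (tens_mult H (c \<boxtimes> d) w)" for a b c d
    using assms(3)
    by (induction rule: T_induct) (auto simp: tmult_zero_right tmult_add_right tmult_ten mult.assoc)
  have 2: "tens_mult H (tens_mult H (a \<boxtimes> b) u) w = tens_mult H (a \<boxtimes> b) (tens_mult H u w)" for a b
    using assms(2)
    by (induction rule: T_induct) (auto simp: tmult_zero_right tmult_zero_left tmult_add_right tmult_add_left 1 assms)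
  show ?thesis using assms(1)
    by (induction rule: T_induct) (auto simp: tmult_zero_left tmult_add_left 2 assms)
qed

lemma tmult_one:
  assumes "t \<in> T"
  shows "tens_mult H (1 \<boxtimes> 1) t = t" "tens_mult H t (1 \<boxtimes> 1) = t"
  using assms by (induction rule: T_induct) (auto simp: tmult_zero_left tmult_zero_right tmult_add_right tmult_add_left tmult_ten)

text \<open>Tensors are functionals on bilinear forms, so \<phi> \<otimes> \<psi> is evaluation at
  the product form. Linearity in the tensor is then pointwise and asks for no membership in
  \<open>T\<close>.\<close>

definition pair :: "('h \<Rightarrow> 'k) \<Rightarrow> ('h \<Rightarrow> 'k) \<Rightarrow> ('k, 'h, 'h) tensor \<Rightarrow> 'k"
  where "pair \<phi> \<psi> t = t (\<lambda>a b. \<phi> a * \<psi> b)"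

lemma pair_ten: "lin \<phi> \<Longrightarrow> lin \<psi> \<Longrightarrow> pair \<phi> \<psi> (x \<boxtimes> y) = \<phi> x * \<psi> y"
  unfolding pair_def ten_app
  by (subst if_P) (auto intro!: bilinI field_vector_space simp: lin_simps algebra_simps)

lemma pair_simps:
  "pair \<phi> \<psi> (t + u) = pair \<phi> \<psi> t + pair \<phi> \<psi> u" "pair \<phi> \<psi> 0 = 0" "pair \<phi> \<psi> (tens_scale c t) = c * pair \<phi> \<psi> t"
  by (simp_all add: pair_def tens_scale_def plus_fun_apply zero_fun_apply)

lemma pair_sum: "pair \<phi> \<psi> (\<Sum>i\<in>I. t i) = (\<Sum>i\<in>I. pair \<phi> \<psi> (t i))"
  by (induction I rule: infinite_finite_induct) (auto simp: pair_simps)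

lemma lin_sumI:
  assumes "\<And>i. i \<in> I \<Longrightarrow> lin (f i)"
  shows "lin (\<lambda>x. \<Sum>i\<in>I. f i x)"
  by (intro linearI vector_space_axioms field_vector_space, unfold sum.distrib[symmetric] sum_distrib_left)
    (rule sum.cong[OF refl], erule lin_simps[OF assms])+

lemma lin_mult_left: "lin f \<Longrightarrow> lin (\<lambda>x. f (y * x))" and lin_mult_right: "lin f \<Longrightarrow> lin (\<lambda>x. f (x * y))"
  by (intro linearI vector_space_axioms field_vector_space;
      simp add: lin_simps distrib_left distrib_right scal_mult_left' scal_mult_right')+

lemma lin_cmult: "lin f \<Longrightarrow> lin (\<lambda>x. c * f x)"
  by (intro linearI vector_space_axioms field_vector_space) (simp_all add: lin_simps algebra_simps)

text \<open>Base change matrices for comatrices. Their entries are central in \<open>H\<close>,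
  whence \<open>emb_commute\<close>.\<close>

definition emb :: "('k, 'n::finite) sqmat \<Rightarrow> ('h, 'n) sqmat"
  where "emb A = Mat (\<lambda>i j. scal H (ent A i j) 1)"

lemma ent_emb [simp]: "ent (emb A) i j = scal H (ent A i j) 1"
  by (simp add: emb_def)

lemma emb_simps: "emb (A * B) = emb A * emb B" "emb 1 = 1" "emb 0 = 0" "emb (A + B) = emb A + emb B"
  "emb (A - B) = emb A - emb B" "emb (- A) = - emb A"
  by (auto intro!: sqmat_eqI simp: ent_mult ent_one scal_mult_left' scale_sum_left
      scale_left_distrib scale_left_diff_distrib)

lemma emb_sum: "emb (\<Sum>i\<in>I. A i) = (\<Sum>i\<in>I. emb (A i))"
  by (induction I rule: infinite_finite_induct) (auto simp: emb_simps)

lemma emb_sc: "emb (sc s) = sc (scal H s 1)"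
  by (rule sqmat_eqI) (auto simp: ent_sc)

lemma scal_one_mult: "scal H s 1 * x = scal H s x" "x * scal H s 1 = scal H s x"
  by (simp_all add: scal_mult_left' scal_mult_right')

lemma emb_commute: "sc x * emb A = emb A * sc x"
  by (rule sqmat_eqI) (simp add: ent_sc_mult ent_mult_sc scal_one_mult)

lemma ent_emb_mult: "ent (emb A * X) i j = (\<Sum>l\<in>UNIV. scal H (ent A i l) (ent X l j))"
  "ent (X * emb A) i j = (\<Sum>l\<in>UNIV. scal H (ent A l j) (ent X i l))"
  by (simp_all add: ent_mult scal_one_mult)

definition ev :: "('h \<Rightarrow> 'k) \<Rightarrow> ('h, 'n::finite) sqmat \<Rightarrow> ('k, 'n) sqmat"
  where "ev \<phi> X = Mat (\<lambda>i j. \<phi> (ent X i j))"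

lemma ent_ev [simp]: "ent (ev \<phi> X) i j = \<phi> (ent X i j)"
  by (simp add: ev_def)

lemma ev_emb: 
  assumes "lin \<phi>"
  shows "ev \<phi> (emb A * X) = A * ev \<phi> X" "ev \<phi> (X * emb A) = ev \<phi> X * A"
  by (rule sqmat_eqI, simp add: ent_emb_mult lin_simps[OF assms], simp add: ent_mult mult.commute)+

lemma ev_simps: 
  assumes "lin \<phi>"
  shows "ev \<phi> (X + Y) = ev \<phi> X + ev \<phi> Y" "ev \<phi> (X - Y) = ev \<phi> X - ev \<phi> Y" "ev \<phi> 0 = 0"
    "ev \<phi> (\<Sum>i\<in>I. Z i) = (\<Sum>i\<in>I. ev \<phi> (Z i))"
  by (rule sqmat_eqI, simp add: ent_sum lin_simps[OF assms])+

end

sublocale bialgebra \<subseteq> tensor_algebra H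
  by unfold_locales (simp_all add: scal_mult_left scal_mult_right)

section \<open>Group-like elements, comatrices and coordinates\<close>

lemma sum_munit: "(\<Sum>p\<in>UNIV. munit p p) = (1 :: ('a::ring_1, 'n::finite) sqmat)"
proof (rule sqmat_eqI)
  fix i j :: 'n
  have "(\<Sum>p\<in>UNIV. if i = p \<and> j = p then 1 else 0) = (\<Sum>p\<in>UNIV. if p = i then (if i = j then 1 else 0) else (0::'a))"
    by (rule sum.cong) auto
  then show "ent (\<Sum>p\<in>UNIV. munit p p) i j = ent (1 :: ('a, 'n) sqmat) i j"
    by (simp add: ent_sum ent_munit ent_one)
qed

context hopf_algebra
begin

definition glike :: "'h \<Rightarrow> bool"
  where "glike g \<longleftrightarrow> comult H g = g \<boxtimes> g \<and> counit H g = 1"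

definition comat :: "('h, 'n::finite) sqmat \<Rightarrow> bool"
  where "comat d \<longleftrightarrow>
    (\<forall>i j. comult H (ent d i j) = (\<Sum>l\<in>UNIV. ent d i l \<boxtimes> ent d l j)) \<and>
    (\<forall>i j. counit H (ent d i j) = (if i = j then 1 else 0))"

definition mS :: "('h, 'n::finite) sqmat \<Rightarrow> ('h, 'n) sqmat"
  where "mS d = Mat (\<lambda>i j. S (ent d i j))"

lemma ent_mS [simp]: "ent (mS d) i j = S (ent d i j)"
  by (simp add: mS_def)

lemma comult_T [simp, intro]: "comult H x \<in> T"
  by (rule comult_in)

lemma comult_simps: "comult H (x + y) = comult H x + comult H y" "comult H (scal H c x) = tens_scale c (comult H x)"
  "comult H 0 = 0"
  using lin_simps[OF comult_linear] by auto

lemma comult_sum: "comult H (\<Sum>i\<in>I. f i) = (\<Sum>i\<in>I. comult H (f i))"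
  using lin_simps[OF comult_linear] by auto

lemmas counit_simps = lin_simps[OF counit_linear]

lemma S_simps: "S (x + y) = S x + S y" "S (scal H c x) = scal H c (S x)" "S 0 = 0" "S (sum f A) = (\<Sum>a\<in>A. S (f a))"
  by (simp_all add: lin_simps[OF antipode_linear])

lemma bilin_S: "bilin (scal H) (\<lambda>a b. S a * b)" "bilin (scal H) (\<lambda>a b. a * S b)"
  by (intro bilinI vector_space_axioms; simp add: S_simps algebra_simps scal_mult_left scal_mult_right)+

lemma bilin_adj: "bilin (scal H) (\<lambda>a b. a * x * S b)"
  by (intro bilinI vector_space_axioms; simp add: S_simps algebra_simps scal_mult_left scal_mult_right)

lemmas lift_S = lift_sum_ten[OF vector_space_axioms bilin_S(1)] lift_sum_ten[OF vector_space_axioms bilin_S(2)]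
  lift_ten[OF vector_space_axioms bilin_S(1)] lift_ten[OF vector_space_axioms bilin_S(2)]

text \<open>Read entry by entry, these are the two antipode axioms.\<close>

lemma comat_inv:
  assumes "comat d"
  shows "d * mS d = 1" "mS d * d = 1"
proof -
  have c: "comult H (ent d i j) = (\<Sum>l\<in>UNIV. ent d i l \<boxtimes> ent d l j)" "counit H (ent d i j) = (if i = j then 1 else 0)" for i j
    using assms by (auto simp: comat_def)
  show "d * mS d = 1" "mS d * d = 1"
    using antipode_right[of "ent d i j" for i j] antipode_left[of "ent d i j" for i j]
    by (auto intro!: sqmat_eqI simp: ent_mult ent_one c lift_S)
qed

lemma glike_inv: "glike g \<Longrightarrow> g * S g = 1" "glike g \<Longrightarrow> S g * g = 1"
  using antipode_right[of g] antipode_left[of g] by (auto simp: glike_def lift_S)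

lemma glike_one: "glike 1"
  by (simp add: glike_def comult_one counit_one)

lemma glike_mult: "glike g \<Longrightarrow> glike h \<Longrightarrow> glike (g * h)"
  by (simp add: glike_def comult_mult counit_mult tmult_ten)

lemma glike_nonzero: "glike g \<Longrightarrow> g \<noteq> 0"
  by (auto simp: glike_def counit_simps)

lemma glike_S:
  assumes g: "glike g"
  shows "glike (S g)"
proof -
  have "1 \<boxtimes> 1 = tens_mult H (g \<boxtimes> g) (comult H (S g))"
    using g glike_inv[OF g] comult_mult[of g "S g"] by (simp add: glike_def comult_one)
  then have "tens_mult H (S g \<boxtimes> S g) (1 \<boxtimes> 1) = tens_mult H (tens_mult H (S g \<boxtimes> S g) (g \<boxtimes> g)) (comult H (S g))"
    by (simp add: tmult_assoc)
  then have "S g \<boxtimes> S g = comult H (S g)"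
    by (simp add: tmult_ten glike_inv[OF g] tmult_one)
  moreover have "counit H g * counit H (S g) = 1"
    using glike_inv[OF g] counit_mult[of g "S g"] counit_one by simp
  ultimately show ?thesis using g by (simp add: glike_def)
qed

lemma comat_sc_mult:
  assumes g: "glike g" and d: "comat d"
  shows "comat (sc g * d)" "comat (d * sc g)"
  using g d by (auto simp: comat_def glike_def ent_sc_mult ent_mult_sc comult_mult counit_mult
      tmult_sum_left tmult_sum_right tmult_ten)

text \<open>The product of the dual algebra of \<open>H\<close>.\<close>

definition conv :: "('h \<Rightarrow> 'k) \<Rightarrow> ('h \<Rightarrow> 'k) \<Rightarrow> 'h \<Rightarrow> 'k"
  where "conv \<phi> \<psi> x = pair \<phi> \<psi> (comult H x)"

lemma conv_lin: "lin (conv \<phi> \<psi>)"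
  by (intro linearI vector_space_axioms field_vector_space) (simp_all add: conv_def comult_simps pair_simps)

lemma conv_glike: "lin \<phi> \<Longrightarrow> lin \<psi> \<Longrightarrow> glike g \<Longrightarrow> conv \<phi> \<psi> g = \<phi> g * \<psi> g"
  by (simp add: conv_def glike_def pair_ten)

text \<open>A comatrix \<open>d\<close> amounts to a matrix representation \<phi> \<mapsto>
  \<open>ev \<phi> d\<close> of the dual algebra, so questions about comatrices become questions
  about modules over a product of matrix algebras.\<close>

lemma ev_conv:
  assumes "lin \<phi>" "lin \<psi>" "comat d"
  shows "ev (conv \<phi> \<psi>) d = ev \<phi> d * ev \<psi> d"
proof (rule sqmat_eqI)
  fix i j
  have "comult H (ent d i j) = (\<Sum>l\<in>UNIV. ent d i l \<boxtimes> ent d l j)"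
    using assms by (auto simp: comat_def)
  then show "ent (ev (conv \<phi> \<psi>) d) i j = ent (ev \<phi> d * ev \<psi> d) i j"
    by (simp add: conv_def ent_mult pair_sum pair_ten assms)
qed

lemma ev_counit: "comat d \<Longrightarrow> ev (counit H) d = 1"
  by (rule sqmat_eqI) (simp add: comat_def ent_one)

end

text \<open>The coordinate functionals \<open>\<gamma>\<close> and \<open>\<kappa>\<close> are
  parameters, so that the blocks \<open>cc\<close> can later be replaced by conjugate ones
  (\<open>rebase\<close>) together with their coordinates.\<close>

locale cobasis = hopf_algebra H S
  for H :: "('k::{alg_closed_field, field_char_0}, 'h::ring_1) coalg" and S :: "'h \<Rightarrow> 'h" +
  fixes G :: "'h set" and cc :: "nat \<Rightarrow> ('h, 4) sqmat"
    and \<gamma> :: "'h \<Rightarrow> 'h \<Rightarrow> 'k" and \<kappa> :: "nat \<Rightarrow> 4 \<Rightarrow> 4 \<Rightarrow> 'h \<Rightarrow> 'k"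
  assumes finite_G: "finite G" and card_G: "card G = 12"
    and glike_G: "g \<in> G \<Longrightarrow> glike g"
    and comat_cc: "m < 3 \<Longrightarrow> comat (cc m)"
    and lin_\<gamma>: "lin (\<gamma> g)" and lin_\<kappa>: "lin (\<kappa> m i j)"
    and \<gamma>_G: "g \<in> G \<Longrightarrow> g' \<in> G \<Longrightarrow> \<gamma> g g' = (if g = g' then 1 else 0)"
    and \<gamma>_cc: "g \<in> G \<Longrightarrow> m < 3 \<Longrightarrow> \<gamma> g (ent (cc m) i j) = 0"
    and \<kappa>_G: "m < 3 \<Longrightarrow> g \<in> G \<Longrightarrow> \<kappa> m i j g = 0"
    and \<kappa>_cc: "m < 3 \<Longrightarrow> n < 3 \<Longrightarrow>
      \<kappa> m i j (ent (cc n) p q) = (if m = n \<and> i = p \<and> j = q then 1 else 0)"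
    and expand: "x = (\<Sum>g\<in>G. scal H (\<gamma> g x) g) +
      (\<Sum>m<3. \<Sum>i\<in>UNIV. \<Sum>j\<in>UNIV. scal H (\<kappa> m i j x) (ent (cc m) i j))"
begin

lemma ev_\<gamma>_cc: "g \<in> G \<Longrightarrow> m < 3 \<Longrightarrow> ev (\<gamma> g) (cc m) = 0"
  by (rule sqmat_eqI) (simp add: \<gamma>_cc)

lemma ev_\<kappa>_cc: "m < 3 \<Longrightarrow> n < 3 \<Longrightarrow> ev (\<kappa> m i j) (cc n) = (if m = n then munit i j else 0)"
  by (rule sqmat_eqI) (auto simp: \<kappa>_cc ent_munit)

lemma lin_ext:
  assumes "lin \<phi>" "lin \<psi>" "\<And>g. g \<in> G \<Longrightarrow> \<phi> g = \<psi> g" "\<And>m. m < 3 \<Longrightarrow> ev \<phi> (cc m) = ev \<psi> (cc m)"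
  shows "\<phi> = \<psi>"
proof
  fix x
  have e: "\<phi> (ent (cc m) i j) = \<psi> (ent (cc m) i j)" if "m < 3" for m i j
    using assms(4)[OF that] by (metis ent_ev)
  show "\<phi> x = \<psi> x"
    by (subst (1 2) expand[of x])
      (simp add: lin_simps[OF assms(1)] lin_simps[OF assms(2)] assms(3) e)
qed

lemma eq_coords:
  assumes "\<And>g. g \<in> G \<Longrightarrow> \<gamma> g x = \<gamma> g y" "\<And>m i j. m < 3 \<Longrightarrow> \<kappa> m i j x = \<kappa> m i j y"
  shows "x = y"
  by (subst expand[of x], subst expand[of y]) (simp add: assms)

lemma mat_eq_coords:
  assumes "\<And>g. g \<in> G \<Longrightarrow> ev (\<gamma> g) X = ev (\<gamma> g) Y" "\<And>m i j. m < 3 \<Longrightarrow> ev (\<kappa> m i j) X = ev (\<kappa> m i j) Y"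
  shows "X = Y"
  using assms by (intro sqmat_eqI eq_coords) (metis ent_ev)+

text \<open>This and the next two lemmas identify the dual algebra as
  \<open>k^12 x M_4(k)^3\<close>: the \<open>\<kappa>\<close> are matrix units, the
  \<open>\<gamma>\<close> orthogonal idempotents.\<close>

lemma conv_\<kappa>\<kappa>:
  "m < 3 \<Longrightarrow> n < 3 \<Longrightarrow> conv (\<kappa> m i j) (\<kappa> n p q) = (if m = n \<and> j = p then \<kappa> m i q else (\<lambda>x. 0))"
proof (rule lin_ext, goal_cases)
  case 2 then show ?case by (auto intro!: lin_\<kappa> linearI vector_space_axioms field_vector_space)
next
  case (4 l) then show ?case
    by (auto simp: ev_conv lin_\<kappa> comat_cc ev_\<kappa>_cc munit_mult intro!: sqmat_eqI)
qed (auto simp: conv_lin conv_glike lin_\<kappa> glike_G \<kappa>_G)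

lemma conv_\<gamma>\<kappa>: "g \<in> G \<Longrightarrow> m < 3 \<Longrightarrow> conv (\<gamma> g) (\<kappa> m i j) = (\<lambda>x. 0)"
  and conv_\<kappa>\<gamma>: "g \<in> G \<Longrightarrow> m < 3 \<Longrightarrow> conv (\<kappa> m i j) (\<gamma> g) = (\<lambda>x. 0)"
  by (rule lin_ext; auto intro!: sqmat_eqI linearI vector_space_axioms field_vector_space
      simp: conv_lin conv_glike lin_\<kappa> lin_\<gamma> glike_G \<kappa>_G ev_conv comat_cc ev_\<gamma>_cc)+

lemma conv_\<gamma>\<gamma>: "g \<in> G \<Longrightarrow> g' \<in> G \<Longrightarrow> conv (\<gamma> g) (\<gamma> g') = (if g = g' then \<gamma> g else (\<lambda>x. 0))"
proof (rule lin_ext, goal_cases)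
  case 2 then show ?case by (auto intro!: lin_\<gamma> linearI vector_space_axioms field_vector_space)
qed (auto intro!: sqmat_eqI simp: conv_lin conv_glike lin_\<gamma> glike_G \<gamma>_G ev_conv comat_cc ev_\<gamma>_cc)

lemma counit_expand: "counit H x = (\<Sum>g\<in>G. \<gamma> g x) + (\<Sum>m<3. \<Sum>i\<in>UNIV. \<kappa> m i i x)"
proof -
  have "counit H (ent (cc m) i j) = (if i = j then 1 else 0)" if "m < 3" for m i j
    using comat_cc[OF that] by (simp add: comat_def)
  moreover have "counit H g = 1" if "g \<in> G" for g
    using glike_G[OF that] by (simp add: glike_def)
  moreover have "counit H x = (\<Sum>g\<in>G. \<gamma> g x * counit H g) +
      (\<Sum>m<3. \<Sum>i\<in>UNIV. \<Sum>j\<in>UNIV. \<kappa> m i j x * counit H (ent (cc m) i j))"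
    by (subst expand[of x]) (simp add: counit_simps)
  moreover have "(\<Sum>m<3. \<Sum>i\<in>UNIV. \<Sum>j\<in>UNIV. \<kappa> m i j x * counit H (ent (cc m) i j))
      = (\<Sum>m<3. \<Sum>i\<in>UNIV. \<kappa> m i i x)"
    by (intro sum.cong refl) (simp add: calculation(1) if_distrib[of "\<lambda>x. _ * x"] cong: if_cong)
  ultimately show ?thesis by simp
qed

text \<open>Through \<open>d\<close> the dual algebra acts on a space of dimension 4. Where block
  \<open>m\<close> acts nontrivially there is a copy of its simple module, which already has
  dimension 4 and fills the space; so the action is the standard one in another basis, and all other
  blocks and group-likes act as zero.\<close>

lemma comat_classify:
  assumes d: "comat d" and m: "m < 3" and nz: "ev (\<kappa> m i0 j0) d \<noteq> 0"
  shows "\<exists>P Q. P * Q = 1 \<and> Q * P = 1 \<and> d * emb P = emb P * cc m"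
proof -
  let ?\<rho> = "\<lambda>\<phi>. ev \<phi> d"
  obtain r0 s0 where z: "ent (?\<rho> (\<kappa> m i0 j0)) r0 s0 \<noteq> 0"
    using nz by (metis ent_zero sqmat_eqI)
  define z where "z = ent (?\<rho> (\<kappa> m i0 j0)) r0 s0"
  have zero: "?\<rho> (\<lambda>x. 0) = 0" by (rule sqmat_eqI) simp
  have \<rho>\<kappa>: "?\<rho> (\<kappa> n p q) * ?\<rho> (\<kappa> l r s) = (if n = l \<and> q = r then ?\<rho> (\<kappa> n p s) else 0)"
    if "n < 3" "l < 3" for n p q l r s
    using that by (auto simp: conv_\<kappa>\<kappa> zero d simp flip: ev_conv[OF lin_\<kappa> lin_\<kappa>])
  \<comment> \<open>Column \<open>i\<close> of \<open>P\<close> is the image of the basis vector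
    \<open>s0\<close> under \<open>\<kappa> m i j0\<close>; the rows of \<open>Q\<close> come from
    row \<open>r0\<close> in the dual way. The product of matrix units leaves the entry
    \<open>z\<close>, which the factor \<open>inverse z\<close> normalises.\<close>
  define P where "P = Mat (\<lambda>r i. ent (?\<rho> (\<kappa> m i j0)) r s0)"
  define Q where "Q = Mat (\<lambda>q c. inverse z * ent (?\<rho> (\<kappa> m i0 q)) r0 c)"
  have P: "?\<rho> (\<kappa> m p q) * P = P * munit p q" for p q
  proof (rule sqmat_eqI)
    fix r i
    have "ent (?\<rho> (\<kappa> m p q) * P) r i = ent (?\<rho> (\<kappa> m p q) * ?\<rho> (\<kappa> m i j0)) r s0"
      by (simp only: ent_mult P_def ent_Mat)
    then show "ent (?\<rho> (\<kappa> m p q) * P) r i = ent (P * munit p q) r i"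
      by (simp add: \<rho>\<kappa> m ent_mult_munit P_def)
  qed
  have QP: "Q * P = 1"
  proof (rule sqmat_eqI)
    fix q i
    have "ent (Q * P) q i = inverse z * ent (?\<rho> (\<kappa> m i0 q) * ?\<rho> (\<kappa> m i j0)) r0 s0"
      by (simp only: ent_mult P_def Q_def ent_Mat sum_distrib_left mult.assoc)
    also have "\<dots> = (if q = i then 1 else 0)"
      using z m by (simp add: \<rho>\<kappa> z_def)
    finally show "ent (Q * P) q i = ent 1 q i" by (simp add: ent_one)
  qed
  then have PQ: "P * Q = 1" by (rule sqmat_left_right_inverse)
  have \<rho>m: "?\<rho> (\<kappa> m p q) = P * munit p q * Q" for p q
  proof -
    have "?\<rho> (\<kappa> m p q) = ?\<rho> (\<kappa> m p q) * P * Q" by (simp add: PQ mult.assoc)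
    then show ?thesis by (simp only: P)
  qed
  have one: "(\<Sum>p\<in>UNIV. ?\<rho> (\<kappa> m p p)) = 1"
    by (simp only: \<rho>m sum_munit sum_distrib_left[symmetric] sum_distrib_right[symmetric] mult_1_right PQ)
  have other: "?\<rho> (\<kappa> n p q) = 0" if "n < 3" "n \<noteq> m" for n p q
  proof -
    have "?\<rho> (\<kappa> n p q) = ?\<rho> (\<kappa> n p q) * (\<Sum>s\<in>UNIV. ?\<rho> (\<kappa> m s s))" by (simp add: one)
    then show ?thesis using that m by (simp add: sum_distrib_left \<rho>\<kappa>)
  qed
  have other\<gamma>: "?\<rho> (\<gamma> g) = 0" if "g \<in> G" for g
  proof -
    have "?\<rho> (\<gamma> g) = ?\<rho> (\<gamma> g) * (\<Sum>s\<in>UNIV. ?\<rho> (\<kappa> m s s))" by (simp add: one)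
    then show ?thesis using that m
      by (simp add: sum_distrib_left conv_\<gamma>\<kappa> zero d flip: ev_conv[OF lin_\<gamma> lin_\<kappa>])
  qed
  have "d * emb P = emb P * cc m"
  proof (rule mat_eq_coords)
    show "ev (\<gamma> g) (d * emb P) = ev (\<gamma> g) (emb P * cc m)" if "g \<in> G" for g
      using that m by (simp add: ev_emb lin_\<gamma> other\<gamma> ev_\<gamma>_cc)
    show "ev (\<kappa> n i j) (d * emb P) = ev (\<kappa> n i j) (emb P * cc m)" if "n < 3" for n i j
      using that m by (cases "n = m") (simp_all add: ev_emb lin_\<kappa> other ev_\<kappa>_cc P)
  qed
  then show ?thesis using PQ QP by blast
qed

lemma schur:
  assumes m: "m < 3" and c: "cc m * emb X = emb X * cc m"
  shows "\<exists>s. X = sc s"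
proof (rule commutes_munits_scalar)
  fix p q
  have "ev (\<kappa> m p q) (cc m * emb X) = ev (\<kappa> m p q) (emb X * cc m)" using c by simp
  then show "munit p q * X = X * munit p q" using m by (simp add: ev_emb lin_\<kappa> ev_\<kappa>_cc)
qed

lemma schur_zero:
  assumes "m < 3" "n < 3" "m \<noteq> n" and c: "cc m * emb X = emb X * cc n"
  shows "X = 0"
proof -
  have "munit p p * X = 0" for p
  proof -
    have "ev (\<kappa> m p p) (cc m * emb X) = ev (\<kappa> m p p) (emb X * cc n)" using c by simp
    then show ?thesis using assms(1-3) by (simp add: ev_emb lin_\<kappa> ev_\<kappa>_cc)
  qed
  then show ?thesis by (intro sqmat_eqI) (metis ent_munit_mult ent_zero)
qed

text \<open>Evaluation at a group-like is a character of the dual algebra. On a matrix block it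
  vanishes: off-diagonal units square to zero, and every unit is a product through an off-diagonal
  one. On the remaining \<open>k^12\<close> a character is a single coordinate.\<close>

lemma glike_in_G:
  assumes "glike x"
  shows "x \<in> G"
proof -
  have \<kappa>mult: "\<kappa> m i j x * \<kappa> n p q x = (if m = n \<and> j = p then \<kappa> m i q x else 0)" if "m < 3" "n < 3" for m n i j p q
    using conv_\<kappa>\<kappa>[OF that, of i j p q] conv_glike[OF lin_\<kappa> lin_\<kappa> assms, of m i j n p q] by (cases "m = n \<and> j = p") auto
  have off: "\<kappa> m i j x = 0" if "m < 3" "i \<noteq> j" for m i j
    using \<kappa>mult[of m m i j i j] that by simp
  have \<kappa>0: "\<kappa> m i j x = 0" if "m < 3" for m i j
  proof -
    obtain p :: 4 where "p \<noteq> i" by (metis zero_neq_one)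
    then show ?thesis using \<kappa>mult[of m m i p p j] off that by simp
  qed
  have \<gamma>mult: "\<gamma> g x * \<gamma> g' x = (if g = g' then \<gamma> g x else 0)" if "g \<in> G" "g' \<in> G" for g g'
    using conv_\<gamma>\<gamma>[OF that] conv_glike[OF lin_\<gamma> lin_\<gamma> assms, of g g'] by (cases "g = g'") auto
  have x: "x = (\<Sum>g\<in>G. scal H (\<gamma> g x) g)"
    by (subst expand) (simp add: \<kappa>0)
  then obtain g where g: "g \<in> G" "\<gamma> g x \<noteq> 0"
    using glike_nonzero[OF assms] by (metis (no_types, lifting) scale_zero_left sum.neutral)
  have "\<gamma> g x = 1" using \<gamma>mult[OF g(1) g(1)] g(2) by simp
  moreover have "\<gamma> g' x = 0" if "g' \<in> G" "g' \<noteq> g" for g'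
    using \<gamma>mult[OF g(1) that(1)] that(2) g(2) by auto
  ultimately have "x = (\<Sum>g'\<in>G. if g' = g then g else 0)"
    by (subst x) (intro sum.cong, auto)
  then show ?thesis using g finite_G by simp
qed

end

section \<open>Traces and elements of order three\<close>

lemma mult_sc_mult: "A * (sc t * B) = sc t * (A * B)" for t :: "'a::comm_ring_1"
  by (simp only: mult.assoc[symmetric] sc_commute[of t A])

lemma sc_mult_sc_mult: "sc s * A * (sc t * B) = sc (s * t) * (A * B)" for t :: "'a::comm_ring_1"
  by (simp only: mult.assoc[of "sc s"] mult_sc_mult[of A]) (simp only: sc_simps mult.assoc)

text \<open>For a cube root of unity s the mean of 1, sX, s^2 X^2 is idempotent, so its trace is an
  integer. If \<open>tr X\<close> vanished, the products of \<open>tr (X * X)\<close> with all three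
  cube roots of unity would be integers congruent to 2 modulo 3. Size 4 enters by not being
  divisible by 3.\<close>

lemma tr_order3_ne_0:
  fixes X :: "('k::{alg_closed_field, field_char_0}, 4) sqmat"
  assumes X3: "X * X * X = 1"
  shows "tr X \<noteq> 0"
proof
  assume t1: "tr X = 0"
  have "\<exists>x::'k. (\<Sum>k\<le>2. 1 * x ^ k) = 0"
    by (rule alg_closed) auto
  then obtain \<zeta> :: 'k where \<zeta>: "1 + \<zeta> + \<zeta> * \<zeta> = 0"
    by (auto simp: eval_nat_numeral)
  have \<zeta>3: "\<zeta> * \<zeta> * \<zeta> = 1"
  proof -
    have "\<zeta> * \<zeta> * \<zeta> - 1 = (\<zeta> - 1) * (1 + \<zeta> + \<zeta> * \<zeta>)" by (simp add: algebra_simps)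
    then show ?thesis using \<zeta> by simp
  qed
  have ex: "\<exists>N::int. s * s * tr (X * X) = of_int (3 * N - 4)" if s: "s * s * s = 1" for s
  proof -
    define Y where "Y = sc s * X"
    have Y2: "Y * Y = sc (s * s) * (X * X)"
      unfolding Y_def by (rule sc_mult_sc_mult)
    have "Y * Y * Y = sc (s * s * s) * (X * X * X)"
      by (simp only: Y2) (simp only: Y_def sc_mult_sc_mult)
    then have Y3: "Y * (Y * Y) = 1" by (simp only: s X3 sc_simps(2) mult_1_left mult.assoc[of Y Y Y])
    have Y4: "Y * (Y * (Y * Y)) = Y" using Y3 by simp
    define E where "E = sc (1 / 3) * (1 + Y + Y * Y)"
    have "(1 + Y + Y * Y) * (1 + Y + Y * Y) = sc 3 * (1 + Y + Y * Y)"
    proof -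
      have "(3::'k) = 1 + 1 + 1" by simp
      then have three: "sc (3::'k) = (1 + 1 + 1 :: ('k, 4) sqmat)" by (simp only: sc_simps)
      show ?thesis by (simp only: three distrib_left distrib_right mult.assoc Y3 Y4 mult_1_left mult_1_right add_ac)
    qed
    then have "E * E = sc (1 / 3 * (1 / 3)) * (sc 3 * (1 + Y + Y * Y))"
      unfolding E_def by (simp only: sc_mult_sc_mult)
    also have "\<dots> = sc (1 / 3 * (1 / 3) * 3) * (1 + Y + Y * Y)"
      by (simp only: sc_simps mult.assoc)
    finally have "E * E = E" by (simp add: E_def)
    then obtain n where n: "tr E = of_nat n" using idempotent_tr_nat by blast
    have "tr E = (4 + s * s * tr (X * X)) / 3"
      by (simp add: E_def tr_sc_mult tr_simps tr_one Y2) (simp add: Y_def tr_sc_mult t1)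
    then have "s * s * tr (X * X) = of_int (3 * int n - 4)"
      using n by (simp add: field_simps)
    then show ?thesis by blast
  qed
  obtain N0 where N0: "tr (X * X) = of_int (3 * N0 - 4)" using ex[of 1] by auto
  obtain N1 where N1: "\<zeta> * \<zeta> * tr (X * X) = of_int (3 * N1 - 4)" using ex[of \<zeta>] \<zeta>3 by auto
  have "\<zeta> * \<zeta> * (\<zeta> * \<zeta>) * (\<zeta> * \<zeta>) = 1" using \<zeta>3 by (simp add: mult.assoc[symmetric])
  then obtain N2 where N2': "\<zeta> * \<zeta> * (\<zeta> * \<zeta>) * tr (X * X) = of_int (3 * N2 - 4)"
    using ex[of "\<zeta> * \<zeta>"] by auto
  have N2: "\<zeta> * tr (X * X) = of_int (3 * N2 - 4)"
    using N2' \<zeta>3 by (simp add: mult.assoc[symmetric])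
  define p q where "p = 3 * N0 - 4" and "q = 3 * N2 - 4"
  define r where "r = 3 * N1 - 4"
  have pk: "tr (X * X) = of_int p" "\<zeta> * tr (X * X) = of_int q" "\<zeta> * \<zeta> * tr (X * X) = of_int r"
    using N0 N1 N2 by (simp_all only: p_def q_def r_def)
  have "(of_int (p + q + r) :: 'k) = (1 + \<zeta> + \<zeta> * \<zeta>) * tr (X * X)"
    unfolding of_int_add pk[symmetric] by (simp add: algebra_simps)
  then have sum0: "p + q + r = 0" using \<zeta> by (metis mult_zero_left of_int_eq_0_iff)
  \<comment> \<open>The quotient q / p would be a primitive cube root of unity in the rationals.
    With r = - p - q the relation becomes p^2 + p q + q^2 = 0, multiplied by 4 to exhibit a sum of
    squares.\<close>
  have "(of_int (q * q) :: 'k) = of_int (p * r)"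
    unfolding of_int_mult pk[symmetric] by (simp only: mult_ac)
  then have "q * q = p * r" by (simp only: of_int_eq_iff)
  moreover have "r = - p - q" using sum0 by simp
  ultimately have "(2 * q + p) * (2 * q + p) + 3 * (p * p) = 0" by (simp add: algebra_simps)
  then have "p = 0"
    by (metis add_nonneg_eq_0_iff mult_eq_0_iff mult_nonneg_nonneg zero_le_numeral zero_le_square zero_neq_numeral)
  then show False unfolding p_def by presburger
qed

section \<open>The trace of the regular representation\<close>

context cobasis
begin

definition bidx :: "('h + nat \<times> 4 \<times> 4) set"
  where "bidx = G <+> ({..<3} \<times> UNIV \<times> UNIV)"

definition bas :: "'h + nat \<times> 4 \<times> 4 \<Rightarrow> 'h"
  where "bas t = (case t of Inl g \<Rightarrow> g | Inr (m, i, j) \<Rightarrow> ent (cc m) i j)"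

definition cor :: "'h + nat \<times> 4 \<times> 4 \<Rightarrow> 'h \<Rightarrow> 'k"
  where "cor t = (case t of Inl g \<Rightarrow> \<gamma> g | Inr (m, i, j) \<Rightarrow> \<kappa> m i j)"

lemma finite_bidx: "finite bidx"
  by (simp add: bidx_def finite_G)

lemma card_bidx: "card bidx = 60"
  by (simp add: bidx_def card_Plus finite_G card_G card_cartesian_product)

lemma lin_cor: "lin (cor t)"
  by (auto simp: cor_def lin_\<gamma> lin_\<kappa> split: sum.split)

lemma expand_bas: "x = (\<Sum>t\<in>bidx. scal H (cor t x) (bas t))"
  by (subst expand) (simp add: bidx_def sum.Plus finite_G bas_def cor_def sum.cartesian_product split_def)

lemma cor_bas: "t \<in> bidx \<Longrightarrow> cor t (bas t) = 1"
  by (auto simp: bidx_def cor_def bas_def \<gamma>_G \<kappa>_cc)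

text \<open>The trace of right multiplication by \<open>x\<close>.\<close>

definition \<tau> :: "'h \<Rightarrow> 'k"
  where "\<tau> x = (\<Sum>t\<in>bidx. cor t (bas t * x))"

lemma lin_\<tau>: "lin \<tau>"
  unfolding \<tau>_def by (intro lin_sumI lin_mult_left lin_cor)

lemma \<tau>_one: "\<tau> 1 = 60"
  by (simp add: \<tau>_def cor_bas card_bidx)

lemma \<tau>_mult: "\<tau> (x * y) = (\<Sum>t\<in>bidx. \<Sum>s\<in>bidx. cor s (bas t * x) * cor t (bas s * y))"
proof -
  have "cor t (bas t * (x * y)) = (\<Sum>s\<in>bidx. cor s (bas t * x) * cor t (bas s * y))" for t
  proof -
    have "bas t * (x * y) = (\<Sum>s\<in>bidx. scal H (cor s (bas t * x)) (bas s)) * y"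
      by (simp only: expand_bas[symmetric] mult.assoc)
    then show ?thesis
      by (simp add: sum_distrib_right scal_mult_left lin_simps[OF lin_cor])
  qed
  then show ?thesis by (simp add: \<tau>_def)
qed

lemma \<tau>_commute: "\<tau> (x * y) = \<tau> (y * x)"
  unfolding \<tau>_mult by (subst sum.swap) (simp add: mult.commute)

lemma \<tau>_tr_commute: "\<tau> (tr (A * B)) = \<tau> (tr (B * A))"
  unfolding tr_def ent_mult
  by (simp add: lin_simps[OF lin_\<tau>], subst sum.swap, simp add: \<tau>_commute)

lemma tr_emb: "tr (sc x * emb X) = scal H (tr X) x"
  by (simp add: tr_def ent_sc_mult scal_one_mult scale_sum_left)

text \<open>The trace of right multiplication by an idempotent is the dimension of its range, and
  \<open>e\<close> itself lies in that range.\<close>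

lemma \<tau>_idempotent_zero:
  assumes "e * e = e" "\<tau> e = 0"
  shows "e = 0"
proof -
  have "(\<Sum>t\<in>bidx. cor t (bas t * e)) = of_nat (dim (range (\<lambda>x. x * e)))"
  proof (rule idempotent_trace[OF finite_bidx expand_bas lin_cor])
    show "Vector_Spaces.linear (scal H) (scal H) (\<lambda>x. x * e)"
      by (intro linearI vector_space_axioms) (simp_all add: distrib_right scal_mult_left)
  qed (simp add: mult.assoc assms)
  then have "dim (range (\<lambda>x. x * e)) = 0" using assms(2) by (simp add: \<tau>_def)
  moreover have "dim (range (\<lambda>x. x * e)) \<noteq> 0" if "e \<noteq> 0"
  proof -
    have "e \<in> range (\<lambda>x. x * e)" using assms(1) by (metis rangeI)
    then obtain B where B: "B \<subseteq> range (\<lambda>x. x * e)" "independent B" "range (\<lambda>x. x * e) \<subseteq> span B" "card B = dim (range (\<lambda>x. x * e))"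
      using basis_exists by blast
    have "span (bas ` bidx) = UNIV"
      by (auto, subst expand_bas) (intro span_sum span_scale span_base imageI)
    then have "finite B" using independent_span_bound[of "bas ` bidx" B] B finite_bidx by auto
    moreover have "B \<noteq> {}" using that \<open>e \<in> range _\<close> B(3) by auto
    ultimately show ?thesis using B(4) by (metis card_eq_0_iff)
  qed
  ultimately show ?thesis by auto
qed

text \<open>The mean \<open>e\<close> of the powers of \<open>g\<close> is an idempotent of full
  trace 60, so \<open>1 - e\<close> has trace 0 and vanishes; then g = g * e = e = 1.\<close>

lemma \<tau>_order3:
  assumes g3: "g * g * g = 1" and t: "\<tau> g = 60" "\<tau> (g * g) = 60"
  shows "g = 1"
proof -
  define e where "e = scal H (1 / 3) (1 + g + g * g)"
  have g3': "g * (g * g) = 1" using g3 by (simp add: mult.assoc)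
  then have g4: "g * (g * (g * g)) = g" by simp
  have ge: "g * e = e"
    by (simp add: e_def scal_mult_right distrib_left g3' add_ac)
  have "scal H 3 e = scal H (1 + 1 + 1) e" by simp
  then have "(1 + g + g * g) * e = scal H 3 e"
    using ge by (simp only: distrib_right mult.assoc scale_left_distrib scale_one mult_1_left)
  then have ee: "e * e = e"
    unfolding e_def by (simp add: scal_mult_left)
  have "\<tau> e = 60"
    by (simp add: e_def lin_simps[OF lin_\<tau>] \<tau>_one t)
  then have "\<tau> (1 - e) = 0" by (simp add: lin_simps[OF lin_\<tau>] \<tau>_one)
  moreover have "(1 - e) * (1 - e) = 1 - e" by (simp add: algebra_simps ee)
  ultimately have "1 - e = 0" using \<tau>_idempotent_zero by blast
  then show ?thesis using ge by simp
qed

text \<open>The hypothesis says that g' X is the conjugate of X by the comatrix. Since \<tau>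
  \<circ> \<open>tr\<close> is a trace on matrices over \<open>H\<close>
  (\<open>\<tau>_tr_commute\<close>), it does not change under conjugation.\<close>

lemma stab_trace_left:
  assumes m: "m < 3" and X: "sc g * cc m * emb X = emb X * cc m" and g': "g' * g = 1"
  shows "\<tau> g' * tr X = 60 * tr X"
proof -
  note inv = comat_inv[OF comat_cc[OF m]]
  have 1: "sc g' * (sc g * cc m * emb X) = cc m * emb X"
    using g' by (simp add: mult.assoc[symmetric] sc_simps(6)[symmetric] sc_simps)
  have "sc g' * emb X = sc g' * (emb X * cc m) * mS (cc m)"
    by (simp add: mult.assoc inv)
  then have "sc g' * emb X = cc m * emb X * mS (cc m)"
    by (simp only: X[symmetric] 1)
  then have "\<tau> (tr (sc g' * emb X)) = \<tau> (tr (mS (cc m) * (cc m * emb X)))"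
    by (metis \<tau>_tr_commute)
  also have "\<dots> = \<tau> (tr (sc 1 * emb X))"
    using inv by (simp add: mult.assoc[symmetric] sc_simps)
  finally show ?thesis by (simp add: tr_emb lin_simps[OF lin_\<tau>] \<tau>_one mult.commute)
qed

lemma stab_trace_right:
  assumes m: "m < 3" and X: "cc m * sc g * emb X = emb X * cc m"
  shows "\<tau> g * tr X = 60 * tr X"
proof -
  note inv = comat_inv[OF comat_cc[OF m]]
  have "sc g * emb X = mS (cc m) * (emb X * cc m)"
    using inv by (simp only: X[symmetric]) (simp add: mult.assoc[symmetric])
  then have "\<tau> (tr (sc g * emb X)) = \<tau> (tr (emb X * cc m * mS (cc m)))"
    by (metis \<tau>_tr_commute)
  also have "\<dots> = \<tau> (tr (sc 1 * emb X))"
    using inv by (simp add: mult.assoc sc_simps)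
  finally show ?thesis by (simp add: tr_emb lin_simps[OF lin_\<tau>] \<tau>_one mult.commute)
qed

text \<open>By Schur the cube of the intertwiner \<open>X\<close> is scalar; rescaled to cube 1,
  neither \<open>X\<close> nor its square has trace 0. The trace lemmas can then be cancelled to
  \<tau> g = \<tau> (g * g) = 60, which only g = 1 satisfies.\<close>

lemma order3_no_stab:
  assumes g3: "g * g * g = 1" and g1: "g \<noteq> 1" and m: "m < 3" and XY: "X * Y = 1"
    and X: "sc g * cc m * emb X = emb X * cc m \<or> cc m * sc g * emb X = emb X * cc m"
  shows False
proof -
  have g3': "g * (g * g) = 1" "g * g * (g * g) = g" using g3 by (simp_all add: mult.assoc[symmetric])
  have sg: "sc g * sc (g * g) = (1 :: ('h, 4) sqmat)" "sc (g * g) * sc g = (1 :: ('h, 4) sqmat)" "sc (g * g) * sc (g * g) = (sc g :: ('h, 4) sqmat)"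
    using g3 g3' by (simp_all add: sc_simps(6)[symmetric] sc_simps(2))
  note ec = emb_commute[of g X] emb_commute[of "g * g" X]
  define c where "c = cc m"
  define U where "U = emb X"
  have U: "sc g * U = U * sc g" "sc (g * g) * U = U * sc (g * g)" using ec by (simp_all add: U_def)
  \<comment> \<open>For left translation the inverse \<open>g * g\<close> is paired with
    \<open>tr X\<close>, for right translation \<open>g\<close> itself; hence the two
    alternatives.\<close>
  have both: "cc m * emb (X * X * X) = emb (X * X * X) * cc m \<and> \<tau> (g * g) * tr X = 60 * tr X
      \<and> \<tau> g * tr (X * X) = 60 * tr (X * X) \<or> cc m * emb (X * X * X) = emb (X * X * X) * cc m \<and>
      \<tau> g * tr X = 60 * tr X \<and> \<tau> (g * g) * tr (X * X) = 60 * tr (X * X)"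
    using X
  proof
    assume L: "sc g * cc m * emb X = emb X * cc m"
    have "c * U = sc (g * g) * sc g * (c * U)" by (simp add: sg)
    also have "\<dots> = sc (g * g) * (U * c)" using L by (simp add: c_def U_def mult.assoc)
    finally have cU: "c * U = sc (g * g) * (U * c)" .
    have cUZ: "c * (U * Z) = sc (g * g) * (U * (c * Z))" for Z
      by (simp only: mult.assoc[symmetric] cU)
    have UZ: "U * (sc (g * g) * Z) = sc (g * g) * (U * Z)" for Z
      by (simp only: mult.assoc[symmetric] U)
    have 1: "c * (U * U * U) = U * U * U * c"
      by (simp only: mult.assoc cU cUZ UZ) (simp add: sg flip: mult.assoc)
    have 2: "sc (g * g) * c * (U * U) = U * U * c"
      by (simp only: mult.assoc cU cUZ UZ) (simp add: sg flip: mult.assoc)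
    show ?thesis
      using 1 2 stab_trace_left[OF m L, of "g * g"] stab_trace_left[OF m, of "g * g" "X * X" g] g3 g3'
      by (simp add: emb_simps c_def U_def)
  next
    assume R: "cc m * sc g * emb X = emb X * cc m"
    then have cUg: "c * U * sc g = U * c" by (simp add: c_def U_def mult.assoc emb_commute)
    have "c * U = c * U * (sc g * sc (g * g))" by (simp add: sg)
    also have "\<dots> = U * (c * sc (g * g))" by (simp only: cUg mult.assoc[symmetric])
    finally have cU: "c * U = U * (c * sc (g * g))" .
    have cUZ: "c * (U * Z) = U * (c * (sc (g * g) * Z))" for Z
      by (simp only: mult.assoc[symmetric] cU[unfolded mult.assoc[symmetric]])
    have UZ: "sc (g * g) * (U * Z) = U * (sc (g * g) * Z)" for Z
      by (simp only: mult.assoc[symmetric] U)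
    have s3: "sc (g * g) * (sc (g * g) * sc (g * g)) = (1 :: ('h, 4) sqmat)" by (simp only: sg)
    have 1: "c * (U * U * U) = U * U * U * c"
      by (simp only: mult.assoc cU cUZ UZ U(2) s3 mult_1_right)
    have 2: "c * sc (g * g) * (U * U) = U * U * c"
      by (simp only: mult.assoc cU cUZ UZ U(2) s3 mult_1_right)
    show ?thesis
      using 1 2 stab_trace_right[OF m R] stab_trace_right[OF m, of "g * g" "X * X"]
      by (simp add: emb_simps c_def U_def)
  qed
  then have "cc m * emb (X * X * X) = emb (X * X * X) * cc m" by blast
  then obtain s where s: "X * X * X = sc s" using schur[OF m] by blast
  have "X * X * X * (Y * Y * Y) = 1"
  proof -
    have "X * X * X * (Y * Y * Y) = X * (X * (X * Y) * Y) * Y" by (simp add: mult.assoc)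
    then show ?thesis by (simp add: XY)
  qed
  then have s0: "s \<noteq> 0" using s by (auto simp: sc_simps)
  obtain r where r: "r ^ 3 = s" using nth_root_exists[of 3 s] by auto
  then have r0: "r \<noteq> 0" using s0 by auto
  define Z where "Z = sc (inverse r) * X"
  have Z2: "Z * Z = sc (inverse r * inverse r) * (X * X)"
    unfolding Z_def by (rule sc_mult_sc_mult)
  have "Z * Z * Z = sc (inverse r * inverse r * inverse r) * (X * X * X)"
    by (simp only: Z2) (simp only: Z_def sc_mult_sc_mult)
  also have "\<dots> = sc (inverse r * inverse r * inverse r * s)"
    by (simp only: s sc_simps)
  also have "inverse r * inverse r * inverse r * s = 1"
    using r0 by (simp add: r[symmetric] power3_eq_cube field_simps)
  finally have Z3: "Z * Z * Z = 1" by (simp only: sc_simps(2))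
  have "(Z * Z) * (Z * Z) * (Z * Z) = Z * Z * Z * (Z * Z * Z)" by (simp only: mult.assoc)
  then have "(Z * Z) * (Z * Z) * (Z * Z) = 1" by (simp only: Z3 mult_1_left)
  with Z3 have "tr Z \<noteq> 0" "tr (Z * Z) \<noteq> 0" using tr_order3_ne_0 by blast+
  then have "tr X \<noteq> 0" "tr (X * X) \<noteq> 0" unfolding Z2 by (auto simp: Z_def tr_sc_mult)
  with both have "\<tau> g = 60" "\<tau> (g * g) = 60" by auto
  then show False using \<tau>_order3 g3 g1 by blast
qed

lemma G_mult: "g \<in> G \<Longrightarrow> h \<in> G \<Longrightarrow> g * h \<in> G"
  by (simp add: glike_in_G glike_mult glike_G)

lemma G_one: "1 \<in> G"
  by (simp add: glike_in_G glike_one)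

lemma G_S: "g \<in> G \<Longrightarrow> S g \<in> G"
  by (simp add: glike_in_G glike_S glike_G)

lemma G_inv: "g \<in> G \<Longrightarrow> g * S g = 1" "g \<in> G \<Longrightarrow> S g * g = 1"
  using glike_inv glike_G by auto

definition Gm :: "'h monoid"
  where "Gm = \<lparr>carrier = G, mult = (*), one = 1\<rparr>"

lemma Gm_simps [simp]: "carrier Gm = G" "mult Gm = (*)" "one Gm = 1"
  by (simp_all add: Gm_def)

lemma group_Gm: "group Gm"
  by (rule groupI) (auto simp: G_mult G_one mult.assoc intro: G_S G_inv)

lemma exists_order3: "\<exists>a\<in>G. a * a * a = 1 \<and> a \<noteq> 1"
proof -
  interpret group Gm by (rule group_Gm)
  have "\<exists>K. subgroup K Gm \<and> card K = 3 ^ 1"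
    by (rule sylow_thm[of 3 Gm 1 4]) (simp_all add: group_Gm order_def card_G finite_G)
  then obtain K where K: "subgroup K Gm" "card K = 3" by auto
  have "\<not> K \<subseteq> {1}" using card_mono[of "{1}" K] K(2) by auto
  then obtain a where a: "a \<in> K" "a \<noteq> 1" by blast
  interpret K: group "Gm\<lparr>carrier := K\<rparr>" by (rule subgroup.subgroup_is_group[OF K(1) group_Gm])
  have "a [^]\<^bsub>Gm\<lparr>carrier := K\<rparr>\<^esub> order (Gm\<lparr>carrier := K\<rparr>) = \<one>\<^bsub>Gm\<lparr>carrier := K\<rparr>\<^esub>"
    by (rule K.pow_order_eq_1) (use a in simp)
  then have "a * a * a = 1" using K by (simp add: order_def eval_nat_numeral K.nat_pow_Suc)
  then show ?thesis using a K subgroup.subset[OF K(1)] by auto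
qed

lemma block_exists:
  assumes d: "comat d" and nz: "ent d i j \<notin> span G"
  shows "\<exists>n<3. \<exists>P Q. P * Q = 1 \<and> Q * P = 1 \<and> d * emb P = emb P * cc n"
proof -
  have "\<exists>n<3. \<exists>p q. ev (\<kappa> n p q) d \<noteq> 0"
  proof (rule ccontr)
    assume "\<not> ?thesis"
    then have "\<kappa> n p q (ent d i j) = 0" if "n < 3" for n p q using that by (metis ent_ev ent_zero)
    then have "ent d i j = (\<Sum>g\<in>G. scal H (\<gamma> g (ent d i j)) g)"
      by (subst expand) simp
    then show False using nz by (metis (no_types, lifting) span_base span_scale span_sum)
  qed
  then show ?thesis using comat_classify[OF d] by blast
qed

lemma span_G_mult: "x \<in> span G \<Longrightarrow> y \<in> span G \<Longrightarrow> x * y \<in> span G"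
proof -
  have 1: "g * y \<in> span G" if "g \<in> G" "y \<in> span G" for g y
    using that(2)
  proof (induction rule: span_induct_alt)
    case (step c x y)
    then show ?case using that(1)
      by (simp add: distrib_left scal_mult_right span_add span_scale span_base G_mult)
  qed (simp add: span_zero)
  show "x \<in> span G \<Longrightarrow> y \<in> span G \<Longrightarrow> x * y \<in> span G"
  proof (induction rule: span_induct_alt)
    case (step c x z)
    then show ?case
      by (simp add: distrib_right scal_mult_left span_add span_scale 1)
  qed (simp add: span_zero)
qed

lemma \<kappa>_span_G: "x \<in> span G \<Longrightarrow> m < 3 \<Longrightarrow> \<kappa> m i j x = 0"
  by (induction rule: span_induct_alt) (simp_all add: lin_simps[OF lin_\<kappa>] \<kappa>_G)

lemma left_block:
  assumes "g \<in> G" "m < 3"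
  shows "\<exists>n<3. \<exists>P Q. P * Q = 1 \<and> Q * P = 1 \<and> sc g * cc m * emb P = emb P * cc n"
proof (rule block_exists)
  show "comat (sc g * cc m)" using assms comat_sc_mult glike_G comat_cc by blast
  show "ent (sc g * cc m) 0 0 \<notin> span G"
  proof
    assume "ent (sc g * cc m) 0 0 \<in> span G"
    then have "S g * (g * ent (cc m) 0 0) \<in> span G"
      using span_G_mult[OF span_base[OF G_S[OF assms(1)]]] by (simp add: ent_sc_mult)
    then have "ent (cc m) 0 0 \<in> span G" using G_inv[OF assms(1)] by (simp add: mult.assoc[symmetric])
    from \<kappa>_span_G[OF this assms(2), of 0 0] show False using assms(2) by (simp add: \<kappa>_cc)
  qed
qed

lemma right_block:
  assumes "g \<in> G" "m < 3"
  shows "\<exists>n<3. \<exists>P Q. P * Q = 1 \<and> Q * P = 1 \<and> cc m * sc g * emb P = emb P * cc n"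
proof (rule block_exists)
  show "comat (cc m * sc g)" using assms comat_sc_mult glike_G comat_cc by blast
  show "ent (cc m * sc g) 0 0 \<notin> span G"
  proof
    assume "ent (cc m * sc g) 0 0 \<in> span G"
    then have "ent (cc m) 0 0 * g * S g \<in> span G"
      using span_G_mult[OF _ span_base[OF G_S[OF assms(1)]]] by (simp add: ent_mult_sc)
    then have "ent (cc m) 0 0 \<in> span G" using G_inv[OF assms(1)] by (simp add: mult.assoc)
    from \<kappa>_span_G[OF this assms(2), of 0 0] show False using assms(2) by (simp add: \<kappa>_cc)
  qed
qed

end

section \<open>The stabiliser of a block\<close>

lemma inverse_pair_mult:
  assumes "P * Q = 1" "P' * Q' = 1"
  shows "P * P' * (Q' * Q) = (1 :: 'z::monoid_mult)"
proof -
  have "P * P' * (Q' * Q) = P * (P' * Q') * Q" by (simp only: mult.assoc)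
  then show ?thesis by (simp add: assms)
qed

context tensor_algebra
begin

lemma tr_emb_commute: "tr (emb A * X) = tr (X * emb A)"
  unfolding tr_def ent_emb_mult by (rule sum.swap)

lemma tr_emb_transp: "tr (emb (mtransp A) * X) = (\<Sum>i\<in>UNIV. \<Sum>j\<in>UNIV. scal H (ent A i j) (ent X i j))"
  unfolding tr_def ent_emb_mult by (subst sum.swap) simp

end

context cobasis
begin

text \<open>For d = P c Q the coordinate matrix K must become K' = \<open>Q^T K P^T\<close>: the
  transpose of K' is \<open>P K^T Q\<close>, and with Q P = 1 cyclicity of the trace under
  \<open>emb\<close> gives \<open>tr (K'^T d) = tr (K^T c)\<close>, which is the expansion formula
  of the block.\<close>

lemma rebase:
  assumes bij: "bij_betw n {..<3} {..<3::nat}"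
    and d: "\<And>i. i < 3 \<Longrightarrow> comat (d i)" and PQ: "\<And>i. i < 3 \<Longrightarrow> P i * Q i = 1"
    and eq: "\<And>i. i < 3 \<Longrightarrow> d i * emb (P i) = emb (P i) * cc (n i)"
  shows "cobasis H S G d \<gamma>
    (\<lambda>i r s x. ent (mtransp (Q i) * Mat (\<lambda>p q. \<kappa> (n i) p q x) * mtransp (P i)) r s)"
proof -
  have n: "n i < 3" if "i < 3" for i using bij that by (auto simp: bij_betw_def)
  have QP: "Q i * P i = 1" if "i < 3" for i using sqmat_left_right_inverse[OF PQ[OF that]] .
  have di: "d i = emb (P i) * cc (n i) * emb (Q i)" if "i < 3" for i
    by (simp add: eq[OF that, symmetric] mult.assoc PQ[OF that] emb_simps flip: emb_simps(1))
  have evd: "ev \<phi> (d i) = P i * ev \<phi> (cc (n i)) * Q i" if "i < 3" "lin \<phi>" for \<phi> i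
    by (simp add: di[OF that(1)] ev_emb[OF that(2)])
  show ?thesis
  proof (intro cobasis.intro cobasis_axioms.intro)
    show "hopf_algebra H S" by (rule hopf_algebra_axioms)
    show "comat (d i)" if "i < 3" for i by (rule d[OF that])
    show "lin (\<lambda>x. ent (mtransp (Q i) * Mat (\<lambda>p q. \<kappa> (n i) p q x) * mtransp (P i)) r s)" for i r s
      by (auto simp: ent_mult mult.commute[of _ "ent (P i) _ _"] intro!: lin_sumI lin_cmult lin_\<kappa>)
    fix i assume i: "i < (3::nat)"
    show "\<gamma> g (ent (d i) p q) = 0" if "g \<in> G" for g p q
    proof -
      have "ev (\<gamma> g) (d i) = 0" using that i n by (simp add: evd lin_\<gamma> ev_\<gamma>_cc)
      then show ?thesis by (metis ent_ev ent_zero)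
    qed
    show "ent (mtransp (Q i) * Mat (\<lambda>p q. \<kappa> (n i) p q g) * mtransp (P i)) r s = 0" if "g \<in> G" for g r s
      using that i n by (simp add: \<kappa>_G ent_mult)
    fix j assume j: "j < (3::nat)"
    have nij: "n i = n j \<longleftrightarrow> i = j" using bij i j by (auto simp: bij_betw_def inj_on_def)
    have k: "\<kappa> (n i) p q (ent (d j) u v) = (if i = j then ent (P j) u p * ent (Q j) q v else 0)" for p q u v
    proof -
      have "\<kappa> (n i) p q (ent (d j) u v) = ent (P j * ev (\<kappa> (n i) p q) (cc (n j)) * Q j) u v"
        using evd[OF j lin_\<kappa>] by (metis ent_ev)
      also have "\<dots> = (if i = j then ent (P j * (munit p q * Q j)) u v else 0)"
        using i j n nij by (simp add: ev_\<kappa>_cc mult.assoc)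
      also have "ent (P j * (munit p q * Q j)) u v = ent (P j) u p * ent (Q j) q v"
        unfolding ent_mult[of "P j"] ent_munit_mult by (simp add: if_distrib[of "\<lambda>x. _ * x"] cong: if_cong)
      finally show ?thesis .
    qed
    show "ent (mtransp (Q i) * Mat (\<lambda>p q. \<kappa> (n i) p q (ent (d j) u v)) * mtransp (P i)) r s =
      (if i = j \<and> r = u \<and> s = v then 1 else 0)" for r s u v
    proof (cases "i = j")
      case True
      have kj: "\<kappa> (n j) p q (ent (d j) u v) = ent (P j) u p * ent (Q j) q v" for p q
        using k[of p q u v] True by simp
      have "ent (mtransp (Q i) * Mat (\<lambda>p q. \<kappa> (n i) p q (ent (d j) u v)) * mtransp (P i)) r s
          = (\<Sum>q\<in>UNIV. \<Sum>p\<in>UNIV. (ent (P i) u p * ent (Q i) p r) * (ent (P i) s q * ent (Q i) q v))"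
        using True by (simp add: ent_mult kj sum_distrib_left sum_distrib_right mult_ac, subst sum.swap, simp add: mult_ac)
      also have "\<dots> = (\<Sum>q\<in>UNIV. ent (P i * Q i) u r * (ent (P i) s q * ent (Q i) q v))"
        by (simp add: ent_mult sum_distrib_left sum_distrib_right)
      also have "\<dots> = ent (P i * Q i) u r * ent (P i * Q i) s v"
        by (simp add: ent_mult sum_distrib_left)
      finally show ?thesis using True PQ[OF i] by (auto simp: ent_one)
    qed (simp add: k ent_mult)
  next
    fix x
    have blk: "(\<Sum>r\<in>UNIV. \<Sum>s\<in>UNIV. scal H (ent (mtransp (Q i) * Mat (\<lambda>p q. \<kappa> (n i) p q x) * mtransp (P i)) r s) (ent (d i) r s))
       = (\<Sum>r\<in>UNIV. \<Sum>s\<in>UNIV. scal H (\<kappa> (n i) r s x) (ent (cc (n i)) r s))" if i: "i < 3" for i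
    proof -
      let ?K = "Mat (\<lambda>p q. \<kappa> (n i) p q x)"
      have "emb (mtransp (mtransp (Q i) * ?K * mtransp (P i))) * d i
          = emb (P i) * (emb (mtransp ?K) * (emb (Q i * P i) * (cc (n i) * emb (Q i))))"
        by (simp add: mtransp_mult di[OF i] emb_simps mult.assoc)
      then have "tr (emb (mtransp (mtransp (Q i) * ?K * mtransp (P i))) * d i)
          = tr (emb (P i) * (emb (mtransp ?K) * (cc (n i) * emb (Q i))))"
        by (simp add: QP[OF i] emb_simps)
      also have "\<dots> = tr (emb (mtransp ?K) * (cc (n i) * emb (Q i * P i)))"
        unfolding tr_emb_commute[of "P i"] by (simp add: mult.assoc emb_simps)
      also have "\<dots> = tr (emb (mtransp ?K) * cc (n i))"
        by (simp add: QP[OF i] emb_simps)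
      finally show ?thesis by (simp add: tr_emb_transp)
    qed
    have "(\<Sum>m<3. \<Sum>r\<in>UNIV. \<Sum>s\<in>UNIV. scal H (\<kappa> m r s x) (ent (cc m) r s))
        = (\<Sum>i<3. \<Sum>r\<in>UNIV. \<Sum>s\<in>UNIV. scal H (\<kappa> (n i) r s x) (ent (cc (n i)) r s))"
      by (rule sum.reindex_bij_betw[OF bij, symmetric])
    then show "x = (\<Sum>g\<in>G. scal H (\<gamma> g x) g) + (\<Sum>i<3. \<Sum>r\<in>UNIV. \<Sum>s\<in>UNIV.
        scal H (ent (mtransp (Q i) * Mat (\<lambda>p q. \<kappa> (n i) p q x) * mtransp (P i)) r s) (ent (d i) r s))"
      by (subst expand) (simp add: blk)
  qed (simp_all add: finite_G card_G glike_G lin_\<gamma> \<gamma>_G)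
qed

end

text \<open>All three blocks are right translates of one comatrix \<open>c\<close> by powers of an
  element of order 3, so a matrix identity for \<open>c\<close> controls the whole noncommutative
  part of the coalgebra.\<close>

locale based = cobasis H S G cc \<gamma> \<kappa>
  for H :: "('k::{alg_closed_field, field_char_0}, 'h::ring_1) coalg" and S G cc \<gamma> \<kappa> +
  fixes a :: 'h and c :: "('h, 4) sqmat"
  assumes a_G: "a \<in> G" and a3: "a * a * a = 1" and a1: "a \<noteq> 1"
    and cc_eq: "m < 3 \<Longrightarrow> cc m = c * sc (a ^ m)"

context cobasis
begin

text \<open>The translates of block 0 by 1, \<open>a\<close>, \<open>a^2\<close> lie in different
  blocks, because a coincidence would let \<open>a\<close> or \<open>a^2\<close> stabilise block 0,
  against \<open>order3_no_stab\<close>.\<close>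

lemma exists_based: "\<exists>a \<kappa>'. based H S G (\<lambda>m. cc 0 * sc (a ^ m)) \<gamma> \<kappa>' a (cc 0)"
proof -
  obtain a where a: "a \<in> G" "a * a * a = 1" "a \<noteq> 1" using exists_order3 by blast
  have apow: "a ^ m \<in> G" for m by (induction m) (auto simp: G_one G_mult a)
  have a': "a ^ 2 \<noteq> 1" "a ^ 2 * a ^ 2 * a ^ 2 = 1" using a(2,3)
    by (auto simp: power2_eq_square mult.assoc)
  have "\<exists>n P Q. n < 3 \<and> P * Q = 1 \<and> Q * P = 1 \<and> cc 0 * sc (a ^ i) * emb P = emb P * cc n" for i
    using right_block[OF apow, of 0 i] by auto
  then obtain n P Q where n: "\<And>i. n i < 3" and PQ: "\<And>i. P i * Q i = 1" "\<And>i. Q i * P i = 1"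
    and eq: "\<And>i. cc 0 * sc (a ^ i) * emb (P i) = emb (P i) * cc (n i)" by metis
  have neq: "n i \<noteq> n j" if ij: "i < j" "j < 3" for i j
  proof
    assume nn: "n i = n j"
    have 1: "cc 0 * sc (a ^ j) = emb (P j) * cc (n j) * emb (Q j)"
      by (simp add: eq[symmetric] mult.assoc PQ emb_simps flip: emb_simps(1))
    have cn: "cc (n i) = emb (Q i) * (cc 0 * sc (a ^ i)) * emb (P i)"
      by (simp add: mult.assoc eq[unfolded mult.assoc])
        (simp add: PQ emb_simps flip: mult.assoc emb_simps(1))
    define X where "X = P j * Q i"
    have XY: "X * (P i * Q j) = 1" "P i * Q j * X = 1"
      unfolding X_def by (rule inverse_pair_mult[OF PQ(1) PQ(2)])+
    have 2: "cc 0 * sc (a ^ j) = emb X * (cc 0 * sc (a ^ i)) * emb (P i * Q j)"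
      by (simp only: 1 nn[symmetric] cn X_def emb_simps mult.assoc)
    have aj: "a ^ j = a ^ (j - i) * a ^ i" using ij by (simp flip: power_add)
    have bb: "sc (a ^ i) * sc (S (a ^ i)) = (1 :: ('h, 4) sqmat)"
      using G_inv[OF apow] by (simp add: sc_simps(2) flip: sc_simps(6))
    then have bbZ: "sc (a ^ i) * (sc (S (a ^ i)) * Z) = Z" for Z :: "('h, 4) sqmat"
      by (simp flip: mult.assoc)
    have "cc 0 * sc (a ^ j) * emb X * sc (S (a ^ i)) =
        emb X * (cc 0 * sc (a ^ i)) * (emb (P i * Q j) * emb X) * sc (S (a ^ i))"
      by (simp only: 2 mult.assoc)
    also have "\<dots> = emb X * cc 0"
      by (simp only: XY emb_simps(1)[symmetric]) (simp add: emb_simps mult.assoc bb)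
    also have "cc 0 * sc (a ^ j) * emb X * sc (S (a ^ i)) = cc 0 * sc (a ^ (j - i)) * emb X"
      by (simp only: aj sc_simps mult.assoc emb_commute[symmetric] bbZ)
    finally have "cc 0 * sc (a ^ (j - i)) * emb X = emb X * cc 0" .
    moreover have "j - i = 1 \<or> j - i = 2" using ij by auto
    ultimately show False
      using order3_no_stab[of a 0 X "P i * Q j"] order3_no_stab[of "a ^ 2" 0 X "P i * Q j"] a a' XY by auto
  qed
  have "inj_on n {..<3}"
    by (rule inj_onI) (metis lessThan_iff linorder_neqE_nat neq)
  then have bij: "bij_betw n {..<3} {..<3}"
    using n by (simp add: bij_betw_def endo_inj_surj image_subset_iff)
  have "cobasis H S G (\<lambda>m. cc 0 * sc (a ^ m)) \<gamma>
    (\<lambda>i r s x. ent (mtransp (Q i) * Mat (\<lambda>p q. \<kappa> (n i) p q x) * mtransp (P i)) r s)"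
    by (rule rebase[OF bij]) (auto simp: PQ eq intro!: comat_sc_mult glike_G apow comat_cc)
  then show ?thesis
    unfolding based_def based_axioms_def using a by blast
qed

end

section \<open>The degree homomorphism to Z/3 and its kernel\<close>

context based
begin

lemma a_pow_G: "a ^ m \<in> G"
  by (induction m) (auto simp: G_one G_mult a_G)

lemma a_pow_mod: "a ^ m = a ^ (m mod 3)"
proof -
  have "a ^ 3 = 1" using a3 by (simp add: power3_eq_cube)
  then have "a ^ (3 * (m div 3)) = 1" by (simp add: power_mult)
  moreover have "m = 3 * (m div 3) + m mod 3" by simp
  ultimately show ?thesis by (metis mult_1_left power_add)
qed

lemma c_cc: "c = cc 0"
  using cc_eq[of 0] by (simp add: sc_simps)

lemma comat_c: "comat c"
  unfolding c_cc by (rule comat_cc) simp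

definition d :: "('h, 4) sqmat" where "d = mS c"

lemma cd: "c * d = 1" "d * c = 1"
  unfolding d_def by (rule comat_inv[OF comat_c])+

text \<open>\<open>rel g m\<close>: left translation by \<open>g\<close> maps the matrix coalgebra of \<open>c\<close> to that of \<open>c a\<^sup>m\<close>; \<open>relR\<close> is the
  analogue for right translation.\<close>

definition rel :: "'h \<Rightarrow> nat \<Rightarrow> bool"
  where "rel g m \<longleftrightarrow> (\<exists>P Q. P * Q = 1 \<and> Q * P = 1 \<and> sc g * c * emb P = emb P * c * sc (a ^ m))"

definition relR :: "'h \<Rightarrow> nat \<Rightarrow> bool"
  where "relR g m \<longleftrightarrow> (\<exists>P Q. P * Q = 1 \<and> Q * P = 1 \<and> c * sc g * emb P = emb P * sc (a ^ m) * c)"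

lemma rel_mult:
  assumes "rel g m" "rel h n"
  shows "rel (g * h) (m + n)"
proof -
  obtain P Q where P: "P * Q = 1" "Q * P = 1" "sc g * c * emb P = emb P * c * sc (a ^ m)"
    using assms unfolding rel_def by blast
  obtain P' Q' where P': "P' * Q' = 1" "Q' * P' = 1" "sc h * c * emb P' = emb P' * c * sc (a ^ n)"
    using assms unfolding rel_def by blast
  have "sc (g * h) * c * emb (P' * P) = sc g * (sc h * c * emb P') * emb P"
    by (simp only: sc_simps emb_simps mult.assoc)
  also have "\<dots> = (sc g * emb P') * c * (sc (a ^ n) * emb P)"
    by (simp only: P'(3)) (simp only: mult.assoc)
  also have "\<dots> = emb P' * (sc g * c * emb P) * sc (a ^ n)"
    by (simp only: emb_commute mult.assoc)
  also have "\<dots> = emb (P' * P) * c * sc (a ^ (m + n))"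
    by (simp only: P(3)) (simp only: emb_simps sc_simps power_add mult.assoc)
  finally show ?thesis unfolding rel_def
    using inverse_pair_mult[OF P'(1) P(1)] inverse_pair_mult[OF P(2) P'(2)] by blast
qed

text \<open>This additivity is why \<open>relR\<close> writes the power of \<open>a\<close> to the
  left of \<open>c\<close>: after the first translation an unchanged \<open>c\<close> stands next to
  the second one.\<close>

lemma relR_mult:
  assumes "relR g m" "relR h n"
  shows "relR (g * h) (m + n)"
proof -
  obtain P Q where P: "P * Q = 1" "Q * P = 1" "c * sc g * emb P = emb P * sc (a ^ m) * c"
    using assms unfolding relR_def by blast
  obtain P' Q' where P': "P' * Q' = 1" "Q' * P' = 1" "c * sc h * emb P' = emb P' * sc (a ^ n) * c"
    using assms unfolding relR_def by blast
  have "c * sc (g * h) * emb (P * P') = c * sc g * (sc h * emb P) * emb P'"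
    by (simp only: sc_simps emb_simps mult.assoc)
  also have "\<dots> = (c * sc g * emb P) * (sc h * emb P')"
    by (simp only: emb_commute[of h P] mult.assoc)
  also have "\<dots> = emb P * sc (a ^ m) * (c * sc h * emb P')"
    by (simp only: P(3)) (simp only: mult.assoc)
  also have "\<dots> = emb P * (sc (a ^ m) * emb P') * sc (a ^ n) * c"
    by (simp only: P'(3)) (simp only: mult.assoc)
  also have "\<dots> = emb (P * P') * sc (a ^ (m + n)) * c"
    by (simp only: emb_commute[of "a ^ m" P'] emb_simps sc_simps power_add mult.assoc)
  finally show ?thesis unfolding relR_def
    using inverse_pair_mult[OF P(1) P'(1)] inverse_pair_mult[OF P'(2) P(2)] by blast
qed

lemma rel_unique:
  assumes "rel g m" "rel g n" "m < 3" "n < 3"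
  shows "m = n"
proof (rule ccontr)
  assume mn: "m \<noteq> n"
  obtain P Q where P: "P * Q = 1" "Q * P = 1" "sc g * c * emb P = emb P * c * sc (a ^ m)"
    using assms unfolding rel_def by blast
  obtain P' Q' where P': "P' * Q' = 1" "Q' * P' = 1" "sc g * c * emb P' = emb P' * c * sc (a ^ n)"
    using assms unfolding rel_def by blast
  have gc: "sc g * c = emb P * cc m * emb Q"
    using P(3) cc_eq[OF assms(3)] P(1)
    by (simp add: mult.assoc[symmetric] P(3)[symmetric]) (simp add: mult.assoc emb_simps flip: emb_simps(1))
  have "emb Q * (sc g * c * emb P') = emb Q * (emb P' * cc n)"
    using P'(3) cc_eq[OF assms(4)] by (simp add: mult.assoc)
  moreover have "emb Q * (sc g * c * emb P') = emb (Q * P) * cc m * emb (Q * P')"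
    by (simp only: gc emb_simps mult.assoc)
  ultimately have "cc m * emb (Q * P') = emb (Q * P') * cc n"
    by (simp add: P emb_simps mult.assoc)
  then have "Q * P' = 0" using schur_zero[OF assms(3,4) mn] by blast
  moreover have "Q * P' * (Q' * P) = 1" by (rule inverse_pair_mult[OF P(2) P'(1)])
  ultimately show False by simp
qed

lemma rel_exists:
  assumes "g \<in> G"
  shows "\<exists>m<3. rel g m"
proof -
  obtain n P Q where n: "n < 3" "P * Q = 1" "Q * P = 1" "sc g * c * emb P = emb P * cc n"
    using left_block[OF assms, of 0] by (auto simp flip: c_cc)
  then have "sc g * c * emb P = emb P * c * sc (a ^ n)" by (simp add: cc_eq mult.assoc)
  then show ?thesis unfolding rel_def using n by blast
qed

text \<open>The block reached by left translation. By \<open>dg_mult\<close> it is a homomorphism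
  from G to Z/3, with values represented by 0, 1, 2.\<close>

definition dg :: "'h \<Rightarrow> nat" where "dg g = (SOME m. m < 3 \<and> rel g m)"

lemma dg: "g \<in> G \<Longrightarrow> dg g < 3 \<and> rel g (dg g)"
  unfolding dg_def by (rule someI_ex) (rule rel_exists)

lemma rel_mod: "rel g m \<longleftrightarrow> rel g (m mod 3)" "relR g m \<longleftrightarrow> relR g (m mod 3)"
  unfolding rel_def relR_def using a_pow_mod by simp_all

lemma dg_eq: "g \<in> G \<Longrightarrow> rel g m \<Longrightarrow> dg g = m mod 3"
  using dg rel_unique rel_mod by (metis mod_less_divisor zero_less_numeral)

lemma dg_mult: "g \<in> G \<Longrightarrow> h \<in> G \<Longrightarrow> dg (g * h) = (dg g + dg h) mod 3"
  by (rule dg_eq) (auto intro: G_mult rel_mult simp: dg)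

lemma rel_one: "rel 1 0" "relR 1 0"
  unfolding rel_def relR_def by (auto simp: emb_simps sc_simps intro!: exI[of _ 1])

lemma dg_one: "dg 1 = 0"
  using dg_eq[OF G_one rel_one(1)] by simp

lemma dg_a: "dg a \<noteq> 0"
proof
  assume "dg a = 0"
  then have "rel a 0" using dg[OF a_G] by simp
  then obtain P Q where "P * Q = 1" "sc a * cc 0 * emb P = emb P * cc 0"
    unfolding rel_def by (auto simp: sc_simps c_cc)
  then show False using order3_no_stab[of a 0 P Q] a3 a1 by simp
qed

definition \<Gamma> :: "'h set" where "\<Gamma> = {g \<in> G. dg g = 0}"

lemma \<Gamma>_G: "g \<in> \<Gamma> \<Longrightarrow> g \<in> G" by (simp add: \<Gamma>_def)

lemma finite_\<Gamma>: "finite \<Gamma>" by (simp add: \<Gamma>_def finite_G)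

lemma \<Gamma>_one: "1 \<in> \<Gamma>" by (simp add: \<Gamma>_def G_one dg_one)

lemma \<Gamma>_mult: "g \<in> \<Gamma> \<Longrightarrow> h \<in> \<Gamma> \<Longrightarrow> g * h \<in> \<Gamma>"
  by (simp add: \<Gamma>_def G_mult dg_mult)

lemma dg_S: "g \<in> G \<Longrightarrow> (dg g + dg (S g)) mod 3 = 0"
  using dg_mult[of g "S g"] by (simp add: G_S G_inv dg_one)

lemma \<Gamma>_S: "g \<in> \<Gamma> \<Longrightarrow> S g \<in> \<Gamma>"
  using dg_S[of g] dg[of "S g"] by (simp add: \<Gamma>_def G_S)

lemma \<Gamma>_conj: "g \<in> G \<Longrightarrow> h \<in> \<Gamma> \<Longrightarrow> g * h * S g \<in> \<Gamma>"
  using dg_S[of g] by (simp add: \<Gamma>_def G_S G_mult dg_mult mod_add_left_eq)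

text \<open>All three fibres of \<open>dg\<close> are inhabited, since \<open>dg a\<close> generates
  Z/3, and each is a translate of the kernel: 12 = 3 * 4.\<close>

lemma card_\<Gamma>: "card \<Gamma> = 4"
proof -
  have f: "card {g \<in> G. dg g = i} = card \<Gamma>" if "i < 3" for i
  proof -
    have "\<exists>b\<in>G. dg b = i"
    proof -
      have "dg a = 1 \<or> dg a = 2" using dg[OF a_G] dg_a by auto
      then have "i = dg 1 \<or> i = dg a \<or> i = dg (a * a)" using that by (auto simp: dg_one dg_mult a_G)
      then show ?thesis using a_G G_mult G_one by metis
    qed
    then obtain b where b: "b \<in> G" "dg b = i" by blast
    have "bij_betw (\<lambda>g. g * b) \<Gamma> {g \<in> G. dg g = i}"
    proof (rule bij_betwI[where g = "\<lambda>g. g * S b"])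
      show "(\<lambda>g. g * b) \<in> \<Gamma> \<rightarrow> {g \<in> G. dg g = i}"
        using b that by (auto simp: \<Gamma>_def G_mult dg_mult)
      show "(\<lambda>g. g * S b) \<in> {g \<in> G. dg g = i} \<rightarrow> \<Gamma>"
        using b dg_S[OF b(1)] by (auto simp: \<Gamma>_def G_mult G_S dg_mult)
    qed (use G_inv[OF b(1)] in \<open>simp_all add: mult.assoc\<close>)
    from bij_betw_same_card[OF this] show ?thesis by simp
  qed
  have "(\<Union>i\<in>{..<3}. {g \<in> G. dg g = i}) = G" using dg by auto
  moreover have "card (\<Union>i\<in>{..<3}. {g \<in> G. dg g = i}) = (\<Sum>i<3. card {g \<in> G. dg g = i})"
    by (rule card_UN_disjoint) (auto simp: finite_G)
  ultimately have "card G = (\<Sum>i<3. card {g \<in> G. dg g = i})" by simp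
  also have "\<dots> = (\<Sum>i\<in>{..<3::nat}. card \<Gamma>)" by (rule sum.cong) (auto simp: f)
  finally show ?thesis using card_G by simp
qed

definition \<Gamma>m :: "'h monoid"
  where "\<Gamma>m = \<lparr>carrier = \<Gamma>, mult = (*), one = 1\<rparr>"

lemma \<Gamma>m_simps [simp]: "carrier \<Gamma>m = \<Gamma>" "mult \<Gamma>m = (*)" "one \<Gamma>m = 1"
  by (simp_all add: \<Gamma>m_def)

lemma group_\<Gamma>m: "group \<Gamma>m"
  by (rule groupI) (auto simp: \<Gamma>_mult \<Gamma>_one mult.assoc intro: \<Gamma>_S G_inv \<Gamma>_G)

lemma \<Gamma>_pow4: "g \<in> \<Gamma> \<Longrightarrow> g * g * (g * g) = 1"
proof -
  assume g: "g \<in> \<Gamma>"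
  interpret group \<Gamma>m by (rule group_\<Gamma>m)
  have "g [^]\<^bsub>\<Gamma>m\<^esub> (4::nat) = 1" using pow_order_eq_1[of g] g by (simp add: order_def card_\<Gamma>)
  then show ?thesis by (simp add: eval_nat_numeral mult.assoc)
qed

text \<open>Right translation leads to some block \<open>c a^k\<close>. Choosing j with
  \<open>dg (a^j) = k\<close> rewrites this block, up to base change, as \<open>a^j c\<close>, the
  form that \<open>relR\<close> asks for.\<close>

lemma relR_exists:
  assumes "g \<in> G"
  shows "\<exists>m<3. relR g m"
proof -
  obtain k P Q where k: "k < 3" "P * Q = 1" "Q * P = 1" "c * sc g * emb P = emb P * (c * sc (a ^ k))"
    using right_block[OF assms, of 0] cc_eq by (auto simp flip: c_cc)
  have "\<exists>j. dg (a ^ j) = k"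
  proof -
    have "dg a = 1 \<or> dg a = 2" using dg[OF a_G] dg_a by auto
    then have "k = dg 1 \<or> k = dg a \<or> k = dg (a * a)" using k(1) by (auto simp: dg_one dg_mult a_G)
    then show ?thesis by (metis power_0 power_one_right power2_eq_square)
  qed
  then obtain j where "dg (a ^ j) = k" by blast
  then have "rel (a ^ j) k" using dg[OF a_pow_G] by blast
  then obtain P' Q' where P': "P' * Q' = 1" "Q' * P' = 1" "sc (a ^ j) * c * emb P' = emb P' * c * sc (a ^ k)"
    unfolding rel_def by blast
  have ck: "c * sc (a ^ k) = emb Q' * (sc (a ^ j) * c * emb P')"
    by (simp only: P'(3)) (simp add: P' emb_simps flip: mult.assoc emb_simps(1))
  have "c * sc g * emb (P * Q') = (c * sc g * emb P) * emb Q'"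
    by (simp only: emb_simps mult.assoc)
  also have "\<dots> = emb P * emb Q' * sc (a ^ j) * c * (emb P' * emb Q')"
    by (simp only: k(4) ck) (simp only: mult.assoc)
  also have "\<dots> = emb (P * Q') * sc (a ^ j) * c"
    by (simp add: P' emb_simps flip: emb_simps(1))
  finally have "relR g j" unfolding relR_def
    using inverse_pair_mult[OF k(2) P'(2)] inverse_pair_mult[OF P'(1) k(3)] by blast
  then show ?thesis using rel_mod(2) by (metis mod_less_divisor zero_less_numeral)
qed

lemma relR_one_zero:
  assumes "relR 1 m" "m < 3"
  shows "m = 0"
proof -
  obtain P Q where P: "P * Q = 1" "Q * P = 1" "c * sc 1 * emb P = emb P * sc (a ^ m) * c"
    using assms unfolding relR_def by blast
  have "sc (a ^ m) * c * emb Q = emb (Q * P) * sc (a ^ m) * c * emb Q"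
    by (simp add: P emb_simps)
  also have "\<dots> = emb Q * (emb P * sc (a ^ m) * c) * emb Q"
    by (simp only: emb_simps mult.assoc)
  also have "\<dots> = emb Q * c * emb (P * Q)"
    by (simp only: P(3)[symmetric]) (simp only: sc_simps(2) mult_1_right emb_simps mult.assoc)
  finally have "sc (a ^ m) * c * emb Q = emb Q * c * sc (a ^ 0)"
    by (simp add: P emb_simps sc_simps)
  then have "rel (a ^ m) 0" unfolding rel_def using P by blast
  then have "dg (a ^ m) = 0" using dg_eq[OF a_pow_G] by simp
  moreover have "m = 0 \<or> m = 1 \<or> m = 2" using assms(2) by auto
  moreover have "dg a = 1 \<or> dg a = 2" using dg[OF a_G] dg_a by auto
  ultimately show ?thesis by (auto simp: power2_eq_square dg_mult a_G)
qed

text \<open>The right degree m is additive and g^4 = 1, so 4 m is 0 modulo 3. Hence the left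
  stabiliser of the block also stabilises it from the right.\<close>

lemma \<Gamma>_relR:
  assumes g: "g \<in> \<Gamma>"
  shows "relR g 0"
proof -
  obtain m where m: "m < 3" "relR g m" using relR_exists[OF \<Gamma>_G[OF g]] by blast
  have "relR 1 (m + m + (m + m))"
    using relR_mult[OF relR_mult[OF m(2) m(2)] relR_mult[OF m(2) m(2)]] \<Gamma>_pow4[OF g] by simp
  then have "relR 1 ((m + m + (m + m)) mod 3)" using rel_mod(2) by blast
  then have "(m + m + (m + m)) mod 3 = 0" using relR_one_zero by simp
  then have "m = 0" using m(1) by presburger
  then show ?thesis using m by simp
qed

lemma exists_u: "g \<in> \<Gamma> \<Longrightarrow> \<exists>P Q. P * Q = 1 \<and> Q * P = 1 \<and> sc g * c * emb P = emb P * c"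
  using dg[of g] by (auto simp: \<Gamma>_def rel_def sc_simps)

lemma exists_v: "g \<in> \<Gamma> \<Longrightarrow> \<exists>P Q. P * Q = 1 \<and> Q * P = 1 \<and> c * sc g * emb P = emb P * c"
  using \<Gamma>_relR[of g] by (auto simp: relR_def sc_simps)

end

section \<open>The two projective representations of the stabiliser\<close>

lemma sqmat_invertible:
  fixes M :: "('a::field, 'n::finite) sqmat"
  assumes "\<And>X. M * X = 0 \<Longrightarrow> X = 0"
  shows "\<exists>N. M * N = 1 \<and> N * M = 1"
proof -
  let ?c = "\<lambda>M. (\<chi> i j. ent M i j) :: 'a^'n^'n"
  have "x = 0" if x: "?c M *v x = 0" for x
  proof -
    have "M * Mat (\<lambda>i j. x $ i) = 0"
      using x by (intro sqmat_eqI) (simp add: matrix_vector_mult_def ent_mult vec_eq_iff)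
    then have "Mat (\<lambda>i j. x $ i) = (0 :: ('a, 'n) sqmat)" by (rule assms)
    then show ?thesis by (metis ent_Mat ent_zero vec_eq_iff zero_index)
  qed
  then obtain B where B: "B ** ?c M = mat 1" using matrix_left_invertible_ker by blast
  have "Mat (\<lambda>i j. B $ i $ j) * M = 1"
  proof (rule sqmat_eqI)
    fix i j
    have "(B ** ?c M) $ i $ j = mat 1 $ i $ j" using B by simp
    then show "ent (Mat (\<lambda>i j. B $ i $ j) * M) i j = ent 1 i j"
      by (simp add: matrix_matrix_mult_def ent_mult ent_one mat_def)
  qed
  then show ?thesis using sqmat_left_right_inverse by blast
qed

lemma munit_sandwich: "munit y x * A * munit y x = sc (ent A x y) * munit y x"
  by (rule sqmat_eqI) (auto simp: ent_sc ent_sc_mult ent_munit_mult ent_mult_munit ent_munit)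

lemma exists_fourth_root:
  assumes "s \<noteq> (0 :: 'k::alg_closed_field)"
  obtains r where "r * r * (r * r) = s" "r \<noteq> 0"
proof -
  obtain r where "r ^ 4 = s" using nth_root_exists[of 4 s] by auto
  then show thesis using that[of r] assms by (auto simp: eval_nat_numeral mult.assoc)
qed

lemma exists_imaginary_unit:
  obtains i :: "'k::alg_closed_field" where "i * i = - 1"
  using nth_root_exists[of 2 "- 1 :: 'k"] by (auto simp: power2_eq_square)

lemma scale_fourth_power:
  fixes A :: "('k::alg_closed_field, 'n::finite) sqmat"
  assumes "A * A * (A * A) = sc s" "s \<noteq> 0"
  obtains r where "r \<noteq> 0" "sc r * A * (sc r * A) * (sc r * A * (sc r * A)) = 1"
proof -
  obtain t where t: "t * t * (t * t) = s" "t \<noteq> 0" using exists_fourth_root[OF assms(2)] .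
  define r where "r = inverse t"
  have "sc r * A * (sc r * A) * (sc r * A * (sc r * A)) = sc (r * r * (r * r) * s)"
    by (simp only: sc_mult_sc_mult assms(1)) (simp only: sc_simps(6))
  also have "r * r * (r * r) * s = 1"
    using t by (simp add: r_def t(1)[symmetric] field_simps)
  finally show thesis using that[of r] t by (simp add: r_def sc_simps)
qed

text \<open>On the range of \<open>e\<close> the matrix \<open>X\<close> is an involution, and
  \<open>f\<close> projects onto an eigenspace. The projections for 1 and -1 add up to
  \<open>e\<close>, so one of them is nonzero; being a polynomial in \<open>e\<close> and
  \<open>X\<close>, it commutes with whatever commutes with both.\<close>

lemma involution_idempotent:
  fixes e X :: "('k::field_char_0, 'n::finite) sqmat"
  assumes e: "e * e = e" "e \<noteq> 0" and Xe: "X * e = e * X" and XX: "X * (X * e) = e"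
  shows "\<exists>s f. s * s = 1 \<and> f * f = f \<and> f \<noteq> 0 \<and> X * f = sc s * f \<and> f * X = X * f \<and>
    (\<forall>Z. Z * e = e * Z \<longrightarrow> Z * X = X * Z \<longrightarrow> Z * f = f * Z) \<and> e * f = f"
proof -
  define f where "f s = sc (1 / 2) * (e + sc s * (X * e))" for s
  have eXe: "e * (X * e) = X * e" by (simp only: mult.assoc[symmetric] Xe[symmetric]) (simp only: mult.assoc e)
  have ef: "e * f s = f s" for s
    unfolding f_def mult_sc_mult[of e] distrib_left eXe e(1) by simp
  have Xf: "X * f s = sc s * f s" if "s * s = 1" for s
  proof -
    have "X * f s = sc (1 / 2) * (X * e + sc s * e)"
      unfolding f_def mult_sc_mult[of X] distrib_left XX by simp
    moreover have "sc s * (sc s * (X * e)) = X * e"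
      by (simp only: mult.assoc[symmetric] sc_simps(6)[symmetric] that) (simp add: sc_simps)
    then have "sc s * f s = sc (1 / 2) * (sc s * e + X * e)"
      unfolding f_def by (subst mult_sc_mult) (simp add: distrib_left)
    ultimately show ?thesis by (simp add: add.commute)
  qed
  have ff: "f s * f s = f s" if s: "s * s = 1" for s
  proof -
    have "sc s * (X * e) * f s = f s"
      by (simp only: mult.assoc ef Xf[OF s]) (simp only: mult.assoc[symmetric] sc_simps(6)[symmetric] s sc_simps(2) mult_1_left)
    then have "f s * f s = sc (1 / 2) * (f s + f s)"
      by (subst (1) f_def) (simp only: mult.assoc[of "sc (1 / 2)"] distrib_right ef)
    also have "f s + f s = sc (1 + 1) * f s" by (simp only: sc_simps distrib_right mult_1_left)
    also have "sc (1 / 2) * (sc (1 + 1) * f s) = sc (1 / 2 * (1 + 1)) * f s" by (simp only: sc_simps(6) mult.assoc)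
    finally show ?thesis by (simp add: sc_simps)
  qed
  have Zf: "Z * f s = f s * Z" if "Z * e = e * Z" "Z * X = X * Z" for Z s
  proof -
    have "Z * (X * e) = X * e * Z" by (simp only: mult.assoc[symmetric] that(2)) (simp only: mult.assoc that(1))
    then show ?thesis unfolding f_def mult_sc_mult[of Z] mult.assoc[of "sc (1 / 2)"]
      by (simp only: distrib_left distrib_right mult_sc_mult[of Z] mult.assoc[of "sc s"] that)
  qed
  have "f 1 + f (- 1) = sc (1 / 2) * (e + e)" by (simp add: f_def sc_simps flip: distrib_left)
  also have "e + e = sc (1 + 1) * e" by (simp only: sc_simps distrib_right mult_1_left)
  also have "sc (1 / 2) * (sc (1 + 1) * e) = sc (1 / 2 * (1 + 1)) * e" by (simp only: sc_simps(6) mult.assoc)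
  finally have "f 1 + f (- 1) = e" by (simp add: sc_simps)
  then have "f 1 \<noteq> 0 \<or> f (- 1) \<noteq> 0" using e(2) by auto
  then obtain s where s: "s * s = 1" "f s \<noteq> 0" by (metis mult_minus_left mult_minus_right mult_1_left minus_minus)
  show ?thesis
    by (intro exI[of _ s] exI[of _ "f s"] conjI allI impI s ff Xf Zf ef Zf[symmetric] Xe refl)
qed

text \<open>After rescaling, split off an eigenspace of the square and inside it one of the matrix
  itself. On the resulting projection \<open>p\<close> the matrix \<open>A\<close> acts as a scalar
  from both sides, so every compression \<open>p * munit y x * p\<close> commutes with
  \<open>A\<close>; dividing by an entry makes it idempotent of trace 1.\<close>

lemma rank_one_idempotent_commuting:
  fixes A :: "('k::{alg_closed_field, field_char_0}, 'n::finite) sqmat"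
  assumes "A * A * (A * A) = sc s" "s \<noteq> 0"
  obtains W where "W * W = W" "tr W = 1" "A * W = W * A"
proof -
  obtain r where r: "r \<noteq> 0" "sc r * A * (sc r * A) * (sc r * A * (sc r * A)) = 1"
    using scale_fourth_power[OF assms] .
  define B where "B = sc r * A"
  have B4: "B * B * (B * B * 1) = 1" using r(2) by (simp add: B_def)
  have "1 * 1 = (1 :: ('k, 'n) sqmat)" "(1 :: ('k, 'n) sqmat) \<noteq> 0" "B * B * 1 = 1 * (B * B)" by simp_all
  from involution_idempotent[OF this B4]
  obtain t f where f: "t * t = 1" "f * f = f" "f \<noteq> 0" "B * B * f = sc t * f"
    and fZ: "\<forall>Z. Z * 1 = 1 * Z \<longrightarrow> Z * (B * B) = B * B * Z \<longrightarrow> Z * f = f * Z"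
    by blast
  have Bf: "B * f = f * B" using fZ by (simp add: mult.assoc)
  \<comment> \<open>\<open>B * B\<close> acts as \<open>t\<close>, a square root of 1, on the range
    of \<open>f\<close>; the factor \<open>q\<close> makes \<open>C\<close> an involution there,
    since q^2 t = t^2 = 1.\<close>
  obtain q where q: "q * q = t" using nth_root_exists[of 2 t] by (auto simp: power2_eq_square)
  define C where "C = sc q * B"
  have "C * (C * f) = sc (q * q) * (B * B * f)"
    unfolding C_def by (simp only: mult.assoc mult_sc_mult[of B] sc_simps)
  also have "\<dots> = sc (t * t) * f" by (simp only: f(4) q) (simp only: sc_simps(6) mult.assoc)
  finally have CCf: "C * (C * f) = f" by (simp only: f(1) sc_simps(2) mult_1_left)
  have Cf: "C * f = f * C" unfolding C_def by (simp only: mult_sc_mult[of f] mult.assoc Bf)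
  from involution_idempotent[OF f(2,3) Cf CCf]
  obtain u p where u: "u * u = 1" and pp: "p * p = p" "p \<noteq> 0" and Cp: "C * p = sc u * p" "p * C = C * p"
    by blast
  have q0: "q \<noteq> 0" using q f(1) by auto
  have BC: "B = sc (inverse q) * C"
    using q0 by (simp add: C_def mult.assoc[symmetric] sc_simps(6)[symmetric] sc_simps(2))
  define v where "v = inverse q * u"
  have l: "B * p = sc v * p" and rr: "p * B = sc v * p"
    by (simp_all only: BC v_def mult.assoc Cp mult_sc_mult[of p] sc_simps(6))
  obtain x y where xy: "ent p x y \<noteq> 0" using pp by (metis ent_zero sqmat_eqI)
  define z where "z = ent p x y"
  define W where "W = sc (inverse z) * (p * munit y x * p)"
  show thesis
  proof
    have "p * munit y x * p * (p * munit y x * p) = p * (munit y x * (p * p) * munit y x) * p"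
      by (simp only: mult.assoc)
    also have "\<dots> = p * (sc z * munit y x) * p"
      by (simp only: pp(1) munit_sandwich z_def)
    also have "\<dots> = sc z * (p * munit y x * p)"
      by (simp only: mult_sc_mult[of "p"] mult.assoc)
    finally have "W * W = sc (inverse z * inverse z) * (sc z * (p * munit y x * p))"
      unfolding W_def sc_mult_sc_mult by (simp only:)
    also have "\<dots> = sc (inverse z * inverse z * z) * (p * munit y x * p)"
      by (simp only: sc_simps(6) mult.assoc)
    also have "inverse z * inverse z * z = inverse z" using xy by (simp add: z_def)
    finally show "W * W = W" by (simp only: W_def)
    have "tr (p * munit y x * p) = tr (p * p * munit y x)"
      using tr_mult_commute[of "p * munit y x" "p"] by (simp only: mult.assoc)
    also have "\<dots> = z"
      unfolding pp(1) tr_def ent_mult_munit by (simp add: z_def)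
    finally show "tr W = 1" using xy by (simp add: W_def tr_sc_mult z_def)
    have BW: "B * W = W * B"
    proof -
      have "B * (p * munit y x * p) = (B * p) * (munit y x * p)" by (simp only: mult.assoc)
      also have "\<dots> = sc v * (p * munit y x * p)" by (simp only: l mult.assoc)
      finally have 1: "B * (p * munit y x * p) = sc v * (p * munit y x * p)" .
      have "p * munit y x * p * B = p * munit y x * (p * B)" by (simp only: mult.assoc)
      also have "\<dots> = sc v * (p * munit y x * p)"
        by (simp only: rr mult_sc_mult)
      finally have 2: "p * munit y x * p * B = sc v * (p * munit y x * p)" .
      show ?thesis unfolding W_def mult_sc_mult[of B] by (simp only: mult.assoc[of "sc (inverse z)"] 1 2)
    qed
    have "A = sc (inverse r) * B"
      using r(1) by (simp add: B_def mult.assoc[symmetric] sc_simps(6)[symmetric] sc_simps(2))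
    then show "A * W = W * A"
      by (simp only: mult.assoc BW mult_sc_mult[of W])
  qed
qed

definition kron :: "('a::comm_ring_1, 'n::finite) sqmat \<Rightarrow> ('a, 'n) sqmat \<Rightarrow> ('a, 'n \<times> 'n) sqmat"
  where "kron A B = Mat (\<lambda>p q. ent A (fst p) (fst q) * ent B (snd p) (snd q))"

lemma ent_kron [simp]: "ent (kron A B) p q = ent A (fst p) (fst q) * ent B (snd p) (snd q)"
  by (simp add: kron_def)

lemma sum_UNIV_prod: "(\<Sum>p\<in>(UNIV :: ('n::finite \<times> 'n) set). f p) = (\<Sum>i\<in>UNIV. \<Sum>j\<in>UNIV. f (i, j))"
  by (simp add: sum.cartesian_product)

lemma kron_mult: "kron A B * kron A' B' = kron (A * A') (B * B')"
  by (rule sqmat_eqI) (simp add: ent_mult sum_UNIV_prod sum_product mult_ac)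

lemma kron_sc: "kron (sc s) (sc t) = sc (s * t)"
  by (rule sqmat_eqI) (auto simp: ent_sc prod_eq_iff)

lemma kron_sc_mult: "kron (sc s * A) B = sc s * kron A B"
  by (rule sqmat_eqI) (simp add: ent_sc_mult mult_ac)

lemma sum2_delta:
  "(\<Sum>p\<in>UNIV. \<Sum>q\<in>UNIV. if p = i then if q = j then f p q else 0 else 0) = f (i::'n::finite) (j::'m::finite)"
proof -
  have "(\<Sum>p\<in>UNIV. \<Sum>q\<in>UNIV. if p = i then if q = j then f p q else 0 else 0)
      = (\<Sum>p\<in>UNIV. if p = i then f i j else 0)"
    by (intro sum.cong refl) simp
  then show ?thesis by simp
qed

lemma sum_rotate: "(\<Sum>t\<in>A. \<Sum>p\<in>B. \<Sum>q\<in>C. F t p q) = (\<Sum>p\<in>B. \<Sum>q\<in>C. \<Sum>t\<in>A. F t p q)"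
  by (rule trans[OF sum.swap]) (rule sum.cong[OF refl sum.swap])

context based
begin

text \<open>The matrix is unique up to a scalar (\<open>uL_unique\<close>,
  \<open>vR_unique\<close>), so each predicate describes a projective representation of the
  stabiliser. Composition reverses the order for \<open>uL\<close> and keeps it for
  \<open>vR\<close>.\<close>

definition uL :: "'h \<Rightarrow> ('k, 4) sqmat \<Rightarrow> bool"
  where "uL g P \<longleftrightarrow> g \<in> \<Gamma> \<and> sc g * c * emb P = emb P * c \<and> (\<exists>Q. P * Q = 1 \<and> Q * P = 1)"

definition vR :: "'h \<Rightarrow> ('k, 4) sqmat \<Rightarrow> bool"
  where "vR g P \<longleftrightarrow> g \<in> \<Gamma> \<and> c * sc g * emb P = emb P * c \<and> (\<exists>Q. P * Q = 1 \<and> Q * P = 1)"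

lemma uL_exists: "g \<in> \<Gamma> \<Longrightarrow> \<exists>P. uL g P"
  unfolding uL_def using exists_u[of g] by blast

lemma vR_exists: "g \<in> \<Gamma> \<Longrightarrow> \<exists>P. vR g P"
  unfolding vR_def using exists_v[of g] by blast

lemma schur_c: "c * emb X = emb X * c \<Longrightarrow> \<exists>s. X = sc s"
  using schur[of 0 X] by (simp add: c_cc)

lemma emb_inv: "P * Q = 1 \<Longrightarrow> emb P * emb Q = 1" "P * Q = 1 \<Longrightarrow> emb P * (emb Q * Z) = Z"
  by (simp_all add: emb_simps mult.assoc[symmetric] flip: emb_simps(1))

lemma sc_inv: "g * h = 1 \<Longrightarrow> sc g * sc h = 1" "g * h = 1 \<Longrightarrow> sc g * (sc h * Z) = Z"
  by (simp_all add: sc_simps(2) mult.assoc[symmetric] flip: sc_simps(6))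

lemma uL_unique:
  assumes "uL g P" and X: "sc g * c * emb X = emb X * c"
  shows "\<exists>s. X = sc s * P"
proof -
  obtain Q where Q: "P * Q = 1" "Q * P = 1" and P: "sc g * c * emb P = emb P * c"
    using assms unfolding uL_def by blast
  have gc: "sc g * c = emb P * c * emb Q"
    by (simp only: P[symmetric]) (simp add: mult.assoc emb_inv[OF Q(1)])
  have "c * emb (Q * X) = emb Q * (emb P * c * emb Q * emb X)"
    by (simp add: emb_simps mult.assoc emb_inv[OF Q(2)])
  also have "\<dots> = emb (Q * X) * c"
    by (simp only: gc[symmetric] X) (simp only: emb_simps mult.assoc)
  finally obtain s where s: "Q * X = sc s" using schur_c by blast
  have "X = P * Q * X" by (simp only: Q mult_1_left)
  also have "\<dots> = sc s * P" by (simp only: mult.assoc s sc_commute)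
  finally show ?thesis by blast
qed

lemma uL_mult:
  assumes "uL g P" "uL h P'"
  shows "uL (h * g) (P * P')"
proof -
  obtain Q Q' where Q: "P * Q = 1" "Q * P = 1" "P' * Q' = 1" "Q' * P' = 1"
    and P: "sc g * c * emb P = emb P * c" "sc h * c * emb P' = emb P' * c"
    using assms unfolding uL_def by blast
  have "sc (h * g) * c * emb (P * P') = sc h * (sc g * c * emb P) * emb P'"
    by (simp only: sc_simps emb_simps mult.assoc)
  also have "\<dots> = (sc h * emb P) * c * emb P'" by (simp only: P) (simp only: mult.assoc)
  also have "\<dots> = emb P * (sc h * c * emb P')" by (simp only: emb_commute mult.assoc)
  also have "\<dots> = emb (P * P') * c" by (simp only: P) (simp only: emb_simps mult.assoc)
  finally show ?thesis unfolding uL_def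
    using inverse_pair_mult[OF Q(1,3)] inverse_pair_mult[OF Q(4,2)] assms \<Gamma>_mult unfolding uL_def by blast
qed

lemma vR_mult:
  assumes "vR g P" "vR h P'"
  shows "vR (g * h) (P * P')"
proof -
  obtain Q Q' where Q: "P * Q = 1" "Q * P = 1" "P' * Q' = 1" "Q' * P' = 1"
    and P: "c * sc g * emb P = emb P * c" "c * sc h * emb P' = emb P' * c"
    using assms unfolding vR_def by blast
  have "c * sc (g * h) * emb (P * P') = c * sc g * (sc h * emb P) * emb P'"
    by (simp only: sc_simps emb_simps mult.assoc)
  also have "\<dots> = (c * sc g * emb P) * (sc h * emb P')" by (simp only: emb_commute[of h P] mult.assoc)
  also have "\<dots> = emb P * (c * sc h * emb P')" by (simp only: P(1)) (simp only: mult.assoc)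
  also have "\<dots> = emb (P * P') * c" by (simp only: P) (simp only: emb_simps mult.assoc)
  finally show ?thesis unfolding vR_def
    using inverse_pair_mult[OF Q(1,3)] inverse_pair_mult[OF Q(4,2)] assms \<Gamma>_mult unfolding vR_def by blast
qed

lemma uL_nonzero: "uL g P \<Longrightarrow> P \<noteq> 0" and vR_nonzero: "vR g P \<Longrightarrow> P \<noteq> 0"
  unfolding uL_def vR_def by auto

lemma uL_scale: "uL g P \<Longrightarrow> s \<noteq> 0 \<Longrightarrow> uL g (sc s * P)"
  and vR_scale: "vR g P \<Longrightarrow> s \<noteq> 0 \<Longrightarrow> vR g (sc s * P)"
proof -
  have inv: "\<exists>Q'. sc s * P * Q' = 1 \<and> Q' * (sc s * P) = 1" if Q: "P * Q = 1" "Q * P = 1" and s: "s \<noteq> 0" for Q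
  proof -
    have "sc s * P * (sc (inverse s) * Q) = 1" "sc (inverse s) * Q * (sc s * P) = 1"
      using s by (simp_all add: sc_mult_sc_mult Q sc_simps(2))
    then show ?thesis by blast
  qed
  have e: "emb (sc s * P) = sc (scal H s 1) * emb P" by (simp only: emb_simps emb_sc)
  have cent: "sc (scal H s 1) * X = X * sc (scal H s 1)" for X :: "('h, 4) sqmat"
    by (rule sqmat_eqI) (simp add: ent_sc_mult ent_mult_sc scal_one_mult)
  show "uL g P \<Longrightarrow> s \<noteq> 0 \<Longrightarrow> uL g (sc s * P)"
    unfolding uL_def e cent[of "emb P"] using inv by (auto simp: mult.assoc[symmetric] cent) 
      (simp add: mult.assoc cent[of c])
  show "vR g P \<Longrightarrow> s \<noteq> 0 \<Longrightarrow> vR g (sc s * P)"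
    unfolding vR_def e cent[of "emb P"] using inv by (auto simp: mult.assoc[symmetric] cent)
      (simp add: mult.assoc cent[of c])
qed

lemma vR_unique:
  assumes "vR g P" and X: "c * sc g * emb X = emb X * c"
  shows "\<exists>s. X = sc s * P"
proof -
  obtain Q where Q: "P * Q = 1" "Q * P = 1" and P: "c * sc g * emb P = emb P * c"
    using assms unfolding vR_def by blast
  have gc: "c * sc g = emb P * c * emb Q"
    by (simp only: P[symmetric]) (simp add: mult.assoc emb_inv[OF Q(1)])
  have "c * emb (Q * X) = emb Q * (emb P * c * emb Q * emb X)"
    by (simp add: emb_simps mult.assoc emb_inv[OF Q(2)])
  also have "\<dots> = emb (Q * X) * c"
    by (simp only: gc[symmetric] X) (simp only: emb_simps mult.assoc)
  finally obtain s where s: "Q * X = sc s" using schur_c by blast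
  have "X = P * Q * X" by (simp only: Q mult_1_left)
  also have "\<dots> = sc s * P" by (simp only: mult.assoc s sc_commute)
  finally show ?thesis by blast
qed

text \<open>Both products intertwine the simultaneous translation of \<open>c\<close> by g on the
  left and h on the right, so Schur makes them proportional.\<close>

lemma uL_vR_commute:
  assumes uL: "uL g P" and vR: "vR h R"
  obtains b where "b \<noteq> 0" "R * P = sc b * (P * R)"
proof -
  obtain Q where Q: "P * Q = 1" "Q * P = 1" and P: "sc g * c * emb P = emb P * c"
    using uL unfolding uL_def by blast
  obtain R' where R': "R * R' = 1" "R' * R = 1" and R: "c * sc h * emb R = emb R * c"
    using vR unfolding vR_def by blast
  have 1: "sc g * c * sc h * emb (R * P) = emb (R * P) * c"
  proof -
    have "sc g * c * sc h * emb (R * P) = sc g * (c * sc h * emb R) * emb P"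
      by (simp only: emb_simps mult.assoc)
    also have "\<dots> = emb R * (sc g * c * emb P)"
      by (simp only: R mult.assoc[symmetric] emb_commute)
    also have "\<dots> = emb (R * P) * c" by (simp only: P) (simp only: emb_simps mult.assoc)
    finally show ?thesis .
  qed
  have 2: "sc g * c * sc h * emb (P * R) = emb (P * R) * c"
  proof -
    have "sc g * c * sc h * emb (P * R) = sc g * c * (sc h * emb P) * emb R"
      by (simp only: emb_simps mult.assoc)
    also have "\<dots> = (sc g * c * emb P) * sc h * emb R"
      by (simp only: emb_commute[of h P] mult.assoc)
    also have "\<dots> = emb P * (c * sc h * emb R)" by (simp only: P) (simp only: mult.assoc)
    also have "\<dots> = emb (P * R) * c" by (simp only: R) (simp only: emb_simps mult.assoc)
    finally show ?thesis .
  qed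
  define Y where "Y = R' * Q * (P * R)"
  have Yi: "P * R * (R' * Q) = 1" "R' * Q * (P * R) = 1" "R * P * (Q * R') = 1"
    by (rule inverse_pair_mult[OF Q(1) R'(1)], rule inverse_pair_mult[OF R'(2) Q(2)], rule inverse_pair_mult[OF R'(1) Q(1)])
  have gch: "sc g * c * sc h = emb (P * R) * c * emb (R' * Q)"
    by (simp only: 2[symmetric]) (simp only: mult.assoc emb_inv(1)[OF Yi(1)] mult_1_right)
  have "c * emb (R' * Q * (R * P)) = emb (R' * Q) * (emb (P * R) * c * emb (R' * Q) * emb (R * P))"
    by (simp only: emb_simps(1)[of "R' * Q" "R * P"]) (simp only: mult.assoc emb_inv(2)[OF Yi(2)])
  also have "\<dots> = emb (R' * Q * (R * P)) * c"
    by (simp only: gch[symmetric] 1) (simp only: emb_simps(1)[of "R' * Q" "R * P"] mult.assoc[of "emb _"])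
  finally obtain b where b: "R' * Q * (R * P) = sc b" using schur_c by blast
  have "R * P = P * R * (R' * Q) * (R * P)" by (simp only: Yi mult_1_left)
  also have "\<dots> = P * R * sc b" by (simp only: b[symmetric] mult.assoc)
  finally have RP: "R * P = sc b * (P * R)" by (simp only: sc_commute)
  have "b \<noteq> 0"
  proof
    assume "b = 0"
    then have "R * P = 0" using RP by (simp add: sc_simps)
    then show False using Yi(3) by simp
  qed
  then show thesis using that RP by blast
qed

lemma uL_pow4:
  assumes "uL g P"
  obtains s where "s \<noteq> 0" "P * P * (P * P) = sc s"
proof -
  have "uL 1 (P * P * (P * P))"
    using uL_mult[OF uL_mult[OF assms assms] uL_mult[OF assms assms]] \<Gamma>_pow4[of g] assms
    by (simp add: uL_def)
  then have "c * emb (P * P * (P * P)) = emb (P * P * (P * P)) * c" and nz: "P * P * (P * P) \<noteq> 0"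
    using uL_nonzero by (auto simp: uL_def sc_simps)
  then obtain s where s: "P * P * (P * P) = sc s" using schur_c by blast
  with nz have "s \<noteq> 0" by (auto simp: sc_simps)
  then show thesis using that s by blast
qed

lemma vR_pow4:
  assumes "vR g P"
  obtains s where "s \<noteq> 0" "P * P * (P * P) = sc s"
proof -
  have "vR 1 (P * P * (P * P))"
    using vR_mult[OF vR_mult[OF assms assms] vR_mult[OF assms assms]] \<Gamma>_pow4[of g] assms
    by (simp add: vR_def)
  then have "c * emb (P * P * (P * P)) = emb (P * P * (P * P)) * c" and nz: "P * P * (P * P) \<noteq> 0"
    using vR_nonzero by (auto simp: vR_def sc_simps)
  then obtain s where s: "P * P * (P * P) = sc s" using schur_c by blast
  with nz have "s \<noteq> 0" by (auto simp: sc_simps)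
  then show thesis using that s by blast
qed

section \<open>The tensor square of the block of \<open>c\<close> as a comodule\<close>

definition sq :: "('h, 4 \<times> 4) sqmat"
  where "sq = Mat (\<lambda>p q. ent c (fst p) (fst q) * ent c (snd p) (snd q))"

lemma comat_sq: "comat sq"
proof -
  have c: "comult H (ent c i j) = (\<Sum>l\<in>UNIV. ent c i l \<boxtimes> ent c l j)" "counit H (ent c i j) = (if i = j then 1 else 0)" for i j
    using comat_c by (auto simp: comat_def)
  show ?thesis
    by (auto simp: comat_def sq_def comult_mult counit_mult c tmult_sum_left tmult_sum_right tmult_ten
        sum_UNIV_prod prod_eq_iff, rule sum.swap)
qed

lemma ent_sq_kron: "ent (sq * emb (kron A B)) (i, l) (j, k) = ent (c * emb A) i j * ent (c * emb B) l k"
  "ent (emb (kron A B) * sq) (i, l) (j, k) = ent (emb A * c) i j * ent (emb B * c) l k"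
  by (simp_all add: ent_emb_mult sq_def sum_UNIV_prod sum_product scal_mult_left scal_mult_right mult.commute)

text \<open>The element of the dual algebra that acts as \<open>W\<close> in all three blocks and
  kills the group-likes: the diagonal copy of \<open>M_4\<close> in \<open>M_4^3\<close>. Taking the
  same \<open>W\<close> in each block suits blocks of the form \<open>c a^m\<close>.\<close>

definition \<omega> :: "('k, 4) sqmat \<Rightarrow> 'h \<Rightarrow> 'k"
  where "\<omega> W x = (\<Sum>m<3. \<Sum>p\<in>UNIV. \<Sum>q\<in>UNIV. ent W p q * \<kappa> m p q x)"

lemma lin_\<omega>: "lin (\<omega> W)"
  unfolding \<omega>_def by (intro lin_sumI lin_cmult lin_\<kappa>)

lemma \<omega>_G: "g \<in> G \<Longrightarrow> \<omega> W g = 0"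
  by (simp add: \<omega>_def \<kappa>_G)

lemma ev_\<omega>_cc: "m < 3 \<Longrightarrow> ev (\<omega> W) (cc m) = W"
proof (rule sqmat_eqI)
  fix i j assume m: "m < 3"
  have "ent (ev (\<omega> W) (cc m)) i j = (\<Sum>n<3. \<Sum>p\<in>UNIV. \<Sum>q\<in>UNIV. if n = m then if p = i then if q = j then ent W p q else 0 else 0 else 0)"
    unfolding \<omega>_def ent_ev by (intro sum.cong refl) (use m in \<open>auto simp: \<kappa>_cc\<close>)
  also have "\<dots> = (\<Sum>n<3. if n = m then ent W i j else 0)"
    by (intro sum.cong refl) (simp add: sum2_delta)
  finally show "ent (ev (\<omega> W) (cc m)) i j = ent W i j" using m by simp
qed

lemma conv_\<omega>: "conv (\<omega> W) (\<omega> W') = \<omega> (W * W')"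
  by (rule lin_ext) (simp_all add: conv_lin lin_\<omega> conv_glike glike_G \<omega>_G ev_conv comat_cc ev_\<omega>_cc)

lemma \<omega>_counit: "counit H x = (\<Sum>g\<in>G. \<gamma> g x) + \<omega> 1 x"
proof -
  have "(\<Sum>q\<in>UNIV. ent 1 p q * \<kappa> m p q x) = \<kappa> m p p x" for m p
    by (simp add: ent_one if_distrib[of "\<lambda>x. x * _"] cong: if_cong)
  then show ?thesis by (simp add: counit_expand \<omega>_def)
qed

abbreviation "\<rho> \<phi> \<equiv> ev \<phi> sq"

lemma \<rho>_\<omega>_mult: "\<rho> (\<omega> W) * \<rho> (\<omega> W') = \<rho> (\<omega> (W * W'))"
  by (simp add: comat_sq lin_\<omega> conv_\<omega> flip: ev_conv)

text \<open>W \<mapsto> \<rho> (\<omega> W) is multiplicative, so its trace is a trace form on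
  \<open>M_4\<close> and a multiple of \<open>tr\<close>; the value at \<open>munit 0 0\<close> is
  the multiplicity of the blocks.\<close>

lemma tr_\<rho>_\<omega>: "tr (\<rho> (\<omega> W)) = tr W * tr (\<rho> (\<omega> (munit 0 0)))"
proof -
  have off: "tr (\<rho> (\<omega> (munit p q))) = (if p = q then tr (\<rho> (\<omega> (munit 0 0))) else 0)" for p q
  proof -
    have "tr (\<rho> (\<omega> (munit p q))) = tr (\<rho> (\<omega> (munit p 0)) * \<rho> (\<omega> (munit 0 q)))"
      by (simp add: \<rho>_\<omega>_mult munit_mult)
    also have "\<dots> = tr (\<rho> (\<omega> (munit 0 q)) * \<rho> (\<omega> (munit p 0)))" by (rule tr_mult_commute)
    also have "\<dots> = (if p = q then tr (\<rho> (\<omega> (munit 0 0))) else tr (\<rho> (\<omega> 0)))"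
      by (simp add: \<rho>_\<omega>_mult munit_mult)
    also have "tr (\<rho> (\<omega> 0)) = 0" by (simp add: tr_def \<omega>_def)
    finally show ?thesis .
  qed
  have w: "\<omega> W x = (\<Sum>p\<in>UNIV. \<Sum>q\<in>UNIV. ent W p q * \<omega> (munit p q) x)" for x
  proof -
    have "\<omega> (munit p q) x = (\<Sum>m<3. \<kappa> m p q x)" for p q
    proof -
      have "(\<Sum>r\<in>UNIV. \<Sum>s\<in>UNIV. ent (munit p q) r s * \<kappa> m r s x) =
        (\<Sum>r\<in>UNIV. \<Sum>s\<in>UNIV. if r = p then if s = q then \<kappa> m r s x else 0 else 0)" for m
        by (intro sum.cong refl) (simp add: ent_munit)
      also have "\<dots> m = \<kappa> m p q x" for m by (rule sum2_delta)
      finally show ?thesis by (simp add: \<omega>_def)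
    qed
    then show ?thesis
      by (simp add: \<omega>_def sum_distrib_left) (rule sum_rotate)
  qed
  have "tr (\<rho> (\<omega> W)) = (\<Sum>p\<in>UNIV. \<Sum>q\<in>UNIV. ent W p q * tr (\<rho> (\<omega> (munit p q))))"
  proof -
    have "tr (\<rho> (\<omega> W)) = (\<Sum>t\<in>UNIV. \<Sum>p\<in>UNIV. \<Sum>q\<in>UNIV. ent W p q * \<omega> (munit p q) (ent sq t t))"
      unfolding tr_def ent_ev by (rule sum.cong[OF refl w])
    then show ?thesis unfolding tr_def ent_ev sum_distrib_left using sum_rotate by (rule trans)
  qed
  also have "\<dots> = (\<Sum>p\<in>UNIV. \<Sum>q\<in>UNIV. if q = p then ent W p p * tr (\<rho> (\<omega> (munit 0 0))) else 0)"
    by (intro sum.cong refl) (subst off, simp)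
  also have "\<dots> = tr W * tr (\<rho> (\<omega> (munit 0 0)))"
    unfolding tr_def[of W] sum_distrib_right by (intro sum.cong refl) simp
  finally show ?thesis .
qed

text \<open>The counit is the unit of the dual algebra and acts as the identity in dimension 16; its
  parts in the blocks and at the group-likes give the two summands.\<close>

lemma tr_\<rho>_total: "16 = 4 * tr (\<rho> (\<omega> (munit 0 0))) + (\<Sum>g\<in>G. tr (\<rho> (\<gamma> g)))"
proof -
  have "\<rho> (counit H) = 1" by (rule ev_counit[OF comat_sq])
  then have "tr (\<rho> (counit H)) = 16" by (simp add: tr_one)
  moreover have "tr (\<rho> (counit H)) = tr (\<rho> (\<omega> 1)) + (\<Sum>g\<in>G. tr (\<rho> (\<gamma> g)))"
    by (simp add: tr_def \<omega>_counit sum.distrib add.commute, rule sum.swap)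
  moreover have "tr (\<rho> (\<omega> 1)) = 4 * tr (\<rho> (\<omega> (munit 0 0)))"
    by (subst tr_\<rho>_\<omega>) (simp add: tr_one)
  ultimately show ?thesis by simp
qed

lemma card_fiber:
  assumes i: "i < 3"
  shows "card {g \<in> G. dg g = i} = 4"
proof -
  have "\<exists>b\<in>G. dg b = i"
  proof -
    have "dg a = 1 \<or> dg a = 2" using dg[OF a_G] dg_a by auto
    then have "i = dg 1 \<or> i = dg a \<or> i = dg (a * a)" using i by (auto simp: dg_one dg_mult a_G)
    then show ?thesis using a_G G_mult G_one by metis
  qed
  then obtain b where b: "b \<in> G" "dg b = i" by blast
  have "bij_betw (\<lambda>g. g * b) \<Gamma> {g \<in> G. dg g = i}"
  proof (rule bij_betwI[where g = "\<lambda>g. g * S b"])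
    show "(\<lambda>g. g * b) \<in> \<Gamma> \<rightarrow> {g \<in> G. dg g = i}"
      using b i by (auto simp: \<Gamma>_def G_mult dg_mult)
    show "(\<lambda>g. g * S b) \<in> {g \<in> G. dg g = i} \<rightarrow> \<Gamma>"
      using b dg_S[OF b(1)] by (auto simp: \<Gamma>_def G_mult G_S dg_mult)
  qed (use G_inv[OF b(1)] in \<open>simp_all add: mult.assoc\<close>)
  from bij_betw_same_card[OF this] show ?thesis by (simp add: card_\<Gamma>)
qed

lemma \<gamma>_cc_mult:
  assumes "g \<in> G" "g' \<in> G" "m < 3"
  shows "\<gamma> g (ent (cc m) i j * g') = 0"
proof -
  obtain n P Q where n: "n < 3" "P * Q = 1" "cc m * sc g' * emb P = emb P * cc n"
    using right_block[OF assms(2,3)] by blast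
  have "cc m * sc g' = cc m * sc g' * emb P * emb Q" by (simp add: mult.assoc emb_inv[OF n(2)])
  then have "ev (\<gamma> g) (cc m * sc g') = 0"
    by (simp only: n(3) ev_emb lin_\<gamma> ev_\<gamma>_cc[OF assms(1) n(1)]) simp
  then have "ent (ev (\<gamma> g) (cc m * sc g')) i j = 0" by simp
  then show ?thesis by (simp add: ent_mult_sc)
qed

lemma \<gamma>_shift:
  assumes "g \<in> G" "h \<in> G"
  shows "\<gamma> g (y * h) = \<gamma> (g * S h) y"
proof -
  have "(\<lambda>y. \<gamma> g (y * h)) = \<gamma> (g * S h)"
  proof (rule lin_ext)
    show "lin (\<lambda>y. \<gamma> g (y * h))" by (intro lin_mult_right lin_\<gamma>)
    show "lin (\<gamma> (g * S h))" by (rule lin_\<gamma>)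
    show "\<gamma> g (g' * h) = \<gamma> (g * S h) g'" if "g' \<in> G" for g'
    proof -
      have "g = g' * h \<longleftrightarrow> g * S h = g'" using G_inv[OF assms(2)]
        by (metis mult.assoc mult.right_neutral)
      then show ?thesis using assms that by (simp add: \<gamma>_G G_mult G_S)
    qed
    show "ev (\<lambda>y. \<gamma> g (y * h)) (cc m) = ev (\<gamma> (g * S h)) (cc m)" if "m < 3" for m
      using assms that by (intro sqmat_eqI) (simp add: \<gamma>_cc_mult \<gamma>_cc G_mult G_S)
  qed
  then show ?thesis by metis
qed

text \<open>If no group-like occurred in c \<otimes> c, then \<open>\<gamma> 1\<close> would vanish
  on all products of an entry of \<open>c\<close> with an element of \<open>H\<close>, hence on the
  diagonal entries of c * d = 1.\<close>

lemma exists_\<rho>_\<gamma>: "\<exists>g\<in>G. \<rho> (\<gamma> g) \<noteq> 0"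
proof (rule ccontr)
  assume "\<not> ?thesis"
  then have z: "\<rho> (\<gamma> g) = 0" if "g \<in> G" for g using that by blast
  have cc0: "\<gamma> g (ent c i j * ent c p q) = 0" if "g \<in> G" for g i j p q
  proof -
    have "ent (\<rho> (\<gamma> g)) (i, p) (j, q) = 0" by (simp only: z[OF that] ent_zero)
    then show ?thesis by (simp add: sq_def)
  qed
  have cx: "\<gamma> 1 (ent c i j * x) = 0" for i j x
  proof -
    have 1: "\<gamma> 1 (ent c i j * g) = 0" if "g \<in> G" for g
      using \<gamma>_cc_mult[OF G_one that, of 0 i j] by (simp add: c_cc)
    have 2: "\<gamma> 1 (ent c i j * ent (cc m) p q) = 0" if "m < 3" for m p q
    proof -
      have "ent c i j * ent (cc m) p q = ent c i j * ent c p q * a ^ m"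
        by (simp add: cc_eq[OF that] ent_mult_sc mult.assoc)
      then show ?thesis by (simp add: \<gamma>_shift G_one a_pow_G cc0 G_S)
    qed
    show ?thesis
      by (subst expand[of x]) (simp add: distrib_left sum_distrib_left scal_mult_right lin_simps[OF lin_\<gamma>] 1 2)
  qed
  have "\<gamma> 1 (ent (c * d) 0 0) = 0"
    by (simp add: ent_mult lin_simps[OF lin_\<gamma>] cx)
  moreover have "\<gamma> 1 (ent (c * d) 0 0) = 1"
    by (simp add: cd ent_one \<gamma>_G G_one)
  ultimately show False by simp
qed

lemma ev_sc_emb: "lin \<phi> \<Longrightarrow> ev \<phi> (sc x * emb E) = sc (\<phi> x) * E"
  by (rule sqmat_eqI) (simp add: ent_sc_mult scal_one_mult lin_simps mult.commute)

lemma proj_sq: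
  assumes g: "g \<in> G"
  shows "sq * emb (\<rho> (\<gamma> g)) = sc g * emb (\<rho> (\<gamma> g))"
proof (rule mat_eq_coords)
  have z: "ev (\<lambda>x. 0) sq = 0" by (rule sqmat_eqI) simp
  show "ev (\<gamma> g') (sq * emb (\<rho> (\<gamma> g))) = ev (\<gamma> g') (sc g * emb (\<rho> (\<gamma> g)))" if "g' \<in> G" for g'
    using that g
    by (simp only: ev_sc_emb[OF lin_\<gamma>]) (simp add: ev_emb lin_\<gamma> \<gamma>_G conv_\<gamma>\<gamma> comat_sq z sc_simps flip: ev_conv)
  show "ev (\<kappa> m i j) (sq * emb (\<rho> (\<gamma> g))) = ev (\<kappa> m i j) (sc g * emb (\<rho> (\<gamma> g)))" if "m < 3" for m i j
    using that g
    by (simp only: ev_sc_emb[OF lin_\<kappa>]) (simp add: ev_emb lin_\<gamma> lin_\<kappa> \<kappa>_G conv_\<kappa>\<gamma> comat_sq z sc_simps flip: ev_conv)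
qed

text \<open>The nonzero solutions \<open>M\<close> describe copies of the one-dimensional comodule \<open>k g\<close> in \<open>c \<otimes> c\<close>.\<close>

definition sol :: "'h \<Rightarrow> ('k, 4) sqmat \<Rightarrow> bool"
  where "sol g M \<longleftrightarrow> c * emb M * mtransp c = sc g * emb M"

lemma sol_entries: "sol g M \<longleftrightarrow>
  (\<forall>i l. (\<Sum>k\<in>UNIV. \<Sum>j\<in>UNIV. scal H (ent M j k) (ent c i j * ent c l k)) = scal H (ent M i l) g)"
proof -
  have "sol g M \<longleftrightarrow> (\<forall>i l. ent (c * emb M * mtransp c) i l = ent (sc g * emb M) i l)"
    unfolding sol_def using sqmat_eqI by metis
  then show ?thesis
    unfolding ent_sc_mult ent_emb scal_one_mult
    by (simp add: ent_mult[of "c * emb M"] ent_emb_mult sum_distrib_right scal_mult_left)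
qed

text \<open>The columns of the projection \<rho> (\<gamma> g) span the part of c \<otimes> c where
  \<open>k g\<close> sits; a column of length 16 is reshaped into a 4 x 4 matrix.\<close>

lemma sol_column:
  assumes g: "g \<in> G"
  shows "sol g (Mat (\<lambda>j k. ent (\<rho> (\<gamma> g)) (j, k) r))"
  unfolding sol_entries
proof (intro allI)
  fix i l
  have "ent (sq * emb (\<rho> (\<gamma> g))) (i, l) r = ent (sc g * emb (\<rho> (\<gamma> g))) (i, l) r"
    by (simp only: proj_sq[OF g])
  moreover have "ent (sq * emb (\<rho> (\<gamma> g))) (i, l) r =
      (\<Sum>j\<in>UNIV. \<Sum>k\<in>UNIV. scal H (ent (\<rho> (\<gamma> g)) (j, k) r) (ent c i j * ent c l k))"
    by (simp add: ent_emb_mult(2) sum_UNIV_prod sq_def)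
  moreover have "ent (sc g * emb (\<rho> (\<gamma> g))) (i, l) r = scal H (ent (\<rho> (\<gamma> g)) (i, l) r) g"
    by (simp only: ent_sc_mult ent_emb scal_one_mult)
  ultimately have "(\<Sum>j\<in>UNIV. \<Sum>k\<in>UNIV. scal H (ent (\<rho> (\<gamma> g)) (j, k) r) (ent c i j * ent c l k))
      = scal H (ent (\<rho> (\<gamma> g)) (i, l) r) g"
    by simp
  then show "(\<Sum>k\<in>UNIV. \<Sum>j\<in>UNIV. scal H (ent (Mat (\<lambda>j k. ent (\<rho> (\<gamma> g)) (j, k) r)) j k) (ent c i j * ent c l k))
      = scal H (ent (Mat (\<lambda>j k. ent (\<rho> (\<gamma> g)) (j, k) r)) i l) g"
    by (subst sum.swap) simp
qed

lemma sol_nonzero_imp: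
  assumes g: "g \<in> G" and M: "sol g M" "M \<noteq> 0"
  shows "\<rho> (\<gamma> g) \<noteq> 0"
proof
  assume z: "\<rho> (\<gamma> g) = 0"
  have "ent M i l = 0" for i l
  proof -
    have "\<gamma> g (\<Sum>k\<in>UNIV. \<Sum>j\<in>UNIV. scal H (ent M j k) (ent c i j * ent c l k)) = ent M i l"
      using M(1) g unfolding sol_entries by (simp add: lin_simps[OF lin_\<gamma>] \<gamma>_G)
    moreover have "\<gamma> g (ent c i j * ent c l k) = 0" for j k
    proof -
      have "ent (\<rho> (\<gamma> g)) (i, l) (j, k) = 0" by (simp only: z ent_zero)
      then show ?thesis by (simp add: sq_def)
    qed
    ultimately show ?thesis by (simp add: lin_simps[OF lin_\<gamma>])
  qed
  then show False using M(2) by (metis ent_zero sqmat_eqI)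
qed

lemma sol_transp: "sol g M \<Longrightarrow> emb M * mtransp c = d * (sc g * emb M)"
proof -
  assume "sol g M"
  then have "d * (c * emb M * mtransp c) = d * (sc g * emb M)" by (simp only: sol_def)
  moreover have "d * (c * emb M * mtransp c) = d * c * (emb M * mtransp c)" by (simp only: mult.assoc)
  ultimately show ?thesis by (simp add: cd(2))
qed

text \<open>A vector killed by \<open>M\<close> is still killed after the transposed comatrix acts
  on it. Reading off coordinates gives \<open>M * munit q p * X = 0\<close> for all q and p, and a
  nonzero \<open>M\<close> leaves only X = 0.\<close>

lemma sol_invertible:
  assumes "sol g M" "M \<noteq> 0"
  shows "\<exists>N. M * N = 1 \<and> N * M = 1"
proof (rule sqmat_invertible)
  fix X assume X: "M * X = 0"
  have "emb M * mtransp c * emb X = d * (sc g * emb (M * X))"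
    by (simp add: sol_transp[OF assms(1)] emb_simps mult.assoc)
  then have z: "emb M * mtransp c * emb X = 0" by (simp add: X emb_simps)
  have "M * munit q p * X = 0" for p q
  proof -
    have "ev (\<kappa> 0 p q) (mtransp c) = munit q p"
      by (rule sqmat_eqI) (auto simp: c_cc \<kappa>_cc ent_munit)
    moreover have "ev (\<kappa> 0 p q) (emb M * mtransp c * emb X) = M * ev (\<kappa> 0 p q) (mtransp c) * X"
      by (simp add: ev_emb lin_\<kappa>)
    ultimately show ?thesis by (simp add: z ev_simps lin_\<kappa>)
  qed
  then have e: "ent M i q * ent X p j = 0" for i q p j
  proof -
    have "ent (M * munit q p * X) i j = ent M i q * ent X p j"
      unfolding ent_mult[of "M * munit q p"] ent_mult_munit by (simp add: if_distrib[of "\<lambda>x. x * _"] cong: if_cong)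
    then show ?thesis by (simp add: \<open>\<And>q p. M * munit q p * X = 0\<close>)
  qed
  obtain i q where "ent M i q \<noteq> 0" using assms(2) by (metis ent_zero sqmat_eqI)
  then show "X = 0" using e by (intro sqmat_eqI) (metis ent_zero mult_eq_0_iff)
qed

text \<open>Each solution expresses \<open>mtransp c\<close> through \<open>d\<close>; equating two
  such expressions produces an intertwiner for left translation by the quotient of the
  group-likes.\<close>

lemma sol_trans:
  assumes g: "g \<in> G" "g' \<in> G" and M: "sol g M" "sol g' M'" and N: "M * N = 1"
  shows "sc (g * S g') * c * emb (M' * N) = emb (M' * N) * c"
proof -
  have NM: "N * M = 1" by (rule sqmat_left_right_inverse[OF N])
  define K where "K = emb (M' * N)"
  have "mtransp c = emb N * (emb M * mtransp c)" by (simp add: emb_inv[OF NM])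
  also have "\<dots> = emb N * (d * (sc g * emb M))" by (simp only: sol_transp[OF M(1)])
  finally have 1: "mtransp c = emb N * (d * (sc g * emb M))" .
  have "emb M' * (emb N * (d * (sc g * emb M))) * emb N = d * (sc g' * emb M') * emb N"
    by (simp only: 1[symmetric] sol_transp[OF M(2)])
  then have 2: "K * (d * sc g) = d * (sc g' * K)"
    by (simp add: K_def emb_simps mult.assoc emb_inv(1)[OF N])
  have "c * K = c * (K * (d * sc g)) * (sc (S g) * c)"
    by (simp add: mult.assoc sc_inv(2)[OF G_inv(1)[OF g(1)]] cd)
  also have "\<dots> = c * d * sc g' * (K * sc (S g)) * c"
    by (simp only: 2) (simp only: mult.assoc)
  also have "\<dots> = sc g' * (sc (S g) * (K * c))"
    by (simp add: cd K_def mult.assoc flip: emb_commute)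
  finally have "sc g * (sc (S g') * (c * K)) = K * c"
    by (simp add: sc_inv(2)[OF G_inv(2)[OF g(2)]] sc_inv(2)[OF G_inv(1)[OF g(1)]])
  then show ?thesis by (simp add: K_def sc_simps mult.assoc)
qed

lemma sol_shift:
  assumes M: "sol g M" and P: "uL y P"
  shows "sol (S y * g) (P * M)"
proof -
  have y: "sc (S y) * sc y = (1 :: ('h, 4) sqmat)"
    using P G_inv(2)[OF \<Gamma>_G] by (auto simp: uL_def intro!: sc_inv)
  have "sc y * c * emb P = emb P * c" using P by (simp add: uL_def)
  then have "sc (S y) * sc y * (c * emb P) = sc (S y) * (emb P * c)" by (simp only: mult.assoc)
  then have cP: "c * emb P = sc (S y) * (emb P * c)" by (simp only: y mult_1_left)
  have "c * emb (P * M) * mtransp c = c * emb P * (emb M * mtransp c)"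
    by (simp only: emb_simps mult.assoc)
  also have "\<dots> = sc (S y) * (emb P * (c * emb M * mtransp c))"
    by (simp only: cP mult.assoc)
  also have "\<dots> = sc (S y) * ((sc g * emb P) * emb M)"
    using M unfolding sol_def by (simp only: emb_commute mult.assoc)
  also have "\<dots> = sc (S y * g) * emb (P * M)"
    by (simp only: sc_simps emb_simps mult.assoc)
  finally show ?thesis by (simp only: sol_def)
qed

text \<open>Two solutions for the same g differ by an intertwiner of \<open>c\<close> with itself, a
  scalar. So all columns of the idempotent are proportional: rank and trace are 1.\<close>

lemma tr_\<rho>_\<gamma>:
  assumes g: "g \<in> G" and nz: "\<rho> (\<gamma> g) \<noteq> 0"
  shows "tr (\<rho> (\<gamma> g)) = 1"
proof -
  define E where "E = \<rho> (\<gamma> g)"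
  have EE: "E * E = E" by (simp add: E_def g comat_sq lin_\<gamma> conv_\<gamma>\<gamma> flip: ev_conv)
  define M where "M r = Mat (\<lambda>j k. ent E (j, k) r)" for r
  have sol: "sol g (M r)" for r unfolding M_def E_def by (rule sol_column[OF g])
  obtain p0 r0 where pr: "ent E p0 r0 \<noteq> 0" using nz by (metis E_def ent_zero sqmat_eqI)
  then have "ent (M r0) (fst p0) (snd p0) \<noteq> 0" by (simp add: M_def)
  then have "M r0 \<noteq> 0" by (metis ent_zero)
  then obtain N where N: "M r0 * N = 1" "N * M r0 = 1" using sol_invertible[OF sol] by blast
  have "\<exists>s. M r = sc s * M r0" for r
  proof -
    have "c * emb (M r * N) = emb (M r * N) * c"
      using sol_trans[OF g g sol sol N(1)] G_inv[OF g] by (simp add: sc_simps)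
    then obtain s where s: "M r * N = sc s" using schur_c by blast
    have "M r = M r * (N * M r0)" by (simp add: N)
    then have "M r = sc s * M r0" by (simp add: s flip: mult.assoc)
    then show ?thesis by blast
  qed
  then obtain y where y: "\<And>r. M r = sc (y r) * M r0" by metis
  have Ey: "ent E p r = y r * ent E p r0" for p r
    using arg_cong[OF y[of r], of "\<lambda>X. ent X (fst p) (snd p)"] by (simp add: M_def ent_sc_mult)
  have "ent E p0 r0 = ent (E * E) p0 r0" by (simp add: EE)
  also have "\<dots> = ent E p0 r0 * (\<Sum>t\<in>UNIV. y t * ent E t r0)"
    unfolding ent_mult sum_distrib_left by (rule sum.cong[OF refl], subst Ey) simp
  finally have "(\<Sum>t\<in>UNIV. y t * ent E t r0) = 1" using pr by simp
  then show ?thesis by (simp add: tr_def flip: E_def Ey)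
qed

text \<open>By \<open>sol_trans\<close> and \<open>sol_shift\<close> the group-likes in c \<otimes>
  c form one coset of \<Gamma>, and each of its four elements contributes trace 1.\<close>

lemma sum_tr_\<rho>_\<gamma>: "(\<Sum>g\<in>G. tr (\<rho> (\<gamma> g))) = 4"
proof -
  obtain g0 where g0: "g0 \<in> G" "\<rho> (\<gamma> g0) \<noteq> 0" using exists_\<rho>_\<gamma> by blast
  have solex: "\<exists>M. sol g M \<and> M \<noteq> 0" if g: "g \<in> G" and nz: "\<rho> (\<gamma> g) \<noteq> 0" for g
  proof -
    obtain p r where "ent (\<rho> (\<gamma> g)) p r \<noteq> 0" using nz by (metis ent_zero sqmat_eqI)
    then have "ent (Mat (\<lambda>j k. ent (\<rho> (\<gamma> g)) (j, k) r)) (fst p) (snd p) \<noteq> ent 0 (fst p) (snd p)"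
      by simp
    then have "Mat (\<lambda>j k. ent (\<rho> (\<gamma> g)) (j, k) r) \<noteq> 0"
      by (rule contrapos_nn) (simp only:)
    with sol_column[OF g] show ?thesis by blast
  qed
  obtain M0 where M0: "sol g0 M0" "M0 \<noteq> 0" using solex[OF g0] by blast
  obtain N0 where N0: "M0 * N0 = 1" "N0 * M0 = 1" using sol_invertible[OF M0] by blast
  have dgS: "dg (g0 * S g) = 0 \<longleftrightarrow> dg g = dg g0" if "g \<in> G" for g
  proof -
    have "dg g < 3" "dg g0 < 3" "dg (S g) < 3" "(dg g + dg (S g)) mod 3 = 0"
      using dg[OF that] dg[OF g0(1)] dg[OF G_S[OF that]] dg_S[OF that] by auto
    then have "(dg g0 + dg (S g)) mod 3 = 0 \<longleftrightarrow> dg g = dg g0" by presburger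
    then show ?thesis using g0 that by (simp add: dg_mult G_S)
  qed
  have "\<rho> (\<gamma> g) \<noteq> 0 \<longleftrightarrow> dg g = dg g0" if g: "g \<in> G" for g
  proof
    assume "\<rho> (\<gamma> g) \<noteq> 0"
    then obtain M where M: "sol g M" "M \<noteq> 0" using solex[OF g] by blast
    obtain N where N: "M * N = 1" "N * M = 1" using sol_invertible[OF M] by blast
    have "sc (g0 * S g) * c * emb (M * N0) = emb (M * N0) * c * sc (a ^ 0)"
      using sol_trans[OF g0(1) g M0(1) M(1) N0(1)] by (simp add: sc_simps)
    then have "rel (g0 * S g) 0"
      unfolding rel_def using inverse_pair_mult[OF N(1) N0(2)] inverse_pair_mult[OF N0(1) N(2)] by blast
    then have "dg (g0 * S g) = 0" using dg_eq g0 g by (simp add: G_mult G_S)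
    then show "dg g = dg g0" using dgS[OF g] by simp
  next
    assume "dg g = dg g0"
    then have y: "g0 * S g \<in> \<Gamma>" using dgS[OF g] g g0 by (simp add: \<Gamma>_def G_mult G_S)
    then obtain P where P: "uL (g0 * S g) P" using uL_exists by blast
    have "sol (S (g0 * S g) * g0) (P * M0)" by (rule sol_shift[OF M0(1) P])
    moreover have "S (g0 * S g) * g0 = g"
    proof -
      have "S (g0 * S g) * g0 = S (g0 * S g) * (g0 * S g) * g"
        using G_inv[OF g] by (simp add: mult.assoc)
      then show ?thesis using G_inv(2)[OF \<Gamma>_G[OF y]] by simp
    qed
    moreover have "P * M0 \<noteq> 0"
    proof
      assume z: "P * M0 = 0"
      obtain Q where "Q * P = 1" using P unfolding uL_def by blast
      then have "M0 = Q * (P * M0)" by (simp flip: mult.assoc)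
      then show False using z M0 by simp
    qed
    ultimately show "\<rho> (\<gamma> g) \<noteq> 0" using sol_nonzero_imp[OF g] by metis
  qed
  then have "(\<Sum>g\<in>G. tr (\<rho> (\<gamma> g))) = (\<Sum>g\<in>G. if dg g = dg g0 then 1 else 0)"
    by (intro sum.cong refl) (metis tr_\<rho>_\<gamma> tr_simps(1))
  also have "\<dots> = of_nat (card {g \<in> G. dg g = dg g0})"
    using finite_G by (simp add: sum.If_cases Int_def)
  also have "\<dots> = 4" using card_fiber dg[OF g0(1)] by simp
  finally show ?thesis .
qed

lemma tr_\<rho>_\<omega>_munit: "tr (\<rho> (\<omega> (munit 0 0))) = 3"
proof -
  have "4 * tr (\<rho> (\<omega> (munit 0 0))) = 4 * (3 :: 'k)"
    using tr_\<rho>_total unfolding sum_tr_\<rho>_\<gamma> by (simp add: algebra_simps)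
  then show ?thesis by simp
qed

text \<open>Translation by \<open>S g\<close> conjugates every block by \<open>P\<close>; a
  \<open>W\<close> commuting with \<open>P\<close> makes \<open>\<omega> W\<close> blind to
  it.\<close>

lemma \<omega>_left_invariant:
  assumes P: "uL g P" and W: "P * W = W * P"
  shows "\<omega> W (S g * x) = \<omega> W x"
proof -
  obtain Q where Q: "P * Q = 1" "Q * P = 1" and g: "g \<in> \<Gamma>" "sc g * c * emb P = emb P * c"
    using P unfolding uL_def by blast
  note gi = G_inv[OF \<Gamma>_G[OF g(1)]]
  have "emb Q * c * emb P = emb Q * (sc (S g) * (sc g * c * emb P))"
    by (simp add: mult.assoc sc_inv(2)[OF gi(2)])
  also have "\<dots> = emb Q * ((sc (S g) * emb P) * c)" by (simp only: g(2)) (simp only: mult.assoc)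
  also have "\<dots> = emb Q * (emb P * (sc (S g) * c))" by (simp only: emb_commute mult.assoc)
  finally have gc: "sc (S g) * c = emb Q * c * emb P" by (simp add: emb_inv[OF Q(2)])
  have "(\<lambda>x. \<omega> W (S g * x)) = \<omega> W"
  proof (rule lin_ext)
    show "lin (\<lambda>x. \<omega> W (S g * x))" by (intro lin_mult_left lin_\<omega>)
    show "\<omega> W (S g * h) = \<omega> W h" if "h \<in> G" for h
      using that g by (simp add: \<omega>_G G_mult G_S \<Gamma>_G)
    show "ev (\<lambda>x. \<omega> W (S g * x)) (cc m) = ev (\<omega> W) (cc m)" if m: "m < 3" for m
    proof -
      have "ev (\<lambda>x. \<omega> W (S g * x)) (cc m) = ev (\<omega> W) (sc (S g) * cc m)"
        by (rule sqmat_eqI) (simp add: ent_sc_mult)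
      also have "sc (S g) * cc m = emb Q * cc m * emb P"
        by (simp only: cc_eq[OF m] mult.assoc[symmetric] gc) (simp only: mult.assoc emb_commute)
      also have "ev (\<omega> W) \<dots> = Q * W * P" by (simp add: ev_emb lin_\<omega> ev_\<omega>_cc m)
      also have "\<dots> = W" by (simp only: mult.assoc W[symmetric]) (simp only: mult.assoc[symmetric] Q mult_1_left)
      finally show ?thesis using m by (simp add: ev_\<omega>_cc)
    qed
  qed (rule lin_\<omega>)
  then show ?thesis by metis
qed

text \<open>The 16-dimensional comodule \<open>c \<otimes> c\<close> is a sum of three simple comodules of dimension 4 and four
  group-likes, so a rank-one idempotent \<open>W\<close> acts on it with trace 3.  An anticommuting pair would give an
  operator commuting with this action that splits the trace into two equal integers.\<close>

lemma no_anticommute: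
  assumes P: "uL g P" and R: "vR h R" and RP: "R * P = - (P * R)"
  shows False
proof -
  obtain Q where Q: "P * Q = 1" "Q * P = 1" and g: "g \<in> \<Gamma>" "sc g * c * emb P = emb P * c"
    using P unfolding uL_def by blast
  have h: "h \<in> \<Gamma>" "c * sc h * emb R = emb R * c" using R unfolding vR_def by blast+
  obtain U where U: "uL h U" using uL_exists[OF h(1)] by blast
  obtain U' where U': "U * U' = 1" "U' * U = 1" and hU: "sc h * c * emb U = emb U * c"
    using U unfolding uL_def by blast
  obtain s1 where s1: "s1 \<noteq> 0" "P * P * (P * P) = sc s1" by (rule uL_pow4[OF P])
  obtain s2 where s2: "s2 \<noteq> 0" "R * R * (R * R) = sc s2" by (rule vR_pow4[OF R])
  obtain s3 where s3: "s3 \<noteq> 0" "U * U * (U * U) = sc s3" by (rule uL_pow4[OF U])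
  obtain W where W: "W * W = W" "tr W = 1" "P * W = W * P"
    by (rule rank_one_idempotent_commuting[OF s1(2,1)])
  define E where "E = \<rho> (\<omega> W)"
  have EE: "E * E = E" by (simp add: E_def \<rho>_\<omega>_mult W)
  have trE: "tr E = 3" unfolding E_def by (subst tr_\<rho>_\<omega>) (simp add: W tr_\<rho>_\<omega>_munit)
  \<comment> \<open>Moving \<open>R\<close> across \<open>c\<close> creates a factor h to the right
    of the first entry, moving \<open>U'\<close> across \<open>c\<close> one to the left of the
    second. In a product of entries both are the same middle factor, so \<theta> commutes with
    \<open>sq\<close>.\<close>
  define \<theta> where "\<theta> = kron R U'"
  define L where "L = kron P 1"
  define L' where "L' = kron Q 1"
  have k1: "kron 1 1 = (1 :: ('k, 4 \<times> 4) sqmat)" using kron_sc[of 1 1] by (simp add: sc_simps)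
  have LLinv: "L * L' = 1" "L' * L = 1" by (simp_all add: L_def L'_def kron_mult Q k1)
  have cU: "c * emb U' = sc h * (emb U' * c)"
  proof -
    have "emb U' * (sc h * c * emb U) * emb U' = emb U' * (emb U * c) * emb U'" by (simp only: hU)
    then have "emb U' * (sc h * c) = c * emb U'"
      by (simp add: mult.assoc emb_inv[OF U'(1)] emb_inv[OF U'(2)])
    then show ?thesis by (simp add: mult.assoc[symmetric] emb_commute)
  qed
  have "sq * emb \<theta> = emb \<theta> * sq"
  proof (rule sqmat_eqI)
    fix p q :: "4 \<times> 4"
    obtain i l j k where pq: "p = (i, l)" "q = (j, k)" by (metis surj_pair)
    have "emb R * c = c * emb R * sc h" by (simp only: h(2)[symmetric] mult.assoc emb_commute)
    then have 1: "ent (emb R * c) i j = ent (c * emb R) i j * h" by (simp only: ent_mult_sc)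
    have 2: "ent (c * emb U') l k = h * ent (emb U' * c) l k" by (simp only: cU ent_sc_mult)
    show "ent (sq * emb \<theta>) p q = ent (emb \<theta> * sq) p q"
      unfolding pq \<theta>_def ent_sq_kron 1 2 by (simp only: mult.assoc)
  qed
  then have "ev (\<omega> W) (sq * emb \<theta>) = ev (\<omega> W) (emb \<theta> * sq)" by simp
  then have E\<theta>: "E * \<theta> = \<theta> * E" by (simp add: ev_emb lin_\<omega> E_def)
  \<comment> \<open>\<open>L\<close> translates only the first factor; the resulting
    \<open>S g\<close> is invisible to \<open>\<omega> W\<close>, because \<open>W\<close> was
    chosen to commute with \<open>P\<close>.\<close>
  have "sq * emb L = sc (S g) * (emb L * sq)"
  proof (rule sqmat_eqI)
    fix p q :: "4 \<times> 4"
    obtain i l j k where pq: "p = (i, l)" "q = (j, k)" by (metis surj_pair)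
    have "sc (S g) * (emb P * c) = sc (S g) * (sc g * (c * emb P))" by (simp only: g(2)[symmetric] mult.assoc)
    then have cP: "c * emb P = sc (S g) * (emb P * c)" by (simp only: sc_inv(2)[OF G_inv(2)[OF \<Gamma>_G[OF g(1)]]])
    show "ent (sq * emb L) p q = ent (sc (S g) * (emb L * sq)) p q"
      unfolding pq L_def ent_sc_mult ent_sq_kron cP by (simp add: mult.assoc emb_simps)
  qed
  then have "E * L = ev (\<omega> W) (sc (S g) * (emb L * sq))" by (simp add: E_def ev_emb lin_\<omega> flip: ev_emb)
  also have "\<dots> = ev (\<omega> W) (emb L * sq)"
    by (rule sqmat_eqI) (simp add: ent_sc_mult \<omega>_left_invariant[OF P W(3)])
  finally have EL: "E * L = L * E" by (simp add: ev_emb lin_\<omega> E_def)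
  have \<theta>L: "\<theta> * L = - (L * \<theta>)"
  proof -
    have "\<theta> * L = kron (sc (- 1) * (P * R)) U'" by (simp add: \<theta>_def L_def kron_mult RP sc_simps)
    then show ?thesis unfolding kron_sc_mult by (simp add: \<theta>_def L_def kron_mult sc_simps)
  qed
  have "U' * U' * (U' * U') * (U * U * (U * U)) = 1"
    using inverse_pair_mult[OF inverse_pair_mult[OF U'(2) U'(2)] inverse_pair_mult[OF U'(2) U'(2)]] by (simp only: mult.assoc)
  then have U4: "U' * U' * (U' * U') * sc s3 = 1" by (simp only: s3)
  have "U' * U' * (U' * U') = U' * U' * (U' * U') * (sc s3 * sc (inverse s3))"
    using s3 by (simp add: sc_simps(2) flip: sc_simps(6))
  also have "\<dots> = sc (inverse s3)" by (simp only: mult.assoc[symmetric] U4[unfolded mult.assoc[symmetric]] mult_1_left)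
  finally have "\<theta> * \<theta> * (\<theta> * \<theta>) = sc (s2 * inverse s3)"
    by (simp add: \<theta>_def kron_mult s2 kron_sc)
  moreover have "s2 * inverse s3 \<noteq> 0" using s2 s3 by simp
  ultimately obtain r where r: "r \<noteq> 0" "sc r * \<theta> * (sc r * \<theta>) * (sc r * \<theta> * (sc r * \<theta>)) = 1"
    using scale_fourth_power by blast
  define T where "T = sc r * \<theta>"
  have T4: "T * (T * (T * T)) = 1" using r(2) by (simp add: T_def mult.assoc)
  have T4': "T * (T * T) * T = 1" by (simp only: mult.assoc T4)
  from T4 have T6: "T * (T * T) * (T * (T * T)) = T * T" by (simp add: mult.assoc)
  have ET: "E * T = T * E" unfolding T_def by (simp only: mult_sc_mult[of E] E\<theta> mult.assoc)
  have TL: "T * L = - (L * T)" unfolding T_def by (simp only: mult.assoc \<theta>L mult_sc_mult[of L]) simp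
  obtain i :: 'k where i: "i * i = - 1" using exists_imaginary_unit .
  \<comment> \<open>Chosen so that \<open>A\<close> = \<alpha> T + \<beta> T^3 squares to 1/4 when
    T^4 = 1. Only odd powers of \<open>T\<close> occur, so \<open>A\<close> still anticommutes with
    \<open>L\<close>, and \<open>1/2 + A\<close> is an idempotent that conjugation by
    \<open>L\<close> exchanges with its complement.\<close>
  define \<alpha> \<beta> where "\<alpha> = (1 + i) / 4" and "\<beta> = (1 - i) / 4"
  have \<alpha>\<beta>: "\<alpha> * \<alpha> + \<beta> * \<beta> = 0" "\<alpha> * \<beta> + \<beta> * \<alpha> = 1 / 4"
    using i by (simp_all add: \<alpha>_def \<beta>_def field_simps)
  define A where "A = sc \<alpha> * T + sc \<beta> * (T * (T * T))"
  have "A * A = sc (\<alpha> * \<alpha>) * (T * T) + sc (\<alpha> * \<beta>) * (T * (T * (T * T)))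
      + (sc (\<beta> * \<alpha>) * (T * (T * T) * T) + sc (\<beta> * \<beta>) * (T * (T * T) * (T * (T * T))))"
    unfolding A_def distrib_left distrib_right sc_mult_sc_mult by simp
  also have "\<dots> = sc (\<alpha> * \<alpha> + \<beta> * \<beta>) * (T * T) + sc (\<alpha> * \<beta> + \<beta> * \<alpha>)"
    by (simp only: T4 T4' T6 mult_1_right sc_simps(3) distrib_right add_ac)
  finally have AA: "A * A = sc (1 / 4)" by (simp only: \<alpha>\<beta> sc_simps(1) mult_zero_left add_0)
  have "E * (T * (T * T)) = T * (T * T) * E"
    by (simp only: mult.assoc[symmetric] ET) (simp only: mult.assoc ET)
  then have EA: "E * A = A * E"
    unfolding A_def distrib_left distrib_right mult_sc_mult[of E] by (simp only: ET mult.assoc)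
  have "T * (T * T) * L = - (L * (T * (T * T)))"
  proof -
    have "T * (L * Z) = - (L * (T * Z))" for Z by (simp add: TL flip: mult.assoc)
    then show ?thesis by (simp add: mult.assoc TL)
  qed
  then have AL: "A * L = - (L * A)"
    unfolding A_def distrib_left distrib_right mult_sc_mult[of L] by (simp add: TL mult.assoc)
  define \<pi> where "\<pi> = sc (1 / 2) + A"
  have "\<pi> * \<pi> = sc (1 / 2) * sc (1 / 2) + A * A + (sc (1 / 2) + sc (1 / 2)) * A"
    unfolding \<pi>_def by (simp only: distrib_left distrib_right sc_commute[of "1 / 2" A, symmetric] add_ac)
  also have "\<dots> = sc (1 / 2 * (1 / 2) + 1 / 4) + sc (1 / 2 + 1 / 2) * A"
    unfolding AA by (simp only: sc_simps)
  finally have \<pi>\<pi>: "\<pi> * \<pi> = \<pi>" by (simp add: \<pi>_def sc_simps(2))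
  have E\<pi>: "E * \<pi> = \<pi> * E"
    unfolding \<pi>_def by (simp only: distrib_left distrib_right EA sc_commute)
  have "\<pi> * E * (\<pi> * E) = \<pi> * (E * \<pi>) * E" by (simp only: mult.assoc)
  also have "\<dots> = \<pi> * \<pi> * (E * E)" by (simp only: E\<pi> mult.assoc)
  finally have "\<pi> * E * (\<pi> * E) = \<pi> * E" by (simp only: \<pi>\<pi> EE)
  then obtain n where n: "tr (\<pi> * E) = of_nat n" by (rule idempotent_tr_nat)
  have "L * \<pi> = (1 - \<pi>) * L"
  proof -
    have one: "(1 :: ('k, 4 \<times> 4) sqmat) = sc (1 / 2) + sc (1 / 2)"
      by (simp add: sc_simps(2) flip: sc_simps(3))
    have m: "1 - \<pi> = sc (1 / 2) - A" unfolding \<pi>_def by (subst one) simp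
    have "(1 - \<pi>) * L = sc (1 / 2) * L + L * A" by (simp only: m left_diff_distrib AL diff_minus_eq_add)
    then show ?thesis unfolding \<pi>_def by (simp only: distrib_left sc_commute[of "1 / 2" L])
  qed
  then have "L * (\<pi> * E) * L' = (1 - \<pi>) * (L * E) * L'" by (simp add: mult.assoc[symmetric])
  also have "\<dots> = (1 - \<pi>) * E * (L * L')" by (simp only: EL[symmetric] mult.assoc)
  finally have "tr ((1 - \<pi>) * E) = tr (L * (\<pi> * E) * L')" by (simp add: LLinv)
  also have "\<dots> = tr (L' * (L * (\<pi> * E)))" by (rule tr_mult_commute)
  also have "\<dots> = tr (\<pi> * E)" by (simp add: LLinv flip: mult.assoc)
  finally have "tr E = of_nat n + of_nat n"
    using n by (simp add: left_diff_distrib tr_simps)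
  then have "of_nat (n + n) = (of_nat 3 :: 'k)" using trE by simp
  then have "n + n = 3" by (simp only: of_nat_eq_iff)
  then show False by presburger
qed

text \<open>The commutation scalar \<open>b\<close> satisfies b^4 = 1, because P^4 is scalar. The
  value -1 contradicts \<open>no_anticommute\<close> for \<open>P\<close>, and b^2 = -1 contradicts
  it for \<open>P * P\<close>.\<close>

lemma uL_vR_commutes:
  assumes P: "uL g P" and R: "vR h R"
  shows "R * P = P * R"
proof -
  obtain b where b: "b \<noteq> 0" "R * P = sc b * (P * R)" by (rule uL_vR_commute[OF P R])
  have PP: "R * (P * P) = sc (b * b) * (P * P * R)"
  proof -
    have "R * (P * P) = R * P * P" by (simp only: mult.assoc)
    also have "\<dots> = sc b * (P * (R * P))" by (simp only: b mult.assoc)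
    also have "\<dots> = sc b * (sc b * (P * (P * R)))" by (simp only: b(2) mult_sc_mult[of P])
    finally show ?thesis by (simp only: sc_simps mult.assoc)
  qed
  obtain s where s: "s \<noteq> 0" "P * P * (P * P) = sc s" by (rule uL_pow4[OF P])
  have "R * sc s = R * (P * P) * (P * P)" by (simp only: s(2)[symmetric] mult.assoc)
  also have "\<dots> = sc (b * b) * (P * P * (R * (P * P)))" by (subst PP) (simp only: mult.assoc)
  also have "\<dots> = sc (b * b) * (sc (b * b) * (P * P * (P * P) * R))"
    by (simp only: PP, simp only: mult_sc_mult[of "P * P"], simp only: mult.assoc)
  also have "\<dots> = sc (b * b * (b * b) * s) * R" by (simp only: s(2)) (simp only: sc_simps mult.assoc)
  finally have bs: "sc s * R = sc (b * b * (b * b) * s) * R" by (simp only: sc_commute)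
  obtain i j where "ent R i j \<noteq> 0" using vR_nonzero[OF R] by (metis ent_zero sqmat_eqI)
  then have "s = b * b * (b * b) * s"
    using arg_cong[OF bs, of "\<lambda>X. ent X i j"] unfolding ent_sc_mult by simp
  then have "(b * b - 1) * (b * b + 1) = 0" using s(1) by (simp add: algebra_simps)
  moreover have False if "b * b = - 1"
    using no_anticommute[OF uL_mult[OF P P] R] PP that by (simp add: sc_simps)
  moreover have "b = 1" if "b * b = 1"
  proof -
    have "(b - 1) * (b + 1) = 0" using that by (simp add: algebra_simps)
    moreover have False if "b = - 1" using no_anticommute[OF P R] b that by (simp add: sc_simps)
    ultimately show ?thesis by (auto simp: eq_neg_iff_add_eq_0)
  qed
  ultimately have "b = 1" by (auto simp: eq_neg_iff_add_eq_0)
  then show ?thesis using b by (simp add: sc_simps)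
qed

end

section \<open>Simplicity excludes commuting representations\<close>

text \<open>An idempotent of trace 1 has rank 1, hence is a column times a row, and the row,
  \<open>M\<close> and the column multiply to a scalar.\<close>

lemma trace_one_sandwich:
  fixes P :: "('k::field_char_0, 'n::finite) sqmat"
  assumes PP: "P * P = P" and tr: "tr P = 1"
  shows "\<exists>s. P * M * P = sc s * P"
proof -
  have "of_nat (vec.dim (range (mact P))) = (of_nat 1 :: 'k)"
    using idempotent_tr_dim[OF PP] tr by simp
  then have dim: "vec.dim (range (mact P)) = 1" by (simp only: of_nat_eq_iff)
  obtain B where "range (mact P) \<subseteq> vec.span B" "card B = vec.dim (range (mact P))"
    using vec.basis_exists by blast
  then obtain b where b: "range (mact P) \<subseteq> vec.span {b}" using dim by (metis card_1_singletonE)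
  have "\<exists>y. mact P (axis j 1) = y *s b" for j
    using b vec.span_singleton by blast
  then obtain y where y: "\<And>j. mact P (axis j 1) = y j *s b" by metis
  have P: "ent P i j = b $ i * y j" for i j
    using arg_cong[OF y[of j], of "\<lambda>x. x $ i"] by (simp add: mact_axis del: mact_nth)
  have "P * M * P = sc (\<Sum>l\<in>UNIV. \<Sum>k\<in>UNIV. y k * ent M k l * b $ l) * P"
    by (rule sqmat_eqI, unfold ent_sc_mult)
      (simp add: ent_mult P sum_distrib_left sum_distrib_right mult_ac, rule sum.swap)
  then show ?thesis by blast
qed

text \<open>The commuting pair has four joint spectral projections \<open>f s r\<close>.
  Independence makes all of them nonzero, so in dimension 4 each has rank one, and \<open>V\<close>
  acts on each by a scalar. The alternative \<open>sc \<sigma> * A\<close> for the square of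
  \<open>B\<close> serves the cyclic group of order 4.\<close>

lemma four_term_commutant:
  fixes A B V :: "('k::{alg_closed_field, field_char_0}, 4) sqmat"
  assumes AA: "A * A = 1" and AB: "A * B = B * A"
    and BB: "B * B = sc \<sigma> \<or> B * B = sc \<sigma> * A" and \<sigma>: "\<sigma> \<noteq> 0"
    and indep: "\<And>x y z w. sc x + sc y * A + sc z * B + sc w * (A * B) = 0 \<Longrightarrow> x = 0"
    and V: "V * A = A * V" "V * B = B * V"
  shows "\<exists>x y z w. V = sc x + sc y * A + sc z * B + sc w * (A * B)"
proof -
  define sg :: "bool \<Rightarrow> 'k" where "sg s = (if s then 1 else - 1)" for s
  have sg: "sg s * sg s = 1" for s by (simp add: sg_def)
  \<comment> \<open>The eigenvalue of \<open>B * B\<close> where \<open>A\<close> acts as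
    \<open>sg s\<close>; its square root \<open>t s\<close> gives the two possible eigenvalues of
    \<open>B\<close> there.\<close>
  define \<sigma>' where "\<sigma>' s = (if B * B = sc \<sigma> then \<sigma> else \<sigma> * sg s)" for s
  have "\<exists>t. t * t = \<sigma>' s" for s using nth_root_exists[of 2 "\<sigma>' s"] by (auto simp: power2_eq_square)
  then obtain t where t: "\<And>s. t s * t s = \<sigma>' s" by metis
  have "\<sigma>' s \<noteq> 0" for s using \<sigma> by (simp add: \<sigma>'_def sg_def)
  then have t0: "t s \<noteq> 0" for s using t by (metis mult_zero_left)
  define e where "e s = sc (1 / 2) * (1 + sc (sg s) * A)" for s
  define h where "h s r = sc (1 / 2) * (1 + sc (sg r * inverse (t s)) * B)" for s r
  define f where "f s r = e s * h s r" for s r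
  have half: "sc (1 / 2) * X + sc (1 / 2) * X = X" for X :: "('k, 4) sqmat"
    by (simp flip: distrib_right sc_simps(3)) (simp add: sc_simps)
  have hX: "sc (1 / 2) * (1 + X) + sc (1 / 2) * (1 - X) = 1" for X :: "('k, 4) sqmat"
  proof -
    have "sc (1 / 2) * (1 + X) + sc (1 / 2) * (1 - X) = sc (1 / 2) * 1 + sc (1 / 2) * (1 :: ('k, 4) sqmat)"
      by (simp only: distrib_left right_diff_distrib) simp
    then show ?thesis by (simp only: half)
  qed
  have Ae: "A * e s = sc (sg s) * e s" for s
  proof -
    have "A * (1 + sc (sg s) * A) = A + sc (sg s)"
      by (simp only: distrib_left mult_sc_mult[of A] AA mult_1_right)
    moreover have "sc (sg s) * (1 + sc (sg s) * A) = sc (sg s) + A"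
      by (simp only: distrib_left mult_1_right mult.assoc[symmetric] sc_simps(6)[symmetric] sg sc_simps(2) mult_1_left)
    ultimately have "A * (1 + sc (sg s) * A) = sc (sg s) * (1 + sc (sg s) * A)" by (simp only: add.commute)
    then show ?thesis unfolding e_def mult_sc_mult[of A] by (simp only: mult_sc_mult[of "sc (sg s)"])
  qed
  have comm_e: "X * e s = e s * X" if "X * A = A * X" for X s
    unfolding e_def mult_sc_mult[of X] mult.assoc[of "sc (1 / 2)"]
    by (simp only: distrib_left distrib_right mult_1_left mult_1_right mult_sc_mult[of X] that mult.assoc)
  have comm_h: "X * h s r = h s r * X" if "X * B = B * X" for X s r
    unfolding h_def mult_sc_mult[of X] mult.assoc[of "sc (1 / 2)"]
    by (simp only: distrib_left distrib_right mult_1_left mult_1_right mult_sc_mult[of X] that mult.assoc)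
  have comm_f: "X * f s r = f s r * X" if "X * A = A * X" "X * B = B * X" for X s r
    unfolding f_def by (simp only: mult.assoc[symmetric] comm_e[OF that(1)])
      (simp only: mult.assoc comm_h[OF that(2)])
  have BBe: "B * (B * e s) = sc (\<sigma>' s) * e s" for s
  proof (cases "B * B = sc \<sigma>")
    case True
    then show ?thesis by (simp add: \<sigma>'_def flip: mult.assoc)
  next
    case False
    then have "B * B = sc \<sigma> * A" using BB by blast
    then have "B * (B * e s) = sc \<sigma> * (A * e s)" by (simp only: mult.assoc[symmetric])
    then show ?thesis using False by (simp add: Ae \<sigma>'_def sc_simps mult.assoc)
  qed
  have Bf: "B * f s r = sc (sg r * t s) * f s r" for s r
  proof -
    have "B * (e s * B) = B * (B * e s)" by (simp only: comm_e[OF AB[symmetric]])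
    then have eB: "B * (e s * B) = sc (t s * t s) * e s" by (simp only: BBe t)
    have "B * (e s * (1 + sc (sg r * inverse (t s)) * B)) = B * e s + sc (sg r * inverse (t s) * (t s * t s)) * e s"
      by (simp only: distrib_left mult_1_right mult_sc_mult[of "e s"] mult_sc_mult[of B] eB sc_simps(6) mult.assoc)
    also have "sg r * inverse (t s) * (t s * t s) = sg r * t s" using t0[of s] by (simp add: field_simps)
    finally have 1: "B * (e s * (1 + sc (sg r * inverse (t s)) * B)) = B * e s + sc (sg r * t s) * e s" .
    have "sc (sg r * t s) * (e s * (1 + sc (sg r * inverse (t s)) * B)) =
        sc (sg r * t s) * e s + sc (sg r * t s * (sg r * inverse (t s))) * (e s * B)"
      by (simp only: distrib_left mult_1_right mult_sc_mult[of "e s"] sc_simps(6) mult.assoc)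
    also have "sg r * t s * (sg r * inverse (t s)) = 1" using t0[of s] by (simp add: sg_def)
    finally have 2: "sc (sg r * t s) * (e s * (1 + sc (sg r * inverse (t s)) * B)) = sc (sg r * t s) * e s + B * e s"
      by (simp only: sc_simps(2) mult_1_left comm_e[OF AB[symmetric]])
    show ?thesis
      unfolding f_def h_def mult_sc_mult[of "e s"] mult_sc_mult[of B] mult_sc_mult[of "sc (sg r * t s)"] 1 2
      by (simp only: add.commute)
  qed
  have Af: "A * f s r = sc (sg s) * f s r" for s r
    unfolding f_def by (simp only: mult.assoc[symmetric] Ae)
  have ef: "e s' * f s r = (if s' = s then f s r else 0)" for s' s r
  proof -
    have "e s' * f s r = sc (1 / 2 * (1 + sg s' * sg s)) * f s r"
      unfolding e_def by (simp only: mult.assoc distrib_right Af mult_1_left)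
        (simp only: sc_simps distrib_left distrib_right mult_1_left mult.assoc)
    moreover have "1 / 2 * (1 + sg s' * sg s) = (if s' = s then 1 else 0)" by (auto simp: sg_def)
    ultimately show ?thesis by (simp add: sc_simps)
  qed
  have hf: "h s r' * f s r = (if r' = r then f s r else 0)" for r' s r
  proof -
    have "h s r' * f s r = sc (1 / 2 * (1 + sg r' * inverse (t s) * (sg r * t s))) * f s r"
      unfolding h_def by (simp only: mult.assoc distrib_right Bf mult_1_left)
        (simp only: sc_simps distrib_left distrib_right mult_1_left mult.assoc)
    moreover have "1 / 2 * (1 + sg r' * inverse (t s) * (sg r * t s)) = (if r' = r then 1 else 0)"
      using t0[of s] by (auto simp: sg_def)
    ultimately show ?thesis by (simp add: sc_simps)
  qed
  have ff: "f s r * f s r = f s r" for s r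
  proof -
    have "f s r * f s r = e s * (h s r * f s r)" by (subst f_def) (simp only: mult.assoc)
    then show ?thesis by (simp add: hf ef)
  qed
  have hsum: "h s True + h s False = 1" for s
    using hX[of "sc (inverse (t s)) * B"] by (simp add: h_def sg_def sc_simps)
  have esum: "e True + e False = 1"
    using hX[of A] by (simp add: e_def sg_def sc_simps)
  have fsum: "f True True + f True False + (f False True + f False False) = 1"
    unfolding f_def by (simp only: distrib_left[symmetric] hsum mult_1_right esum)
  \<comment> \<open>In terms of 1, \<open>A\<close>, \<open>B\<close>, \<open>A * B\<close> the
    constant coefficient of \<open>f s r\<close> is 1/4, which \<open>indep\<close> excludes for a
    vanishing combination.\<close>
  have f0: "f s r \<noteq> 0" for s r
  proof
    assume z: "f s r = 0"
    have "f s r = sc (1 / 4) + sc (sg s / 4) * A + sc (sg r * inverse (t s) / 4) * B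
        + sc (sg s * (sg r * inverse (t s)) / 4) * (A * B)"
    proof -
      have "f s r = sc (1 / 2 * (1 / 2)) * ((1 + sc (sg s) * A) * (1 + sc (sg r * inverse (t s)) * B))"
        unfolding f_def e_def h_def by (rule sc_mult_sc_mult)
      also have "(1 + sc (sg s) * A) * (1 + sc (sg r * inverse (t s)) * B) =
          1 + sc (sg s) * A + sc (sg r * inverse (t s)) * B + sc (sg s * (sg r * inverse (t s))) * (A * B)"
        by (simp only: distrib_left distrib_right mult_1_left mult_1_right sc_mult_sc_mult add_ac)
      finally show ?thesis
        by (simp only: distrib_left mult_1_right mult.assoc[symmetric] sc_simps(6)[symmetric]) (simp add: mult_ac)
    qed
    then have "(1 / 4 :: 'k) = 0" using z indep by metis
    then show False by simp
  qed
  have "\<exists>n. tr (f s r) = of_nat n \<and> n \<ge> 1" for s r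
  proof -
    have d: "tr (f s r) = of_nat (vec.dim (range (mact (f s r))))" by (rule idempotent_tr_dim[OF ff])
    have "vec.dim (range (mact (f s r))) \<noteq> 0"
    proof
      assume "vec.dim (range (mact (f s r))) = 0"
      then have "range (mact (f s r)) \<subseteq> {0}" by (simp add: vec.dim_eq_0)
      then have "mact (f s r) x = 0" for x by blast
      moreover have "mact 0 x = (0 :: 'k^4)" for x by (simp add: vec_eq_iff)
      ultimately have "f s r = 0" by (intro mact_eqI) metis
      then show False using f0 by blast
    qed
    then have "1 \<le> vec.dim (range (mact (f s r)))" by linarith
    with d show ?thesis by blast
  qed
  then obtain n where n: "\<And>s r. tr (f s r) = of_nat (n s r)" "\<And>s r. n s r \<ge> 1" by metis
  have "tr (f True True + f True False + (f False True + f False False)) = 4"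
    by (simp only: fsum tr_one) simp
  then have "of_nat (n True True + n True False + (n False True + n False False)) = (of_nat 4 :: 'k)"
    by (simp add: tr_simps n)
  then have "n True True + n True False + (n False True + n False False) = 4" by (simp only: of_nat_eq_iff)
  moreover have "n True True \<ge> 1" "n True False \<ge> 1" "n False True \<ge> 1" "n False False \<ge> 1" by (rule n)+
  ultimately have "n True True = 1" "n True False = 1" "n False True = 1" "n False False = 1" by linarith+
  then have "n s r = 1" for s r by (cases s; cases r) auto
  then have trf: "tr (f s r) = 1" for s r by (simp add: n)
  have "\<exists>l. V * f s r = sc l * f s r" for s r
  proof -
    have "V * f s r = V * (f s r * f s r)" by (simp only: ff)
    also have "\<dots> = f s r * V * f s r" by (simp only: mult.assoc[symmetric] comm_f[OF V])
    finally show ?thesis using trace_one_sandwich[OF ff trf, of s r V] by metis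
  qed
  then obtain l where l: "\<And>s r. V * f s r = sc (l s r) * f s r" by metis
  let ?U = "{X. \<exists>x y z w. X = sc x + sc y * A + sc z * B + sc w * (A * B)}"
  have add: "X + Y \<in> ?U" if XY: "X \<in> ?U" "Y \<in> ?U" for X Y
  proof -
    obtain x y z w x' y' z' w' where "X = sc x + sc y * A + sc z * B + sc w * (A * B)"
      "Y = sc x' + sc y' * A + sc z' * B + sc w' * (A * B)" using XY by blast
    then have "X + Y = sc (x + x') + sc (y + y') * A + sc (z + z') * B + sc (w + w') * (A * B)"
      by (simp add: sc_simps distrib_right add_ac)
    then show ?thesis by blast
  qed
  have scale: "sc u * X \<in> ?U" if X: "X \<in> ?U" for u X
  proof -
    obtain x y z w where "X = sc x + sc y * A + sc z * B + sc w * (A * B)" using X by blast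
    then have "sc u * X = sc (u * x) + sc (u * y) * A + sc (u * z) * B + sc (u * w) * (A * B)"
      by (simp add: sc_simps distrib_left mult.assoc)
    then show ?thesis by blast
  qed
  have fU: "f s r \<in> ?U" for s r
  proof -
    have "(1 + sc (sg s) * A) * (1 + sc (sg r * inverse (t s)) * B) =
        sc 1 + sc (sg s) * A + sc (sg r * inverse (t s)) * B + sc (sg s * (sg r * inverse (t s))) * (A * B)"
      by (simp only: distrib_left distrib_right mult_1_left mult_1_right sc_mult_sc_mult sc_simps(2) add_ac)
    then have "(1 + sc (sg s) * A) * (1 + sc (sg r * inverse (t s)) * B) \<in> ?U" by blast
    then have "sc (1 / 2 * (1 / 2)) * ((1 + sc (sg s) * A) * (1 + sc (sg r * inverse (t s)) * B)) \<in> ?U" by (rule scale)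
    then show ?thesis unfolding f_def e_def h_def sc_mult_sc_mult .
  qed
  have "V = V * (f True True + f True False + (f False True + f False False))" by (simp only: fsum mult_1_right)
  also have "\<dots> = sc (l True True) * f True True + sc (l True False) * f True False
      + (sc (l False True) * f False True + sc (l False False) * f False False)"
    by (simp only: distrib_left l)
  also have "\<dots> \<in> ?U" by (intro add scale fU)
  finally show ?thesis by blast
qed

lemma (in tensor_algebra) sc_scal_one_commute: "X * sc (scal H s 1) = sc (scal H s 1) * X"
  by (rule sqmat_eqI) (simp add: ent_sc_mult ent_mult_sc scal_one_mult)

lemma (in tensor_algebra) mult_sc_scal_one: "A * (sc (scal H s 1) * X) = sc (scal H s 1) * (A * X)"
  by (simp only: mult.assoc[symmetric] sc_scal_one_commute[of A])

lemma (in tensor_algebra) tens_space_subspace: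
  assumes X: "subspace X"
  shows "0 \<in> tens2_space H X" "t \<in> tens2_space H X \<Longrightarrow> u \<in> tens2_space H X \<Longrightarrow> t + u \<in> tens2_space H X"
    "t \<in> tens2_space H X \<Longrightarrow> tens_scale c t \<in> tens2_space H X"
proof -
  show "0 \<in> tens2_space H X" unfolding tens_space_def by (auto intro!: exI[of _ "[]"])
  show "t + u \<in> tens2_space H X" if tu: "t \<in> tens2_space H X" "u \<in> tens2_space H X"
  proof -
    obtain xs ys where "t = (\<Sum>(v, w)\<leftarrow>xs. v \<boxtimes> w)" "set xs \<subseteq> X \<times> X" "u = (\<Sum>(v, w)\<leftarrow>ys. v \<boxtimes> w)" "set ys \<subseteq> X \<times> X"
      using tu unfolding tens_space_def by blast
    then show ?thesis unfolding tens_space_def by (auto intro!: exI[of _ "xs @ ys"])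
  qed
  show "tens_scale c t \<in> tens2_space H X" if t: "t \<in> tens2_space H X"
  proof -
    obtain xs where xs: "t = (\<Sum>(v, w)\<leftarrow>xs. v \<boxtimes> w)" "set xs \<subseteq> X \<times> X"
      using t unfolding tens_space_def by blast
    have "tens_scale c (\<Sum>(v, w)\<leftarrow>zs. v \<boxtimes> w) = (\<Sum>(v, w)\<leftarrow>map (\<lambda>(v, w). (scal H c v, w)) zs. v \<boxtimes> w)" for zs
      by (induction zs) (auto simp: tens_scale_simps ten_simps)
    moreover have "set (map (\<lambda>(v, w). (scal H c v, w)) xs) \<subseteq> X \<times> X"
      using xs(2) X by (auto simp: subspace_scale)
    ultimately show ?thesis unfolding tens_space_def xs(1) by blast
  qed
qed

section \<open>Normal Hopf subalgebras spanned by group-like elements\<close>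

context based
begin

lemma span_closed:
  assumes N: "\<And>x y. x \<in> N \<Longrightarrow> y \<in> N \<Longrightarrow> x * y \<in> N"
  shows "x \<in> span N \<Longrightarrow> y \<in> span N \<Longrightarrow> x * y \<in> span N"
proof -
  have 1: "g * y \<in> span N" if "g \<in> N" "y \<in> span N" for g y
    using that(2)
  proof (induction rule: span_induct_alt)
    case (step c x y)
    then show ?case using that(1)
      by (simp add: distrib_left scal_mult_right span_add span_scale span_base N)
  qed (simp add: span_zero)
  show "x \<in> span N \<Longrightarrow> y \<in> span N \<Longrightarrow> x * y \<in> span N"
  proof (induction rule: span_induct_alt)
    case (step c x z)
    then show ?case by (simp add: distrib_right scal_mult_left span_add span_scale 1)
  qed (simp add: span_zero)
qed

lemma mS_cc:
  assumes "m < 3"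
  shows "mS (cc m) = sc (S (a ^ m)) * d"
proof -
  have "cc m * (sc (S (a ^ m)) * d) = 1"
    by (simp add: cc_eq[OF assms] mult.assoc sc_inv(2)[OF G_inv(1)[OF a_pow_G]] cd)
  then have "mS (cc m) * (cc m * (sc (S (a ^ m)) * d)) = mS (cc m)" by simp
  then show ?thesis by (simp add: comat_inv[OF comat_cc[OF assms]] flip: mult.assoc)
qed

lemma left_adjoint_simps:
  "left_adjoint H S (x + y) z = left_adjoint H S x z + left_adjoint H S y z"
  "left_adjoint H S (scal H s x) z = scal H s (left_adjoint H S x z)"
  "left_adjoint H S 0 z = 0"
  "g \<in> G \<Longrightarrow> left_adjoint H S g z = g * z * S g"
  "m < 3 \<Longrightarrow> left_adjoint H S (ent (cc m) i j) z = ent (cc m * sc z * mS (cc m)) i j"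
proof -
  note l = vector_space_axioms bilin_adj
  show "left_adjoint H S (x + y) z = left_adjoint H S x z + left_adjoint H S y z"
    "left_adjoint H S (scal H s x) z = scal H s (left_adjoint H S x z)"
    "left_adjoint H S 0 z = 0"
    by (simp_all add: left_adjoint_def comult_simps lift_add[OF l] lift_scale[OF l] lift_zero[OF l])
  show "left_adjoint H S g z = g * z * S g" if "g \<in> G"
    using glike_G[OF that] by (simp add: left_adjoint_def glike_def lift_ten[OF l])
  show "left_adjoint H S (ent (cc m) i j) z = ent (cc m * sc z * mS (cc m)) i j" if "m < 3"
    using comat_cc[OF that] by (simp add: left_adjoint_def comat_def lift_sum_ten[OF l] ent_mult[of "_ * sc z"] ent_mult_sc)
qed

text \<open>Stability under the adjoint action is tested on G and on \<open>c\<close> only: the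
  block \<open>c a^m\<close> acts on x as \<open>c\<close> acts on the conjugate of x by
  \<open>a^m\<close>, which is again in \<open>N\<close>.\<close>

lemma normal_span:
  assumes N: "N \<subseteq> G" "1 \<in> N" "\<And>x y. x \<in> N \<Longrightarrow> y \<in> N \<Longrightarrow> x * y \<in> N" "\<And>x. x \<in> N \<Longrightarrow> S x \<in> N"
    and conj: "\<And>g x. g \<in> G \<Longrightarrow> x \<in> N \<Longrightarrow> g * x * S g \<in> N"
    and ent: "\<And>x i j. x \<in> N \<Longrightarrow> ent (c * sc x * d) i j \<in> span N"
  shows "normal_hopf_subalgebra H S (span N)"
  unfolding normal_hopf_subalgebra_def hopf_subalgebra_def
proof (intro conjI ballI allI)
  show "subspace (span N)" by (rule subspace_span)
  show "1 \<in> span N" by (rule span_base[OF N(2)])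
  show "x * y \<in> span N" if "x \<in> span N" "y \<in> span N" for x y by (rule span_closed[OF N(3) that])
  show "comult H x \<in> tens2_space H (span N)" if "x \<in> span N" for x
    using that
  proof (induction rule: span_induct_alt)
    case base
    show ?case unfolding comult_simps by (rule tens_space_subspace[OF subspace_span])
  next
    case (step s x y)
    have "x \<boxtimes> x \<in> tens2_space H (span N)"
      unfolding tens_space_def using step(1) by (auto intro!: exI[of _ "[(x, x)]"] span_base)
    moreover have "comult H x = x \<boxtimes> x" using glike_G step(1) N(1) by (auto simp: glike_def)
    ultimately show ?case
      using step by (simp add: comult_simps tens_space_subspace[OF subspace_span])
  qed
  show "S x \<in> span N" if "x \<in> span N" for x
    using that
    by (induction rule: span_induct_alt) (simp_all add: S_simps span_zero span_add span_scale span_base N(4))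
  fix h x assume x: "x \<in> span N"
  have g: "left_adjoint H S g x \<in> span N" if "g \<in> G" for g
    using x
  proof (induction rule: span_induct_alt)
    case (step s y z)
    have "left_adjoint H S g (scal H s y + z) = scal H s (g * y * S g) + left_adjoint H S g z"
      by (simp add: left_adjoint_simps(4)[OF that] distrib_left distrib_right scal_mult_left scal_mult_right)
    then show ?case using step conj[OF that step(1)] by (simp add: span_add span_scale span_base)
  qed (simp add: left_adjoint_simps that span_zero)
  have m: "left_adjoint H S (ent (cc m) i j) x \<in> span N" if m: "m < 3" for m i j
    using x
  proof (induction rule: span_induct_alt)
    case base
    then show ?case by (simp add: left_adjoint_simps m sc_simps span_zero)
  next
    case (step s y z)
    have lin: "left_adjoint H S (ent (cc m) i j) (scal H s y + z) =
      scal H s (left_adjoint H S (ent (cc m) i j) y) + left_adjoint H S (ent (cc m) i j) z"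
      unfolding left_adjoint_simps(5)[OF m]
      by (simp add: ent_mult[of "_ * sc _"] ent_mult_sc distrib_left distrib_right scal_mult_left scal_mult_right sum.distrib scale_sum_right)
    have "cc m * sc y * mS (cc m) = c * sc (a ^ m * y * S (a ^ m)) * d"
      by (simp only: mS_cc[OF m]) (simp only: cc_eq[OF m] sc_simps mult.assoc)
    then have "left_adjoint H S (ent (cc m) i j) y \<in> span N"
      using ent[OF conj[OF a_pow_G step(1)]] by (simp add: left_adjoint_simps(5)[OF m])
    then show ?case using step by (simp add: lin span_add span_scale)
  qed
  have "left_adjoint H S h x = (\<Sum>g\<in>G. scal H (\<gamma> g h) (left_adjoint H S g x)) +
      (\<Sum>m<3. \<Sum>i\<in>UNIV. \<Sum>j\<in>UNIV. scal H (\<kappa> m i j h) (left_adjoint H S (ent (cc m) i j) x))"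
  proof -
    have s1: "left_adjoint H S (\<Sum>i\<in>I. f i) x = (\<Sum>i\<in>I. left_adjoint H S (f i) x)" for I :: "'h set" and f
      by (induction I rule: infinite_finite_induct) (simp_all add: left_adjoint_simps)
    have s2: "left_adjoint H S (\<Sum>i\<in>I. f i) x = (\<Sum>i\<in>I. left_adjoint H S (f i) x)" for I :: "nat set" and f
      by (induction I rule: infinite_finite_induct) (simp_all add: left_adjoint_simps)
    have s3: "left_adjoint H S (\<Sum>i\<in>I. f i) x = (\<Sum>i\<in>I. left_adjoint H S (f i) x)" for I :: "4 set" and f
      by (induction I rule: infinite_finite_induct) (simp_all add: left_adjoint_simps)
    show ?thesis by (subst expand[of h]) (simp add: left_adjoint_simps s1 s2 s3)
  qed
  also have "\<dots> \<in> span N"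
    by (intro span_add span_sum span_scale g m) auto
  finally show "left_adjoint H S h x \<in> span N" .
qed

text \<open>\<open>span N\<close> lies in \<open>span G\<close>, so it is proper; simplicity reduces
  it to the scalars, and the counit singles out 1 among them.\<close>

lemma simple_no_normal:
  assumes simple: "simple_hopf_algebra H S"
    and N: "N \<subseteq> G" "1 \<in> N" "\<And>x y. x \<in> N \<Longrightarrow> y \<in> N \<Longrightarrow> x * y \<in> N" "\<And>x. x \<in> N \<Longrightarrow> S x \<in> N"
    and conj: "\<And>g x. g \<in> G \<Longrightarrow> x \<in> N \<Longrightarrow> g * x * S g \<in> N"
    and ent: "\<And>x i j. x \<in> N \<Longrightarrow> ent (c * sc x * d) i j \<in> span N"
    and x: "x \<in> N"
  shows "x = 1"
proof -
  have "span N \<noteq> UNIV"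
  proof
    assume "span N = UNIV"
    then have "ent c 0 0 \<in> span G" using span_mono[OF N(1)] by auto
    from \<kappa>_span_G[OF this, of 0 0 0] show False by (simp add: c_cc \<kappa>_cc)
  qed
  then have "span N = {scal H s 1 | s. True}"
    using simple normal_span[OF N conj ent] unfolding simple_hopf_algebra_def by blast
  then obtain s where s: "x = scal H s 1" using span_base[OF x] by auto
  have "counit H x = 1" using x N(1) glike_G by (auto simp: glike_def)
  then have "s = 1" using s by (simp add: counit_simps counit_one)
  then show ?thesis using s by simp
qed

text \<open>Conjugating a linear relation by \<open>c\<close> multiplies the term of g by the
  group-like \<open>S g\<close>. These are distinct basis elements, so every term vanishes
  separately.\<close>

lemma uL_independent:
  assumes F: "finite F" "F \<subseteq> \<Gamma>" and U: "\<And>g. g \<in> F \<Longrightarrow> uL g (U g)"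
    and z: "(\<Sum>g\<in>F. sc (l g) * U g) = 0" and h: "h \<in> F"
  shows "l h = 0"
proof -
  have cUd: "c * emb (U g) * d = sc (S g) * emb (U g)" if "g \<in> F" for g
  proof -
    have "sc (S g) * (sc g * c * emb (U g)) * d = sc (S g) * (emb (U g) * c) * d"
      using U[OF that] by (simp add: uL_def)
    then show ?thesis
      using G_inv(2)[of g] F(2) \<Gamma>_G that by (simp add: mult.assoc sc_inv(2) cd subset_iff)
  qed
  have "(\<Sum>g\<in>F. sc (scal H (l g) 1) * (sc (S g) * emb (U g))) = c * emb (\<Sum>g\<in>F. sc (l g) * U g) * d"
  proof -
    show ?thesis
      by (simp add: emb_sum emb_simps emb_sc sum_distrib_left sum_distrib_right mult_sc_scal_one mult.assoc)
        (simp add: cUd[unfolded mult.assoc])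
  qed
  then have z': "(\<Sum>g\<in>F. sc (scal H (l g) 1) * (sc (S g) * emb (U g))) = 0"
    by (simp add: z emb_simps)
  have inj: "S g = S h' \<longleftrightarrow> g = h'" if g: "g \<in> F" "h' \<in> F" for g h'
  proof
    assume SS: "S g = S h'"
    have "g = g * (S h' * h')" using G_inv(2)[of h'] F(2) \<Gamma>_G g by (auto simp: subset_iff)
    also have "\<dots> = g * S g * h'" by (simp only: SS mult.assoc)
    finally show "g = h'" using G_inv(1)[of g] F(2) \<Gamma>_G g by (auto simp: subset_iff)
  qed simp
  have "l h * ent (U h) i j = 0" for i j
  proof -
    have "ent (\<Sum>g\<in>F. sc (scal H (l g) 1) * (sc (S g) * emb (U g))) i j = 0"
      by (simp only: z' ent_zero)
    then have "(\<Sum>g\<in>F. scal H (l g * ent (U g) i j) (S g)) = 0"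
      by (simp add: ent_sum ent_sc_mult scal_one_mult)
    then have "\<gamma> (S h) (\<Sum>g\<in>F. scal H (l g * ent (U g) i j) (S g)) = 0"
      by (simp add: lin_simps[OF lin_\<gamma>])
    moreover have "\<gamma> (S h) (\<Sum>g\<in>F. scal H (l g * ent (U g) i j) (S g)) = (\<Sum>g\<in>F. if g = h then l h * ent (U h) i j else 0)"
      unfolding lin_simps[OF lin_\<gamma>]
      by (rule sum.cong[OF refl]) (use F(2) h in \<open>auto simp: \<gamma>_G G_S \<Gamma>_G subset_iff inj\<close>)
    ultimately show ?thesis using F(1) h by simp
  qed
  moreover obtain i j where "ent (U h) i j \<noteq> 0" using uL_nonzero[OF U[OF h]] by (metis ent_zero sqmat_eqI)
  ultimately show ?thesis by (metis mult_eq_0_iff)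
qed

lemma vR_independent:
  assumes F: "finite F" "F \<subseteq> \<Gamma>" and U: "\<And>g. g \<in> F \<Longrightarrow> vR g (U g)"
    and z: "(\<Sum>g\<in>F. sc (l g) * U g) = 0" and h: "h \<in> F"
  shows "l h = 0"
proof -
  have dUc: "d * emb (U g) * c = sc g * emb (U g)" if "g \<in> F" for g
  proof -
    have "d * (emb (U g) * c) = d * (c * sc g * emb (U g))"
      using U[OF that] by (simp add: vR_def)
    then show ?thesis using cd by (simp flip: mult.assoc)
  qed
  have "(\<Sum>g\<in>F. sc (scal H (l g) 1) * (sc g * emb (U g))) = d * emb (\<Sum>g\<in>F. sc (l g) * U g) * c"
  proof -
    show ?thesis
      by (simp add: emb_sum emb_simps emb_sc sum_distrib_left sum_distrib_right mult_sc_scal_one mult.assoc)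
        (simp add: dUc[unfolded mult.assoc])
  qed
  then have z': "(\<Sum>g\<in>F. sc (scal H (l g) 1) * (sc g * emb (U g))) = 0"
    by (simp add: z emb_simps)
  have "l h * ent (U h) i j = 0" for i j
  proof -
    have "ent (\<Sum>g\<in>F. sc (scal H (l g) 1) * (sc g * emb (U g))) i j = 0"
      by (simp only: z' ent_zero)
    then have "(\<Sum>g\<in>F. scal H (l g * ent (U g) i j) g) = 0"
      by (simp add: ent_sum ent_sc_mult scal_one_mult)
    then have "\<gamma> h (\<Sum>g\<in>F. scal H (l g * ent (U g) i j) g) = 0"
      by (simp add: lin_simps[OF lin_\<gamma>])
    moreover have "\<gamma> h (\<Sum>g\<in>F. scal H (l g * ent (U g) i j) g) = (\<Sum>g\<in>F. if g = h then l h * ent (U h) i j else 0)"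
      unfolding lin_simps[OF lin_\<gamma>]
      by (rule sum.cong[OF refl]) (use F(2) h in \<open>auto simp: \<gamma>_G \<Gamma>_G subset_iff\<close>)
    ultimately show ?thesis using F(1) h by simp
  qed
  moreover obtain i j where "ent (U h) i j \<noteq> 0" using vR_nonzero[OF U[OF h]] by (metis ent_zero sqmat_eqI)
  ultimately show ?thesis by (metis mult_eq_0_iff)
qed

end

section \<open>The stabiliser as a Klein four-group acting by anticommuting matrices\<close>

locale simple_based = based H S G cc \<gamma> \<kappa> a c
  for H :: "('k::{alg_closed_field, field_char_0}, 'h::ring_1) coalg" and S G cc \<gamma> \<kappa> a c +
  assumes simple: "simple_hopf_algebra H S"
begin

lemma \<Gamma>_cancel_left: "g \<in> \<Gamma> \<Longrightarrow> g * x = g * y \<longleftrightarrow> x = y"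
proof
  assume g: "g \<in> \<Gamma>" and eq: "g * x = g * y"
  have "S g * (g * x) = S g * (g * y)" by (simp only: eq)
  then show "x = y" using G_inv(2)[OF \<Gamma>_G[OF g]] by (simp flip: mult.assoc)
qed simp

lemma \<Gamma>_cancel_right: "g \<in> \<Gamma> \<Longrightarrow> x * g = y * g \<longleftrightarrow> x = y"
proof
  assume g: "g \<in> \<Gamma>" and eq: "x * g = y * g"
  have "x * g * S g = y * g * S g" by (simp only: eq)
  then show "x = y" using G_inv(1)[OF \<Gamma>_G[OF g]] by (simp add: mult.assoc)
qed simp

lemma \<Gamma>_cancel_one: "g \<in> \<Gamma> \<Longrightarrow> g * x = g \<longleftrightarrow> x = 1" "g \<in> \<Gamma> \<Longrightarrow> x * g = g \<longleftrightarrow> x = 1"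
  using \<Gamma>_cancel_left[of g x 1] \<Gamma>_cancel_right[of g x 1] by simp_all

text \<open>A noncommuting pair would give five distinct elements 1, g, h, g * h, h * g in a group
  of order 4.\<close>

lemma \<Gamma>_commute:
  assumes g: "g \<in> \<Gamma>" and h: "h \<in> \<Gamma>"
  shows "g * h = h * g"
proof (rule ccontr)
  assume ne: "g * h \<noteq> h * g"
  then have "g \<noteq> 1" "h \<noteq> 1" "g \<noteq> h" by auto
  moreover have "g * h \<noteq> 1" "h * g \<noteq> 1"
  proof -
    have "h = S g" if "g * h = 1" using \<Gamma>_cancel_left[OF g, of h "S g"] that G_inv(1)[OF \<Gamma>_G[OF g]] by simp
    then show 1: "g * h \<noteq> 1" using ne G_inv[OF \<Gamma>_G[OF g]] by auto
    have "h = S g" if "h * g = 1" using \<Gamma>_cancel_right[OF g, of h "S g"] that G_inv(2)[OF \<Gamma>_G[OF g]] by simp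
    then show "h * g \<noteq> 1" using ne G_inv[OF \<Gamma>_G[OF g]] by auto
  qed
  moreover have "g * h \<noteq> g" "g * h \<noteq> h" "h * g \<noteq> g" "h * g \<noteq> h"
    using calculation by (simp_all add: \<Gamma>_cancel_one g h)
  ultimately have "card {1, g, h, g * h, h * g} = 5" using ne by auto
  moreover have "{1, g, h, g * h, h * g} \<subseteq> \<Gamma>" using g h by (auto simp: \<Gamma>_one \<Gamma>_mult)
  then have "card {1, g, h, g * h, h * g} \<le> card \<Gamma>" by (rule card_mono[OF finite_\<Gamma>])
  ultimately show False by (simp add: card_\<Gamma>)
qed

lemma \<Gamma>_four:
  assumes p: "p \<in> \<Gamma>" "p \<noteq> 1" "p * p = 1" and q: "q \<in> \<Gamma>" "q \<noteq> 1" "q \<noteq> p"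
  shows "p * q \<noteq> 1" "p * q \<noteq> p" "p * q \<noteq> q" "\<Gamma> = {1, p, q, p * q}"
proof -
  show d: "p * q \<noteq> 1" "p * q \<noteq> p" "p * q \<noteq> q"
    using p q \<Gamma>_cancel_left[OF p(1), of q p] by (auto simp: \<Gamma>_cancel_one)
  have "card {1, p, q, p * q} = 4" using p q d by auto
  then show "\<Gamma> = {1, p, q, p * q}"
    using card_subset_eq[OF finite_\<Gamma>, of "{1, p, q, p * q}"] p q by (auto simp: card_\<Gamma> \<Gamma>_one \<Gamma>_mult)
qed

lemma uL_one: "uL 1 1"
  by (auto simp: uL_def \<Gamma>_one sc_simps emb_simps intro!: exI[of _ 1])

lemma vR_one: "vR 1 1"
  by (auto simp: vR_def \<Gamma>_one sc_simps emb_simps intro!: exI[of _ 1])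

lemma uL_one_scalar: "uL 1 X \<Longrightarrow> \<exists>s. s \<noteq> 0 \<and> X = sc s"
  using uL_unique[OF uL_one, of X] uL_nonzero[of 1 X] by (auto simp: uL_def sc_simps)

lemma vR_one_scalar: "vR 1 X \<Longrightarrow> \<exists>s. s \<noteq> 0 \<and> X = sc s"
  using vR_unique[OF vR_one, of X] vR_nonzero[of 1 X] by (auto simp: vR_def sc_simps)

lemma scale_square:
  assumes "A * A = sc s" "s \<noteq> (0 :: 'k)"
  obtains r where "r \<noteq> 0" "sc r * A * (sc r * A) = (1 :: ('k, 4) sqmat)"
proof -
  obtain t where t: "t * t = s" using nth_root_exists[of 2 s] by (auto simp: power2_eq_square)
  then have t0: "t \<noteq> 0" using assms by auto
  have "sc (inverse t) * A * (sc (inverse t) * A) = sc (inverse t * inverse t * s)"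
    by (simp only: sc_mult_sc_mult assms(1)) (simp only: sc_simps)
  also have "inverse t * inverse t * s = 1" using t0 by (simp add: t[symmetric] field_simps)
  finally show thesis using that[of "inverse t"] t0 by (simp add: sc_simps)
qed

lemma sum_four:
  assumes "p \<noteq> 1" "q \<noteq> 1" "q \<noteq> p" "p * q \<noteq> 1" "p * q \<noteq> p" "p * q \<noteq> q"
  shows "(\<Sum>g\<in>{1, p, q, p * q}. F g) = F 1 + F p + F q + F (p * q :: 'h)"
  using assms by (simp add: add.assoc)

text \<open>The matrices whose conjugate by \<open>c\<close> has entries in the group algebra of
  \<Gamma>. The left intertwiners belong to it, since conjugation by \<open>c\<close> only
  multiplies them by a group-like.\<close>

definition \<Q> :: "('k, 4) sqmat set"
  where "\<Q> = {X. \<forall>i j. ent (c * emb X * d) i j \<in> span \<Gamma>}"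

lemma \<Q>_add: "X \<in> \<Q> \<Longrightarrow> Y \<in> \<Q> \<Longrightarrow> X + Y \<in> \<Q>"
  by (simp add: \<Q>_def emb_simps distrib_left distrib_right span_add)

lemma \<Q>_scale: "X \<in> \<Q> \<Longrightarrow> sc s * X \<in> \<Q>"
  by (simp add: \<Q>_def emb_simps emb_sc mult.assoc mult_sc_scal_one ent_sc_mult scal_one_mult span_scale)

lemma \<Q>_uL: "uL g P \<Longrightarrow> P \<in> \<Q>"
proof -
  assume P: "uL g P"
  then have g: "g \<in> \<Gamma>" and e: "sc g * c * emb P = emb P * c" by (simp_all add: uL_def)
  have "sc (S g) * (sc g * c * emb P) * d = sc (S g) * (emb P * c) * d" by (simp only: e)
  then have "c * emb P * d = sc (S g) * emb P"
    using G_inv(2)[OF \<Gamma>_G[OF g]] by (simp add: mult.assoc sc_inv(2) cd)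
  then show ?thesis
    by (simp add: \<Q>_def ent_sc_mult scal_one_mult span_scale span_base \<Gamma>_S g)
qed

text \<open>If the two matrices commuted, then 1, \<open>A\<close>, \<open>B\<close>,
  \<open>A * B\<close> would span their commutant. The inverses of the right intertwiners lie in
  that commutant, hence in \<open>\<Q>\<close>, so c x d has entries in k\<Gamma> for x in \<Gamma>,
  and k\<Gamma> would be a normal Hopf subalgebra. The alternatives for \<open>q * q\<close> cover
  both groups of order 4.\<close>

lemma u_noncommute:
  assumes p: "p \<in> \<Gamma>" "p \<noteq> 1" "p * p = 1" and q: "q \<in> \<Gamma>" "q \<noteq> 1" "q \<noteq> p" and qq: "q * q = 1 \<or> q * q = p"
    and A: "uL p A" and B: "uL q B"
  shows "A * B \<noteq> B * A"
proof
  assume AB: "A * B = B * A"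
  note four = \<Gamma>_four[OF p q]
  have "uL 1 (A * A)" using uL_mult[OF A A] p by simp
  then obtain s where s: "s \<noteq> 0" "A * A = sc s" using uL_one_scalar by blast
  obtain r where r: "r \<noteq> 0" "sc r * A * (sc r * A) = 1" by (rule scale_square[OF s(2,1)])
  define A' where "A' = sc r * A"
  have A': "uL p A'" unfolding A'_def by (rule uL_scale[OF A r(1)])
  have AA: "A' * A' = 1" using r by (simp add: A'_def)
  have AB': "A' * B = B * A'" unfolding A'_def by (simp only: mult_sc_mult[of B] mult.assoc AB)
  have "\<exists>\<sigma>. \<sigma> \<noteq> 0 \<and> (B * B = sc \<sigma> \<or> B * B = sc \<sigma> * A')"
    using qq
  proof
    assume "q * q = 1"
    then show ?thesis using uL_mult[OF B B] uL_one_scalar by auto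
  next
    assume "q * q = p"
    then have 1: "uL p (B * B)" using uL_mult[OF B B] by simp
    then obtain \<sigma> where \<sigma>: "B * B = sc \<sigma> * A'" using uL_unique[OF A'] by (auto simp: uL_def)
    moreover have "\<sigma> \<noteq> 0" using uL_nonzero[OF 1] \<sigma> by (auto simp: sc_simps)
    ultimately show ?thesis by blast
  qed
  then obtain \<sigma> where \<sigma>: "\<sigma> \<noteq> 0" "B * B = sc \<sigma> \<or> B * B = sc \<sigma> * A'" by blast
  have AB2: "uL (p * q) (A' * B)" using uL_mult[OF A' B] \<Gamma>_commute[OF p(1) q(1)] by simp
  have indep: "x = 0" if z: "sc x + sc y * A' + sc z * B + sc w * (A' * B) = 0" for x y z w
  proof -
    define U where "U g = (if g = 1 then 1 else if g = p then A' else if g = q then B else A' * B)" for g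
    define l where "l g = (if g = 1 then x else if g = p then y else if g = q then z else w)" for g
    have "(\<Sum>g\<in>{1, p, q, p * q}. sc (l g) * U g) = 0"
      unfolding sum_four[OF p(2) q(2,3) four(1-3)] using z p q four by (simp add: l_def U_def)
    moreover have "uL g (U g)" if "g \<in> {1, p, q, p * q}" for g
      using that uL_one A' B AB2 four p q by (auto simp: U_def)
    ultimately have "l 1 = 0"
      using uL_independent[of "{1, p, q, p * q}" U l 1] four(4) by auto
    then show ?thesis by (simp add: l_def)
  qed
  have "ent (c * sc x * d) i j \<in> span \<Gamma>" if x: "x \<in> \<Gamma>" for x i j
  proof -
    obtain R where R: "vR x R" using vR_exists[OF x] by blast
    then obtain R' where R': "R * R' = 1" "R' * R = 1" and e: "c * sc x * emb R = emb R * c"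
      unfolding vR_def by blast
    have inv: "R' * X = X * R'" if "R * X = X * R" for X
    proof -
      have "R' * (R * X) * R' = R' * (X * R) * R'" by (simp only: that)
      then show ?thesis using R' by (simp add: mult.assoc) (simp flip: mult.assoc add: R')
    qed
    have "R' * A' = A' * R'" "R' * B = B * R'"
      using inv uL_vR_commutes[OF A' R] uL_vR_commutes[OF B R] by blast+
    then have "\<exists>x y z w. R' = sc x + sc y * A' + sc z * B + sc w * (A' * B)"
      by (intro four_term_commutant[OF AA AB' \<sigma>(2,1)]) (rule indep, assumption+)
    then obtain x1 y1 z1 w1 where R'eq: "R' = sc x1 + sc y1 * A' + sc z1 * B + sc w1 * (A' * B)" by blast
    have "sc x1 * 1 + sc y1 * A' + sc z1 * B + sc w1 * (A' * B) \<in> \<Q>"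
      by (intro \<Q>_add \<Q>_scale) (auto intro: \<Q>_uL uL_one A' B AB2)
    then have RQ: "ent (c * emb R' * d) i j \<in> span \<Gamma>" for i j by (simp add: \<Q>_def R'eq)
    have "c * sc x * d = c * sc x * emb R * emb R' * d"
      by (simp add: mult.assoc emb_inv[OF R'(1)])
    also have "\<dots> = emb R * (c * emb R' * d)" by (simp only: e) (simp only: mult.assoc)
    finally show ?thesis
      by (simp only: ent_emb_mult(1)) (intro span_sum span_scale RQ)
  qed
  then have "p = 1"
    using simple_no_normal[OF simple, of \<Gamma> p] p \<Gamma>_G \<Gamma>_one \<Gamma>_mult \<Gamma>_S \<Gamma>_conj by auto
  then show False using p by simp
qed

text \<open>For q of order 4 the matrix \<open>B * B\<close> belongs to q^2 and commutes with
  \<open>B\<close>, which \<open>u_noncommute\<close> forbids.\<close>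

lemma \<Gamma>_square:
  assumes q: "q \<in> \<Gamma>"
  shows "q * q = 1"
proof (rule ccontr)
  assume qq: "q * q \<noteq> 1"
  obtain B where B: "uL q B" using uL_exists[OF q] by blast
  have "B * B * B \<noteq> B * (B * B)"
    by (rule u_noncommute[OF _ qq _ q _ _ _ uL_mult[OF B B] B])
      (use q qq \<Gamma>_pow4[OF q] \<Gamma>_cancel_one[OF q, of q] in \<open>auto simp: \<Gamma>_mult\<close>)
  then show False by (simp add: mult.assoc)
qed

text \<open>Moving \<open>A\<close> past the scalar matrix \<open>B * B\<close> in two steps gives
  t^2 = 1.\<close>

lemma commutator_sign:
  fixes A B :: "('k, 4) sqmat"
  assumes t: "A * B = sc t * (B * A)" and s: "B * B = sc s" "s \<noteq> 0" and A: "A \<noteq> 0" and ne: "A * B \<noteq> B * A"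
  shows "A * B = - (B * A)"
proof -
  have "A * (B * B) = A * B * B" by (simp only: mult.assoc)
  also have "\<dots> = sc t * (B * (A * B))" by (simp only: t mult.assoc)
  also have "\<dots> = sc t * (sc t * (B * B * A))" by (simp only: t mult_sc_mult[of B] mult.assoc)
  finally have e: "sc s * A = sc (t * t * s) * A"
    unfolding s(1) sc_commute[of s A, symmetric] by (simp only: sc_simps mult.assoc)
  obtain i j where "ent A i j \<noteq> 0" using A by (metis ent_zero sqmat_eqI)
  then have "s = t * t * s" using arg_cong[OF e, of "\<lambda>X. ent X i j"] unfolding ent_sc_mult by simp
  then have "(t - 1) * (t + 1) = 0" using s(2) by (simp add: algebra_simps)
  moreover have "t \<noteq> 1" using ne t by (auto simp: sc_simps)
  ultimately have "t = - 1" by (simp add: eq_neg_iff_add_eq_0)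
  then show ?thesis using t by (simp add: sc_simps)
qed

lemma u_anticommute:
  assumes p: "p \<in> \<Gamma>" "p \<noteq> 1" and q: "q \<in> \<Gamma>" "q \<noteq> 1" "q \<noteq> p" and A: "uL p A" and B: "uL q B"
  shows "A * B = - (B * A)"
proof -
  have "uL (q * p) (A * B)" "uL (q * p) (B * A)"
    using uL_mult[OF A B] uL_mult[OF B A] \<Gamma>_commute[OF p(1) q(1)] by simp_all
  then obtain t where t: "A * B = sc t * (B * A)" using uL_unique by (meson uL_def)
  have "uL 1 (B * B)" using uL_mult[OF B B] \<Gamma>_square[OF q(1)] by simp
  then obtain s where s: "s \<noteq> 0" "B * B = sc s" using uL_one_scalar by blast
  have "A * B \<noteq> B * A" using u_noncommute[OF p \<Gamma>_square[OF p(1)] q _ A B] \<Gamma>_square[OF q(1)] by simp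
  then show ?thesis by (rule commutator_sign[OF t s(2,1) uL_nonzero[OF A]])
qed

lemma exists_pq: "\<exists>p q. p \<in> \<Gamma> \<and> p \<noteq> 1 \<and> q \<in> \<Gamma> \<and> q \<noteq> 1 \<and> q \<noteq> p"
proof -
  have "\<not> \<Gamma> \<subseteq> {1}" using card_mono[of "{1}" \<Gamma>] card_\<Gamma> by auto
  then obtain p where p: "p \<in> \<Gamma>" "p \<noteq> 1" by blast
  have "\<not> \<Gamma> \<subseteq> {1, p}" using card_mono[of "{1, p}" \<Gamma>] card_\<Gamma> p by auto
  then show ?thesis using p by blast
qed

text \<open>Reduced to the left representation: commuting right matrices would span their commutant,
  which contains all left matrices, so the left matrices would commute with each other as
  well.\<close>

lemma v_noncommute:
  assumes p: "p \<in> \<Gamma>" "p \<noteq> 1" and q: "q \<in> \<Gamma>" "q \<noteq> 1" "q \<noteq> p" and A: "vR p A" and B: "vR q B"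
  shows "A * B \<noteq> B * A"
proof
  assume AB: "A * B = B * A"
  note pp = \<Gamma>_square[OF p(1)]
  note four = \<Gamma>_four[OF p pp q]
  have "vR 1 (A * A)" "vR 1 (B * B)" using vR_mult[OF A A] vR_mult[OF B B] \<Gamma>_square p q by simp_all
  then obtain s \<sigma> where s: "s \<noteq> 0" "A * A = sc s" and \<sigma>: "\<sigma> \<noteq> 0" "B * B = sc \<sigma>" using vR_one_scalar by (metis (lifting))
  obtain r where r: "r \<noteq> 0" "sc r * A * (sc r * A) = 1" by (rule scale_square[OF s(2,1)])
  define A' where "A' = sc r * A"
  have A': "vR p A'" unfolding A'_def by (rule vR_scale[OF A r(1)])
  have AA: "A' * A' = 1" using r by (simp add: A'_def)
  have AB': "A' * B = B * A'" unfolding A'_def by (simp only: mult_sc_mult[of B] mult.assoc AB)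
  have AB2: "vR (p * q) (A' * B)" using vR_mult[OF A' B] by simp
  have indep: "x = 0" if z: "sc x + sc y * A' + sc z * B + sc w * (A' * B) = 0" for x y z w
  proof -
    define U where "U g = (if g = 1 then 1 else if g = p then A' else if g = q then B else A' * B)" for g
    define l where "l g = (if g = 1 then x else if g = p then y else if g = q then z else w)" for g
    have "(\<Sum>g\<in>{1, p, q, p * q}. sc (l g) * U g) = 0"
      unfolding sum_four[OF p(2) q(2,3) four(1-3)] using z p q four by (simp add: l_def U_def)
    moreover have "vR g (U g)" if "g \<in> {1, p, q, p * q}" for g
      using that vR_one A' B AB2 four p q by (auto simp: U_def)
    ultimately have "l 1 = 0"
      using vR_independent[of "{1, p, q, p * q}" U l 1] four(4) by auto
    then show ?thesis by (simp add: l_def)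
  qed
  have span: "\<exists>x y z w. P = sc x + sc y * A' + sc z * B + sc w * (A' * B)" if "uL g P" for g P
    by (rule four_term_commutant[OF AA AB' _ \<sigma>(1) indep])
      (use \<sigma>(2) uL_vR_commutes[OF that A'] uL_vR_commutes[OF that B] in auto)
  obtain U1 U2 where U: "uL p U1" "uL q U2" using uL_exists p q by blast
  obtain x y z w where U1: "U1 = sc x + sc y * A' + sc z * B + sc w * (A' * B)" using span[OF U(1)] by blast
  have "U2 * A' = A' * U2" "U2 * B = B * U2" using uL_vR_commutes[OF U(2) A'] uL_vR_commutes[OF U(2) B] by simp_all
  then have com1: "A' * U2 = U2 * A'" "B * U2 = U2 * B" by simp_all
  have "A' * (B * U2) = A' * U2 * B" by (simp only: com1(2) mult.assoc)
  also have "\<dots> = U2 * (A' * B)" by (simp only: com1(1)) (simp only: mult.assoc)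
  finally have com: "sc x * U2 = U2 * sc x" "A' * U2 = U2 * A'" "B * U2 = U2 * B" "A' * B * U2 = U2 * (A' * B)"
    using com1 sc_commute[of x U2] by (simp_all add: mult.assoc)
  then have "U1 * U2 = U2 * U1"
    unfolding U1 distrib_left distrib_right mult_sc_mult[of U2] mult.assoc[of "sc _"]
    by (simp only: com)
  then show False using u_noncommute[OF p pp q _ U] \<Gamma>_square[OF q(1)] by simp
qed

lemma v_anticommute:
  assumes p: "p \<in> \<Gamma>" "p \<noteq> 1" and q: "q \<in> \<Gamma>" "q \<noteq> 1" "q \<noteq> p" and A: "vR p A" and B: "vR q B"
  shows "A * B = - (B * A)"
proof -
  have "vR (p * q) (A * B)" "vR (p * q) (B * A)"
    using vR_mult[OF A B] vR_mult[OF B A] \<Gamma>_commute[OF p(1) q(1)] by simp_all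
  then obtain t where t: "A * B = sc t * (B * A)" using vR_unique by (meson vR_def)
  have "vR 1 (B * B)" using vR_mult[OF B B] \<Gamma>_square[OF q(1)] by simp
  then obtain s where s: "s \<noteq> 0" "B * B = sc s" using vR_one_scalar by blast
  have "A * B \<noteq> B * A" using v_noncommute[OF p q A B] by simp
  then show ?thesis by (rule commutator_sign[OF t s(2,1) vR_nonzero[OF A]])
qed

section \<open>Elements of order three do not centralise the stabiliser\<close>

lemma G_decomp:
  assumes g: "g \<in> G"
  shows "\<exists>h\<in>\<Gamma>. \<exists>k<3. g = h * a ^ k"
proof -
  have da: "dg a = 1 \<or> dg a = 2" using dg_a dg[OF a_G] by linarith
  have dp: "dg (a ^ k) = k * dg a mod 3" for k
    by (induction k) (auto simp: dg_one dg_mult a_G a_pow_G mod_simps)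
  have "\<exists>k\<in>{..<3}. (dg g + dg (a ^ k)) mod 3 = 0"
  proof -
    have "dg g \<in> {0, 1, 2}" using dg[OF g] by auto
    then have "(dg g + dg (a ^ 0)) mod 3 = 0 \<or> (dg g + dg (a ^ 1)) mod 3 = 0 \<or> (dg g + dg (a ^ 2)) mod 3 = 0"
      unfolding dp using da by auto
    moreover have "{..<3} = {0, 1, 2 :: nat}" by auto
    ultimately show ?thesis by simp
  qed
  then obtain k where k: "k < 3" "(dg g + dg (a ^ k)) mod 3 = 0" by auto
  have "g * a ^ k \<in> \<Gamma>" using k by (simp add: \<Gamma>_def G_mult g a_pow_G dg_mult)
  moreover have "g = g * a ^ k * a ^ ((3 - k) mod 3)"
  proof -
    have "a ^ k * a ^ (3 - k) = 1" using k(1) a3 by (simp add: power3_eq_cube flip: power_add)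
    then show ?thesis by (metis a_pow_mod mult.assoc mult_1_right)
  qed
  ultimately show ?thesis by (metis mod_less_divisor zero_less_numeral)
qed

lemma emb_left_commute: "sc x * (emb A * Z) = emb A * (sc x * Z)"
  by (simp only: mult.assoc[symmetric] emb_commute)

text \<open>\<open>P\<close> relates left translation by \<open>a\<close> to right translation by
  \<open>b\<close>. When both centralise g, conjugation by \<open>P\<close> sends an intertwiner for
  g to another one for the same g, hence to a multiple of it.\<close>

lemma intertwiner_conj:
  assumes PQ: "P * Q = 1" "Q * P = 1" and e: "sc a * c * emb P = emb P * c * sc b"
    and g: "a * g = g * a" "b * g = g * b"
  shows "sc g * c * emb A = emb A * c \<Longrightarrow> sc g * c * emb (P * A * Q) = emb (P * A * Q) * c"
    and "c * sc g * emb A = emb A * c \<Longrightarrow> c * sc g * emb (P * A * Q) = emb (P * A * Q) * c"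
proof -
  have aS: "S a * a = 1" "a * S a = 1" using G_inv[OF a_G] by auto
  have gS: "g * S a = S a * g"
  proof -
    have "S a * (a * g) * S a = S a * (g * a) * S a" by (simp only: g)
    then show ?thesis using aS by (simp add: mult.assoc) (simp flip: mult.assoc)
  qed
  have e1: "c * emb P = sc (S a) * emb P * c * sc b"
  proof -
    have "sc (S a) * (sc a * c * emb P) = sc (S a) * (emb P * c * sc b)" by (simp only: e)
    then show ?thesis using aS by (simp add: mult.assoc sc_inv(2))
  qed
  have e2: "c * sc b = emb Q * (sc a * c * emb P)"
    by (simp only: e) (simp only: mult.assoc emb_inv(2)[OF PQ(2)])
  have com: "sc g * sc (S a) = sc (S a) * sc g" "sc b * sc g = sc g * sc b"
    using gS g by (simp_all flip: sc_simps(6))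
  have fin: "sc (S a) * emb P * emb A * (c * sc b) * emb Q = emb (P * A * Q) * c"
  proof -
    have "sc (S a) * emb P * emb A * (c * sc b) * emb Q = sc (S a) * emb (P * A * Q) * sc a * c * (emb P * emb Q)"
      unfolding e2 by (simp only: emb_simps mult.assoc)
    also have "\<dots> = sc (S a) * (sc a * emb (P * A * Q)) * c"
      unfolding emb_inv(1)[OF PQ(1)] by (simp only: mult.assoc emb_commute emb_left_commute mult_1_right)
    also have "\<dots> = (sc (S a) * sc a) * emb (P * A * Q) * c" by (simp only: mult.assoc)
    finally show ?thesis unfolding sc_inv(1)[OF aS(1)] by simp
  qed
  { assume A: "sc g * c * emb A = emb A * c"
    have "sc g * c * emb (P * A * Q) = sc g * (c * emb P) * emb A * emb Q" by (simp only: emb_simps mult.assoc)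
    also have "\<dots> = (sc g * sc (S a)) * emb P * c * sc b * emb A * emb Q" unfolding e1 by (simp only: mult.assoc)
    also have "\<dots> = sc (S a) * (sc g * emb P) * c * (sc b * emb A) * emb Q" unfolding com by (simp only: mult.assoc)
    also have "\<dots> = sc (S a) * emb P * (sc g * c * emb A) * sc b * emb Q"
      by (simp only: mult.assoc emb_commute emb_left_commute)
    also have "\<dots> = sc (S a) * emb P * emb A * (c * sc b) * emb Q" unfolding A by (simp only: mult.assoc)
    finally show "sc g * c * emb (P * A * Q) = emb (P * A * Q) * c" unfolding fin .
  }
  { assume A: "c * sc g * emb A = emb A * c"
    have "c * sc g * emb (P * A * Q) = c * (sc g * emb P) * emb A * emb Q" by (simp only: emb_simps mult.assoc)
    also have "\<dots> = (c * emb P) * sc g * emb A * emb Q" by (simp only: mult.assoc emb_commute emb_left_commute)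
    also have "\<dots> = sc (S a) * emb P * c * (sc b * sc g) * emb A * emb Q" unfolding e1 by (simp only: mult.assoc)
    also have "\<dots> = sc (S a) * emb P * c * sc g * (sc b * emb A) * emb Q" unfolding com by (simp only: mult.assoc)
    also have "\<dots> = sc (S a) * emb P * (c * sc g * emb A) * sc b * emb Q"
      by (simp only: mult.assoc emb_commute emb_left_commute)
    also have "\<dots> = sc (S a) * emb P * emb A * (c * sc b) * emb Q" unfolding A by (simp only: mult.assoc)
    finally show "c * sc g * emb (P * A * Q) = emb (P * A * Q) * c" unfolding fin .
  }
qed

lemma sc_eq_0: "sc x = (0 :: ('k, 4) sqmat) \<longleftrightarrow> x = 0"
proof
  assume "sc x = (0 :: ('k, 4) sqmat)"
  then have "ent (sc x :: ('k, 4) sqmat) 0 0 = 0" by simp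
  then show "x = 0" by (simp add: ent_sc)
qed (simp add: sc_simps)

text \<open>A scalar by which an element of order 3 rescales an involution is both a cube root and a square root of 1.\<close>

lemma order_two_three_commute:
  fixes P Q A :: "('k, 4) sqmat"
  assumes PQ: "P * Q = 1" "Q * P = 1" and P3: "P * P * P = sc r" and A2: "A * A = sc \<sigma>" "\<sigma> \<noteq> 0"
    and conj: "P * A * Q = sc s * A"
  shows "P * A = A * P"
proof -
  have A0: "A \<noteq> 0" using A2 by (auto simp: sc_eq_0)
  have r0: "r \<noteq> 0"
  proof
    assume "r = 0"
    then have "P * P * P * (Q * Q) = 0" using P3 by (simp add: sc_simps)
    moreover have "P * P * P * (Q * Q) = P * (P * (P * Q) * Q)" by (simp only: mult.assoc)
    ultimately have "P = 0" using PQ by simp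
    then show False using PQ by simp
  qed
  have eqA: "t = 1" if "sc t * A = A" for t
  proof -
    obtain i j where "ent A i j \<noteq> 0" using A0 by (metis ent_zero sqmat_eqI)
    then show ?thesis using arg_cong[OF that, of "\<lambda>X. ent X i j"] by (simp add: ent_sc_mult)
  qed
  have PA: "P * A = sc s * (A * P)"
  proof -
    have "P * A * Q * P = sc s * A * P" by (simp only: conj)
    moreover have "P * A * Q * P = P * A * (Q * P)" by (simp only: mult.assoc)
    ultimately show ?thesis using PQ by (simp add: mult.assoc)
  qed
  have "P * (A * A) = P * A * A" by (simp only: mult.assoc)
  also have "\<dots> = sc s * (A * (P * A))" by (subst PA) (simp only: mult.assoc)
  also have "\<dots> = sc s * (sc s * (A * A * P))" unfolding PA mult_sc_mult[of A] by (simp only: mult.assoc)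
  finally have "sc \<sigma> * P = sc \<sigma> * (sc (s * s) * P)"
    unfolding A2 sc_commute[of \<sigma>] by (simp only: sc_simps mult.assoc)
  then have "sc (inverse \<sigma>) * (sc \<sigma> * P) * Q = sc (inverse \<sigma>) * (sc \<sigma> * (sc (s * s) * P)) * Q" by (simp only:)
  then have "sc (s * s) = (1 :: ('k, 4) sqmat)"
    using PQ A2(2) by (simp add: mult.assoc) (simp flip: mult.assoc sc_simps(6) add: sc_simps(2))
  then have ss: "s * s = 1" using eqA[of "s * s"] by simp
  have "P * P * P * A = P * P * (P * A)" by (simp only: mult.assoc)
  also have "\<dots> = sc s * (P * (P * A) * P)" by (subst PA) (simp only: mult_sc_mult[of "P * P"] mult_sc_mult[of P] mult.assoc)
  also have "\<dots> = sc s * (sc s * (P * A * P * P))"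
      by (subst PA) (simp only: mult_sc_mult[of P] mult.assoc)
  also have "\<dots> = sc s * (sc s * (sc s * (A * (P * P * P))))" unfolding PA by (simp only: mult.assoc)
  finally have "sc r * A = sc r * (sc (s * s * s) * A)"
    unfolding P3 sc_commute[of r, symmetric] mult_sc_mult[of _ r] by (simp only: sc_simps mult.assoc)
  then have "sc (inverse r) * (sc r * A) = sc (inverse r) * (sc r * (sc (s * s * s) * A))" by (simp only:)
  then have "A = sc (s * s * s) * A"
    using r0 by (simp flip: mult.assoc sc_simps(6) add: sc_simps(2))
  then have "s * s * s = 1" by (intro eqA) simp
  then show ?thesis using ss PA by (simp add: sc_simps)
qed

lemma anticommuting_invertible_zero:
  fixes X B :: "('k, 4) sqmat"
  assumes "X * B = B * X" "X * B = - (B * X)" "B * B = sc \<sigma>" "\<sigma> \<noteq> 0"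
  shows "X = 0"
proof -
  have "B * X = - (B * X)" using assms(1,2) by simp
  then have "ent (B * X) i j = 0" for i j
  proof -
    have "ent (B * X) i j = - ent (B * X) i j"
      using arg_cong[OF \<open>B * X = - (B * X)\<close>, of "\<lambda>X. ent X i j"] by (simp only: ent_minus)
    then have "2 * ent (B * X) i j = 0" by (simp only: mult_2) (metis add.right_inverse)
    then show ?thesis by simp
  qed
  then have "B * X = 0" by (intro sqmat_eqI) simp
  then have "B * B * X = 0" by (simp add: mult.assoc)
  then have "sc \<sigma> * X = 0" by (simp only: assms(3))
  then have "\<sigma> * ent X i j = 0" for i j by (metis ent_sc_mult ent_zero)
  then show ?thesis using assms(4) by (intro sqmat_eqI) simp
qed

text \<open>Commutation with \<open>B\<close> removes the terms containing \<open>A\<close>, which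
  anticommute with it; then commutation with \<open>D\<close> removes the term in
  \<open>C\<close>.\<close>

lemma four_term_scalar:
  fixes A B C D :: "('k, 4) sqmat"
  assumes AB: "A * B = - (B * A)" and CD: "C * D = - (D * C)"
    and AD: "A * D = D * A" and CB: "C * B = B * C"
    and B: "B * B = sc \<sigma>" "\<sigma> \<noteq> 0" and D: "D * D = sc \<delta>" "\<delta> \<noteq> 0"
    and X: "X = sc x + sc y * A + sc z * C + sc w * (A * C)" and XB: "X * B = B * X" and XD: "X * D = D * X"
  shows "X = sc x"
proof -
  define Y where "Y = sc y * A + sc w * (A * C)"
  define Z where "Z = sc z * C"
  have XYZ: "X = sc x + Z + Y" by (simp add: X Y_def Z_def)
  have ZB: "Z * B = B * Z" by (simp add: Z_def mult_sc_mult[of B] mult.assoc CB)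
  have "A * C * B = A * B * C" by (simp only: CB mult.assoc)
  then have "Y * B = - (B * Y)"
    by (simp add: Y_def distrib_left distrib_right mult_sc_mult[of B] mult.assoc[of "sc _"] AB) (simp add: mult.assoc)
  moreover have "Y * B = B * Y"
    using XB ZB unfolding XYZ distrib_left distrib_right sc_commute[of x B] by simp
  ultimately have "Y = 0" using anticommuting_invertible_zero B by blast
  then have XZ: "X = sc x + Z" by (simp add: XYZ)
  have "Z * D = - (D * Z)" by (simp add: Z_def mult_sc_mult[of D] mult.assoc CD)
  moreover have "Z * D = D * Z"
    using XD unfolding XZ distrib_left distrib_right sc_commute[of x D] by simp
  ultimately have "Z = 0" using anticommuting_invertible_zero D by blast
  then show ?thesis by (simp add: XZ)
qed

text \<open>If \<open>a\<close> centralised \<Gamma>, its intertwiner \<open>P\<close> would commute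
  with all left and right matrices by \<open>order_two_three_commute\<close> and so be scalar. Then
  a c = c a^e, and the powers of \<open>a\<close> span a normal Hopf subalgebra.\<close>

lemma a_noncentral: "\<exists>g\<in>\<Gamma>. a * g \<noteq> g * a"
proof (rule ccontr)
  assume "\<not> ?thesis"
  then have com: "g \<in> \<Gamma> \<Longrightarrow> a * g = g * a" for g by blast
  have compow: "a ^ k * g = g * a ^ k" if "g \<in> \<Gamma>" for g k
    using com[OF that] by (metis power_commuting_commutes)
  define e where "e = dg a"
  have e: "e = 1 \<or> e = 2" using dg_a dg[OF a_G] unfolding e_def by linarith
  obtain P Q where PQ: "P * Q = 1" "Q * P = 1" and Pe: "sc a * c * emb P = emb P * c * sc (a ^ e)"
    using dg[OF a_G] unfolding rel_def e_def by blast
  \<comment> \<open>Three uses of the intertwining relation collect three factors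
    \<open>a * a\<close> on the left and three factors \<open>a^e\<close> on the right. Both
    products are 1, so the cube of \<open>P\<close> commutes with \<open>c\<close>.\<close>
  obtain r where r: "P * P * P = sc r"
  proof -
    have ex: "sc a * (X * sc y) = (sc a * X) * sc y" for X y by (simp only: mult.assoc)
    have 1: "c * emb P = sc (a * a) * emb P * c * sc (a ^ e)"
    proof -
      have "sc (a * a) * (sc a * c * emb P) = sc (a * a) * (emb P * c * sc (a ^ e))" by (simp only: Pe)
      moreover have "sc (a * a) * (sc a * c * emb P) = sc (a * a * a) * (c * emb P)"
        unfolding sc_simps(6) by (simp only: mult.assoc)
      ultimately show ?thesis unfolding a3 by (simp add: sc_simps(2) mult.assoc)
    qed
    have "c * emb (P * P * P) = c * emb P * emb P * emb P" by (simp add: emb_simps mult.assoc)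
    also have "\<dots> = sc (a * a) * emb P * c * (sc (a ^ e) * emb P) * emb P" unfolding 1 by (simp only: mult.assoc)
    also have "\<dots> = sc (a * a) * emb P * (c * emb P) * (sc (a ^ e) * emb P)" by (simp only: mult.assoc emb_commute emb_left_commute)
    also have "\<dots> = sc (a * a) * (emb P * sc (a * a)) * emb P * c * sc (a ^ e) * (sc (a ^ e) * emb P)" unfolding 1 by (simp only: mult.assoc)
    also have "\<dots> = sc (a * a) * sc (a * a) * emb P * emb P * c * sc (a ^ e) * (emb P * sc (a ^ e))"
      by (simp only: mult.assoc emb_commute emb_left_commute)
    also have "\<dots> = sc (a * a) * sc (a * a) * emb P * emb P * c * (sc (a ^ e) * emb P) * sc (a ^ e)"
      by (simp only: mult.assoc)
    also have "\<dots> = sc (a * a) * sc (a * a) * emb P * emb P * (c * emb P) * sc (a ^ e) * sc (a ^ e)"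
      by (simp only: mult.assoc emb_commute emb_left_commute)
    also have "\<dots> = sc (a * a) * sc (a * a) * emb P * (emb P * sc (a * a)) * emb P * c * sc (a ^ e) * sc (a ^ e) * sc (a ^ e)"
      unfolding 1 by (simp only: mult.assoc)
    also have "\<dots> = sc (a * a) * sc (a * a) * (emb P * sc (a * a)) * emb P * emb P * c * sc (a ^ e) * sc (a ^ e) * sc (a ^ e)"
      by (simp only: mult.assoc emb_commute emb_left_commute)
    also have "\<dots> = (sc (a * a) * sc (a * a) * sc (a * a)) * (emb P * emb P * emb P) * c * (sc (a ^ e) * sc (a ^ e) * sc (a ^ e))"
      by (simp only: mult.assoc emb_commute emb_left_commute)
    also have "sc (a * a) * sc (a * a) * sc (a * a) = 1"
    proof -
      have "a * a * (a * a) * (a * a) = (a * a * a) * (a * a * a)" by (simp only: mult.assoc)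
      then show ?thesis by (simp add: a3 sc_simps(2) flip: sc_simps(6))
    qed
    also have "sc (a ^ e) * sc (a ^ e) * sc (a ^ e) = 1"
    proof -
      have "e + e + e = 3 * e" by simp
      then have "a ^ e * a ^ e * a ^ e = (a ^ 3) ^ e" by (metis power_add power_mult)
      then have "a ^ e * a ^ e * a ^ e = 1" using a3 by (simp add: power3_eq_cube)
      then show ?thesis by (simp add: sc_simps(2) flip: sc_simps(6))
    qed
    finally have "c * emb (P * P * P) = emb (P * P * P) * c" by (simp add: emb_simps mult.assoc)
    then show thesis using schur_c that by blast
  qed
  have uP: "P * A = A * P" if A: "uL g A" for g A
  proof -
    have g: "g \<in> \<Gamma>" using A by (simp add: uL_def)
    have "sc g * c * emb (P * A * Q) = emb (P * A * Q) * c"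
      using A by (intro intertwiner_conj(1)[OF PQ Pe]) (simp_all add: com compow g uL_def)
    then obtain s where s: "P * A * Q = sc s * A" using uL_unique[OF A] by blast
    have "uL 1 (A * A)" using uL_mult[OF A A] \<Gamma>_square[OF g] by simp
    then obtain \<sigma> where "\<sigma> \<noteq> 0" "A * A = sc \<sigma>" using uL_one_scalar by blast
    then show ?thesis using order_two_three_commute[OF PQ r _ _ s] by blast
  qed
  have vP: "P * A = A * P" if A: "vR g A" for g A
  proof -
    have g: "g \<in> \<Gamma>" using A by (simp add: vR_def)
    have "c * sc g * emb (P * A * Q) = emb (P * A * Q) * c"
      using A by (intro intertwiner_conj(2)[OF PQ Pe]) (simp_all add: com compow g vR_def)
    then obtain s where s: "P * A * Q = sc s * A" using vR_unique[OF A] by blast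
    have "vR 1 (A * A)" using vR_mult[OF A A] \<Gamma>_square[OF g] by simp
    then obtain \<sigma> where "\<sigma> \<noteq> 0" "A * A = sc \<sigma>" using vR_one_scalar by blast
    then show ?thesis using order_two_three_commute[OF PQ r _ _ s] by blast
  qed
  obtain p q where p: "p \<in> \<Gamma>" "p \<noteq> 1" and q: "q \<in> \<Gamma>" "q \<noteq> 1" "q \<noteq> p" using exists_pq by blast
  obtain A0 B C D where A0: "uL p A0" and B: "uL q B" and C: "vR p C" and D: "vR q D"
    using uL_exists vR_exists p q by meson
  have "uL 1 (A0 * A0)" "uL 1 (B * B)" "vR 1 (C * C)" "vR 1 (D * D)"
    using uL_mult[OF A0 A0] uL_mult[OF B B] vR_mult[OF C C] vR_mult[OF D D] \<Gamma>_square p q by simp_all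
  then obtain s0 \<sigma> s1 \<delta> where sq: "A0 * A0 = sc s0" "s0 \<noteq> 0" "B * B = sc \<sigma>" "\<sigma> \<noteq> 0"
    "C * C = sc s1" "s1 \<noteq> 0" "D * D = sc \<delta>" "\<delta> \<noteq> 0"
    using uL_one_scalar vR_one_scalar by meson
  obtain t where t: "t \<noteq> 0" "sc t * A0 * (sc t * A0) = 1" by (rule scale_square[OF sq(1,2)])
  define A where "A = sc t * A0"
  have A: "uL p A" unfolding A_def by (rule uL_scale[OF A0 t(1)])
  have AA: "A * A = 1" using t by (simp add: A_def)
  note rels = u_anticommute[OF p q A B] v_anticommute[OF p q C D]
    uL_vR_commutes[OF A D, symmetric] uL_vR_commutes[OF B C] sq(3,4,7,8)
  have AC: "A * C = C * A" using uL_vR_commutes[OF A C] by simp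
  have indep: "x = 0" if "sc x + sc y * A + sc z * C + sc w * (A * C) = 0" for x y z w
  proof -
    have "0 = (sc x :: ('k, 4) sqmat)" by (rule four_term_scalar[OF rels that[symmetric]]) simp_all
    then show ?thesis by (metis sc_eq_0)
  qed
  have "\<exists>x y z w. P = sc x + sc y * A + sc z * C + sc w * (A * C)"
    using sq(5,6) uP[OF A] vP[OF C] by (intro four_term_commutant[OF AA AC]) (auto intro: indep)
  then obtain x y z w where "P = sc x + sc y * A + sc z * C + sc w * (A * C)" by blast
  then have Px: "P = sc x" by (rule four_term_scalar[OF rels _ uP[OF B] vP[OF D]])
  have ac: "sc a * c = c * sc (a ^ e)"
  proof -
    have "sc a * c * (emb P * emb Q) = emb P * c * sc (a ^ e) * emb Q"
      unfolding Pe[symmetric] by (simp only: mult.assoc)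
    also have "\<dots> = c * (emb P * (sc (a ^ e) * emb Q))"
      unfolding Px emb_sc by (simp only: mult_sc_scal_one[of c] mult.assoc)
    also have "\<dots> = c * sc (a ^ e) * (emb P * emb Q)"
      by (simp only: mult.assoc emb_commute emb_left_commute)
    finally show ?thesis using emb_inv(1)[OF PQ(1)] by simp
  qed
  define N where "N = {1, a, a * a}"
  have Npow: "N = range (\<lambda>k. a ^ k)"
  proof -
    have "a ^ k \<in> N" for k
    proof -
      have "k mod 3 \<in> {0, 1, 2}" by auto
      then show ?thesis unfolding N_def by (subst a_pow_mod) (auto simp: power2_eq_square)
    qed
    moreover have "1 \<in> range (\<lambda>k. a ^ k)" "a \<in> range (\<lambda>k. a ^ k)" "a * a \<in> range (\<lambda>k. a ^ k)"
      using rangeI[of "\<lambda>k. a ^ k" 0] rangeI[of "\<lambda>k. a ^ k" 1] rangeI[of "\<lambda>k. a ^ k" 2]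
      by (simp_all add: power2_eq_square)
    ultimately show ?thesis unfolding N_def by auto
  qed
  have caN: "c * sc (a ^ (e * k)) = sc (a ^ k) * c" for k
  proof (induction k)
    case 0
    then show ?case by (simp add: sc_simps)
  next
    case (Suc k)
    have "c * sc (a ^ (e * Suc k)) = c * sc (a ^ e) * sc (a ^ (e * k))"
      by (simp add: power_add sc_simps(6) mult.assoc)
    also have "\<dots> = sc a * (c * sc (a ^ (e * k)))" unfolding ac[symmetric] by (simp only: mult.assoc)
    finally show ?case unfolding Suc by (simp add: sc_simps(6) mult.assoc)
  qed
  have "a = 1"
  proof (rule simple_no_normal[OF simple, of N a])
    show "N \<subseteq> G" unfolding Npow using a_pow_G by auto
    show "1 \<in> N" "a \<in> N" by (auto simp: N_def)
    show "x * y \<in> N" if "x \<in> N" "y \<in> N" for x y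
      using that unfolding Npow by (auto simp flip: power_add)
    show SN: "S x \<in> N" if "x \<in> N" for x
    proof -
      obtain k where k: "x = a ^ k" using \<open>x \<in> N\<close> unfolding Npow by blast
      have "a ^ k * a ^ (2 * k) = (a ^ 3) ^ k" by (simp flip: power_add power_mult)
      then have "a ^ k * a ^ (2 * k) = 1" using a3 by (simp add: power3_eq_cube)
      then have "S x * (x * a ^ (2 * k)) = S x" by (simp add: k)
      then have "S x = a ^ (2 * k)" using G_inv(2)[OF a_pow_G, of k] by (simp add: k flip: mult.assoc)
      then show ?thesis by (simp add: Npow)
    qed
    show "g * x * S g \<in> N" if "g \<in> G" "x \<in> N" for g x
    proof -
      obtain k where k: "x = a ^ k" using \<open>x \<in> N\<close> unfolding Npow by blast
      obtain h j where h: "h \<in> \<Gamma>" "g = h * a ^ j" using G_decomp[OF \<open>g \<in> G\<close>] by blast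
      have "g * x = x * g"
        unfolding h k mult.assoc by (metis compow[OF h(1)] mult.assoc power_add add.commute)
      then have "g * x * S g = x" using G_inv(1)[OF \<open>g \<in> G\<close>] by (simp add: mult.assoc)
      then show ?thesis using that by simp
    qed
    show "ent (c * sc x * d) i j \<in> span N" if "x \<in> N" for x i j
    proof -
      obtain k where k: "x = a ^ k" using \<open>x \<in> N\<close> unfolding Npow by blast
      \<comment> \<open>As e is 1 or 2, its square is 1 modulo 3; so every power of \<open>a\<close>
        has an exponent divisible by e, as \<open>caN\<close> requires.\<close>
      have "e * (e * k) mod 3 = k mod 3" using e by (auto simp: mod_simps) presburger
      then have "x = a ^ (e * (e * k))" unfolding k using a_pow_mod by metis
      then have "c * sc x * d = sc (a ^ (e * k)) * (c * d)" using caN[of "e * k"] by (simp add: mult.assoc)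
      then have "ent (c * sc x * d) i j = (if i = j then a ^ (e * k) else 0)" by (simp add: cd ent_sc)
      then show ?thesis by (auto simp: Npow intro: span_base span_zero)
    qed
  qed
  then show False using a1 by simp
qed

section \<open>Cocycles on the Klein four-group\<close>

lemma \<Gamma>_cancel_square: "g \<in> \<Gamma> \<Longrightarrow> g * (g * x) = x"
  using \<Gamma>_square[of g] by (simp flip: mult.assoc)

lemma \<Gamma>_eq_one_iff: "g \<in> \<Gamma> \<Longrightarrow> g * x = 1 \<longleftrightarrow> x = g"
  using \<Gamma>_cancel_left[of g x g] \<Gamma>_square[of g] by simp

lemma \<Gamma>_four': "p \<in> \<Gamma> \<Longrightarrow> p \<noteq> 1 \<Longrightarrow> q \<in> \<Gamma> \<Longrightarrow> q \<noteq> 1 \<Longrightarrow> q \<noteq> p \<Longrightarrow> \<Gamma> = {1, p, q, p * q}"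
  using \<Gamma>_four(4) \<Gamma>_square by blast

lemma \<Gamma>_distinct:
  "p \<in> \<Gamma> \<Longrightarrow> p \<noteq> 1 \<Longrightarrow> q \<in> \<Gamma> \<Longrightarrow> q \<noteq> 1 \<Longrightarrow> q \<noteq> p \<Longrightarrow> p * q \<noteq> 1 \<and> p * q \<noteq> p \<and> p * q \<noteq> q"
  using \<Gamma>_four(1-3) \<Gamma>_square by blast

lemma sum_\<Gamma>_shift: "h \<in> \<Gamma> \<Longrightarrow> (\<Sum>g\<in>\<Gamma>. F (h * g)) = sum F \<Gamma>"
  by (rule sum.reindex_bij_witness[of _ "\<lambda>g. h * g" "\<lambda>g. h * g"]) (auto simp: \<Gamma>_mult \<Gamma>_cancel_square)

text \<open>The nondegenerate alternating bicharacter of the Klein four-group.\<close>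

definition \<beta> :: "'h \<Rightarrow> 'h \<Rightarrow> 'k"
  where "\<beta> v g = (if v = 1 \<or> g = 1 \<or> v = g then 1 else - 1)"

lemma \<beta>_sym: "\<beta> v g = \<beta> g v"
  by (auto simp: \<beta>_def)

lemma \<beta>_square [simp]: "\<beta> v g * \<beta> v g = 1"
  by (simp add: \<beta>_def)

lemma \<beta>_simps [simp]: "\<beta> v 1 = 1" "\<beta> 1 v = 1" "\<beta> v v = 1" "\<beta> v g \<noteq> 0"
  by (simp_all add: \<beta>_def)

lemma \<beta>_mult_right:
  assumes "v \<in> \<Gamma>" "g \<in> \<Gamma>" "h \<in> \<Gamma>"
  shows "\<beta> v (g * h) = \<beta> v g * \<beta> v h"
proof (cases "v = 1 \<or> g = 1 \<or> h = 1 \<or> h = g")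
  case True
  then show ?thesis using assms \<Gamma>_square by auto
next
  case False
  then have "v \<in> {g, h, g * h}" using \<Gamma>_four'[of g h] assms by auto
  then show ?thesis using False \<Gamma>_distinct[of g h] assms by (auto simp: \<beta>_def)
qed

lemma \<beta>_mult_left: "v \<in> \<Gamma> \<Longrightarrow> g \<in> \<Gamma> \<Longrightarrow> h \<in> \<Gamma> \<Longrightarrow> \<beta> (g * h) v = \<beta> g v * \<beta> h v"
  using \<beta>_mult_right by (simp add: \<beta>_sym[of _ v])

lemma \<beta>_nondegenerate: "v \<in> \<Gamma> \<Longrightarrow> v \<noteq> 1 \<Longrightarrow> \<exists>g\<in>\<Gamma>. \<beta> g v = - 1"
  using exists_pq by (metis \<beta>_def)

lemma \<beta>_sum:
  assumes "v \<in> \<Gamma>"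
  shows "(\<Sum>g\<in>\<Gamma>. \<beta> v g) = (if v = 1 then 4 else 0)"
proof (cases "v = 1")
  case True
  then show ?thesis by (simp add: card_\<Gamma>)
next
  case False
  obtain g where g: "g \<in> \<Gamma>" "\<beta> v g = - 1" using \<beta>_nondegenerate assms False by (metis \<beta>_sym)
  have "(\<Sum>h\<in>\<Gamma>. \<beta> v h) = (\<Sum>h\<in>\<Gamma>. \<beta> v (g * h))" using sum_\<Gamma>_shift[OF g(1), of "\<beta> v"] by simp
  also have "\<dots> = - (\<Sum>h\<in>\<Gamma>. \<beta> v h)" by (simp add: \<beta>_mult_right assms g sum_negf)
  finally have "2 * (\<Sum>h\<in>\<Gamma>. \<beta> v h) = 0" by (simp only: mult_2) (metis add.right_inverse)
  then show ?thesis using False by simp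
qed

lemma \<beta>_orthogonal:
  assumes "v \<in> \<Gamma>" "w \<in> \<Gamma>"
  shows "(\<Sum>g\<in>\<Gamma>. \<beta> v g * \<beta> w g) = (if v = w then 4 else 0)"
proof -
  have "(\<Sum>g\<in>\<Gamma>. \<beta> v g * \<beta> w g) = (\<Sum>g\<in>\<Gamma>. \<beta> (v * w) g)"
    by (rule sum.cong) (simp_all add: \<beta>_mult_left assms)
  also have "\<dots> = (if v = w then 4 else 0)" using \<beta>_sum[of "v * w"] assms by (auto simp: \<Gamma>_mult \<Gamma>_eq_one_iff)
  finally show ?thesis .
qed

text \<open>Normalised 2-cocycles with commutator \<beta>. Here \<Gamma> stands for its own
  character group, v corresponding to the character \<open>\<beta> v\<close>.\<close>

definition coc :: "('h \<Rightarrow> 'h \<Rightarrow> 'k) \<Rightarrow> bool"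
  where "coc l \<longleftrightarrow> (\<forall>g\<in>\<Gamma>. \<forall>h\<in>\<Gamma>. l g h \<noteq> 0) \<and>
    (\<forall>g\<in>\<Gamma>. \<forall>h\<in>\<Gamma>. \<forall>k\<in>\<Gamma>. l g h * l (g * h) k = l h k * l g (h * k)) \<and>
    (\<forall>g\<in>\<Gamma>. l g 1 = 1 \<and> l 1 g = 1) \<and> (\<forall>g\<in>\<Gamma>. \<forall>h\<in>\<Gamma>. l g h = \<beta> g h * l h g)"

lemma cocD:
  assumes "coc l"
  shows "g \<in> \<Gamma> \<Longrightarrow> h \<in> \<Gamma> \<Longrightarrow> l g h \<noteq> 0"
    "g \<in> \<Gamma> \<Longrightarrow> h \<in> \<Gamma> \<Longrightarrow> k \<in> \<Gamma> \<Longrightarrow> l g h * l (g * h) k = l h k * l g (h * k)"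
    "g \<in> \<Gamma> \<Longrightarrow> l g 1 = 1" "g \<in> \<Gamma> \<Longrightarrow> l 1 g = 1"
    "g \<in> \<Gamma> \<Longrightarrow> h \<in> \<Gamma> \<Longrightarrow> l g h = \<beta> g h * l h g"
  using assms unfolding coc_def by blast+

lemma coc_inverse:
  assumes l: "coc l"
  shows "coc (\<lambda>g h. inverse (l g h))"
  unfolding coc_def
proof (intro conjI ballI)
  fix g h assume \<Gamma>: "g \<in> \<Gamma>" "h \<in> \<Gamma>"
  show "inverse (l g h) = \<beta> g h * inverse (l h g)"
    unfolding cocD(5)[OF l \<Gamma>] by (simp add: \<beta>_def)
  fix k assume "k \<in> \<Gamma>"
  then show "inverse (l g h) * inverse (l (g * h) k) = inverse (l h k) * inverse (l g (h * k))"
    by (simp only: inverse_mult_distrib[symmetric] cocD(2)[OF l \<Gamma>])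
qed (simp_all add: cocD(1,3,4)[OF l])

text \<open>Symmetric cocycles are coboundaries because the units of \<open>k\<close> are divisible;
  for the Klein four-group, square roots of the values at (p, p) and (q, q) suffice.\<close>

lemma symmetric_cocycle_trivial:
  assumes nz: "\<And>g h. g \<in> \<Gamma> \<Longrightarrow> h \<in> \<Gamma> \<Longrightarrow> r g h \<noteq> (0 :: 'k)"
    and cocycle: "\<And>g h k. g \<in> \<Gamma> \<Longrightarrow> h \<in> \<Gamma> \<Longrightarrow> k \<in> \<Gamma> \<Longrightarrow> r g h * r (g * h) k = r h k * r g (h * k)"
    and one: "\<And>g. g \<in> \<Gamma> \<Longrightarrow> r g 1 = 1" "\<And>g. g \<in> \<Gamma> \<Longrightarrow> r 1 g = 1"
    and sym: "\<And>g h. g \<in> \<Gamma> \<Longrightarrow> h \<in> \<Gamma> \<Longrightarrow> r g h = r h g"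
  shows "\<exists>z. z 1 = 1 \<and> (\<forall>g\<in>\<Gamma>. z g \<noteq> 0) \<and> (\<forall>g\<in>\<Gamma>. \<forall>h\<in>\<Gamma>. z g * z h = r g h * z (g * h))"
proof -
  obtain p q where p: "p \<in> \<Gamma>" "p \<noteq> 1" and q: "q \<in> \<Gamma>" "q \<noteq> 1" "q \<noteq> p" using exists_pq by blast
  have four: "\<Gamma> = {1, p, q, p * q}" by (rule \<Gamma>_four'[OF p q])
  have dist: "p * q \<noteq> 1" "p * q \<noteq> p" "p * q \<noteq> q" using \<Gamma>_distinct[OF p q] by auto
  have pq: "p * q \<in> \<Gamma>" by (rule \<Gamma>_mult[OF p(1) q(1)])
  have mult: "p * p = 1" "q * q = 1" "q * p = p * q" "p * (p * q) = q" "q * (p * q) = p" "p * q * p = q"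
    "p * q * q = p" "p * q * (p * q) = 1"
  proof -
    show 1: "p * p = 1" "q * q = 1" "q * p = p * q" "p * (p * q) = q" "p * q * q = p" "p * q * (p * q) = 1"
      using \<Gamma>_square[OF p(1)] \<Gamma>_square[OF q(1)] \<Gamma>_square[OF pq] \<Gamma>_commute[OF q(1) p(1)]
        \<Gamma>_cancel_square[OF p(1)] by (simp_all add: mult.assoc)
    show "p * q * p = q" using 1(3,4) by (simp add: mult.assoc)
    show "q * (p * q) = p" using 1(3,5) by (simp flip: mult.assoc)
  qed
  obtain s t where s: "s * s = r p p" and t: "t * t = r q q"
    using nth_root_exists[of 2 "r p p"] nth_root_exists[of 2 "r q q"] by (auto simp: power2_eq_square)
  have st0: "s \<noteq> 0" "t \<noteq> 0" using s t nz p q by force+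
  \<comment> \<open>The value at p * q is forced by the coboundary equation for the pair (p,
    q).\<close>
  define z where "z g = (if g = 1 then 1 else if g = p then s else if g = q then t else s * t / r p q)" for g
  have z: "z 1 = 1" "z p = s" "z q = t" "z (p * q) = s * t / r p q"
    using p q dist by (auto simp: z_def)
  have r: "r p (p * q) = r p p / r p q" "r q (p * q) = r q q / r p q" "r (p * q) (p * q) = r p p * r q q / (r p q * r p q)"
    "r q p = r p q" "r (p * q) p = r p p / r p q" "r (p * q) q = r q q / r p q"
  proof -
    note nzs = nz[OF p(1) q(1)] nz[OF p(1) p(1)] nz[OF q(1) q(1)]
    show 1: "r p (p * q) = r p p / r p q"
      using cocycle[OF p(1) p(1) q(1)] one(2)[OF q(1)] nzs by (simp add: mult field_simps)
    show 2: "r q p = r p q" by (rule sym[OF q(1) p(1)])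
    show 3: "r q (p * q) = r q q / r p q"
      using cocycle[OF q(1) q(1) p(1)] one(2)[OF p(1)] nzs by (simp add: mult 2 field_simps)
    show "r (p * q) (p * q) = r p p * r q q / (r p q * r p q)"
      using cocycle[OF p(1) q(1) pq] nzs by (simp add: mult 3 field_simps)
    show "r (p * q) p = r p p / r p q" "r (p * q) q = r q q / r p q"
      using sym[OF pq p(1)] sym[OF pq q(1)] 1 3 by simp_all
  qed
  have "z g * z h = r g h * z (g * h)" if "g \<in> \<Gamma>" "h \<in> \<Gamma>" for g h
  proof -
    have "g \<in> {1, p, q, p * q}" "h \<in> {1, p, q, p * q}" using that four by auto
    then show ?thesis
      using one[OF p(1)] one[OF q(1)] one[OF pq] one[OF \<Gamma>_one] nz[OF p(1) q(1)]
      by (elim insertE emptyE; simp add: z mult r s[symmetric] t[symmetric] field_simps)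
  qed
  moreover have "z g \<noteq> 0" for g using st0 nz[OF p(1) q(1)] by (simp add: z_def)
  ultimately show ?thesis using z by blast
qed

text \<open>Equal commutators make the quotient of the two cocycles symmetric.\<close>

lemma cocycles_cohomologous:
  assumes l: "coc l" and m: "coc m"
  shows "\<exists>z. z 1 = 1 \<and> (\<forall>g\<in>\<Gamma>. z g \<noteq> 0) \<and> (\<forall>g\<in>\<Gamma>. \<forall>h\<in>\<Gamma>. z g * z h * l g h = m g h * z (g * h))"
proof -
  have "\<exists>z. z 1 = 1 \<and> (\<forall>g\<in>\<Gamma>. z g \<noteq> 0) \<and> (\<forall>g\<in>\<Gamma>. \<forall>h\<in>\<Gamma>. z g * z h = m g h / l g h * z (g * h))"
  proof (rule symmetric_cocycle_trivial)
    fix g h k assume \<Gamma>: "g \<in> \<Gamma>" "h \<in> \<Gamma>" "k \<in> \<Gamma>"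
    show "m g h / l g h * (m (g * h) k / l (g * h) k) = m h k / l h k * (m g (h * k) / l g (h * k))"
      using cocD(2)[OF l \<Gamma>] cocD(2)[OF m \<Gamma>] by (simp add: times_divide_times_eq)
  next
    fix g h assume \<Gamma>: "g \<in> \<Gamma>" "h \<in> \<Gamma>"
    show "m g h / l g h = m h g / l h g"
      using cocD(5)[OF l \<Gamma>] cocD(5)[OF m \<Gamma>] by (simp add: \<beta>_def split: if_splits)
  qed (simp_all add: cocD(1,3,4)[OF l] cocD(1,3,4)[OF m])
  then obtain z where z: "z 1 = 1" "\<And>g. g \<in> \<Gamma> \<Longrightarrow> z g \<noteq> 0"
    and zz: "\<And>g h. g \<in> \<Gamma> \<Longrightarrow> h \<in> \<Gamma> \<Longrightarrow> z g * z h = m g h / l g h * z (g * h)" by blast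
  have "z g * z h * l g h = m g h * z (g * h)" if "g \<in> \<Gamma>" "h \<in> \<Gamma>" for g h
    using zz[OF that] cocD(1)[OF l that] by simp
  then show ?thesis using z by blast
qed

text \<open>A projective representation of \<Gamma> with multiplier \<open>m\<close>, normalised at
  1.\<close>

definition psys :: "('h \<Rightarrow> 'h \<Rightarrow> 'k) \<Rightarrow> ('h \<Rightarrow> ('k, 4) sqmat) \<Rightarrow> bool"
  where "psys m U \<longleftrightarrow> U 1 = 1 \<and> (\<forall>g\<in>\<Gamma>. \<forall>h\<in>\<Gamma>. U g * U h = sc (m g h) * U (g * h))"

lemma psysD:
  assumes "psys m U"
  shows "U 1 = 1" "g \<in> \<Gamma> \<Longrightarrow> h \<in> \<Gamma> \<Longrightarrow> U g * U h = sc (m g h) * U (g * h)"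
  using assms by (simp_all add: psys_def)

lemma sc_cancel: "sc x * A = sc y * A \<Longrightarrow> A \<noteq> 0 \<Longrightarrow> x = y" for A :: "('k, 4) sqmat"
proof -
  assume e: "sc x * A = sc y * A" and "A \<noteq> 0"
  then obtain i j where "ent A i j \<noteq> 0" by (metis ent_zero sqmat_eqI)
  then show "x = y" using arg_cong[OF e, of "\<lambda>X. ent X i j"] by (simp add: ent_sc_mult)
qed

text \<open>Anticommutation says that the multiplier of \<open>U\<close> has commutator \<beta>. It
  is therefore cohomologous to the prescribed \<open>m\<close>, and the cochain between them
  provides the scalars.\<close>

lemma psys_rescale:
  assumes U1: "U 1 = 1" and U0: "\<And>g. g \<in> \<Gamma> \<Longrightarrow> U g \<noteq> 0" and UU0: "\<And>g h. g \<in> \<Gamma> \<Longrightarrow> h \<in> \<Gamma> \<Longrightarrow> U g * U h \<noteq> 0"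
    and mult: "\<And>g h. g \<in> \<Gamma> \<Longrightarrow> h \<in> \<Gamma> \<Longrightarrow> \<exists>s. U g * U h = sc s * U (g * h)"
    and anti: "\<And>g h. g \<in> \<Gamma> \<Longrightarrow> h \<in> \<Gamma> \<Longrightarrow> g \<noteq> 1 \<Longrightarrow> h \<noteq> 1 \<Longrightarrow> h \<noteq> g \<Longrightarrow> U g * U h = - (U h * U g)"
    and m: "coc m"
  shows "\<exists>z. z 1 = 1 \<and> (\<forall>g\<in>\<Gamma>. z g \<noteq> 0) \<and> psys m (\<lambda>g. sc (z g) * U g)"
proof -
  obtain l where l: "\<And>g h. g \<in> \<Gamma> \<Longrightarrow> h \<in> \<Gamma> \<Longrightarrow> U g * U h = sc (l g h) * U (g * h)"
    using mult by metis
  have \<beta>: "U g * U h = sc (\<beta> g h) * (U h * U g)" if "g \<in> \<Gamma>" "h \<in> \<Gamma>" for g h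
    using anti[OF that] by (auto simp: \<beta>_def sc_simps U1)
  have "coc l"
    unfolding coc_def
  proof (intro conjI ballI)
    fix g h k assume \<Gamma>: "g \<in> \<Gamma>" "h \<in> \<Gamma>" "k \<in> \<Gamma>"
    show "l g h \<noteq> 0" using l[OF \<Gamma>(1,2)] UU0[OF \<Gamma>(1,2)] by (auto simp: sc_simps)
    have "sc (l g h * l (g * h) k) * U (g * h * k) = sc (l g h) * (U (g * h) * U k)"
      unfolding l[OF \<Gamma>_mult[OF \<Gamma>(1,2)] \<Gamma>(3)] sc_simps by (simp only: mult.assoc)
    also have "\<dots> = U g * (U h * U k)"
      unfolding mult.assoc[symmetric] l[OF \<Gamma>(1,2)] ..
    also have "\<dots> = sc (l h k) * (U g * U (h * k))" unfolding l[OF \<Gamma>(2,3)] by (rule mult_sc_mult)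
    also have "\<dots> = sc (l h k * l g (h * k)) * U (g * h * k)"
      unfolding l[OF \<Gamma>(1) \<Gamma>_mult[OF \<Gamma>(2,3)]] sc_simps by (simp only: mult.assoc)
    finally show "l g h * l (g * h) k = l h k * l g (h * k)"
      by (rule sc_cancel) (intro U0 \<Gamma>_mult \<Gamma>)
  next
    fix g h assume \<Gamma>: "g \<in> \<Gamma>" "h \<in> \<Gamma>"
    show "l g 1 = 1" "l 1 g = 1"
      using l[OF \<Gamma>(1) \<Gamma>_one] l[OF \<Gamma>_one \<Gamma>(1)] U0[OF \<Gamma>(1)] sc_cancel[of 1 "U g"] U1 by (auto simp: sc_simps)
    have "sc (l g h) * U (g * h) = sc (\<beta> g h * l h g) * U (g * h)"
      using \<beta>[OF \<Gamma>] l[OF \<Gamma>] l[OF \<Gamma>(2,1)] \<Gamma>_commute[OF \<Gamma>] by (simp add: sc_simps mult.assoc)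
    then show "l g h = \<beta> g h * l h g" by (rule sc_cancel) (intro U0 \<Gamma>_mult \<Gamma>)
  qed
  then obtain z where z: "z 1 = 1" "\<forall>g\<in>\<Gamma>. z g \<noteq> 0" "\<forall>g\<in>\<Gamma>. \<forall>h\<in>\<Gamma>. z g * z h * l g h = m g h * z (g * h)"
    using cocycles_cohomologous[OF _ m] by blast
  have "sc (z g) * U g * (sc (z h) * U h) = sc (m g h) * (sc (z (g * h)) * U (g * h))" if \<Gamma>: "g \<in> \<Gamma>" "h \<in> \<Gamma>" for g h
  proof -
    have "sc (z g) * U g * (sc (z h) * U h) = sc (z g * z h * l g h) * U (g * h)"
      by (simp only: sc_mult_sc_mult l[OF \<Gamma>]) (simp only: sc_simps mult.assoc)
    also have "\<dots> = sc (m g h) * (sc (z (g * h)) * U (g * h))"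
      unfolding z(3)[rule_format, OF \<Gamma>] by (simp only: sc_simps mult.assoc)
    finally show ?thesis .
  qed
  then have "psys m (\<lambda>g. sc (z g) * U g)" by (simp add: psys_def U1 z(1) sc_simps)
  then show ?thesis using z(1,2) by blast
qed

section \<open>Generators of matrix coalgebras\<close>

lemma psys_commutator:
  assumes m: "coc m" and U: "psys m U" and \<Gamma>: "g \<in> \<Gamma>" "h \<in> \<Gamma>"
  shows "U g * U h = sc (\<beta> g h) * (U h * U g)"
  unfolding psysD(2)[OF U \<Gamma>] psysD(2)[OF U \<Gamma>(2,1)] \<Gamma>_commute[OF \<Gamma>(2,1)]
  by (subst cocD(5)[OF m \<Gamma>]) (simp only: sc_simps mult.assoc)

lemma psys_square:
  assumes U: "psys m U" and \<Gamma>: "g \<in> \<Gamma>"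
  shows "U g * U g = sc (m g g)"
  using psysD(2)[OF U \<Gamma> \<Gamma>] by (simp add: \<Gamma>_square[OF \<Gamma>] psysD(1)[OF U])

text \<open>Two commuting Pauli-type systems act irreducibly on dimension 4: commuting with
  \<open>u p\<close> and \<open>v p\<close> confines \<open>X\<close> to four terms, and commuting
  with \<open>u q\<close> and \<open>v q\<close> leaves only the constant one.\<close>

lemma psys_pair_schur:
  assumes m: "coc m" "coc m'" and u: "psys m u" and v: "psys m' v"
    and uv: "\<And>g h. g \<in> \<Gamma> \<Longrightarrow> h \<in> \<Gamma> \<Longrightarrow> u g * v h = v h * u g"
    and X: "\<And>g. g \<in> \<Gamma> \<Longrightarrow> X * u g = u g * X" "\<And>g. g \<in> \<Gamma> \<Longrightarrow> X * v g = v g * X"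
  shows "\<exists>s. X = sc s"
proof -
  obtain p q where p: "p \<in> \<Gamma>" "p \<noteq> 1" and q: "q \<in> \<Gamma>" "q \<noteq> 1" "q \<noteq> p" using exists_pq by blast
  obtain t where t: "t \<noteq> 0" "sc t * u p * (sc t * u p) = 1"
    by (rule scale_square[OF psys_square[OF u p(1)] cocD(1)[OF m(1) p(1) p(1)]])
  define A where "A = sc t * u p"
  have AA: "A * A = 1" using t by (simp add: A_def)
  have b: "\<beta> p q = - 1" using p q by (simp add: \<beta>_def)
  have com: "A * Z = Z * A" if "u p * Z = Z * u p" for Z
    by (simp only: A_def mult.assoc mult_sc_mult[of Z] that)
  have "A * u q = - (u q * A)"
    using psys_commutator[OF m(1) u p(1) q(1)]
    by (simp add: A_def b mult_sc_mult[of "u q"] mult.assoc sc_simps)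
  moreover have "v p * v q = - (v q * v p)"
    using psys_commutator[OF m(2) v p(1) q(1)] by (simp add: b sc_simps)
  ultimately have rels: "A * u q = - (u q * A)" "v p * v q = - (v q * v p)" "A * v q = v q * A" "v p * u q = u q * v p"
    "u q * u q = sc (m q q)" "m q q \<noteq> 0" "v q * v q = sc (m' q q)" "m' q q \<noteq> 0"
    using com[OF uv[OF p(1) q(1)]] uv[OF q(1) p(1)] psys_square[OF u q(1)] psys_square[OF v q(1)]
      cocD(1)[OF m(1) q(1) q(1)] cocD(1)[OF m(2) q(1) q(1)] by simp_all
  have AC: "A * v p = v p * A" by (rule com[OF uv[OF p(1) p(1)]])
  have indep: "x = 0" if "sc x + sc y * A + sc z * v p + sc w * (A * v p) = 0" for x y z w
  proof -
    have "0 = (sc x :: ('k, 4) sqmat)" by (rule four_term_scalar[OF rels that[symmetric]]) simp_all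
    then show ?thesis by (metis sc_eq_0)
  qed
  have "\<exists>x y z w. X = sc x + sc y * A + sc z * v p + sc w * (A * v p)"
    using psys_square[OF v p(1)] cocD(1)[OF m(2) p(1) p(1)] X(2)[OF p(1)] com[OF X(1)[OF p(1), symmetric]]
    by (intro four_term_commutant[OF AA AC]) (auto intro: indep)
  then obtain x y z w where "X = sc x + sc y * A + sc z * v p + sc w * (A * v p)" by blast
  then have "X = sc x" by (rule four_term_scalar[OF rels _ X(1)[OF q(1)] X(2)[OF q(1)]])
  then show ?thesis by blast
qed

definition K :: "('h \<times> 'h) set" where "K = \<Gamma> \<times> \<Gamma>"

lemma K_iff: "s \<in> K \<longleftrightarrow> fst s \<in> \<Gamma> \<and> snd s \<in> \<Gamma>"
  by (cases s) (simp add: K_def)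

lemma finite_K [simp]: "finite K"
  by (simp add: K_def finite_\<Gamma>)

lemma card_K: "card K = 16"
  by (simp add: K_def card_cartesian_product card_\<Gamma>)

definition kmul :: "'h \<times> 'h \<Rightarrow> 'h \<times> 'h \<Rightarrow> 'h \<times> 'h"
  where "kmul s t = (fst s * fst t, snd s * snd t)"

lemma kmul_simps [simp]: "fst (kmul s t) = fst s * fst t" "snd (kmul s t) = snd s * snd t"
  by (simp_all add: kmul_def)

lemma kmul_K: "s \<in> K \<Longrightarrow> t \<in> K \<Longrightarrow> kmul s t \<in> K"
  by (simp add: K_iff \<Gamma>_mult)

lemma kmul_cancel: "s \<in> K \<Longrightarrow> kmul s (kmul s t) = t"
  by (simp add: K_iff kmul_def \<Gamma>_cancel_square)

lemma sum_K_shift: "s \<in> K \<Longrightarrow> (\<Sum>t\<in>K. F (kmul s t)) = sum F K"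
  by (rule sum.reindex_bij_witness[of _ "kmul s" "kmul s"]) (auto simp: kmul_K kmul_cancel)

end

section \<open>Orthogonality relations for a commuting pair of Pauli-type systems\<close>

locale psys_pair = simple_based H S G cc \<gamma> \<kappa> a c
  for H :: "('k::{alg_closed_field, field_char_0}, 'h::ring_1) coalg" and S G cc \<gamma> \<kappa> a c +
  fixes m m' :: "'h \<Rightarrow> 'h \<Rightarrow> 'k" and u v :: "'h \<Rightarrow> ('k, 4) sqmat"
  assumes m: "coc m" and m': "coc m'" and u: "psys m u" and v: "psys m' v"
    and uv: "\<And>g h. g \<in> \<Gamma> \<Longrightarrow> h \<in> \<Gamma> \<Longrightarrow> u g * v h = v h * u g"
begin

definition ui :: "'h \<Rightarrow> ('k, 4) sqmat" where "ui g = sc (inverse (m g g)) * u g"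
definition vi :: "'h \<Rightarrow> ('k, 4) sqmat" where "vi g = sc (inverse (m' g g)) * v g"
definition w :: "'h \<times> 'h \<Rightarrow> ('k, 4) sqmat" where "w s = u (fst s) * v (snd s)"
definition wi :: "'h \<times> 'h \<Rightarrow> ('k, 4) sqmat" where "wi s = vi (snd s) * ui (fst s)"

lemma ui: "g \<in> \<Gamma> \<Longrightarrow> u g * ui g = 1" "g \<in> \<Gamma> \<Longrightarrow> ui g * u g = 1"
  unfolding ui_def mult_sc_mult[of "u g"] mult.assoc psys_square[OF u]
  by (simp_all only: sc_simps(6)[symmetric]) (simp_all add: cocD(1)[OF m] sc_simps)

lemma vi: "g \<in> \<Gamma> \<Longrightarrow> v g * vi g = 1" "g \<in> \<Gamma> \<Longrightarrow> vi g * v g = 1"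
  unfolding vi_def mult_sc_mult[of "v g"] mult.assoc psys_square[OF v]
  by (simp_all only: sc_simps(6)[symmetric]) (simp_all add: cocD(1)[OF m'] sc_simps)

lemma wi: assumes "s \<in> K" shows "w s * wi s = 1" "wi s * w s = 1"
proof -
  have \<Gamma>: "fst s \<in> \<Gamma>" "snd s \<in> \<Gamma>" using assms by (simp_all add: K_iff)
  have "w s * wi s = u (fst s) * (v (snd s) * vi (snd s)) * ui (fst s)" by (simp only: w_def wi_def mult.assoc)
  then show "w s * wi s = 1" using \<Gamma> by (simp add: ui vi)
  have "wi s * w s = vi (snd s) * (ui (fst s) * u (fst s)) * v (snd s)" by (simp only: w_def wi_def mult.assoc)
  then show "wi s * w s = 1" using \<Gamma> by (simp add: ui vi)
qed

definition \<mu> :: "'h \<times> 'h \<Rightarrow> 'h \<times> 'h \<Rightarrow> 'k"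
  where "\<mu> s t = m (fst s) (fst t) * m' (snd s) (snd t)"

lemma w_mult:
  assumes "s \<in> K" "t \<in> K"
  shows "w s * w t = sc (\<mu> s t) * w (kmul s t)"
proof -
  have \<Gamma>: "fst s \<in> \<Gamma>" "snd s \<in> \<Gamma>" "fst t \<in> \<Gamma>" "snd t \<in> \<Gamma>" using assms by (simp_all add: K_iff)
  have "w s * w t = u (fst s) * (v (snd s) * u (fst t)) * v (snd t)" by (simp only: w_def mult.assoc)
  also have "\<dots> = (u (fst s) * u (fst t)) * (v (snd s) * v (snd t))"
    unfolding uv[OF \<Gamma>(3,2), symmetric] by (simp only: mult.assoc)
  also have "\<dots> = sc (\<mu> s t) * w (kmul s t)"
    unfolding psysD(2)[OF u \<Gamma>(1,3)] psysD(2)[OF v \<Gamma>(2,4)] sc_mult_sc_mult by (simp add: \<mu>_def w_def)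
  finally show ?thesis .
qed

lemma \<mu>_nz: "s \<in> K \<Longrightarrow> t \<in> K \<Longrightarrow> \<mu> s t \<noteq> 0"
  by (simp add: \<mu>_def K_iff cocD(1)[OF m] cocD(1)[OF m'])

lemma inverse_unique: "A * B = 1 \<Longrightarrow> C * A = 1 \<Longrightarrow> B = (C :: ('k, 4) sqmat)"
  using mult.assoc[of C A B] by simp

lemma wi_mult:
  assumes "s \<in> K" "t \<in> K"
  shows "sc (\<mu> s t) * (wi t * wi s) = wi (kmul s t)"
proof (rule inverse_unique[of "w (kmul s t)", symmetric])
  show "w (kmul s t) * wi (kmul s t) = 1" by (rule wi(1)[OF kmul_K[OF assms]])
  have "sc (\<mu> s t) * (wi t * wi s) * w (kmul s t) = wi t * wi s * (sc (\<mu> s t) * w (kmul s t))"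
    by (simp only: mult_sc_mult[of "wi t * wi s"]) (simp only: mult.assoc)
  also have "\<dots> = wi t * (wi s * w s) * w t" unfolding w_mult[OF assms, symmetric] by (simp only: mult.assoc)
  finally show "sc (\<mu> s t) * (wi t * wi s) * w (kmul s t) = 1" by (simp add: wi assms)
qed

text \<open>Conjugation by \<open>w t\<close> permutes the summands, the multipliers cancelling
  between \<open>w\<close> and \<open>wi\<close>; so the sum commutes with both systems.\<close>

lemma average_scalar: "\<exists>x. (\<Sum>s\<in>K. w s * M * wi s) = sc x"
proof -
  define X where "X = (\<Sum>s\<in>K. w s * M * wi s)"
  have com: "X * w t = w t * X" if t: "t \<in> K" for t
  proof -
    have sh: "w t * (w s * M * wi s) * wi t = w (kmul t s) * M * wi (kmul t s)" if s: "s \<in> K" for s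
    proof -
      have "w t * (w s * M * wi s) * wi t = (w t * w s) * M * (wi s * wi t)" by (simp only: mult.assoc)
      also have "\<dots> = w (kmul t s) * M * (sc (\<mu> t s) * (wi s * wi t))"
        unfolding w_mult[OF t s] mult_sc_mult[of "w (kmul t s) * M"] by (simp only: mult.assoc)
      finally show ?thesis unfolding wi_mult[OF t s] .
    qed
    have "w t * X * wi t = (\<Sum>s\<in>K. w t * (w s * M * wi s) * wi t)"
      by (simp only: X_def sum_distrib_left sum_distrib_right)
    also have "\<dots> = (\<Sum>s\<in>K. w (kmul t s) * M * wi (kmul t s))" by (rule sum.cong[OF refl sh])
    also have "\<dots> = X" unfolding X_def by (rule sum_K_shift[OF t])
    finally have "w t * X * wi t * w t = X * w t" by simp
    moreover have "w t * X * wi t * w t = w t * X * (wi t * w t)" by (simp only: mult.assoc)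
    ultimately show ?thesis by (simp add: wi t)
  qed
  have "\<exists>x. X = sc x"
  proof (rule psys_pair_schur[OF m m' u v uv])
    show "X * u g = u g * X" if "g \<in> \<Gamma>" for g
      using com[of "(g, 1)"] that by (simp add: K_iff \<Gamma>_one w_def psysD(1)[OF v])
    show "X * v g = v g * X" if "g \<in> \<Gamma>" for g
      using com[of "(1, g)"] that by (simp add: K_iff \<Gamma>_one w_def psysD(1)[OF u])
  qed
  then show ?thesis by (simp add: X_def)
qed

text \<open>The scalar follows from comparing traces: sixteen summands of trace \<open>tr M\<close>
  against 4 times the scalar.\<close>

lemma average: "(\<Sum>s\<in>K. w s * M * wi s) = sc (4 * tr M)"
proof -
  obtain x where x: "(\<Sum>s\<in>K. w s * M * wi s) = sc x" using average_scalar by blast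
  have "tr (w s * M * wi s) = tr M" if "s \<in> K" for s
  proof -
    have "tr (w s * M * wi s) = tr (wi s * w s * M)"
      by (subst tr_mult_commute) (simp only: mult.assoc)
    then show ?thesis by (simp add: wi that)
  qed
  then have "tr (sc x :: ('k, 4) sqmat) = 16 * tr M"
    unfolding x[symmetric] tr_sum by (simp add: card_K)
  moreover have "tr (sc x :: ('k, 4) sqmat) = 4 * x"
    using tr_sc_mult[of x "1 :: ('k, 4) sqmat"] by (simp add: tr_one)
  ultimately have "x = 4 * tr M" by simp
  then show ?thesis using x by simp
qed

text \<open>The averaging formula at a matrix unit. It says that the sixteen matrices
  \<open>w s\<close> span \<open>M_4\<close>, with coefficients given by a quarter of the trace
  against \<open>wi s\<close>.\<close>

lemma completeness: "(\<Sum>s\<in>K. ent (w s) i j * ent (wi s) k l) = (if i = l \<and> j = k then 4 else 0)"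
proof -
  have "ent (w s * munit j k * wi s) i l = ent (w s) i j * ent (wi s) k l" for s
    unfolding mult.assoc ent_mult[of "w s"] ent_munit_mult by (simp add: if_distrib[of "\<lambda>x. _ * x"] cong: if_cong)
  then have "(\<Sum>s\<in>K. ent (w s) i j * ent (wi s) k l) = ent (\<Sum>s\<in>K. w s * munit j k * wi s) i l"
    by (simp add: ent_sum)
  then show ?thesis unfolding average by (simp add: ent_sc tr_munit)
qed

text \<open>By nondegeneracy of \<beta> a nontrivial \<open>w r\<close> is, up to a scalar, a
  product of two anticommuting matrices \<open>w g\<close> and \<open>w t\<close>, and such a
  product has trace 0.\<close>

lemma tr_w:
  assumes r: "r \<in> K" and r1: "r \<noteq> (1, 1)"
  shows "tr (w r) = 0"
proof -
  have \<Gamma>: "fst r \<in> \<Gamma>" "snd r \<in> \<Gamma>" using r by (simp_all add: K_iff)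
  have "fst r \<noteq> 1 \<or> snd r \<noteq> 1" using r1 by (auto simp: prod_eq_iff)
  then obtain g where g: "g \<in> K" and b: "\<beta> (fst g) (fst r) * \<beta> (snd g) (snd r) = - 1"
  proof
    assume "fst r \<noteq> 1"
    then obtain h where "h \<in> \<Gamma>" "\<beta> h (fst r) = - 1" using \<beta>_nondegenerate \<Gamma> by blast
    then show thesis using that[of "(h, 1)"] by (simp add: K_iff \<Gamma>_one)
  next
    assume "snd r \<noteq> 1"
    then obtain h where "h \<in> \<Gamma>" "\<beta> h (snd r) = - 1" using \<beta>_nondegenerate \<Gamma> by blast
    then show thesis using that[of "(1, h)"] by (simp add: K_iff \<Gamma>_one)
  qed
  define t where "t = kmul g r"
  have t: "t \<in> K" "kmul g t = r" unfolding t_def using kmul_K[OF g r] kmul_cancel[OF g] by auto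
  have gt: "kmul t g = kmul g t"
    using g t by (simp add: kmul_def K_iff \<Gamma>_commute)
  have \<Gamma>': "fst g \<in> \<Gamma>" "snd g \<in> \<Gamma>" "fst t \<in> \<Gamma>" "snd t \<in> \<Gamma>" using g t by (simp_all add: K_iff)
  have "\<mu> g t = \<beta> (fst g) (fst t) * \<beta> (snd g) (snd t) * \<mu> t g"
    unfolding \<mu>_def by (subst cocD(5)[OF m \<Gamma>'(1,3)], subst cocD(5)[OF m' \<Gamma>'(2,4)]) (simp only: mult_ac)
  moreover have "\<beta> (fst g) (fst t) * \<beta> (snd g) (snd t) = - 1"
    unfolding t_def using b by (simp add: \<beta>_mult_right \<Gamma> \<Gamma>')
  ultimately have "\<mu> g t = - \<mu> t g" by simp
  moreover have "\<mu> g t * tr (w r) = \<mu> t g * tr (w r)"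
    using tr_mult_commute[of "w g" "w t"] unfolding w_mult[OF g t(1)] w_mult[OF t(1) g] gt t(2) tr_sc_mult .
  ultimately have "2 * (\<mu> t g * tr (w r)) = 0" by (simp only: mult_2 mult_minus_left) (metis add.right_inverse)
  then show ?thesis using \<mu>_nz[OF t(1) g] by simp
qed

lemma w_one: "w (1, 1) = 1"
  by (simp add: w_def psysD(1)[OF u] psysD(1)[OF v])

lemma tr_wi_w:
  assumes s: "s \<in> K" and t: "t \<in> K"
  shows "tr (wi s * w t) = (if s = t then 4 else 0)"
proof (cases "s = t")
  case True
  then show ?thesis by (simp add: wi t tr_one)
next
  case False
  have "w s * w s = sc (\<mu> s s)"
    using w_mult[OF s s] s by (simp add: kmul_def K_iff \<Gamma>_square w_one)
  then have "sc (inverse (\<mu> s s)) * (wi s * (w s * w s)) = sc (inverse (\<mu> s s)) * (wi s * sc (\<mu> s s))" by simp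
  then have "wi s = sc (inverse (\<mu> s s)) * (wi s * w s * w s)"
    unfolding sc_commute[of "\<mu> s s", symmetric] using \<mu>_nz[OF s s]
    by (simp add: mult.assoc sc_simps(2) flip: mult.assoc[of "sc _" "sc _"] sc_simps(6))
  then have "wi s * w t = sc (inverse (\<mu> s s) * \<mu> s t) * w (kmul s t)"
    unfolding wi(2)[OF s] sc_simps(6) by (simp add: mult.assoc w_mult[OF s t])
  moreover have "kmul s t \<noteq> (1, 1)"
    using False s t by (auto simp: kmul_def K_iff \<Gamma>_eq_one_iff prod_eq_iff)
  ultimately show ?thesis using tr_w[OF kmul_K[OF s t]] False by (simp add: tr_sc_mult)
qed

end

lemma tr_mult_sc: "tr (A * sc x) = tr A * x"
  by (simp add: tr_def ent_mult_sc sum_distrib_right)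

section \<open>Primitive idempotents of the group algebra of the stabiliser\<close>

context simple_based
begin

text \<open>The primitive idempotent of the character \<open>\<beta> v\<close>; it corresponds to
  \<open>char_idem\<close> once \<Gamma> is identified with \<open>V\<close>.\<close>

definition \<epsilon> :: "'h \<Rightarrow> 'h"
  where "\<epsilon> v = (\<Sum>g\<in>\<Gamma>. hscal (\<beta> v g / 4) g)"

lemma \<epsilon>_left:
  assumes g: "g \<in> \<Gamma>" and v: "v \<in> \<Gamma>"
  shows "g * \<epsilon> v = hscal (\<beta> v g) (\<epsilon> v)"
proof -
  have "g * \<epsilon> v = (\<Sum>h\<in>\<Gamma>. hscal (\<beta> v (g * (g * h)) / 4) (g * h))"
    by (simp add: \<epsilon>_def sum_distrib_left scal_mult_right \<Gamma>_cancel_square g)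
  also have "\<dots> = (\<Sum>h\<in>\<Gamma>. hscal (\<beta> v (g * h) / 4) h)"
    by (rule sum_\<Gamma>_shift[OF g, of "\<lambda>h. hscal (\<beta> v (g * h) / 4) h"])
  also have "\<dots> = hscal (\<beta> v g) (\<epsilon> v)"
    by (simp add: \<epsilon>_def scale_sum_right \<beta>_mult_right g v)
  finally show ?thesis .
qed

lemma \<epsilon>_eigen_left:
  assumes y: "\<And>g. g \<in> \<Gamma> \<Longrightarrow> g * y = hscal (\<beta> s g) y" and v: "v \<in> \<Gamma>" "s \<in> \<Gamma>"
  shows "\<epsilon> v * y = (if v = s then y else 0)"
proof -
  have "\<epsilon> v * y = (\<Sum>g\<in>\<Gamma>. hscal (\<beta> v g * \<beta> s g / 4) y)"
    by (simp add: \<epsilon>_def sum_distrib_right scal_mult_left y)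
  also have "\<dots> = hscal ((\<Sum>g\<in>\<Gamma>. \<beta> v g * \<beta> s g) / 4) y"
    by (simp add: scale_sum_left sum_divide_distrib)
  finally show ?thesis by (simp add: \<beta>_orthogonal v)
qed

lemma \<epsilon>_eigen_right:
  assumes y: "\<And>g. g \<in> \<Gamma> \<Longrightarrow> y * g = hscal (\<beta> s g) y" and v: "v \<in> \<Gamma>" "s \<in> \<Gamma>"
  shows "y * \<epsilon> v = (if v = s then y else 0)"
proof -
  have "y * \<epsilon> v = (\<Sum>g\<in>\<Gamma>. hscal (\<beta> v g * \<beta> s g / 4) y)"
    by (simp add: \<epsilon>_def sum_distrib_left scal_mult_right y)
  also have "\<dots> = hscal ((\<Sum>g\<in>\<Gamma>. \<beta> v g * \<beta> s g) / 4) y"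
    by (simp add: scale_sum_left sum_divide_distrib)
  finally show ?thesis by (simp add: \<beta>_orthogonal v)
qed

lemma \<epsilon>_orthogonal: "v \<in> \<Gamma> \<Longrightarrow> w \<in> \<Gamma> \<Longrightarrow> \<epsilon> v * \<epsilon> w = (if v = w then \<epsilon> v else 0)"
  using \<epsilon>_eigen_left[OF \<epsilon>_left, of w v] by auto

lemma \<Gamma>_expand:
  assumes h: "h \<in> \<Gamma>"
  shows "h = (\<Sum>v\<in>\<Gamma>. hscal (\<beta> v h) (\<epsilon> v))"
proof -
  have "(\<Sum>v\<in>\<Gamma>. hscal (\<beta> v h) (\<epsilon> v)) = (\<Sum>v\<in>\<Gamma>. \<Sum>g\<in>\<Gamma>. hscal (\<beta> h v * \<beta> g v / 4) g)"
    by (simp add: \<epsilon>_def scale_sum_right \<beta>_sym)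
  also have "\<dots> = (\<Sum>g\<in>\<Gamma>. hscal ((\<Sum>v\<in>\<Gamma>. \<beta> h v * \<beta> g v) / 4) g)"
    by (subst sum.swap) (simp add: scale_sum_left sum_divide_distrib)
  also have "\<dots> = (\<Sum>g\<in>\<Gamma>. if g = h then h else 0)"
    by (rule sum.cong) (auto simp: \<beta>_orthogonal h)
  finally show ?thesis using h finite_\<Gamma> by simp
qed

lemma \<epsilon>_sum: "(\<Sum>v\<in>\<Gamma>. \<epsilon> v) = 1"
  using \<Gamma>_expand[OF \<Gamma>_one] by simp

lemma counit_\<Gamma>: "g \<in> \<Gamma> \<Longrightarrow> counit H g = 1" and comult_\<Gamma>: "g \<in> \<Gamma> \<Longrightarrow> comult H g = g \<boxtimes> g"
  using glike_G[OF \<Gamma>_G] by (simp_all add: glike_def)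

text \<open>The sum runs over the pairs of characters with product v; the partner of w is w * v
  because w is its own inverse.\<close>

lemma comult_\<epsilon>:
  assumes v: "v \<in> \<Gamma>"
  shows "comult H (\<epsilon> v) = (\<Sum>w\<in>\<Gamma>. \<epsilon> w \<boxtimes> \<epsilon> (w * v))"
proof -
  have "(\<Sum>w\<in>\<Gamma>. \<epsilon> w \<boxtimes> \<epsilon> (w * v))
      = (\<Sum>w\<in>\<Gamma>. \<Sum>g\<in>\<Gamma>. \<Sum>h\<in>\<Gamma>. tens_scale (\<beta> v h / 16 * (\<beta> w g * \<beta> w h)) (g \<boxtimes> h))"
    by (rule sum.cong[OF refl], subst sum.swap)
      (simp add: \<epsilon>_def ten_sum ten_simps tens_scale_simps tens_scale_sum \<beta>_mult_left v mult_ac)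
  also have "\<dots> = (\<Sum>g\<in>\<Gamma>. \<Sum>h\<in>\<Gamma>. tens_scale (\<beta> v h / 16 * (\<Sum>w\<in>\<Gamma>. \<beta> g w * \<beta> h w)) (g \<boxtimes> h))"
    by (subst sum.swap, rule sum.cong[OF refl], subst sum.swap)
      (simp add: sum_distrib_left tens_scale_sum \<beta>_sym)
  also have "\<dots> = (\<Sum>g\<in>\<Gamma>. \<Sum>h\<in>\<Gamma>. if h = g then tens_scale (\<beta> v g / 4) (g \<boxtimes> g) else 0)"
    by (intro sum.cong refl) (auto simp: \<beta>_orthogonal tens_scale_simps)
  also have "\<dots> = comult H (\<epsilon> v)"
    by (simp add: \<epsilon>_def comult_sum comult_simps comult_\<Gamma> finite_\<Gamma>)
  finally show ?thesis ..
qed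

lemma counit_\<epsilon>: "v \<in> \<Gamma> \<Longrightarrow> counit H (\<epsilon> v) = (if v = 1 then 1 else 0)"
  using \<beta>_sum[of v] by (simp add: \<epsilon>_def counit_simps counit_\<Gamma> flip: sum_divide_distrib)

definition comp :: "'h \<Rightarrow> 'h \<times> 'h \<Rightarrow> 'h"
  where "comp x s = \<epsilon> (fst s) * x * \<epsilon> (snd s)"

end

context psys_pair
begin

lemma w_commutator:
  assumes s: "s \<in> K" and t: "t \<in> K"
  shows "w s * w t = sc (\<beta> (fst s) (fst t) * \<beta> (snd s) (snd t)) * (w t * w s)"
proof -
  have \<Gamma>: "fst s \<in> \<Gamma>" "snd s \<in> \<Gamma>" "fst t \<in> \<Gamma>" "snd t \<in> \<Gamma>" using s t by (simp_all add: K_iff)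
  have st: "kmul t s = kmul s t" using \<Gamma> by (simp add: kmul_def \<Gamma>_commute)
  have "\<mu> s t = \<beta> (fst s) (fst t) * \<beta> (snd s) (snd t) * \<mu> t s"
    unfolding \<mu>_def by (subst cocD(5)[OF m \<Gamma>(1,3)], subst cocD(5)[OF m' \<Gamma>(2,4)]) (simp only: mult_ac)
  then show ?thesis
    unfolding w_mult[OF s t] w_mult[OF t s] st by (simp add: sc_simps mult.assoc)
qed

lemma wi_conj:
  assumes t: "t \<in> K" and s: "s \<in> K"
  shows "wi t * wi s * w t = sc (\<beta> (fst s) (fst t) * \<beta> (snd s) (snd t)) * wi s"
proof -
  let ?b = "\<beta> (fst s) (fst t) * \<beta> (snd s) (snd t)"
  have "wi s * (w s * w t) * wi s = wi s * (sc ?b * (w t * w s)) * wi s"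
    by (simp only: w_commutator[OF s t])
  moreover have "wi s * (w s * w t) * wi s = (wi s * w s) * w t * wi s" by (simp only: mult.assoc)
  moreover have "wi s * (sc ?b * (w t * w s)) * wi s = sc ?b * (wi s * w t * (w s * wi s))"
    by (simp only: mult_sc_mult[of "wi s"]) (simp only: mult.assoc)
  ultimately have 1: "w t * wi s = sc ?b * (wi s * w t)" by (simp add: wi s)
  have "sc ?b * (w t * wi s) = sc (?b * ?b) * (wi s * w t)"
    unfolding 1 sc_simps(6)[of ?b ?b] by (simp only: mult.assoc)
  moreover have "?b * ?b = 1" by (simp add: mult.assoc[symmetric] \<beta>_def)
  ultimately have "wi s * w t = sc ?b * (w t * wi s)" by (simp only: sc_simps(2) mult_1_left)
  then have "wi t * (wi s * w t) = sc ?b * (wi t * w t * wi s)"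
    by (simp only: mult_sc_mult[of "wi t"] mult.assoc)
  then show ?thesis by (simp add: wi t mult.assoc)
qed

text \<open>A matrix coalgebra on which \<open>\<Gamma>\<close> acts through two Pauli-type systems is generated, as a
  \<open>k\<Gamma>\<close>-bimodule, by a single element; that element is group-like up to the twist.\<close>

lemma comatrix_generator:
  assumes b: "comat b"
    and ub: "\<And>g. g \<in> \<Gamma> \<Longrightarrow> sc g * b * emb (u g) = emb (u g) * b"
    and vb: "\<And>g. g \<in> \<Gamma> \<Longrightarrow> b * sc g * emb (v g) = emb (v g) * b"
  shows "\<exists>x. counit H x = 1 \<and>
    comult H x = (\<Sum>s\<in>K. \<Sum>t\<in>K. tens_scale (\<mu> s t) (comp x s \<boxtimes> comp x t)) \<and>
    b = (\<Sum>s\<in>K. sc (comp x s) * emb (w s))"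
proof -
  \<comment> \<open>The coefficient of \<open>b\<close> along \<open>w s\<close> according to
    \<open>completeness\<close>. It is an eigenvector for both translations by \<Gamma>, with
    characters \<open>fst s\<close> and \<open>snd s\<close>, because conjugation by
    \<open>w t\<close> multiplies \<open>wi s\<close> by a sign.\<close>
  define q where "q s = hscal (1 / 4) (tr (emb (wi s) * b))" for s
  have u1: "w (g, 1) = u g" and v1: "w (1, g) = v g" for g
    by (simp_all add: w_def psysD(1)[OF u] psysD(1)[OF v])
  have gK: "(g, 1) \<in> K" "(1, g) \<in> K" if "g \<in> \<Gamma>" for g using that by (simp_all add: K_iff \<Gamma>_one)
  have conj_tr: "tr (emb (wi s) * (emb (w t) * b * emb (wi t))) = hscal (\<beta> (fst s) (fst t) * \<beta> (snd s) (snd t)) (tr (emb (wi s) * b))"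
    if "s \<in> K" "t \<in> K" for s t
  proof -
    have "tr (emb (wi s) * (emb (w t) * b * emb (wi t))) = tr (emb (wi t) * (emb (wi s) * emb (w t) * b))"
      by (subst tr_emb_commute) (simp only: mult.assoc)
    also have "\<dots> = tr (emb (wi t * wi s * w t) * b)" by (simp only: emb_simps mult.assoc)
    also have "\<dots> = hscal (\<beta> (fst s) (fst t) * \<beta> (snd s) (snd t)) (tr (emb (wi s) * b))"
      unfolding wi_conj[OF that(2,1)] by (simp only: emb_simps(1) emb_sc mult.assoc tr_sc_mult scal_one_mult(1))
    finally show ?thesis .
  qed
  have ub': "sc g * b = emb (w (g, 1)) * b * emb (wi (g, 1))" if "g \<in> \<Gamma>" for g
  proof -
    have "emb (w (g, 1)) * b * emb (wi (g, 1)) = sc g * b * (emb (u g) * emb (wi (g, 1)))"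
      unfolding u1 ub[OF that, symmetric] by (simp only: mult.assoc)
    also have "emb (u g) * emb (wi (g, 1)) = 1"
      using emb_inv(1)[OF wi(1)[OF gK(1)[OF that]]] by (simp only: u1)
    finally show ?thesis by simp
  qed
  have vb': "b * sc g = emb (w (1, g)) * b * emb (wi (1, g))" if "g \<in> \<Gamma>" for g
  proof -
    have "emb (w (1, g)) * b * emb (wi (1, g)) = b * sc g * (emb (v g) * emb (wi (1, g)))"
      unfolding v1 vb[OF that, symmetric] by (simp only: mult.assoc)
    also have "emb (v g) * emb (wi (1, g)) = 1"
      using emb_inv(1)[OF wi(1)[OF gK(2)[OF that]]] by (simp only: v1)
    finally show ?thesis by simp
  qed
  have ql: "g * q s = hscal (\<beta> (fst s) g) (q s)" if g: "g \<in> \<Gamma>" and s: "s \<in> K" for g s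
  proof -
    have "g * tr (emb (wi s) * b) = tr (emb (wi s) * (sc g * b))"
      unfolding tr_sc_mult[symmetric] by (simp only: emb_left_commute)
    then show ?thesis
      unfolding ub'[OF g] conj_tr[OF s gK(1)[OF g]] by (simp add: q_def scal_mult_right)
  qed
  have qr: "q s * g = hscal (\<beta> (snd s) g) (q s)" if g: "g \<in> \<Gamma>" and s: "s \<in> K" for g s
  proof -
    have "tr (emb (wi s) * b) * g = tr (emb (wi s) * (b * sc g))"
      unfolding tr_mult_sc[symmetric] by (simp only: mult.assoc)
    then show ?thesis
      unfolding vb'[OF g] conj_tr[OF s gK(2)[OF g]] by (simp add: q_def scal_mult_left)
  qed
  \<comment> \<open>The coefficients have distinct pairs of characters, so nothing is lost in their
    sum: \<open>comp x s\<close> recovers \<open>q s\<close>.\<close>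
  define x where "x = (\<Sum>s\<in>K. q s)"
  have comp: "comp x t = q t" if t: "t \<in> K" for t
  proof -
    have "comp x t = (\<Sum>s\<in>K. \<epsilon> (fst t) * q s * \<epsilon> (snd t))"
      by (simp add: comp_def x_def sum_distrib_left sum_distrib_right)
    also have "\<dots> = (\<Sum>s\<in>K. if s = t then q t else 0)"
      by (rule sum.cong[OF refl])
        (use t in \<open>auto simp: \<epsilon>_eigen_left[OF ql] \<epsilon>_eigen_right[OF qr] K_iff prod_eq_iff\<close>)
    finally show ?thesis using t by simp
  qed
  have tr_exp: "tr (emb M * b) = (\<Sum>i\<in>UNIV. \<Sum>j\<in>UNIV. hscal (ent M i j) (ent b j i))" for M
    by (simp add: tr_def ent_emb_mult)
  have b_ent: "ent b i j = (\<Sum>s\<in>K. hscal (ent (w s) i j) (q s))" for i j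
  proof -
    have "(\<Sum>s\<in>K. hscal (ent (w s) i j) (q s))
        = (\<Sum>s\<in>K. \<Sum>k\<in>UNIV. \<Sum>l\<in>UNIV. hscal (ent (w s) i j * ent (wi s) k l / 4) (ent b l k))"
      by (simp add: q_def tr_exp scale_sum_right)
    also have "\<dots> = (\<Sum>k\<in>UNIV. \<Sum>l\<in>UNIV. hscal ((\<Sum>s\<in>K. ent (w s) i j * ent (wi s) k l) / 4) (ent b l k))"
      by (subst sum.swap, rule sum.cong[OF refl], subst sum.swap) (simp add: scale_sum_left sum_divide_distrib)
    also have "\<dots> = (\<Sum>k\<in>UNIV. \<Sum>l\<in>UNIV. if k = j then if l = i then ent b l k else 0 else 0)"
      by (intro sum.cong refl) (simp add: completeness)
    also have "\<dots> = ent b i j" by (simp add: sum2_delta)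
    finally show ?thesis ..
  qed
  have "counit H (q s) = (if s = (1, 1) then 1 else 0)" if "s \<in> K" for s
  proof -
    have "counit H (q s) = (\<Sum>i\<in>UNIV. \<Sum>j\<in>UNIV. if j = i then ent (wi s) i j else 0) / 4"
      using b by (simp add: q_def tr_exp counit_simps comat_def if_distrib[of "\<lambda>x. _ * x"] cong: if_cong)
    also have "\<dots> = tr (wi s * w (1, 1)) / 4" by (simp add: tr_def w_one)
    also have "tr (wi s * w (1, 1)) = (if s = (1, 1) then 4 else 0)" by (rule tr_wi_w[OF that]) (simp add: K_iff \<Gamma>_one)
    finally show ?thesis by (simp split: if_splits)
  qed
  then have cx: "counit H x = 1" by (simp add: x_def counit_simps K_iff \<Gamma>_one)
  have cq: "comult H (q r) = (\<Sum>s\<in>K. \<Sum>t\<in>K. tens_scale (tr (wi r * (w s * w t)) / 4) (q s \<boxtimes> q t))" for r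
  proof -
    have bb: "comult H (ent b j i) = (\<Sum>l\<in>UNIV. \<Sum>s\<in>K. \<Sum>t\<in>K. tens_scale (ent (w s) j l * ent (w t) l i) (q s \<boxtimes> q t))" for i j
    proof -
      have "comult H (ent b j i) = (\<Sum>l\<in>UNIV. ent b j l \<boxtimes> ent b l i)" using b by (simp add: comat_def)
      also have "\<dots> = (\<Sum>l\<in>UNIV. \<Sum>s\<in>K. \<Sum>t\<in>K. tens_scale (ent (w s) j l * ent (w t) l i) (q s \<boxtimes> q t))"
        by (rule sum.cong[OF refl], subst sum.swap)
          (simp add: b_ent ten_sum ten_simps tens_scale_simps tens_scale_sum mult.commute)
      finally show ?thesis .
    qed
    have "comult H (q r) = (\<Sum>i\<in>UNIV. \<Sum>j\<in>UNIV. \<Sum>l\<in>UNIV. \<Sum>s\<in>K. \<Sum>t\<in>K.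
        tens_scale (ent (wi r) i j * ent (w s) j l * ent (w t) l i / 4) (q s \<boxtimes> q t))"
      by (simp add: q_def[of r] tr_exp comult_simps comult_sum bb tens_scale_sum tens_scale_simps mult_ac)
    also have "\<dots> = (\<Sum>s\<in>K. \<Sum>t\<in>K. \<Sum>i\<in>UNIV. \<Sum>j\<in>UNIV. \<Sum>l\<in>UNIV.
        tens_scale (ent (wi r) i j * ent (w s) j l * ent (w t) l i / 4) (q s \<boxtimes> q t))"
      unfolding sum.swap[of _ K UNIV] ..
    also have "\<dots> = (\<Sum>s\<in>K. \<Sum>t\<in>K. tens_scale (tr (wi r * (w s * w t)) / 4) (q s \<boxtimes> q t))"
      by (simp add: tr_def ent_mult sum_distrib_left sum_divide_distrib tens_scale_sum mult.assoc)
    finally show ?thesis .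
  qed
  \<comment> \<open>Tracing against \<open>wi r\<close> extracts the coefficient of
    \<open>w r\<close> in \<open>w s * w t\<close>, which is \<mu> s t for r =
    \<open>kmul s t\<close> and 0 otherwise.\<close>
  have tr_sum_wi: "(\<Sum>r\<in>K. tr (wi r * (w s * w t)) / 4) = \<mu> s t" if "s \<in> K" "t \<in> K" for s t
  proof -
    have "(\<Sum>r\<in>K. tr (wi r * (w s * w t)) / 4) = (\<Sum>r\<in>K. if r = kmul s t then \<mu> s t else 0)"
      unfolding w_mult[OF that] mult_sc_mult[of "wi _"] tr_sc_mult
      by (rule sum.cong) (auto simp: tr_wi_w kmul_K that)
    then show ?thesis by (simp add: kmul_K that)
  qed
  have "comult H x = (\<Sum>s\<in>K. \<Sum>t\<in>K. tens_scale (\<Sum>r\<in>K. tr (wi r * (w s * w t)) / 4) (q s \<boxtimes> q t))"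
    unfolding x_def comult_sum cq tens_scale_sum
    by (subst sum.swap, rule sum.cong[OF refl], subst sum.swap) (rule refl)
  also have "\<dots> = (\<Sum>s\<in>K. \<Sum>t\<in>K. tens_scale (\<mu> s t) (comp x s \<boxtimes> comp x t))"
    by (intro sum.cong refl) (simp add: tr_sum_wi comp)
  finally have "comult H x = (\<Sum>s\<in>K. \<Sum>t\<in>K. tens_scale (\<mu> s t) (comp x s \<boxtimes> comp x t))" .
  moreover have "b = (\<Sum>s\<in>K. sc (comp x s) * emb (w s))"
    by (rule sqmat_eqI) (simp add: ent_sum ent_sc_mult scal_one_mult comp b_ent)
  ultimately show ?thesis using cx by blast
qed

end

context simple_based
begin

section \<open>Twisted group-like elements\<close>

definition cnj :: "'h \<Rightarrow> 'h \<Rightarrow> 'h" where "cnj b g = b * g * S b"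

context
  fixes b assumes b: "b \<in> G"
begin

lemma cnj_\<Gamma>: "g \<in> \<Gamma> \<Longrightarrow> cnj b g \<in> \<Gamma>"
  unfolding cnj_def by (rule \<Gamma>_conj[OF b])

lemma cnj_mult: "cnj b (g * h) = cnj b g * cnj b h"
proof -
  have "cnj b g * cnj b h = b * g * (S b * b) * h * S b" by (simp only: cnj_def mult.assoc)
  then show ?thesis by (simp add: G_inv[OF b] cnj_def mult.assoc)
qed

lemma cnj_one: "cnj b 1 = 1"
  by (simp add: cnj_def G_inv[OF b])

lemma cnj_commute: "b * g = cnj b g * b"
proof -
  have "cnj b g * b = b * g * (S b * b)" by (simp only: cnj_def mult.assoc)
  then show ?thesis by (simp add: G_inv[OF b])
qed

lemma cnj_inj: "cnj b g = cnj b h \<longleftrightarrow> g = h"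
proof
  assume "cnj b g = cnj b h"
  then have "b * g = b * h" by (simp only: cnj_commute)
  then have "S b * (b * g) = S b * (b * h)" by simp
  then show "g = h" by (simp add: G_inv[OF b] flip: mult.assoc)
qed simp

text \<open>\<beta> is defined through equality and 1 alone, so every injective map fixing 1
  preserves it.\<close>

lemma \<beta>_cnj: "\<beta> (cnj b g) (cnj b h) = \<beta> g h"
  using cnj_inj cnj_one by (metis \<beta>_def)

lemma cnj_bij: "bij_betw (cnj b) \<Gamma> \<Gamma>"
proof -
  have "inj_on (cnj b) \<Gamma>" by (auto simp: inj_on_def cnj_inj)
  then show ?thesis
    by (simp add: bij_betw_def endo_inj_surj finite_\<Gamma> image_subset_iff cnj_\<Gamma>)
qed

lemma coc_cnj:
  assumes l: "coc l"
  shows "coc (\<lambda>g h. l (cnj b g) (cnj b h))"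
  unfolding coc_def
proof (intro conjI ballI)
  fix g h assume \<Gamma>: "g \<in> \<Gamma>" "h \<in> \<Gamma>"
  note \<Gamma>' = cnj_\<Gamma>[OF \<Gamma>(1)] cnj_\<Gamma>[OF \<Gamma>(2)]
  show "l (cnj b g) (cnj b h) \<noteq> 0" by (rule cocD(1)[OF l \<Gamma>'])
  show "l (cnj b g) (cnj b h) = \<beta> g h * l (cnj b h) (cnj b g)"
    using cocD(5)[OF l \<Gamma>'] by (simp only: \<beta>_cnj)
  fix k assume "k \<in> \<Gamma>"
  then show "l (cnj b g) (cnj b h) * l (cnj b (g * h)) (cnj b k) = l (cnj b h) (cnj b k) * l (cnj b g) (cnj b (h * k))"
    unfolding cnj_mult by (rule cocD(2)[OF l \<Gamma>' cnj_\<Gamma>])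
qed (simp_all add: cnj_one cnj_\<Gamma> cocD(3,4)[OF l])

lemma \<epsilon>_cnj:
  assumes v: "v \<in> \<Gamma>"
  shows "b * \<epsilon> v = \<epsilon> (cnj b v) * b"
proof -
  have "b * \<epsilon> v = (\<Sum>g\<in>\<Gamma>. hscal (\<beta> (cnj b v) (cnj b g) / 4) (cnj b g)) * b"
    by (simp add: \<epsilon>_def sum_distrib_left sum_distrib_right scal_mult_left scal_mult_right \<beta>_cnj cnj_commute)
  also have "(\<Sum>g\<in>\<Gamma>. hscal (\<beta> (cnj b v) (cnj b g) / 4) (cnj b g)) = \<epsilon> (cnj b v)"
    unfolding \<epsilon>_def by (rule sum.reindex_bij_betw[OF cnj_bij])
  finally show ?thesis .
qed

end

lemma sum_K: "(\<Sum>s\<in>K. f s) = (\<Sum>v\<in>\<Gamma>. \<Sum>w\<in>\<Gamma>. f (v, w))"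
  by (simp add: K_def sum.cartesian_product)

text \<open>Elements of k\<Gamma> \<otimes> k\<Gamma> in the basis of idempotents, where
  multiplication is pointwise (\<open>diag_mult\<close>).\<close>

definition diag :: "('h \<Rightarrow> 'h \<Rightarrow> 'k) \<Rightarrow> ('k, 'h, 'h) tensor"
  where "diag f = (\<Sum>v\<in>\<Gamma>. \<Sum>w\<in>\<Gamma>. tens_scale (f v w) (\<epsilon> v \<boxtimes> \<epsilon> w))"

lemma diag_T [simp, intro]: "diag f \<in> T"
  unfolding diag_def by (intro T_sum T_scale T_ten)

lemma tmult_diag_left: "tens_mult H (diag f) (x \<boxtimes> y) = (\<Sum>v\<in>\<Gamma>. \<Sum>w\<in>\<Gamma>. tens_scale (f v w) ((\<epsilon> v * x) \<boxtimes> (\<epsilon> w * y)))"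
  by (simp add: diag_def tmult_sum_left tmult_scale_left tmult_ten T_sum)

lemma tmult_diag_right: "tens_mult H (x \<boxtimes> y) (diag f) = (\<Sum>v\<in>\<Gamma>. \<Sum>w\<in>\<Gamma>. tens_scale (f v w) ((x * \<epsilon> v) \<boxtimes> (y * \<epsilon> w)))"
  by (simp add: diag_def tmult_sum_right tmult_scale_right tmult_ten T_sum)

lemma diag_mult: "tens_mult H (diag f) (diag g) = diag (\<lambda>v w. f v w * g v w)"
proof -
  have "tens_mult H (\<epsilon> v \<boxtimes> \<epsilon> w) (diag g) = tens_scale (g v w) (\<epsilon> v \<boxtimes> \<epsilon> w)" if "v \<in> \<Gamma>" "w \<in> \<Gamma>" for v w
  proof -
    have "tens_mult H (\<epsilon> v \<boxtimes> \<epsilon> w) (diag g) = (\<Sum>v'\<in>\<Gamma>. \<Sum>w'\<in>\<Gamma>. if v' = v then if w' = w then tens_scale (g v w) (\<epsilon> v \<boxtimes> \<epsilon> w) else 0 else 0)"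
      unfolding tmult_diag_right
      by (intro sum.cong refl) (auto simp: \<epsilon>_orthogonal that ten_simps tens_scale_simps)
    also have "\<dots> = (\<Sum>v'\<in>\<Gamma>. if v' = v then tens_scale (g v w) (\<epsilon> v \<boxtimes> \<epsilon> w) else 0)"
      by (intro sum.cong refl) (use that finite_\<Gamma> in auto)
    finally show ?thesis using that finite_\<Gamma> by simp
  qed
  then show ?thesis
    unfolding diag_def[of f] diag_def[of "\<lambda>v w. f v w * g v w"]
    by (simp add: tmult_sum_left tmult_scale_left T_sum tens_scale_simps)
qed

lemma diag_one: "diag (\<lambda>v w. 1) = 1 \<boxtimes> 1"
proof -
  have "1 \<boxtimes> 1 = (\<Sum>v\<in>\<Gamma>. \<epsilon> v) \<boxtimes> (\<Sum>v\<in>\<Gamma>. \<epsilon> v)" by (simp add: \<epsilon>_sum)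
  then show ?thesis by (simp add: diag_def tens_scale_simps ten_sum) (rule sum.swap)
qed

lemma diag_cong: "(\<And>v w. v \<in> \<Gamma> \<Longrightarrow> w \<in> \<Gamma> \<Longrightarrow> f v w = g v w) \<Longrightarrow> diag f = diag g"
  unfolding diag_def by (intro sum.cong refl) simp

lemma diag_cnj:
  assumes b: "b \<in> G"
  shows "tens_mult H (diag f) (b \<boxtimes> b) = tens_mult H (b \<boxtimes> b) (diag (\<lambda>v w. f (cnj b v) (cnj b w)))"
proof -
  have "tens_mult H (diag f) (b \<boxtimes> b) =
      (\<Sum>v\<in>\<Gamma>. \<Sum>w\<in>\<Gamma>. tens_scale (f (cnj b v) (cnj b w)) ((\<epsilon> (cnj b v) * b) \<boxtimes> (\<epsilon> (cnj b w) * b)))"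
    unfolding tmult_diag_left
    by (rule trans[OF sum.reindex_bij_betw[OF cnj_bij[OF b], symmetric]], rule sum.cong[OF refl])
      (rule sum.reindex_bij_betw[OF cnj_bij[OF b], symmetric])
  also have "\<dots> = tens_mult H (b \<boxtimes> b) (diag (\<lambda>v w. f (cnj b v) (cnj b w)))"
    unfolding tmult_diag_right by (intro sum.cong refl) (simp add: \<epsilon>_cnj[OF b])
  finally show ?thesis .
qed

end

section \<open>The twist and its group-like elements\<close>

locale twisting = simple_based H S G cc \<gamma> \<kappa> a c
  for H :: "('k::{alg_closed_field, field_char_0}, 'h::ring_1) coalg" and S G cc \<gamma> \<kappa> a c +
  fixes al :: "'h \<Rightarrow> 'h \<Rightarrow> 'k"
  assumes al: "coc al" and dim60: "dim UNIV = 60"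
begin

definition J where "J = diag al"
definition J' where "J' = diag (\<lambda>v w. inverse (al v w))"

lemma J_T [simp, intro]: "J \<in> T" "J' \<in> T"
  by (simp_all add: J_def J'_def)

lemma J_inv: "tens_mult H J J' = 1 \<boxtimes> 1" "tens_mult H J' J = 1 \<boxtimes> 1"
  unfolding J_def J'_def diag_mult diag_one[symmetric] by (auto intro!: diag_cong simp: cocD(1)[OF al])

text \<open>The group-like elements for the comultiplication \<open>J \<Delta> J\<^sup>-\<^sup>1\<close>.\<close>

definition F :: "'h set"
  where "F = {x. counit H x = 1 \<and> comult H x = tens_mult H (tens_mult H J' (x \<boxtimes> x)) J}"

text \<open>The right-hand side has the shape delivered by \<open>comatrix_generator\<close> for the
  multipliers \<open>inverse al\<close> on the left and \<open>al\<close> on the right.\<close>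

lemma twist_expand:
  "tens_mult H (tens_mult H J' (x \<boxtimes> y)) J =
    (\<Sum>s\<in>K. \<Sum>t\<in>K. tens_scale (inverse (al (fst s) (fst t)) * al (snd s) (snd t)) (comp x s \<boxtimes> comp y t))"
proof -
  have "tens_mult H (tens_mult H J' (x \<boxtimes> y)) J = (\<Sum>v\<in>\<Gamma>. \<Sum>w\<in>\<Gamma>. \<Sum>v'\<in>\<Gamma>. \<Sum>w'\<in>\<Gamma>.
      tens_scale (inverse (al v w) * al v' w') ((\<epsilon> v * x * \<epsilon> v') \<boxtimes> (\<epsilon> w * y * \<epsilon> w')))"
    unfolding J'_def J_def tmult_diag_left
    by (simp add: tmult_sum_left tmult_scale_left T_sum tmult_diag_right tens_scale_sum tens_scale_simps)
  also have "\<dots> = (\<Sum>v\<in>\<Gamma>. \<Sum>v'\<in>\<Gamma>. \<Sum>w\<in>\<Gamma>. \<Sum>w'\<in>\<Gamma>.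
      tens_scale (inverse (al v w) * al v' w') ((\<epsilon> v * x * \<epsilon> v') \<boxtimes> (\<epsilon> w * y * \<epsilon> w')))"
    by (rule sum.cong[OF refl]) (rule sum.swap)
  finally show ?thesis
    by (simp add: sum_K comp_def)
qed

lemma F_iff: "x \<in> F \<longleftrightarrow> counit H x = 1 \<and> comult H x =
    (\<Sum>s\<in>K. \<Sum>t\<in>K. tens_scale (inverse (al (fst s) (fst t)) * al (snd s) (snd t)) (comp x s \<boxtimes> comp x t))"
  by (simp add: F_def twist_expand)

lemma F_mult:
  assumes x: "x \<in> F" and y: "y \<in> F"
  shows "x * y \<in> F"
proof -
  have "comult H (x * y) = tens_mult H (tens_mult H (tens_mult H J' (x \<boxtimes> x)) J) (tens_mult H (tens_mult H J' (y \<boxtimes> y)) J)"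
    using x y by (simp add: comult_mult F_def)
  also have "\<dots> = tens_mult H (tens_mult H J' (x \<boxtimes> x)) (tens_mult H (tens_mult H J J') (tens_mult H (y \<boxtimes> y) J))"
    by (simp add: tmult_assoc)
  also have "\<dots> = tens_mult H (tens_mult H J' ((x * y) \<boxtimes> (x * y))) J"
    by (simp add: J_inv tmult_one tmult_assoc tmult_ten flip: tmult_assoc[of "x \<boxtimes> x"])
  finally show ?thesis using x y by (simp add: F_def counit_mult)
qed

lemma \<Gamma>_F:
  assumes g: "g \<in> \<Gamma>"
  shows "g \<in> F"
proof -
  have "cnj g v = v" if "v \<in> \<Gamma>" for v
    using \<Gamma>_commute[OF g that] G_inv[OF \<Gamma>_G[OF g]] by (simp add: cnj_def mult.assoc)
  then have e: "tens_mult H J' (g \<boxtimes> g) = tens_mult H (g \<boxtimes> g) J'"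
    unfolding J'_def diag_cnj[OF \<Gamma>_G[OF g]] by (intro arg_cong[of _ _ "tens_mult H (g \<boxtimes> g)"] diag_cong) simp
  have "tens_mult H (tens_mult H J' (g \<boxtimes> g)) J = tens_mult H (g \<boxtimes> g) (tens_mult H J' J)"
    unfolding e by (rule tmult_assoc) auto
  then show ?thesis by (simp add: F_def counit_\<Gamma> comult_\<Gamma> g J_inv tmult_one)
qed

lemma F_one: "1 \<in> F"
  by (rule \<Gamma>_F[OF \<Gamma>_one])

text \<open>For \<zeta> = \<Sum> z v \<epsilon> v the condition that b * \<zeta> lies in
  \<open>F\<close> says that z is a cochain relating \<open>al\<close> to its conjugate by b. Such z
  exists because both cocycles have commutator \<beta>; as its values are nonzero, \<zeta> can be
  divided out again and b is recovered.\<close>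

lemma twisted_grouplike_coset:
  assumes b: "b \<in> G"
  shows "\<exists>\<zeta>. b * \<zeta> \<in> F \<and> \<zeta> \<in> span \<Gamma> \<and> b \<in> span ((\<lambda>g. b * \<zeta> * g) ` \<Gamma>)"
proof -
  obtain z where z1: "z 1 = 1" and z0: "\<And>g. g \<in> \<Gamma> \<Longrightarrow> z g \<noteq> 0"
    and z: "\<And>g h. g \<in> \<Gamma> \<Longrightarrow> h \<in> \<Gamma> \<Longrightarrow> z g * z h * al g h = al (cnj b g) (cnj b h) * z (g * h)"
    using cocycles_cohomologous[OF al coc_cnj[OF b al]] by blast
  define \<zeta> where "\<zeta> = (\<Sum>v\<in>\<Gamma>. hscal (z v) (\<epsilon> v))"
  have zz: "\<zeta> \<boxtimes> \<zeta> = diag (\<lambda>v w. z v * z w)"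
    unfolding \<zeta>_def diag_def
    by (subst sum.swap) (simp add: ten_sum ten_simps tens_scale_simps tens_scale_sum mult.commute)
  have "comult H \<zeta> = (\<Sum>v\<in>\<Gamma>. \<Sum>w\<in>\<Gamma>. tens_scale (z v) (\<epsilon> w \<boxtimes> \<epsilon> (w * v)))"
    by (simp add: \<zeta>_def comult_sum comult_simps comult_\<epsilon> tens_scale_sum)
  also have "\<dots> = (\<Sum>w\<in>\<Gamma>. \<Sum>v\<in>\<Gamma>. tens_scale (z (w * (w * v))) (\<epsilon> w \<boxtimes> \<epsilon> (w * v)))"
    by (subst sum.swap) (simp add: \<Gamma>_cancel_square)
  also have "\<dots> = (\<Sum>w\<in>\<Gamma>. \<Sum>v\<in>\<Gamma>. tens_scale (z (w * v)) (\<epsilon> w \<boxtimes> \<epsilon> v))"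
    by (rule sum.cong[OF refl]) (rule sum_\<Gamma>_shift)
  finally have \<Delta>: "comult H \<zeta> = diag (\<lambda>v w. z (v * w))" by (simp add: diag_def)
  have "tens_mult H (tens_mult H J' ((b * \<zeta>) \<boxtimes> (b * \<zeta>))) J
      = tens_mult H (tens_mult H (tens_mult H J' (b \<boxtimes> b)) (\<zeta> \<boxtimes> \<zeta>)) J"
    by (simp add: tmult_ten tmult_assoc)
  also have "\<dots> = tens_mult H (b \<boxtimes> b) (diag (\<lambda>v w. inverse (al (cnj b v) (cnj b w)) * (z v * z w) * al v w))"
    by (simp add: J'_def J_def zz diag_cnj[OF b] tmult_assoc diag_mult mult.assoc)
  also have "diag (\<lambda>v w. inverse (al (cnj b v) (cnj b w)) * (z v * z w) * al v w) = diag (\<lambda>v w. z (v * w))"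
  proof (rule diag_cong)
    fix v w assume vw: "v \<in> \<Gamma>" "w \<in> \<Gamma>"
    show "inverse (al (cnj b v) (cnj b w)) * (z v * z w) * al v w = z (v * w)"
      unfolding mult.assoc[of "inverse _"] z[OF vw] using cocD(1)[OF al cnj_\<Gamma>[OF b vw(1)] cnj_\<Gamma>[OF b vw(2)]] by simp
  qed
  finally have "comult H (b * \<zeta>) = tens_mult H (tens_mult H J' ((b * \<zeta>) \<boxtimes> (b * \<zeta>))) J"
    using glike_G[OF b] by (simp add: comult_mult glike_def \<Delta>)
  moreover have "counit H (b * \<zeta>) = 1"
    using glike_G[OF b] by (simp add: counit_mult glike_def \<zeta>_def counit_simps counit_\<epsilon> if_distrib[of "\<lambda>x. _ * x"] z1 \<Gamma>_one finite_\<Gamma> cong: if_cong)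
  ultimately have F: "b * \<zeta> \<in> F" by (simp add: F_def)
  have \<epsilon>_span: "\<epsilon> v \<in> span \<Gamma>" for v
    unfolding \<epsilon>_def by (intro span_sum span_scale span_base)
  have "\<zeta> \<in> span \<Gamma>" unfolding \<zeta>_def by (intro span_sum span_scale \<epsilon>_span)
  moreover have "b \<in> span ((\<lambda>g. b * \<zeta> * g) ` \<Gamma>)"
  proof -
    have "hscal (inverse (z v)) (b * \<zeta> * \<epsilon> v) = b * \<epsilon> v" if v: "v \<in> \<Gamma>" for v
    proof -
      have "\<zeta> * \<epsilon> v = (\<Sum>w\<in>\<Gamma>. if w = v then hscal (z v) (\<epsilon> v) else 0)"
        unfolding \<zeta>_def sum_distrib_right scal_mult_left
        by (rule sum.cong[OF refl]) (simp add: \<epsilon>_orthogonal v)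
      then have "\<zeta> * \<epsilon> v = hscal (z v) (\<epsilon> v)" using v finite_\<Gamma> by simp
      then show ?thesis by (simp add: mult.assoc scal_mult_right z0 v)
    qed
    then have "b = (\<Sum>v\<in>\<Gamma>. hscal (inverse (z v)) (b * \<zeta> * \<epsilon> v))"
      by (simp add: sum_distrib_left[symmetric] \<epsilon>_sum)
    also have "\<dots> = (\<Sum>v\<in>\<Gamma>. \<Sum>g\<in>\<Gamma>. hscal (inverse (z v) * \<beta> v g / 4) (b * \<zeta> * g))"
      by (simp add: \<epsilon>_def sum_distrib_left scal_mult_right scale_sum_right)
    also have "\<dots> \<in> span ((\<lambda>g. b * \<zeta> * g) ` \<Gamma>)"
      by (intro span_sum span_scale span_base) simp
    finally show ?thesis .
  qed
  ultimately show ?thesis using F by blast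
qed

lemma uL_system: "\<exists>U. U 1 = 1 \<and> (\<forall>g\<in>\<Gamma>. uL g (U g))"
proof -
  obtain U where "\<And>g. g \<in> \<Gamma> \<Longrightarrow> uL g (U g)" using uL_exists by metis
  then show ?thesis using uL_one by (intro exI[of _ "\<lambda>g. if g = 1 then 1 else U g"]) auto
qed

lemma vR_system: "\<exists>U. U 1 = 1 \<and> (\<forall>g\<in>\<Gamma>. vR g (U g))"
proof -
  obtain U where "\<And>g. g \<in> \<Gamma> \<Longrightarrow> vR g (U g)" using vR_exists by metis
  then show ?thesis using vR_one by (intro exI[of _ "\<lambda>g. if g = 1 then 1 else U g"]) auto
qed

text \<open>Rescaling the left intertwiners to the multiplier \<open>inverse al\<close> and the
  right ones to \<open>al\<close> makes the formula of \<open>comatrix_generator\<close> the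
  defining equation of \<open>F\<close>. The conjugation by \<open>a^i\<close> appears because in c
  a^i the right translation by g reaches \<open>c\<close> as its conjugate.\<close>

lemma twisted_grouplike_block:
  assumes i: "i < 3"
  shows "\<exists>x\<in>F. \<forall>p q. ent (cc i) p q \<in> span ((\<lambda>s. fst s * x * snd s) ` K)"
proof -
  let ?b = "a ^ i"
  have b: "?b \<in> G" by (rule a_pow_G)
  note cb = cnj_\<Gamma>[OF b] cnj_mult[OF b] cnj_one[OF b] cnj_inj[OF b]
  obtain U where U1: "U 1 = 1" and U: "\<And>g. g \<in> \<Gamma> \<Longrightarrow> uL g (U g)" using uL_system by blast
  obtain V where V1: "V 1 = 1" and V: "\<And>g. g \<in> \<Gamma> \<Longrightarrow> vR g (V g)" using vR_system by blast
  have "\<exists>z. z 1 = 1 \<and> (\<forall>g\<in>\<Gamma>. z g \<noteq> 0) \<and> psys (\<lambda>g h. inverse (al g h)) (\<lambda>g. sc (z g) * U g)"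
  proof (rule psys_rescale[of U, OF U1 _ _ _ _ coc_inverse[OF al]])
    fix g h assume \<Gamma>: "g \<in> \<Gamma>" "h \<in> \<Gamma>"
    have m: "uL (g * h) (U g * U h)" using uL_mult[OF U U] \<Gamma> by (simp add: \<Gamma>_commute)
    show "U g * U h \<noteq> 0" by (rule uL_nonzero[OF m])
    show "\<exists>s. U g * U h = sc s * U (g * h)" using uL_unique[OF U[OF \<Gamma>_mult[OF \<Gamma>]]] m by (simp add: uL_def)
    show "U g * U h = - (U h * U g)" if "g \<noteq> 1" "h \<noteq> 1" "h \<noteq> g"
      by (rule u_anticommute[OF \<Gamma>(1) that(1) \<Gamma>(2) that(2,3) U[OF \<Gamma>(1)] U[OF \<Gamma>(2)]])
  qed (rule uL_nonzero[OF U])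
  then obtain y where y: "\<And>g. g \<in> \<Gamma> \<Longrightarrow> y g \<noteq> 0" and u: "psys (\<lambda>g h. inverse (al g h)) (\<lambda>g. sc (y g) * U g)" by blast
  have "\<exists>z. z 1 = 1 \<and> (\<forall>g\<in>\<Gamma>. z g \<noteq> 0) \<and> psys al (\<lambda>g. sc (z g) * V (cnj ?b g))"
  proof (rule psys_rescale[of "\<lambda>g. V (cnj ?b g)", OF _ _ _ _ _ al])
    fix g h assume \<Gamma>: "g \<in> \<Gamma>" "h \<in> \<Gamma>"
    note V' = V[OF cb(1)[OF \<Gamma>(1)]] V[OF cb(1)[OF \<Gamma>(2)]]
    have m: "vR (cnj ?b (g * h)) (V (cnj ?b g) * V (cnj ?b h))" using vR_mult[OF V'] by (simp add: cb(2))
    show "V (cnj ?b g) * V (cnj ?b h) \<noteq> 0" by (rule vR_nonzero[OF m])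
    show "\<exists>s. V (cnj ?b g) * V (cnj ?b h) = sc s * V (cnj ?b (g * h))"
      using vR_unique[OF V[OF cb(1)[OF \<Gamma>_mult[OF \<Gamma>]]]] m by (simp add: vR_def)
    show "V (cnj ?b g) * V (cnj ?b h) = - (V (cnj ?b h) * V (cnj ?b g))" if "g \<noteq> 1" "h \<noteq> 1" "h \<noteq> g"
      using v_anticommute[OF cb(1)[OF \<Gamma>(1)] _ cb(1)[OF \<Gamma>(2)] _ _ V'] that by (metis cb(3,4))
  qed (simp_all add: V1 cb(3) vR_nonzero[OF V[OF cb(1)]])
  then obtain z where z: "\<And>g. g \<in> \<Gamma> \<Longrightarrow> z g \<noteq> 0" and v: "psys al (\<lambda>g. sc (z g) * V (cnj ?b g))" by blast
  interpret psys_pair H S G cc \<gamma> \<kappa> a c "\<lambda>g h. inverse (al g h)" al "\<lambda>g. sc (y g) * U g" "\<lambda>g. sc (z g) * V (cnj ?b g)"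
  proof
    fix g h assume \<Gamma>: "g \<in> \<Gamma>" "h \<in> \<Gamma>"
    show "sc (y g) * U g * (sc (z h) * V (cnj ?b h)) = sc (z h) * V (cnj ?b h) * (sc (y g) * U g)"
      by (rule uL_vR_commutes[symmetric, OF uL_scale[OF U[OF \<Gamma>(1)] y[OF \<Gamma>(1)]] vR_scale[OF V[OF cb(1)[OF \<Gamma>(2)]] z[OF \<Gamma>(2)]]])
  qed (rule coc_inverse[OF al] al u v)+
  have "\<exists>x. counit H x = 1 \<and>
    comult H x = (\<Sum>s\<in>K. \<Sum>t\<in>K. tens_scale (\<mu> s t) (comp x s \<boxtimes> comp x t)) \<and>
    cc i = (\<Sum>s\<in>K. sc (comp x s) * emb (w s))"
  proof (rule comatrix_generator[OF comat_cc[OF i]])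
    fix g assume g: "g \<in> \<Gamma>"
    have "uL g (sc (y g) * U g)" by (rule uL_scale[OF U y]) (rule g)+
    then have e: "sc g * c * emb (sc (y g) * U g) = emb (sc (y g) * U g) * c" by (simp add: uL_def)
    have "sc g * cc i * emb (sc (y g) * U g) = sc g * c * emb (sc (y g) * U g) * sc ?b"
      unfolding cc_eq[OF i] by (simp only: mult.assoc emb_commute)
    then show "sc g * cc i * emb (sc (y g) * U g) = emb (sc (y g) * U g) * cc i"
      unfolding e cc_eq[OF i] by (simp only: mult.assoc)
    have "vR (cnj ?b g) (sc (z g) * V (cnj ?b g))" by (rule vR_scale[OF V[OF cb(1)] z]) (rule g)+
    then have e: "c * sc (cnj ?b g) * emb (sc (z g) * V (cnj ?b g)) = emb (sc (z g) * V (cnj ?b g)) * c"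
      by (simp add: vR_def)
    have "cc i * sc g * emb (sc (z g) * V (cnj ?b g)) = c * sc (?b * g) * emb (sc (z g) * V (cnj ?b g))"
      unfolding cc_eq[OF i] by (simp only: mult.assoc sc_simps(6))
    also have "\<dots> = c * sc (cnj ?b g) * emb (sc (z g) * V (cnj ?b g)) * sc ?b"
      unfolding cnj_commute[OF b] by (simp only: mult.assoc sc_simps(6) emb_commute emb_left_commute)
    finally show "cc i * sc g * emb (sc (z g) * V (cnj ?b g)) = emb (sc (z g) * V (cnj ?b g)) * cc i"
      unfolding e cc_eq[OF i] by (simp only: mult.assoc)
  qed
  then obtain x where x: "counit H x = 1" "comult H x = (\<Sum>s\<in>K. \<Sum>t\<in>K. tens_scale (\<mu> s t) (comp x s \<boxtimes> comp x t))"
    and ci: "cc i = (\<Sum>s\<in>K. sc (comp x s) * emb (w s))" by blast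
  have "x \<in> F" using x by (simp add: F_iff \<mu>_def)
  moreover have "ent (cc i) p q \<in> span ((\<lambda>s. fst s * x * snd s) ` K)" for p q
  proof -
    have "comp x s \<in> span ((\<lambda>s. fst s * x * snd s) ` K)" for s
    proof -
      have "comp x s = (\<Sum>g\<in>\<Gamma>. \<Sum>h\<in>\<Gamma>. hscal (\<beta> (fst s) g * \<beta> (snd s) h / 16) (g * x * h))"
        by (simp add: comp_def \<epsilon>_def sum_distrib_left sum_distrib_right scal_mult_left scal_mult_right scale_sum_right)
          (subst sum.swap, simp add: mult_ac)
      also have "\<dots> \<in> span ((\<lambda>s. fst s * x * snd s) ` K)"
      proof (intro span_sum span_scale span_base)
        fix g h assume "g \<in> \<Gamma>" "h \<in> \<Gamma>"
        then show "g * x * h \<in> (\<lambda>s. fst s * x * snd s) ` K" by (intro image_eqI[of _ _ "(g, h)"]) (simp_all add: K_iff)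
      qed
      finally show ?thesis .
    qed
    then show ?thesis
      unfolding ci ent_sum ent_sc_mult ent_emb scal_one_mult by (intro span_sum span_scale)
  qed
  ultimately show ?thesis by blast
qed

end

context simple_based
begin

lemma span_mult_right:
  assumes "x \<in> span A" "\<And>y. y \<in> A \<Longrightarrow> y * h \<in> span B"
  shows "x * h \<in> span B"
  using assms(1)
  by (induction rule: span_induct_alt) (auto simp: distrib_right scal_mult_left intro!: span_add span_scale span_zero assms(2))

lemma span_mult_left:
  assumes "x \<in> span A" "\<And>y. y \<in> A \<Longrightarrow> h * y \<in> span B"
  shows "h * x \<in> span B"
  using assms(1)
  by (induction rule: span_induct_alt) (auto simp: distrib_left scal_mult_right intro!: span_add span_scale span_zero assms(2))

lemma span_\<Gamma>_mult: "x \<in> span \<Gamma> \<Longrightarrow> y \<in> span \<Gamma> \<Longrightarrow> x * y \<in> span \<Gamma>"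
  by (erule span_mult_right) (erule span_mult_left, auto intro: span_base \<Gamma>_mult)

lemma span_\<Gamma>_commute: "x \<in> span \<Gamma> \<Longrightarrow> g \<in> \<Gamma> \<Longrightarrow> x * g = g * x"
  by (induction rule: span_induct_alt) (simp_all add: distrib_left distrib_right scal_mult_left scal_mult_right \<Gamma>_commute)

lemma span_\<Gamma>_shift:
  assumes b: "b \<in> G" and x: "x \<in> span \<Gamma>"
  shows "\<exists>y\<in>span \<Gamma>. x * b = b * y"
  using x
proof (induction rule: span_induct_alt)
  case base
  then show ?case by (intro bexI[of _ 0]) (simp_all add: span_zero)
next
  case (step s g x)
  then obtain y where y: "y \<in> span \<Gamma>" "x * b = b * y" by blast
  obtain h where h: "h \<in> \<Gamma>" "g = cnj b h" using cnj_bij[OF b] step(1) by (auto simp: bij_betw_def)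
  have "(hscal s g + x) * b = b * (hscal s h + y)"
    using cnj_commute[OF b, of h] by (simp add: distrib_left distrib_right scal_mult_left scal_mult_right h(2) y(2))
  then show ?case using y(1) h(1) by (intro bexI[of _ "hscal s h + y"]) (auto intro: span_add span_scale span_base)
qed

end

section \<open>A basis of \<open>H\<close> inside \<open>F\<close>\<close>

context twisting
begin

definition zf :: "nat \<Rightarrow> 'h"
  where "zf i = (SOME z. z \<in> F \<and> (\<exists>\<zeta>\<in>span \<Gamma>. z = a ^ i * \<zeta>) \<and> a ^ i \<in> span ((\<lambda>g. z * g) ` \<Gamma>))"

definition xf :: "nat \<Rightarrow> 'h"
  where "xf i = (SOME x. x \<in> F \<and> (\<forall>p q. ent (cc i) p q \<in> span ((\<lambda>s. fst s * x * snd s) ` K)))"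

lemma zf: "zf i \<in> F" "\<exists>\<zeta>\<in>span \<Gamma>. zf i = a ^ i * \<zeta>" "a ^ i \<in> span ((\<lambda>g. zf i * g) ` \<Gamma>)"
proof -
  have "zf i \<in> F \<and> (\<exists>\<zeta>\<in>span \<Gamma>. zf i = a ^ i * \<zeta>) \<and> a ^ i \<in> span ((\<lambda>g. zf i * g) ` \<Gamma>)"
    unfolding zf_def by (rule someI_ex) (use twisted_grouplike_coset[OF a_pow_G, of i] in blast)
  then show "zf i \<in> F" "\<exists>\<zeta>\<in>span \<Gamma>. zf i = a ^ i * \<zeta>" "a ^ i \<in> span ((\<lambda>g. zf i * g) ` \<Gamma>)" by blast+
qed

lemma xf:
  assumes "i < 3"
  shows "xf i \<in> F" "ent (cc i) p q \<in> span ((\<lambda>s. fst s * xf i * snd s) ` K)"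
proof -
  have "xf i \<in> F \<and> (\<forall>p q. ent (cc i) p q \<in> span ((\<lambda>s. fst s * xf i * snd s) ` K))"
    unfolding xf_def by (rule someI_ex) (use twisted_grouplike_block[OF assms] in blast)
  then show "xf i \<in> F" "ent (cc i) p q \<in> span ((\<lambda>s. fst s * xf i * snd s) ` K)" by blast+
qed

definition PP :: "'h set" where "PP = (\<Union>i<3. (\<lambda>g. zf i * g) ` \<Gamma>)"

definition XX :: "'h set" where "XX = (\<Union>i<3. (\<lambda>s. fst s * xf i * snd s) ` K)"

lemma PP_XX_F: "PP \<subseteq> F" "XX \<subseteq> F"
  unfolding PP_def XX_def by (auto simp: K_iff F_mult \<Gamma>_F zf(1) xf(1))

lemma finite_PP_XX: "finite PP" "finite XX"
  by (simp_all add: PP_def XX_def finite_\<Gamma>)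

lemma card_PP_le: "card PP \<le> 12"
proof -
  have "card PP \<le> (\<Sum>i<3. card ((\<lambda>g. zf i * g) ` \<Gamma>))"
    unfolding PP_def by (rule card_UN_le) simp
  also have "\<dots> \<le> (\<Sum>i<(3::nat). 4)"
    by (rule sum_mono) (use card_image_le[OF finite_\<Gamma>] card_\<Gamma> in auto)
  finally show ?thesis by simp
qed

lemma card_XX_le: "card XX \<le> (\<Sum>i<3. card ((\<lambda>s. fst s * xf i * snd s) ` K))"
  unfolding XX_def by (rule card_UN_le) simp

lemma card_orbit_le: "card ((\<lambda>s. fst s * xf i * snd s) ` K) \<le> 16"
  using card_image_le[OF finite_K] card_K by metis

lemma span_PP_XX: "span (PP \<union> XX) = UNIV"
proof -
  have cc: "ent (cc i) p q \<in> span (PP \<union> XX)" if "i < 3" for i p q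
    using xf(2)[OF that, of p q] by (rule span_mono[THEN subsetD, rotated]) (use that in \<open>auto simp: XX_def\<close>)
  have ak: "a ^ k * h \<in> span (PP \<union> XX)" if "k < 3" "h \<in> \<Gamma>" for k h
    using zf(3)[of k]
  proof (rule span_mult_right)
    fix y assume "y \<in> (\<lambda>g. zf k * g) ` \<Gamma>"
    then have "y * h \<in> (\<lambda>g. zf k * g) ` \<Gamma>" using that by (auto simp: mult.assoc intro: \<Gamma>_mult)
    then have "y * h \<in> PP" using that by (auto simp: PP_def)
    then show "y * h \<in> span (PP \<union> XX)" by (simp add: span_base)
  qed
  have g: "g \<in> span (PP \<union> XX)" if "g \<in> G" for g
  proof -
    obtain h k where hk: "h \<in> \<Gamma>" "k < 3" "g = h * a ^ k" using G_decomp[OF \<open>g \<in> G\<close>] by blast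
    obtain h' where h': "h' \<in> \<Gamma>" "h = cnj (a ^ k) h'"
      using cnj_bij[OF a_pow_G] hk(1) by (auto simp: bij_betw_def)
    show ?thesis using ak[OF hk(2) h'(1)] by (simp add: hk(3) h'(2) flip: cnj_commute[OF a_pow_G])
  qed
  have "x \<in> span (PP \<union> XX)" for x
    by (subst expand[of x]) (intro span_add span_sum span_scale g cc, auto)
  then show ?thesis by blast
qed

text \<open>At most 3 * 4 + 3 * 16 = 60 elements span a space of dimension 60, which leaves no room
  for coincidences or relations.\<close>

lemma PP_XX_basis: "independent (PP \<union> XX)" "card (PP \<union> XX) = 60"
proof -
  obtain B where B: "B \<subseteq> PP \<union> XX" "independent B" "PP \<union> XX \<subseteq> span B"
    using maximal_independent_subset by blast
  have "span B = UNIV" using span_mono[OF B(3)] span_PP_XX by (auto simp: span_span)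
  then have "card B = dim UNIV" by (intro basis_card_eq_dim) (simp_all add: B)
  then have cB: "card B = 60" by (simp add: dim60)
  have "card (PP \<union> XX) \<le> card PP + card XX" by (rule card_Un_le)
  moreover have "(\<Sum>i<3. card ((\<lambda>s. fst s * xf i * snd s) ` K)) \<le> (\<Sum>i<(3::nat). 16)"
    by (rule sum_mono) (rule card_orbit_le)
  ultimately have le: "card (PP \<union> XX) \<le> 60" using card_PP_le card_XX_le by simp
  have "finite (PP \<union> XX)" by (simp add: finite_PP_XX)
  then have "B = PP \<union> XX" by (rule card_seteq) (use B(1) le cB in auto)
  then show "independent (PP \<union> XX)" "card (PP \<union> XX) = 60" using B(2) cB by auto
qed

text \<open>Equality in the count of 60 forces equality in each of its parts; in particular \<Gamma>
  x \<Gamma> acts freely on the orbit of every \<open>xf i\<close>.\<close>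

lemma card_PP: "card PP = 12" and orbit_inj: "i < 3 \<Longrightarrow> inj_on (\<lambda>s. fst s * xf i * snd s) K"
proof -
  let ?o = "\<lambda>i. card ((\<lambda>s. fst s * xf i * snd s) ` K)"
  have le: "60 \<le> card PP + (\<Sum>i<3. ?o i)"
    using card_Un_le[of PP XX] card_XX_le PP_XX_basis(2) by linarith
  have s: "(\<Sum>i<3. ?o i) = ?o 0 + ?o 1 + ?o 2"
    by (simp add: eval_nat_numeral)
  note o = card_orbit_le[of 0] card_orbit_le[of 1] card_orbit_le[of 2]
  show "card PP = 12" using le s o card_PP_le by linarith
  have "?o 0 = 16" "?o 1 = 16" "?o 2 = 16" using le s o card_PP_le by linarith+
  moreover assume "i < 3"
  then have "i = 0 \<or> i = 1 \<or> i = 2" by linarith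
  ultimately have "?o i = card K" unfolding card_K by metis
  then show "inj_on (\<lambda>s. fst s * xf i * snd s) K" by (intro eq_card_imp_inj_on) simp_all
qed

text \<open>The classical independence argument for group-likes, with \<open>D\<close> undoing the
  twist: comparing x \<otimes> x with the expansion of x, the coordinates of x are orthogonal
  idempotents in a field with sum 1, so exactly one of them is 1.\<close>

lemma F_eq: "F = PP \<union> XX"
proof
  show "PP \<union> XX \<subseteq> F" using PP_XX_F by blast
  let ?B = "PP \<union> XX"
  note ind = PP_XX_basis(1)
  define \<phi> where "\<phi> y x = representation ?B x y" for y x
  have lin: "lin (\<phi> y)" for y
    by (intro linearI vector_space_axioms field_vector_space)
      (simp_all add: \<phi>_def representation_add[OF ind] representation_scale[OF ind] span_PP_XX)
  have \<phi>: "\<phi> y z = (if y = z then 1 else 0)" if "z \<in> ?B" for y z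
    by (simp add: \<phi>_def representation_basis[OF ind that])
  have fin: "finite ?B" by (simp add: finite_PP_XX)
  have exp: "x = (\<Sum>y\<in>?B. hscal (\<phi> y x) y)" for x
    unfolding \<phi>_def by (rule sum_representation_eq[OF ind _ fin order_refl, symmetric]) (simp add: span_PP_XX)
  define D where "D t = tens_mult H (tens_mult H J t) J'" for t
  have DF: "D (comult H x) = x \<boxtimes> x" if "x \<in> F" for x
  proof -
    have "D (comult H x) = tens_mult H (tens_mult H (tens_mult H J J') (x \<boxtimes> x)) (tens_mult H J J')"
      using that by (simp add: D_def F_def tmult_assoc)
    then show ?thesis by (simp add: J_inv tmult_one)
  qed
  show "F \<subseteq> PP \<union> XX"
  proof
    fix x assume x: "x \<in> F"
    have "x \<boxtimes> x = D (comult H (\<Sum>y\<in>?B. hscal (\<phi> y x) y))" using DF[OF x] exp[of x] by simp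
    also have "\<dots> = (\<Sum>y\<in>?B. tens_scale (\<phi> y x) (D (comult H y)))"
      unfolding comult_sum comult_simps D_def
      by (simp add: tmult_sum_left tmult_sum_right tmult_scale_left tmult_scale_right)
    also have "\<dots> = (\<Sum>y\<in>?B. tens_scale (\<phi> y x) (y \<boxtimes> y))"
      by (rule sum.cong[OF refl]) (use PP_XX_F DF in \<open>metis UnE subsetD\<close>)
    finally have xx: "x \<boxtimes> x = (\<Sum>y\<in>?B. tens_scale (\<phi> y x) (y \<boxtimes> y))" .
    have prod: "\<phi> y x * \<phi> z x = (if y = z then \<phi> y x else 0)" if "y \<in> ?B" "z \<in> ?B" for y z
    proof -
      have "\<phi> y x * \<phi> z x = pair (\<phi> y) (\<phi> z) (x \<boxtimes> x)" by (simp add: pair_ten lin)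
      also have "\<dots> = (\<Sum>v\<in>?B. \<phi> v x * (\<phi> y v * \<phi> z v))"
        unfolding xx pair_sum by (simp add: pair_simps pair_ten lin)
      also have "\<dots> = (\<Sum>v\<in>?B. if v = y then (if y = z then \<phi> y x else 0) else 0)"
        by (rule sum.cong[OF refl]) (auto simp: \<phi>)
      finally show ?thesis using that fin by simp
    qed
    have "(\<Sum>y\<in>?B. \<phi> y x) = counit H (\<Sum>y\<in>?B. hscal (\<phi> y x) y)"
      unfolding counit_simps(6) by (rule sum.cong[OF refl]) (use PP_XX_F in \<open>auto simp: counit_simps(4) F_def\<close>)
    also have "\<dots> = 1" using exp[of x] x by (simp add: F_def)
    finally have "(\<Sum>y\<in>?B. \<phi> y x) \<noteq> 0" by simp
    then obtain y where y: "y \<in> ?B" "\<phi> y x \<noteq> 0" by (meson sum.neutral)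
    have "\<phi> y x = 1" using prod[OF y(1) y(1)] y(2) by simp
    moreover have "\<phi> z x = 0" if "z \<in> ?B" "z \<noteq> y" for z using prod[OF y(1) that(1)] that(2) y(2) by auto
    ultimately have "(\<Sum>z\<in>?B. hscal (\<phi> z x) z) = (\<Sum>z\<in>?B. if z = y then y else 0)"
      by (intro sum.cong refl) auto
    then have "x = y" using exp[of x] y(1) fin by simp
    then show "x \<in> ?B" using y by simp
  qed
qed

lemma F_basis: "finite F" "card F = 60" "independent F" "span F = UNIV"
  using PP_XX_basis span_PP_XX finite_PP_XX by (simp_all add: F_eq)

lemma F_in_span: "x \<in> F \<Longrightarrow> B \<subseteq> F \<Longrightarrow> x \<in> span B \<Longrightarrow> x \<in> B"
proof (rule ccontr)
  assume x: "x \<in> F" "B \<subseteq> F" "x \<in> span B" "x \<notin> B"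
  then have "span B \<subseteq> span (F - {x})" by (intro span_mono) auto
  then show False using x F_basis(3) by (auto simp: dependent_def)
qed

text \<open>The antipode axiom for \<open>x\<close> writes 1 as a combination of elements \<open>y x g\<close> of the basis \<open>F\<close>.\<close>

lemma F_left_inverse:
  assumes x: "x \<in> F"
  shows "\<exists>y\<in>F. y * x = 1"
proof -
  define B where "B = (\<lambda>(y, g). y * x * g) ` (F \<times> \<Gamma>)"
  have YxB: "Y * x * e \<in> span B" if "e \<in> span \<Gamma>" for Y e
  proof -
    have "Y * (x * g) \<in> span B" if "g \<in> \<Gamma>" for g
    proof (rule span_mult_right[of Y F])
      show "Y \<in> span F" by (simp add: F_basis)
      show "y * (x * g) \<in> span B" if "y \<in> F" for y
        using \<open>g \<in> \<Gamma>\<close> that by (auto simp: B_def mult.assoc intro!: span_base image_eqI[of _ _ "(y, g)"])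
    qed
    then show ?thesis using that by (intro span_mult_left[of e \<Gamma>]) (simp_all add: mult.assoc)
  qed
  have "1 = tens2_lift H (\<lambda>a b. S a * b) (comult H x)"
    using antipode_left[of x] x by (simp add: F_def)
  also have "\<dots> = (\<Sum>s\<in>K. \<Sum>t\<in>K. hscal (inverse (al (fst s) (fst t)) * al (snd s) (snd t)) (S (comp x s) * comp x t))"
  proof -
    have "comult H x = (\<Sum>s\<in>K. \<Sum>t\<in>K. tens_scale (inverse (al (fst s) (fst t)) * al (snd s) (snd t)) (comp x s \<boxtimes> comp x t))"
      using x by (simp add: F_iff)
    then show ?thesis
      by (simp add: lift_sum[OF vector_space_axioms bilin_S(1)] lift_scale[OF vector_space_axioms bilin_S(1)]
          lift_ten[OF vector_space_axioms bilin_S(1)] T_sum)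
  qed
  also have "\<dots> \<in> span B"
  proof (intro span_sum span_scale)
    fix s t :: "'h \<times> 'h"
    have "\<epsilon> (snd t) \<in> span \<Gamma>" unfolding \<epsilon>_def by (intro span_sum span_scale span_base)
    from YxB[OF this, of "S (comp x s) * \<epsilon> (fst t)"]
    show "S (comp x s) * comp x t \<in> span B" by (simp add: comp_def mult.assoc)
  qed
  finally have 1: "1 \<in> span B" .
  have "B \<subseteq> F" by (auto simp: B_def F_mult x \<Gamma>_F)
  then have "1 \<in> B" using 1 by (rule F_in_span[OF F_one])
  then obtain y g where yg: "y \<in> F" "g \<in> \<Gamma>" "1 = y * x * g" by (auto simp: B_def)
  have "g * 1 * g = g * (y * x) * (g * g)" by (subst yg(3)) (simp only: mult.assoc)
  then have "g * y * x = 1" using \<Gamma>_square[OF yg(2)] by (simp add: mult.assoc)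
  then show ?thesis using yg(1,2) by (intro bexI[of _ "g * y"]) (auto intro: F_mult \<Gamma>_F)
qed

definition Fm :: "'h monoid"
  where "Fm = \<lparr>carrier = F, mult = (*), one = 1\<rparr>"

lemma Fm_simps [simp]: "carrier Fm = F" "mult Fm = (*)" "one Fm = 1"
  by (simp_all add: Fm_def)

lemma group_Fm: "group Fm"
  by (rule groupI) (use F_left_inverse in \<open>auto simp: F_mult F_one mult.assoc\<close>)

lemma F_cancel: "x \<in> F \<Longrightarrow> x * y = x * z \<longleftrightarrow> y = z" "x \<in> F \<Longrightarrow> y * x = z * x \<longleftrightarrow> y = z"
proof -
  assume x: "x \<in> F"
  obtain x' where x': "x' \<in> F" "x' * x = 1" using F_left_inverse[OF x] by blast
  obtain x'' where "x'' * x' = 1" using F_left_inverse[OF x'(1)] by blast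
  moreover have "x'' * x' * x * x' = x'' * (x' * x) * x'" by (simp only: mult.assoc)
  ultimately have xx': "x * x' = 1" using x'(2) by simp
  show "x * y = x * z \<longleftrightarrow> y = z"
  proof
    assume "x * y = x * z"
    then have "x' * (x * y) = x' * (x * z)" by simp
    then show "y = z" using x'(2) by (simp flip: mult.assoc)
  qed simp
  show "y * x = z * x \<longleftrightarrow> y = z"
  proof
    assume "y * x = z * x"
    then have "y * x * x' = z * x * x'" by simp
    then show "y = z" using xx' by (simp add: mult.assoc)
  qed simp
qed

lemma span_\<Gamma>_F: "x \<in> F \<Longrightarrow> x \<in> span \<Gamma> \<Longrightarrow> x \<in> \<Gamma>"
  by (rule F_in_span) (auto intro: \<Gamma>_F)

lemma PP_form: "p \<in> PP \<Longrightarrow> \<exists>i<3. \<exists>\<zeta>\<in>span \<Gamma>. p = a ^ i * \<zeta>"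
proof -
  assume "p \<in> PP"
  then obtain i g where i: "i < 3" "g \<in> \<Gamma>" "p = zf i * g" by (auto simp: PP_def)
  obtain \<zeta> where \<zeta>: "\<zeta> \<in> span \<Gamma>" "zf i = a ^ i * \<zeta>" using zf(2) by blast
  have "p = a ^ i * (\<zeta> * g)" by (simp add: i \<zeta> mult.assoc)
  moreover have "\<zeta> * g \<in> span \<Gamma>" using \<zeta>(1) i(2) by (intro span_\<Gamma>_mult) (auto intro: span_base)
  ultimately show ?thesis using i(1) by blast
qed

lemma span_\<Gamma>_G: "x \<in> span \<Gamma> \<Longrightarrow> x \<in> span G"
  using span_mono[of \<Gamma> G] \<Gamma>_G by blast

lemma PP_span: "PP \<subseteq> span G"
proof
  fix p assume "p \<in> PP"
  then obtain i \<zeta> where "\<zeta> \<in> span \<Gamma>" "p = a ^ i * \<zeta>" using PP_form by blast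
  then show "p \<in> span G" by (simp add: span_G_mult span_\<Gamma>_G span_base a_pow_G)
qed

text \<open>An element of \<open>XX\<close> is a \<Gamma>-translate of some \<open>xf i\<close>; if
  it lay in the span of G, so would the whole block \<open>cc i\<close>.\<close>

lemma PP_iff: "p \<in> PP \<longleftrightarrow> p \<in> F \<and> p \<in> span G"
proof
  assume "p \<in> PP"
  then show "p \<in> F \<and> p \<in> span G" using PP_span PP_XX_F by blast
next
  assume p: "p \<in> F \<and> p \<in> span G"
  show "p \<in> PP"
  proof (rule ccontr)
    assume "p \<notin> PP"
    then have "p \<in> XX" using p F_eq by blast
    then obtain i g h where i: "i < 3" "g \<in> \<Gamma>" "h \<in> \<Gamma>" "p = g * xf i * h" by (auto simp: XX_def K_iff)
    have "g * p * h = (g * g) * xf i * (h * h)" by (simp only: i mult.assoc)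
    then have x: "xf i = g * p * h" using i by (simp add: \<Gamma>_square)
    have sG: "g \<in> span G" if "g \<in> \<Gamma>" for g using that by (intro span_base \<Gamma>_G)
    have "(\<lambda>s. fst s * xf i * snd s) ` K \<subseteq> span G"
    proof clarify
      fix r t assume "(r, t) \<in> K"
      then show "fst (r, t) * xf i * snd (r, t) \<in> span G"
        unfolding x using i(2,3) p by (auto simp: K_iff span_G_mult sG)
    qed
    then have "span ((\<lambda>s. fst s * xf i * snd s) ` K) \<subseteq> span G" using span_mono by (metis span_span)
    then have "ent (cc i) 0 0 \<in> span G" using xf(2)[OF i(1)] by blast
    then have "\<kappa> i 0 0 (ent (cc i) 0 0) = 0" by (rule \<kappa>_span_G[OF _ i(1)])
    then show False using i(1) by (simp add: \<kappa>_cc)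
  qed
qed

lemma PP_mult: "x \<in> PP \<Longrightarrow> y \<in> PP \<Longrightarrow> x * y \<in> PP"
  by (auto simp: PP_iff F_mult span_G_mult)

lemma \<Gamma>_PP: "g \<in> \<Gamma> \<Longrightarrow> g \<in> PP"
  by (simp add: PP_iff \<Gamma>_F span_base \<Gamma>_G)

lemma PP_\<Gamma>_commute:
  assumes p: "p \<in> PP"
  shows "\<exists>i<3. (\<exists>\<zeta>\<in>span \<Gamma>. p = a ^ i * \<zeta>) \<and> (\<forall>g\<in>\<Gamma>. p * g = cnj (a ^ i) g * p)"
proof -
  obtain i \<zeta> where i: "i < 3" "\<zeta> \<in> span \<Gamma>" "p = a ^ i * \<zeta>" using PP_form[OF p] by blast
  have "p * g = cnj (a ^ i) g * p" if "g \<in> \<Gamma>" for g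
  proof -
    have "p * g = (a ^ i * g) * \<zeta>" by (simp add: i(3) mult.assoc span_\<Gamma>_commute[OF i(2) that])
    then show ?thesis unfolding cnj_commute[OF a_pow_G] by (simp add: i(3) mult.assoc)
  qed
  then show ?thesis using i by blast
qed

text \<open>An element a^i \<zeta> with \<zeta> in the commutative k\<Gamma> conjugates \<Gamma> as
  \<open>a^i\<close> does, and by \<open>a_noncentral\<close> that is trivial only for i =
  0.\<close>

lemma PP_centraliser:
  assumes p: "p \<in> PP" and com: "\<And>g. g \<in> \<Gamma> \<Longrightarrow> p * g = g * p"
  shows "p \<in> \<Gamma>"
proof -
  obtain i \<zeta> where i: "i < 3" "\<zeta> \<in> span \<Gamma>" "p = a ^ i * \<zeta>" and c: "\<And>g. g \<in> \<Gamma> \<Longrightarrow> p * g = cnj (a ^ i) g * p"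
    using PP_\<Gamma>_commute[OF p] by blast
  have pF: "p \<in> F" using p by (simp add: PP_iff)
  have "a ^ i * g = g * a ^ i" if "g \<in> \<Gamma>" for g
  proof -
    have "cnj (a ^ i) g = g" using c[OF that] com[OF that] F_cancel(2)[OF pF] by metis
    then show ?thesis using cnj_commute[OF a_pow_G, of i g] by simp
  qed
  then have ai: "(a ^ i) ^ n * g = g * (a ^ i) ^ n" if "g \<in> \<Gamma>" for g n
    using that by (metis power_commuting_commutes)
  have "i = 0"
  proof (rule ccontr)
    assume "i \<noteq> 0"
    then have "i = 1 \<or> i = 2" using i(1) by linarith
    then have "\<exists>n. (a ^ i) ^ n = a"
    proof
      assume "i = 2"
      then have "(a ^ i) ^ 2 = a ^ (4 mod 3)" unfolding power_mult[symmetric] by (subst a_pow_mod) simp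
      then show ?thesis by (intro exI[of _ 2]) simp
    qed (auto intro: exI[of _ 1])
    then show False using ai a_noncentral by metis
  qed
  then show ?thesis using i(2,3) pF by (intro span_\<Gamma>_F) simp_all
qed

text \<open>Here p = p^3, and the cube of a^i \<zeta> lies in k\<Gamma>, since the powers of
  \<open>a\<close> can be collected to a^(3 i) = 1.\<close>

lemma PP_involution:
  assumes p: "p \<in> PP" and pp: "p * p = 1"
  shows "p \<in> \<Gamma>"
proof -
  obtain i \<zeta> where i: "i < 3" "\<zeta> \<in> span \<Gamma>" "p = a ^ i * \<zeta>" using PP_form[OF p] by blast
  obtain \<zeta>' where \<zeta>': "\<zeta>' \<in> span \<Gamma>" "\<zeta> * a ^ i = a ^ i * \<zeta>'" using span_\<Gamma>_shift[OF a_pow_G i(2)] by blast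
  obtain \<zeta>'' where \<zeta>'': "\<zeta>'' \<in> span \<Gamma>" "\<zeta>' * a ^ i = a ^ i * \<zeta>''" using span_\<Gamma>_shift[OF a_pow_G \<zeta>'(1)] by blast
  have "p = p * p * p" using pp by simp
  also have "\<dots> = a ^ i * (\<zeta> * a ^ i) * (\<zeta> * a ^ i) * \<zeta>" by (simp only: i(3) mult.assoc)
  also have "\<dots> = a ^ i * a ^ i * (\<zeta>' * a ^ i) * \<zeta>' * \<zeta>" unfolding \<zeta>'(2) by (simp only: mult.assoc)
  also have "\<dots> = (a ^ i * a ^ i * a ^ i) * (\<zeta>'' * \<zeta>' * \<zeta>)" unfolding \<zeta>''(2) by (simp only: mult.assoc)
  also have "a ^ i * a ^ i * a ^ i = (a ^ 3) ^ i"
  proof -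
    have "i + i + i = 3 * i" by simp
    then show ?thesis by (metis power_add power_mult)
  qed
  also have "\<dots> = 1" using a3 by (simp add: power3_eq_cube)
  finally have "p = \<zeta>'' * \<zeta>' * \<zeta>" by simp
  then have "p \<in> span \<Gamma>" using i(2) \<zeta>'(1) \<zeta>''(1) by (auto intro: span_\<Gamma>_mult)
  then show ?thesis using p by (intro span_\<Gamma>_F) (simp_all add: PP_iff)
qed

text \<open>Stabilisers in \<Gamma> of the cosets of \<open>PP\<close> other than \<open>PP\<close>
  itself are trivial: p inherits p^2 = 1 from g, so it lies in \<Gamma>, and then the free action of
  \<Gamma> x \<Gamma> on the orbit of y applies.\<close>

lemma \<Gamma>_free:
  assumes y: "y \<in> F" "y \<notin> PP" and g: "g \<in> \<Gamma>" and p: "p \<in> PP" and e: "g * y = y * p"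
  shows "g = 1"
proof -
  have "y * (p * p) = g * y * p" by (simp add: e mult.assoc)
  also have "\<dots> = y * 1" using \<Gamma>_square[OF g] by (simp add: mult.assoc flip: e) (simp flip: mult.assoc)
  finally have "p * p = 1" using F_cancel(1)[OF y(1)] by blast
  then have p\<Gamma>: "p \<in> \<Gamma>" by (rule PP_involution[OF p])
  have "y \<in> XX" using y F_eq by blast
  then obtain i r t where i: "i < 3" "r \<in> \<Gamma>" "t \<in> \<Gamma>" "y = r * xf i * t" by (auto simp: XX_def K_iff)
  have "(g * r) * xf i * t = r * xf i * (t * p)" using e by (simp add: i mult.assoc)
  then have "(g * r, t) = (r, t * p)"
    using inj_onD[OF orbit_inj[OF i(1)], of "(g * r, t)" "(r, t * p)"] i g p\<Gamma> by (simp add: K_iff \<Gamma>_mult)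
  then show ?thesis using \<Gamma>_cancel_one(2)[OF i(2)] by simp
qed

end

section \<open>The permutation representation\<close>

text \<open>Removing one 2-cycle from an even permutation leaves an odd one, which is not the
  identity; so there is a second 2-cycle, and of five points exactly one remains.\<close>

lemma even_involution_unique_fixpoint:
  assumes p: "p permutes {1..5::nat}" and pp: "p \<circ> p = id" and ne: "p \<noteq> id" and ev: "evenperm p"
  obtains m where "m \<in> {1..5}" "p m = m" "\<And>i. i \<in> {1..5} \<Longrightarrow> p i = i \<Longrightarrow> i = m"
proof -
  have inv: "p (p x) = x" for x using pp by (metis comp_apply id_apply)
  have inj: "p x = p y \<longleftrightarrow> x = y" for x y by (metis inv)
  have supp: "x \<in> {1..5}" if "p x \<noteq> x" for x using that p by (meson permutes_not_in)
  have img: "p x \<in> {1..5} \<longleftrightarrow> x \<in> {1..5}" for x by (rule permutes_in_image[OF p])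
  obtain i where i: "p i \<noteq> i" using ne by (auto simp: fun_eq_iff)
  define q where "q = transpose i (p i) \<circ> p"
  have "permutation p" using p permutation_permutes by blast
  then have "evenperm q \<longleftrightarrow> False"
    unfolding q_def using ev i by (subst evenperm_comp) (auto simp: permutation_swap_id evenperm_swap)
  then have "q \<noteq> id" by auto
  then obtain k where k: "q k \<noteq> k" by (auto simp: fun_eq_iff)
  have "q i = i" "q (p i) = p i" by (simp_all add: q_def inv)
  then have ki: "k \<noteq> i" "k \<noteq> p i" using k by auto
  then have "p k \<noteq> p i" "p k \<noteq> i" using inj[of k i] inv[of k] by auto
  then have pk: "p k \<noteq> k" using k by (simp add: q_def transpose_def)
  let ?A = "{i, p i, k, p k}"
  have "?A \<subseteq> {1..5}" using supp[OF i] supp[OF pk] img[THEN iffD2, OF supp[OF i]] img[THEN iffD2, OF supp[OF pk]] by blast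
  moreover have "card ?A = 4" using i ki pk \<open>p k \<noteq> p i\<close> \<open>p k \<noteq> i\<close> by auto
  ultimately have "card ({1..5} - ?A) = 1" by (subst card_Diff_subset) auto
  then obtain m where m: "{1..5} - ?A = {m}" by (metis card_1_singletonE)
  then have m5: "m \<in> {1..5}" "m \<notin> ?A" by blast+
  have stab: "p x \<in> ?A" if "x \<in> ?A" for x using that inv by blast
  have "p m \<notin> ?A" using stab[of "p m"] m5(2) unfolding inv by blast
  then have "p m \<in> {1..5} - ?A" using m5(1) img by blast
  then have "p m = m" using m by blast
  moreover have "j = m" if "j \<in> {1..5}" "p j = j" for j
  proof -
    have "p x \<noteq> x" if "x \<in> ?A" for x using that i pk inj by blast
    then have "j \<notin> ?A" using that(2) by blast
    then show ?thesis using m that(1) by blast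
  qed
  ultimately show thesis using that m5 by blast
qed

lemma card_alt_group_5: "card (carrier (alt_group 5)) = 60"
  using alt_group_card_carrier[of 5] by (simp add: fact_numeral)

section \<open>Klein four-subgroups of the alternating group\<close>

locale four_subgroup =
  fixes V :: "(nat \<Rightarrow> nat) set"
  assumes V_subgroup: "subgroup V (alt_group 5)"
    and V_iso: "alt5_sub V \<cong> integer_mod_group 2 \<times>\<times> integer_mod_group 2"
begin

lemma V_perm: "v \<in> V \<Longrightarrow> v permutes {1..5}" "v \<in> V \<Longrightarrow> evenperm v"
  using subgroup.subset[OF V_subgroup] by (auto simp: alt_group_carrier)

lemma V_comp: "v \<in> V \<Longrightarrow> w \<in> V \<Longrightarrow> v \<circ> w \<in> V" and V_id: "id \<in> V"
  using subgroup.m_closed[OF V_subgroup, of v w] subgroup.one_closed[OF V_subgroup]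
  by (simp_all add: alt_group_mult alt_group_one)

lemma V_card: "card V = 4" and V_square: "v \<in> V \<Longrightarrow> v \<circ> v = id"
proof -
  obtain h where h: "h \<in> iso (alt5_sub V) (integer_mod_group 2 \<times>\<times> integer_mod_group 2)"
    using V_iso by (auto simp: is_iso_def)
  let ?Z = "integer_mod_group 2 \<times>\<times> integer_mod_group 2"
  have Z: "carrier ?Z = {0..<2} \<times> {0..<2}" by (simp add: DirProd_def carrier_integer_mod_group)
  have bij: "bij_betw h V (carrier ?Z)" using h by (simp add: iso_def)
  then have "card V = card ({0..<2::int} \<times> {0..<2::int})" unfolding Z by (rule bij_betw_same_card)
  then show "card V = 4" by (simp add: card_cartesian_product)
  assume v: "v \<in> V"
  have hom: "h (x \<circ> y) = h x \<otimes>\<^bsub>?Z\<^esub> h y" if "x \<in> V" "y \<in> V" for x y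
    using h that by (auto simp: iso_def hom_def alt_group_mult)
  have sq: "h x \<otimes>\<^bsub>?Z\<^esub> h x = (0, 0)" if "x \<in> V" for x
  proof -
    obtain s t where "h x = (s, t)" by (cases "h x")
    then show ?thesis by (simp add: DirProd_def) 
  qed
  have "h (v \<circ> v) = h (id \<circ> id)" unfolding hom[OF v v] hom[OF V_id V_id] sq[OF v] sq[OF V_id] ..
  then show "v \<circ> v = id" using inj_onD[OF bij_betw_imp_inj_on[OF bij]] v by (simp add: V_comp V_id)
qed

lemma V_finite: "finite V"
  using V_card card.infinite by fastforce

lemma V_square': "v \<in> V \<Longrightarrow> v (v x) = x"
  using V_square by (metis comp_apply id_apply)

lemma V_commute:
  assumes "v \<in> V" "w \<in> V"
  shows "v \<circ> w = w \<circ> v"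
proof
  fix x
  have "v (w (v (w (w (v x))))) = w (v x)"
    using V_square'[OF V_comp[OF assms], of "w (v x)"] by simp
  then show "(v \<circ> w) x = (w \<circ> v) x" by (simp add: V_square' assms)
qed

text \<open>By commutativity all of \<open>V\<close> fixes the unique fixed point of one involution.
  No nontrivial element has another fixed point, so \<open>V\<close> acts simply transitively on the
  other four points.\<close>

lemma V_points:
  obtains p0 p1 where "p0 \<in> {1..5}" "\<And>v. v \<in> V \<Longrightarrow> v p0 = p0" "bij_betw (\<lambda>v. v p1) V ({1..5} - {p0})"
proof -
  have "\<not> V \<subseteq> {id}" using card_mono[of "{id}" V] V_card by auto
  then obtain u where u: "u \<in> V" "u \<noteq> id" by blast
  obtain p0 where p0: "p0 \<in> {1..5}" "u p0 = p0" "\<And>i. i \<in> {1..5} \<Longrightarrow> u i = i \<Longrightarrow> i = p0"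
    by (rule even_involution_unique_fixpoint[OF V_perm(1)[OF u(1)] V_square[OF u(1)] u(2) V_perm(2)[OF u(1)]]) blast
  have fix0: "v p0 = p0" if v: "v \<in> V" for v
  proof (rule p0(3))
    show "v p0 \<in> {1..5}" using permutes_in_image[OF V_perm(1)[OF v]] p0(1) by blast
    show "u (v p0) = v p0" using V_commute[OF u(1) v] p0(2) by (metis comp_apply)
  qed
  have free: "v = id" if vi: "v \<in> V" "v i = i" "i \<in> {1..5}" "i \<noteq> p0" for v i
  proof (rule ccontr)
    assume "v \<noteq> id"
    then obtain m where "\<And>j. j \<in> {1..5} \<Longrightarrow> v j = j \<Longrightarrow> j = m"
      using even_involution_unique_fixpoint[OF V_perm(1)[OF vi(1)] V_square[OF vi(1)] _ V_perm(2)[OF vi(1)]] by blast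
    then show False using vi(2-4) fix0[OF vi(1)] p0(1) by blast
  qed
  have "card ({1..5} - {p0}) = 4" using p0(1) by (subst card_Diff_subset) auto
  then have "{1..5} - {p0} \<noteq> {}" by (metis card.empty zero_neq_numeral)
  then obtain p1 where p1: "p1 \<in> {1..5}" "p1 \<noteq> p0" by blast
  have inj: "inj_on (\<lambda>v. v p1) V"
  proof (rule inj_onI)
    fix v w assume vw: "v \<in> V" "w \<in> V" "v p1 = w p1"
    then have "(w \<circ> v) p1 = p1" by (simp add: V_square')
    then have "w \<circ> v = id" using free[OF V_comp] vw p1 by blast
    then have "w (v x) = x" for x by (metis comp_apply id_apply)
    then show "v = w" by (metis ext V_square' vw(2))
  qed
  have "(\<lambda>v. v p1) ` V \<subseteq> {1..5} - {p0}"
  proof clarify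
    fix v assume v: "v \<in> V"
    have "v p1 = p0 \<Longrightarrow> p1 = p0" using fix0[OF v] V_square'[OF v] by metis
    then show "v p1 \<in> {1..5} - {p0}" using permutes_in_image[OF V_perm(1)[OF v]] p1 by auto
  qed
  moreover have "card ((\<lambda>v. v p1) ` V) = card ({1..5} - {p0})"
    using card_image[OF inj] V_card \<open>card ({1..5} - {p0}) = 4\<close> by simp
  ultimately have "(\<lambda>v. v p1) ` V = {1..5} - {p0}" by (intro card_subset_eq) auto
  then have "bij_betw (\<lambda>v. v p1) V ({1..5} - {p0})" using inj by (simp add: bij_betw_def)
  then show thesis using p0(1) fix0 that by blast
qed

end

locale matched = simple_based H S G cc \<gamma> \<kappa> a c + four_subgroup V
  for H :: "('k::{alg_closed_field, field_char_0}, 'h::ring_1) coalg" and S G cc \<gamma> \<kappa> a c and V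
begin

lemma exists_\<iota>: "\<exists>\<iota>. bij_betw \<iota> V \<Gamma> \<and> (\<forall>v\<in>V. \<forall>w\<in>V. \<iota> (v \<circ> w) = \<iota> v * \<iota> w)"
proof -
  obtain p q where p: "p \<in> \<Gamma>" "p \<noteq> 1" and q: "q \<in> \<Gamma>" "q \<noteq> 1" "q \<noteq> p" using exists_pq by blast
  note dist = \<Gamma>_distinct[OF p q]
  have four: "\<Gamma> = {1, p, q, p * q}" by (rule \<Gamma>_four'[OF p q])
  have mult: "p * p = 1" "q * q = 1" "q * p = p * q" "p * (p * q) = q" "q * (p * q) = p"
    "p * q * p = q" "p * q * q = p" "p * q * (p * q) = 1"
  proof -
    show 1: "p * p = 1" "q * q = 1" "q * p = p * q" "p * (p * q) = q" "p * q * q = p" "p * q * (p * q) = 1"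
      using \<Gamma>_square[OF p(1)] \<Gamma>_square[OF q(1)] \<Gamma>_square[OF \<Gamma>_mult[OF p(1) q(1)]] \<Gamma>_commute[OF q(1) p(1)]
        \<Gamma>_cancel_square[OF p(1)] by (simp_all add: mult.assoc)
    show "p * q * p = q" using 1(3,4) by (simp add: mult.assoc)
    show "q * (p * q) = p" using 1(3,5) by (simp flip: mult.assoc)
  qed
  have "\<not> V \<subseteq> {id}" using card_mono[of "{id}" V] V_card by auto
  then obtain u where u: "u \<in> V" "u \<noteq> id" by blast
  have "\<not> V \<subseteq> {id, u}" using card_mono[of "{id, u}" V] V_card u by auto
  then obtain t where t: "t \<in> V" "t \<noteq> id" "t \<noteq> u" by blast
  define ut where "ut = u \<circ> t"
  have uu: "u (u x) = x" and tt: "t (t x) = x" and tu: "t (u x) = u (t x)" for x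
    using V_square'[OF u(1)] V_square'[OF t(1)] fun_cong[OF V_commute[OF t(1) u(1)], of x] by simp_all
  have comp: "u \<circ> u = id" "t \<circ> t = id" "u \<circ> t = ut" "t \<circ> u = ut" "u \<circ> ut = t" "ut \<circ> u = t"
    "t \<circ> ut = u" "ut \<circ> t = u" "ut \<circ> ut = id"
    by (simp_all add: ut_def fun_eq_iff uu tt tu)
  have d: "ut \<noteq> id" "ut \<noteq> u" "ut \<noteq> t"
  proof -
    show "ut \<noteq> id"
    proof
      assume "ut = id"
      then have "u \<circ> ut = u" by simp
      then show False using comp(5) t(3) by simp
    qed
    show "ut \<noteq> u"
    proof
      assume "ut = u"
      then have "u \<circ> ut = id" using comp(1) by simp
      then show False using comp(5) t(2) by simp
    qed
    show "ut \<noteq> t"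
    proof
      assume "ut = t"
      then have "t \<circ> ut = id" using comp(2) by simp
      then show False using comp(7) u(2) by simp
    qed
  qed
  have ut: "ut \<in> V" unfolding ut_def by (rule V_comp[OF u(1) t(1)])
  have V4: "V = {id, u, t, ut}"
    using card_subset_eq[OF V_finite, of "{id, u, t, ut}"] V_card u t d ut V_id by auto
  define \<iota> where "\<iota> x = (if x = id then 1 else if x = u then p else if x = t then q else p * q)" for x
  have \<iota>: "\<iota> id = 1" "\<iota> u = p" "\<iota> t = q" "\<iota> ut = p * q" using u t d by (simp_all add: \<iota>_def)
  have "\<iota> ` V = \<Gamma>" unfolding V4 four by (simp add: \<iota>)
  then have "bij_betw \<iota> V \<Gamma>"
    using eq_card_imp_inj_on[OF V_finite, of \<iota>] by (simp add: bij_betw_def V_card card_\<Gamma>)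
  moreover have "\<iota> (v \<circ> w) = \<iota> v * \<iota> w" if "v \<in> V" "w \<in> V" for v w
  proof -
    have "v \<in> {id, u, t, ut}" "w \<in> {id, u, t, ut}" using that V4 by auto
    then show ?thesis by (elim insertE emptyE; simp add: \<iota> comp mult)
  qed
  ultimately show ?thesis by blast
qed

end

section \<open>The characters of \<open>V\<close> and the given cocycle\<close>

locale identified = matched H S G cc \<gamma> \<kappa> a c V
  for H :: "('k::{alg_closed_field, field_char_0}, 'h::ring_1) coalg" and S G cc \<gamma> \<kappa> a c and V +
  fixes \<iota> :: "(nat \<Rightarrow> nat) \<Rightarrow> 'h"
  assumes \<iota>_bij: "bij_betw \<iota> V \<Gamma>" and \<iota>_comp: "v \<in> V \<Longrightarrow> w \<in> V \<Longrightarrow> \<iota> (v \<circ> w) = \<iota> v * \<iota> w"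
begin

lemma \<iota>_\<Gamma>: "v \<in> V \<Longrightarrow> \<iota> v \<in> \<Gamma>"
  using \<iota>_bij by (auto simp: bij_betw_def)

lemma \<iota>_eq: "v \<in> V \<Longrightarrow> w \<in> V \<Longrightarrow> \<iota> v = \<iota> w \<longleftrightarrow> v = w"
  using \<iota>_bij by (auto simp: bij_betw_def inj_on_def)

lemma \<iota>_id: "\<iota> id = 1"
  using \<iota>_comp[OF V_id V_id] \<Gamma>_cancel_one(1)[OF \<iota>_\<Gamma>[OF V_id], of "\<iota> id"] by simp

lemma \<iota>_surj: "g \<in> \<Gamma> \<Longrightarrow> \<exists>v\<in>V. g = \<iota> v"
  using \<iota>_bij by (auto simp: bij_betw_def)

abbreviation CG :: "((nat \<Rightarrow> nat) \<Rightarrow> 'k) monoid" where "CG \<equiv> character_group (alt5_sub V)"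

text \<open>\<beta> identifies \<Gamma> with its character group; the restriction to
  \<open>V\<close> meets the extensionality demanded by \<open>character_group\<close>.\<close>

definition chr :: "'h \<Rightarrow> (nat \<Rightarrow> nat) \<Rightarrow> 'k"
  where "chr g = (\<lambda>w\<in>V. \<beta> g (\<iota> w))"

lemma CG_iff: "\<phi> \<in> carrier CG \<longleftrightarrow>
    (\<forall>v\<in>V. \<phi> v \<noteq> 0) \<and> (\<forall>v\<in>V. \<forall>w\<in>V. \<phi> (v \<circ> w) = \<phi> v * \<phi> w) \<and> \<phi> \<in> extensional V"
  by (auto simp: character_group_def hom_def field_units_def alt_group_mult)

lemma chr_CG: "g \<in> \<Gamma> \<Longrightarrow> chr g \<in> carrier CG"
  unfolding CG_iff by (simp add: chr_def V_comp \<iota>_comp \<beta>_mult_right \<iota>_\<Gamma>)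

lemma chr_mult: "g \<in> \<Gamma> \<Longrightarrow> h \<in> \<Gamma> \<Longrightarrow> chr g \<otimes>\<^bsub>CG\<^esub> chr h = chr (g * h)"
  by (auto simp: character_group_def chr_def \<beta>_mult_left \<iota>_\<Gamma> intro!: restrict_ext)

lemma chr_one: "\<one>\<^bsub>CG\<^esub> = chr 1"
  by (simp add: character_group_def chr_def)

lemma chr_inj: "inj_on chr \<Gamma>"
proof (rule inj_onI)
  fix g h assume g: "g \<in> \<Gamma>" "h \<in> \<Gamma>" and e: "chr g = chr h"
  have "\<beta> g k = \<beta> h k" if "k \<in> \<Gamma>" for k
  proof -
    obtain v where v: "v \<in> V" "k = \<iota> v" using \<iota>_surj[OF \<open>k \<in> \<Gamma>\<close>] by blast
    then show ?thesis using fun_cong[OF e, of v] by (simp add: chr_def)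
  qed
  then have "(\<Sum>k\<in>\<Gamma>. \<beta> g k * \<beta> h k) = (\<Sum>k\<in>\<Gamma>. 1)" by (intro sum.cong) simp_all
  then show "g = h" using \<beta>_orthogonal[OF g] card_\<Gamma> by (simp split: if_splits)
qed

text \<open>A character takes the values 1 and -1 and is determined by its signs at two generators;
  the four characters \<open>\<beta> s\<close> realise all four sign patterns.\<close>

lemma carrier_CG: "carrier CG = chr ` \<Gamma>"
proof
  show "chr ` \<Gamma> \<subseteq> carrier CG" using chr_CG by blast
  show "carrier CG \<subseteq> chr ` \<Gamma>"
  proof
    fix \<phi> assume "\<phi> \<in> carrier CG"
    then have nz: "\<And>v. v \<in> V \<Longrightarrow> \<phi> v \<noteq> 0" and mult: "\<And>v w. v \<in> V \<Longrightarrow> w \<in> V \<Longrightarrow> \<phi> (v \<circ> w) = \<phi> v * \<phi> w"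
      and ext: "\<phi> \<in> extensional V" unfolding CG_iff by blast+
    have "\<phi> id = 1" using mult[OF V_id V_id] nz[OF V_id] by simp
    then have sq: "\<phi> v = 1 \<or> \<phi> v = - 1" if "v \<in> V" for v
      using mult[OF that that] V_square[OF that] by (simp add: square_eq_1_iff)
    obtain p q where p: "p \<in> \<Gamma>" "p \<noteq> 1" and q: "q \<in> \<Gamma>" "q \<noteq> 1" "q \<noteq> p" using exists_pq by blast
    obtain u t where u: "u \<in> V" "p = \<iota> u" and t: "t \<in> V" "q = \<iota> t" using \<iota>_surj p q by metis
    have "\<exists>s\<in>\<Gamma>. \<phi> u = \<beta> s p \<and> \<phi> t = \<beta> s q"
    proof -
      have "\<beta> p q = - 1" "\<beta> q p = - 1" "\<beta> (p * q) p = - 1" "\<beta> (p * q) q = - 1"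
        using p q \<Gamma>_distinct[OF p q] by (simp_all add: \<beta>_def)
      then show ?thesis
        using sq[OF u(1)] sq[OF t(1)] p(1) q(1) \<Gamma>_mult[OF p(1) q(1)] \<Gamma>_one by (metis \<beta>_simps(2,3))
    qed
    then obtain s where s: "s \<in> \<Gamma>" "\<phi> u = \<beta> s p" "\<phi> t = \<beta> s q" by blast
    have "\<phi> v = \<beta> s (\<iota> v)" if v: "v \<in> V" for v
    proof -
      have eqv: "\<phi> v = \<beta> s (\<iota> w)" if "\<iota> v = \<iota> w" "\<phi> w = \<beta> s (\<iota> w)" "w \<in> V" for w
        using that v \<iota>_bij by (auto simp: bij_betw_def inj_on_def)
      have "\<iota> (u \<circ> t) = p * q" by (simp add: \<iota>_comp u t)
      moreover have "\<phi> (u \<circ> t) = \<beta> s (p * q)" using mult[OF u(1) t(1)] s p q by (simp add: \<beta>_mult_right)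
      moreover have "\<iota> v \<in> {1, p, q, p * q}" using \<iota>_\<Gamma>[OF v] \<Gamma>_four'[OF p q] by simp
      ultimately show ?thesis
        using eqv[of id] eqv[of u] eqv[of t] eqv[of "u \<circ> t"] \<open>\<phi> id = 1\<close> \<iota>_id s u t V_id V_comp[OF u(1) t(1)]
        by auto
    qed
    then have "\<phi> = chr s" using ext by (auto simp: chr_def fun_eq_iff extensional_def)
    then show "\<phi> \<in> chr ` \<Gamma>" using s(1) by blast
  qed
qed

text \<open>On the Klein four-group nondegeneracy forces the commutator of the cocycle to be \<open>\<beta>\<close>.\<close>

lemma coc_of_nondegenerate:
  assumes \<alpha>: "nondegenerate_2cocycle CG \<alpha>"
  shows "coc (\<lambda>g h. \<alpha> (chr g) (chr h))"
proof -
  define l where "l g h = \<alpha> (chr g) (chr h)" for g h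
  note A = \<alpha>[unfolded nondegenerate_2cocycle_def normalized_2cocycle_def nondegenerate_bicharacter_def]
  have nz: "l g h \<noteq> 0" if "g \<in> \<Gamma>" "h \<in> \<Gamma>" for g h using A chr_CG that by (auto simp: l_def)
  have cocycle: "l g h * l (g * h) k = l h k * l g (h * k)" if \<Gamma>: "g \<in> \<Gamma>" "h \<in> \<Gamma>" "k \<in> \<Gamma>" for g h k
  proof -
    have "\<alpha> (chr g) (chr h) * \<alpha> (chr g \<otimes>\<^bsub>CG\<^esub> chr h) (chr k) = \<alpha> (chr h) (chr k) * \<alpha> (chr g) (chr h \<otimes>\<^bsub>CG\<^esub> chr k)"
      using A chr_CG \<Gamma> by blast
    then show ?thesis by (simp add: chr_mult \<Gamma> l_def)
  qed
  have one: "l g 1 = 1" "l 1 g = 1" if "g \<in> \<Gamma>" for g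
    using A chr_CG[OF that] unfolding chr_one l_def by blast+
  have nd: "g = 1" if g: "g \<in> \<Gamma>" and c: "\<And>h. h \<in> \<Gamma> \<Longrightarrow> l g h * inverse (l h g) = 1" for g
  proof -
    have "\<forall>y\<in>carrier CG. \<alpha> (chr g) y * inverse (\<alpha> y (chr g)) = 1"
      using c unfolding carrier_CG l_def by blast
    then have "chr g = \<one>\<^bsub>CG\<^esub>" using A chr_CG[OF g] by blast
    then show ?thesis using inj_onD[OF chr_inj _ g \<Gamma>_one] by (simp add: chr_one)
  qed
  define b where "b g h = l g h / l h g" for g h
  have bm: "b g (h * k) = b g h * b g k" if \<Gamma>: "g \<in> \<Gamma>" "h \<in> \<Gamma>" "k \<in> \<Gamma>" for g h k
  proof -
    note N = nz[OF \<Gamma>(2,3)] nz[OF \<Gamma>(3,1)] nz[OF \<Gamma>(2,1)] nz[OF \<Gamma>(1) \<Gamma>_mult[OF \<Gamma>(2,3)]]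
      nz[OF \<Gamma>_mult[OF \<Gamma>(2,3)] \<Gamma>(1)] nz[OF \<Gamma>(2) \<Gamma>_mult[OF \<Gamma>(1,3)]]
    have 1: "l g (h * k) = l g h * l (g * h) k / l h k" using cocycle[OF \<Gamma>] N by (simp add: field_simps)
    have 2: "l (g * h) k = l g k * l h (g * k) / l h g"
      using cocycle[OF \<Gamma>(2,1,3)] N \<Gamma>_commute[OF \<Gamma>(2,1)] by (simp add: field_simps)
    have 3: "l (h * k) g = l k g * l h (g * k) / l h k"
      using cocycle[OF \<Gamma>(2,3,1)] N \<Gamma>_commute[OF \<Gamma>(3,1)] by (simp add: field_simps)
    show ?thesis unfolding b_def 1 2 3 using N by (simp add: field_simps)
  qed
  have b: "b g h = \<beta> g h" if \<Gamma>: "g \<in> \<Gamma>" "h \<in> \<Gamma>" for g h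
  proof (cases "g = 1 \<or> h = 1 \<or> g = h")
    case True
    then show ?thesis using \<Gamma> one nz by (auto simp: b_def \<beta>_def)
  next
    case False
    have b1: "b g 1 = 1" using one[OF \<Gamma>(1)] by (simp add: b_def)
    have bg: "b g g = 1" using nz[OF \<Gamma>(1,1)] by (simp add: b_def)
    have "b g h * b g h = 1" using bm[OF \<Gamma> \<Gamma>(2)] \<Gamma>_square[OF \<Gamma>(2)] b1 by simp
    moreover have "b g h \<noteq> 1"
    proof
      assume bh: "b g h = 1"
      have "b g k = 1" if "k \<in> \<Gamma>" for k
      proof -
        have "k \<in> {1, g, h, g * h}" using that \<Gamma>_four'[OF \<Gamma>(1) _ \<Gamma>(2)] False by auto
        then show ?thesis using b1 bg bh bm[OF \<Gamma>(1,1,2)] by auto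
      qed
      then have "g = 1" by (intro nd[OF \<Gamma>(1)]) (simp add: b_def divide_inverse)
      then show False using False by simp
    qed
    ultimately have "b g h = - 1" by (simp add: square_eq_1_iff)
    then show ?thesis using False by (simp add: \<beta>_def)
  qed
  have "l g h = \<beta> g h * l h g" if "g \<in> \<Gamma>" "h \<in> \<Gamma>" for g h
    using b[OF that] nz[OF that(2,1)] by (simp add: b_def field_simps)
  then have "coc l" unfolding coc_def using nz cocycle one by blast
  then show ?thesis by (simp add: l_def[abs_def])
qed

end

section \<open>The action of \<open>F\<close> on the cosets of \<open>PP\<close>\<close>

locale labelled = identified H S G cc \<gamma> \<kappa> a c V \<iota> + twisting H S G cc \<gamma> \<kappa> a c al
  for H :: "('k::{alg_closed_field, field_char_0}, 'h::ring_1) coalg" and S G cc \<gamma> \<kappa> a c al V \<iota>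
begin

lemma PP_inverse: "p \<in> PP \<Longrightarrow> \<exists>q\<in>PP. p * q = 1 \<and> q * p = 1"
proof -
  assume p: "p \<in> PP"
  have fin: "finite PP" by (rule finite_PP_XX)
  have F: "p \<in> F" using p PP_XX_F by blast
  have inj: "inj_on (\<lambda>q. p * q) PP" by (auto simp: inj_on_def F_cancel(1)[OF F])
  have "(\<lambda>q. p * q) ` PP = PP" by (rule endo_inj_surj[OF fin _ inj]) (auto intro: PP_mult p)
  then obtain q where q: "q \<in> PP" "p * q = 1" using \<Gamma>_PP[OF \<Gamma>_one] by (metis imageE)
  have "p * (q * p) = p * 1" using q(2) by (simp flip: mult.assoc)
  then have "q * p = 1" unfolding F_cancel(1)[OF F] .
  then show ?thesis using q by blast
qed

text \<open>Five labelled coset representatives of \<open>PP\<close> in \<open>F\<close>; \<open>V\<close> permutes the labels as \<open>\<Gamma>\<close> permutes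
  the cosets.\<close>

lemma coset_labels:
  obtains l :: "'h \<Rightarrow> nat" and r :: "nat \<Rightarrow> 'h"
  where "\<And>i. i \<in> {1..5} \<Longrightarrow> r i \<in> F" "\<And>y. y \<in> F \<Longrightarrow> l y \<in> {1..5}" "\<And>i. i \<in> {1..5} \<Longrightarrow> l (r i) = i"
    "\<And>y. y \<in> F \<Longrightarrow> \<exists>p\<in>PP. r (l y) = y * p" "\<And>y p. y \<in> F \<Longrightarrow> p \<in> PP \<Longrightarrow> l (y * p) = l y"
    "\<And>v i. v \<in> V \<Longrightarrow> i \<in> {1..5} \<Longrightarrow> l (\<iota> v * r i) = v i" "\<exists>i\<in>{1..5}. r i = 1"
proof -
  obtain p0 p1 where p0: "p0 \<in> {1..5}" and fix0: "\<And>v. v \<in> V \<Longrightarrow> v p0 = p0"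
    and p1: "bij_betw (\<lambda>v. v p1) V ({1..5} - {p0})" using V_points by blast
  have "PP \<noteq> F" using card_PP F_basis(2) by auto
  then obtain y0 where y0: "y0 \<in> F" "y0 \<notin> PP" using PP_XX_F by blast
  \<comment> \<open>\<open>\<Gamma>_free\<close> keeps the four cosets of \<iota> v * y0 apart;
    together with \<open>PP\<close> they exhaust \<open>F\<close>, as 4 * 12 + 12 = 60.\<close>
  have key: "v = w \<and> p = q" if v: "v \<in> V" "w \<in> V" "p \<in> PP" "q \<in> PP" and e: "\<iota> v * y0 * p = \<iota> w * y0 * q" for v w p q
  proof -
    obtain q' where q': "q' \<in> PP" "p * q' = 1" using PP_inverse v by blast
    have "\<iota> w * (\<iota> v * y0 * p) * q' = \<iota> w * (\<iota> w * y0 * q) * q'" by (simp only: e)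
    then have "(\<iota> w * \<iota> v) * y0 = y0 * (q * q')"
      using \<Gamma>_cancel_square[OF \<iota>_\<Gamma>[OF v(2)]] q'(2) by (simp add: mult.assoc)
    then have "\<iota> w * \<iota> v = 1"
      by (intro \<Gamma>_free[OF y0]) (simp_all add: \<Gamma>_mult \<iota>_\<Gamma> v PP_mult q')
    then have "v = w" using \<Gamma>_eq_one_iff[OF \<iota>_\<Gamma>[OF v(2)]] v by (simp add: \<iota>_eq)
    moreover have "\<iota> w * y0 \<in> F" using v y0 by (simp add: F_mult \<Gamma>_F \<iota>_\<Gamma>)
    ultimately show ?thesis using e F_cancel(1) by auto
  qed
  let ?m = "\<lambda>(v, p). \<iota> v * y0 * p"
  have inj: "inj_on ?m (V \<times> PP)" using key by (auto simp: inj_on_def)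
  have notP: "\<iota> v * y0 * p \<in> F - PP" if "v \<in> V" "p \<in> PP" for v p
  proof -
    have "\<iota> v * y0 * p \<in> F" using that PP_XX_F y0 by (auto simp: F_mult \<Gamma>_F \<iota>_\<Gamma>)
    moreover have "\<iota> v * y0 * p \<notin> PP"
    proof
      assume P: "\<iota> v * y0 * p \<in> PP"
      obtain q where q: "q \<in> PP" "p * q = 1" using PP_inverse[OF \<open>p \<in> PP\<close>] by blast
      have "\<iota> v * (\<iota> v * y0 * p) * q \<in> PP" using PP_mult[OF PP_mult[OF \<Gamma>_PP[OF \<iota>_\<Gamma>[OF that(1)]] P] q(1)] .
      then show False using y0 q \<Gamma>_cancel_square[OF \<iota>_\<Gamma>[OF that(1)]] by (simp add: mult.assoc)
    qed
    ultimately show ?thesis by blast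
  qed
  have "card (?m ` (V \<times> PP)) = 48"
    unfolding card_image[OF inj] by (simp add: card_cartesian_product V_card card_PP)
  moreover have "card (F - PP) = 48"
    using card_Diff_subset[OF finite_PP_XX(1) PP_XX_F(1)] by (simp add: F_basis card_PP)
  ultimately have img: "?m ` (V \<times> PP) = F - PP"
    using notP by (intro card_subset_eq) (auto simp: F_basis)
  \<comment> \<open>The coset \<open>PP\<close>, fixed by \<Gamma>, gets the point fixed by
    \<open>V\<close>, and the coset of \<iota> v * y0 gets v p1. So labels transform under \<Gamma>
    exactly as points do under \<open>V\<close>.\<close>
  define l where "l y = (if y \<in> PP then p0 else (THE v. v \<in> V \<and> (\<exists>p\<in>PP. y = \<iota> v * y0 * p)) p1)" for y
  define r where "r i = (if i = p0 then 1 else \<iota> (THE v. v \<in> V \<and> v p1 = i) * y0)" for i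
  have lP: "l y = p0" if "y \<in> PP" for y using that by (simp add: l_def)
  have lX: "l (\<iota> v * y0 * p) = v p1" if "v \<in> V" "p \<in> PP" for v p
  proof -
    have "(THE w. w \<in> V \<and> (\<exists>q\<in>PP. \<iota> v * y0 * p = \<iota> w * y0 * q)) = v"
      by (rule the_equality) (use that key in blast)+
    then show ?thesis using notP[OF that] by (simp add: l_def)
  qed
  have r0: "r p0 = 1" by (simp add: r_def)
  have vp1: "v p1 \<in> {1..5} - {p0}" if "v \<in> V" for v using bij_betwE[OF p1] that by blast
  have rX: "r (v p1) = \<iota> v * y0" if "v \<in> V" for v
  proof -
    have "(THE w. w \<in> V \<and> w p1 = v p1) = v"
      by (rule the_equality) (use that p1 in \<open>auto simp: bij_betw_def inj_on_def\<close>)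
    then show ?thesis using vp1[OF that] by (simp add: r_def)
  qed
  have idx: "i = p0 \<or> (\<exists>v\<in>V. i = v p1)" if "i \<in> {1..5}" for i
    using that p1 by (auto simp: bij_betw_def)
  have els: "y \<in> PP \<or> (\<exists>v\<in>V. \<exists>p\<in>PP. y = \<iota> v * y0 * p)" if "y \<in> F" for y
    using that img by (auto simp: set_eq_iff image_iff)
  have lX1: "l (\<iota> v * y0) = v p1" if "v \<in> V" for v
    using lX[OF that \<Gamma>_PP[OF \<Gamma>_one]] by simp
  show thesis
  proof
    fix i :: nat assume i: "i \<in> {1..5}"
    show "r i \<in> F" using idx[OF i] using y0 by (auto simp: r0 rX F_one F_mult \<Gamma>_F \<iota>_\<Gamma>)
    show "l (r i) = i" using idx[OF i] by (auto simp: r0 rX lX1 lP \<Gamma>_PP \<Gamma>_one)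
    fix v assume v: "v \<in> V"
    show "l (\<iota> v * r i) = v i"
    proof (cases "i = p0")
      case True
      then show ?thesis using fix0[OF v] by (simp add: r0 lP \<Gamma>_PP \<iota>_\<Gamma> v)
    next
      case False
      then obtain w where w: "w \<in> V" "i = w p1" using idx[OF i] by blast
      have "\<iota> v * (\<iota> w * y0) = \<iota> (v \<circ> w) * y0" by (simp add: \<iota>_comp v w mult.assoc)
      then show ?thesis using lX1[OF V_comp[OF v w(1)]] by (simp add: w rX)
    qed
  next
    fix y assume y: "y \<in> F"
    show "l y \<in> {1..5}" using els[OF y] p0 vp1 by (auto simp: lP lX)
    show "\<exists>p\<in>PP. r (l y) = y * p"
      using els[OF y]
    proof
      assume P: "y \<in> PP"
      obtain q where "q \<in> PP" "y * q = 1" using PP_inverse[OF P] by blast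
      then show ?thesis by (intro bexI[of _ q]) (simp_all add: lP[OF P] r0)
    next
      assume "\<exists>v\<in>V. \<exists>p\<in>PP. y = \<iota> v * y0 * p"
      then obtain v p where vp: "v \<in> V" "p \<in> PP" "y = \<iota> v * y0 * p" by blast
      obtain q where "q \<in> PP" "p * q = 1" using PP_inverse[OF vp(2)] by blast
      then show ?thesis by (intro bexI[of _ q]) (simp_all add: vp rX lX[OF vp(1,2), unfolded mult.assoc] mult.assoc)
    qed
    fix p assume p: "p \<in> PP"
    show "l (y * p) = l y"
      using els[OF y]
    proof
      assume "y \<in> PP"
      then show ?thesis using p by (simp add: lP PP_mult)
    next
      assume "\<exists>v\<in>V. \<exists>p\<in>PP. y = \<iota> v * y0 * p"
      then obtain v q where "v \<in> V" "q \<in> PP" "y = \<iota> v * y0 * q" by blast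
      then show ?thesis using lX[of v "q * p"] p by (simp add: mult.assoc PP_mult lX[unfolded mult.assoc])
    qed
  next
    show "\<exists>i\<in>{1..5}. r i = 1" using p0 r0 by blast
  qed
qed

lemma F_right_inverse: "x \<in> F \<Longrightarrow> \<exists>y\<in>F. x * y = 1"
  using group.r_inv[OF group_Fm, of x] group.inv_closed[OF group_Fm, of x] by auto

text \<open>Lagrange for \<Gamma> inside \<open>E\<close>; it will exclude a subgroup of order
  30.\<close>

lemma \<Gamma>_subgroup_order_dvd:
  assumes E: "E \<subseteq> F" "\<Gamma> \<subseteq> E" "\<And>x y. x \<in> E \<Longrightarrow> y \<in> E \<Longrightarrow> x * y \<in> E"
  shows "4 dvd card E"
proof -
  have fin: "finite E" using E(1) F_basis(1) finite_subset by blast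
  let ?E = "\<lparr>carrier = E, mult = (*), one = 1\<rparr> :: 'h monoid"
  have inv: "\<exists>y\<in>E. y * x = 1" if x: "x \<in> E" for x
  proof -
    have "inj_on (\<lambda>y. y * x) E" using F_cancel(2) E(1) x by (auto simp: inj_on_def subset_iff)
    then have "(\<lambda>y. y * x) ` E = E" by (intro endo_inj_surj fin) (auto intro: E x)
    moreover have "1 \<in> E" using E(2) \<Gamma>_one by blast
    ultimately show ?thesis by (metis imageE)
  qed
  interpret E: group ?E
    by (rule groupI) (use E \<Gamma>_one inv in \<open>auto simp: mult.assoc\<close>)
  have "subgroup \<Gamma> ?E"
  proof (rule E.subgroupI)
    fix g assume g: "g \<in> \<Gamma>"
    have "inv\<^bsub>?E\<^esub> g = g" using E(2) g \<Gamma>_square[OF g] by (intro E.inv_equality) auto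
    then show "inv\<^bsub>?E\<^esub> g \<in> \<Gamma>" using g by simp
  qed (use E(2) \<Gamma>_one \<Gamma>_mult in auto)
  from E.lagrange[OF this] show ?thesis by (simp add: order_def card_\<Gamma>) (metis dvd_triv_right)
qed

text \<open>An element of the kernel fixes the trivial coset, so it lies in \<open>PP\<close> and
  normalises \<Gamma>; as \<pi> is injective on \<Gamma>, it centralises \<Gamma>, hence lies in
  \<Gamma> and is 1. If some element acted oddly, the evenly acting elements would form a subgroup
  of order 30 containing \<Gamma>, although 4 does not divide 30.\<close>

lemma permutation_representation:
  obtains \<pi> where "bij_betw \<pi> F (carrier (alt_group 5))"
    "\<And>x y. x \<in> F \<Longrightarrow> y \<in> F \<Longrightarrow> \<pi> (x * y) = \<pi> x \<circ> \<pi> y" "\<And>v. v \<in> V \<Longrightarrow> \<pi> (\<iota> v) = v"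
proof -
  obtain l :: "'h \<Rightarrow> nat" and r :: "nat \<Rightarrow> 'h" where
    r: "\<And>i. i \<in> {1..5} \<Longrightarrow> r i \<in> F" and l: "\<And>y. y \<in> F \<Longrightarrow> l y \<in> {1..5}"
    and lr: "\<And>i. i \<in> {1..5} \<Longrightarrow> l (r i) = i" and rl: "\<And>y. y \<in> F \<Longrightarrow> \<exists>p\<in>PP. r (l y) = y * p"
    and lp: "\<And>y p. y \<in> F \<Longrightarrow> p \<in> PP \<Longrightarrow> l (y * p) = l y"
    and lV: "\<And>v i. v \<in> V \<Longrightarrow> i \<in> {1..5} \<Longrightarrow> l (\<iota> v * r i) = v i"
    and r1: "\<exists>i\<in>{1..5}. r i = 1"
    by (rule coset_labels) blast
  define \<pi> where "\<pi> x i = (if i \<in> {1..5} then l (x * r i) else i)" for x i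
  have in5: "\<pi> x i \<in> {1..5}" if "x \<in> F" "i \<in> {1..5}" for x i
    unfolding \<pi>_def if_P[OF that(2)] by (intro l F_mult that r)
  have \<pi>l: "\<pi> x (l y) = l (x * y)" if "x \<in> F" "y \<in> F" for x y
  proof -
    obtain p where p: "p \<in> PP" "r (l y) = y * p" using rl[OF \<open>y \<in> F\<close>] by blast
    have "\<pi> x (l y) = l (x * y * p)" unfolding \<pi>_def if_P[OF l[OF that(2)]] p(2) by (simp only: mult.assoc)
    then show ?thesis using lp[OF F_mult[OF that] p(1)] by simp
  qed
  have mult: "\<pi> (x * y) = \<pi> x \<circ> \<pi> y" if "x \<in> F" "y \<in> F" for x y
  proof
    fix i
    show "\<pi> (x * y) i = (\<pi> x \<circ> \<pi> y) i"
    proof (cases "i \<in> {1..5}")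
      case True
      then have "\<pi> y i = l (y * r i)" "\<pi> (x * y) i = l (x * (y * r i))" by (simp_all add: \<pi>_def mult.assoc)
      then show ?thesis using \<pi>l[OF that(1) F_mult[OF that(2) r[OF True]]] by simp
    next
      case False
      then have "\<pi> z i = i" for z unfolding \<pi>_def by (rule if_not_P)
      then show ?thesis by simp
    qed
  qed
  have \<pi>1: "\<pi> 1 = id" using lr by (auto simp: \<pi>_def fun_eq_iff)
  have perm: "\<pi> x permutes {1..5}" if x: "x \<in> F" for x
  proof -
    obtain y where y: "y \<in> F" "x * y = 1" using F_right_inverse[OF x] by blast
    obtain z where z: "z \<in> F" "z * x = 1" using F_left_inverse[OF x] by blast
    have "\<pi> x \<circ> \<pi> y = id" "\<pi> z \<circ> \<pi> x = id" using mult[OF x y(1)] mult[OF z(1) x] y z \<pi>1 by simp_all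
    then have "\<pi> x (\<pi> y i) = i" "\<pi> z (\<pi> x i) = i" for i by (metis comp_apply id_apply)+
    then have "bij (\<pi> x)" by (intro bijI) (metis injI, metis surjI)
    moreover have "\<pi> x i = i" if "i \<notin> {1..5}" for i unfolding \<pi>_def by (rule if_not_P[OF that])
    ultimately show ?thesis unfolding permutes_def bij_iff by blast
  qed
  have \<pi>V: "\<pi> (\<iota> v) = v" if v: "v \<in> V" for v
  proof
    fix i
    show "\<pi> (\<iota> v) i = v i"
      using lV[OF v, of i] permutes_not_in[OF V_perm(1)[OF v], of i] by (simp add: \<pi>_def)
  qed
  have \<Gamma>_inj: "g = h" if "g \<in> \<Gamma>" "h \<in> \<Gamma>" "\<pi> g = \<pi> h" for g h
  proof -
    obtain v w where "v \<in> V" "g = \<iota> v" "w \<in> V" "h = \<iota> w" using \<iota>_surj \<open>g \<in> \<Gamma>\<close> \<open>h \<in> \<Gamma>\<close> by blast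
    then show ?thesis using that(3) \<pi>V by simp
  qed
  have ker: "x = 1" if x: "x \<in> F" "\<pi> x = id" for x
  proof -
    obtain i where i: "i \<in> {1..5}" "r i = 1" using r1 by blast
    have "l x = \<pi> x i" using i by (simp add: \<pi>_def)
    then have "l x = i" using x by simp
    then obtain p where p: "p \<in> PP" "1 = x * p" using rl[OF x(1)] i by auto
    obtain q where q: "q \<in> PP" "p * q = 1" using PP_inverse[OF p(1)] by blast
    have "x * p * q = q" using p(2) by simp
    then have "x = q" using q(2) by (simp add: mult.assoc)
    then have xP: "x \<in> PP" using q(1) by simp
    then obtain j where c: "\<And>g. g \<in> \<Gamma> \<Longrightarrow> x * g = cnj (a ^ j) g * x" using PP_\<Gamma>_commute by blast
    have "x * g = g * x" if g: "g \<in> \<Gamma>" for g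
    proof -
      have g': "cnj (a ^ j) g \<in> \<Gamma>" by (rule cnj_\<Gamma>[OF a_pow_G g])
      have "\<pi> (x * g) = \<pi> (cnj (a ^ j) g * x)" by (simp only: c[OF g])
      then have "\<pi> g = \<pi> (cnj (a ^ j) g)" by (simp add: mult x \<Gamma>_F g g')
      then show ?thesis using \<Gamma>_inj[OF g g'] c[OF g] by simp
    qed
    then have "x \<in> \<Gamma>" by (rule PP_centraliser[OF xP])
    then show ?thesis using \<Gamma>_inj[OF _ \<Gamma>_one] x(2) \<pi>1 by simp
  qed
  have inj: "inj_on \<pi> F"
  proof (rule inj_onI)
    fix x y assume xy: "x \<in> F" "y \<in> F" "\<pi> x = \<pi> y"
    obtain z where z: "z \<in> F" "z * x = 1" using F_left_inverse[OF xy(1)] by blast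
    have "\<pi> (z * y) = \<pi> (z * x)" by (simp add: mult z(1) xy)
    then have "z * y = z * x" using ker[OF F_mult[OF z(1) xy(2)]] z(2) \<pi>1 by simp
    then show "x = y" using F_cancel(1)[OF z(1)] by simp
  qed
  have pm: "permutation (\<pi> x)" if "x \<in> F" for x using perm[OF that] permutation_permutes by blast
  have even: "evenperm (\<pi> o')" if o: "o' \<in> F" for o'
  proof (rule ccontr)
    assume odd: "\<not> evenperm (\<pi> o')"
    define E where "E = {x \<in> F. evenperm (\<pi> x)}"
    have ev: "evenperm (\<pi> (x * y)) \<longleftrightarrow> evenperm (\<pi> x) = evenperm (\<pi> y)" if "x \<in> F" "y \<in> F" for x y
      using that by (simp add: mult evenperm_comp pm)
    obtain o2 where o2: "o2 \<in> F" "o2 * o' = 1" using F_left_inverse[OF o] by blast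
    have o2odd: "\<not> evenperm (\<pi> o2)" using ev[OF o2(1) o] o2(2) odd \<pi>1 by simp
    have o3: "o' * o2 = 1"
    proof -
      have "o2 * (o' * o2) = o2 * 1" using o2(2) by (simp flip: mult.assoc)
      then show ?thesis unfolding F_cancel(1)[OF o2(1)] .
    qed
    have "card E = card (F - E)"
    proof (rule bij_betw_same_card[OF bij_betw_byWitness[where f = "\<lambda>x. o' * x" and f' = "\<lambda>x. o2 * x"]])
      show "\<forall>x\<in>E. o2 * (o' * x) = x" using o2(2) by (simp flip: mult.assoc)
      show "\<forall>x\<in>F - E. o' * (o2 * x) = x" using o3 by (simp flip: mult.assoc)
      show "(\<lambda>x. o' * x) ` E \<subseteq> F - E" using ev[OF o] odd F_mult[OF o] by (auto simp: E_def)
      show "(\<lambda>x. o2 * x) ` (F - E) \<subseteq> E" using ev[OF o2(1)] o2odd F_mult[OF o2(1)] by (auto simp: E_def)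
    qed
    moreover have "card F = card E + card (F - E)"
    proof -
      have "card (F - E) = card F - card E" by (rule card_Diff_subset) (auto simp: E_def F_basis)
      moreover have "card E \<le> card F" by (rule card_mono) (auto simp: E_def F_basis)
      ultimately show ?thesis by simp
    qed
    ultimately have "card E = 30" using F_basis(2) by simp
    moreover have "4 dvd card E"
    proof (rule \<Gamma>_subgroup_order_dvd)
      show "\<Gamma> \<subseteq> E"
      proof
        fix g assume g: "g \<in> \<Gamma>"
        obtain v where "v \<in> V" "g = \<iota> v" using \<iota>_surj[OF g] by blast
        then show "g \<in> E" using \<pi>V V_perm(2) \<Gamma>_F[OF g] by (simp add: E_def)
      qed
    qed (auto simp: E_def ev F_mult)
    ultimately show False by simp
  qed
  have "\<pi> ` F \<subseteq> carrier (alt_group 5)" using perm even by (auto simp: alt_group_carrier)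
  moreover have "card (\<pi> ` F) = card (carrier (alt_group 5))"
    by (simp add: card_image[OF inj] F_basis card_alt_group_5)
  moreover have "finite (carrier (alt_group 5))" using card_alt_group_5 card.infinite by fastforce
  ultimately have "\<pi> ` F = carrier (alt_group 5)" by (intro card_subset_eq)
  then show thesis using that inj mult \<pi>V by (simp add: bij_betw_def)
qed

end

section \<open>The isomorphism\<close>

lemma finite_alt5: "finite (UNIV :: alt5 set)"
proof -
  have "finite (carrier (alt_group 5))" using card_alt_group_5 card.infinite by fastforce
  moreover have "(UNIV :: alt5 set) = Abs_alt5 ` carrier (alt_group 5)"
    using type_definition.Abs_image[OF type_definition_alt5] by simp
  ultimately show ?thesis by (metis finite_imageI)
qed

lemma bij_Abs_alt5: "bij_betw Abs_alt5 (carrier (alt_group 5)) UNIV"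
  by (rule bij_betw_byWitness[where f' = Rep_alt5]) (auto simp: Abs_alt5_inverse Rep_alt5_inverse Rep_alt5)

section \<open>The group algebra of the alternating group\<close>

abbreviation kA5 :: "('k::field, alt5 \<Rightarrow>\<^sub>0 'k) coalg" where "kA5 \<equiv> group_algebra"

lemma scal_kA5: "scal kA5 c x = Poly_Mapping.single 0 c * x"
  by (simp add: group_algebra_def Let_def mult_map_scale_conv_mult)

lemma scal_kA5_single: "scal kA5 c (Poly_Mapping.single g r) = Poly_Mapping.single g (c * r)"
  by (simp add: scal_kA5 mult_single)

lemma lookup_scal_kA5: "Poly_Mapping.lookup (scal kA5 c x) g = c * Poly_Mapping.lookup x g"
  by (simp add: group_algebra_def Let_def Poly_Mapping.map.rep_eq when_def)

lemma tensor_algebra_kA5: "tensor_algebra (kA5 :: ('k::field, alt5 \<Rightarrow>\<^sub>0 'k) coalg)"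
proof
  fix c d :: 'k and x y :: "alt5 \<Rightarrow>\<^sub>0 'k"
  show "scal kA5 c (x + y) = scal kA5 c x + scal kA5 c y" by (simp add: scal_kA5 distrib_left)
  show "scal kA5 (c + d) x = scal kA5 c x + scal kA5 d x" by (simp add: scal_kA5 distrib_right single_add)
  show "scal kA5 c (scal kA5 d x) = scal kA5 (c * d) x" by (simp add: scal_kA5 mult_single flip: mult.assoc)
  show "scal kA5 1 x = x" by (simp add: scal_kA5)
  show "scal kA5 c x * y = scal kA5 c (x * y)" by (simp add: scal_kA5 mult.assoc)
  have central: "x * Poly_Mapping.single 0 c = Poly_Mapping.single 0 c * x"
  proof -
    have x: "x = (\<Sum>g\<in>UNIV. Poly_Mapping.single g (Poly_Mapping.lookup x g))"
      by (rule poly_mapping_eqI) (simp add: lookup_sum lookup_single when_def finite_alt5)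
    show ?thesis
      by (subst (1 2) x) (simp add: sum_distrib_left sum_distrib_right mult_single mult.commute)
  qed
  show "x * scal kA5 c y = scal kA5 c (x * y)"
    by (simp add: scal_kA5 central flip: mult.assoc)
qed

lemma comult_kA5: "comult kA5 x =
    (\<Sum>g\<in>UNIV. tens_scale (Poly_Mapping.lookup x g) (tens2 kA5 (Poly_Mapping.single g 1) (Poly_Mapping.single g 1)))"
proof -
  have "comult kA5 x = (\<Sum>g\<in>Poly_Mapping.keys x.
      tens_scale (Poly_Mapping.lookup x g) (tens2 kA5 (Poly_Mapping.single g 1) (Poly_Mapping.single g 1)))"
    by (simp add: group_algebra_def Let_def)
  also have "\<dots> = (\<Sum>g\<in>UNIV. tens_scale (Poly_Mapping.lookup x g) (tens2 kA5 (Poly_Mapping.single g 1) (Poly_Mapping.single g 1)))"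
    by (rule sum.mono_neutral_left)
      (auto simp: finite_alt5 in_keys_iff tensor_algebra.tens_scale_simps[OF tensor_algebra_kA5])
  finally show ?thesis .
qed

lemma counit_kA5: "counit kA5 x = (\<Sum>g\<in>UNIV. Poly_Mapping.lookup x g)"
proof -
  have "counit kA5 x = (\<Sum>g\<in>Poly_Mapping.keys x. Poly_Mapping.lookup x g)"
    by (simp add: group_algebra_def Let_def)
  also have "\<dots> = (\<Sum>g\<in>UNIV. Poly_Mapping.lookup x g)"
    by (rule sum.mono_neutral_left) (auto simp: finite_alt5 in_keys_iff)
  finally show ?thesis .
qed

lemma comult_kA5_linear:
  "comult kA5 (scal kA5 c x + y) = tens_scale c (comult kA5 x) + comult kA5 y"
  "comult kA5 0 = 0" "comult kA5 x \<in> tens2_space kA5 UNIV"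
proof -
  note A = tensor_algebra_kA5
  note tens_scale = tensor_algebra.tens_scale_simps[OF A] tensor_algebra.tens_scale_sum[OF A]
  show "comult kA5 (scal kA5 c x + y) = tens_scale c (comult kA5 x) + comult kA5 y" "comult kA5 0 = 0"
    by (simp_all add: comult_kA5 lookup_add lookup_scal_kA5 sum.distrib tens_scale)
  show "comult kA5 x \<in> tens2_space kA5 UNIV"
    unfolding comult_kA5 by (intro tensor_algebra.T_sum[OF A] tensor_algebra.T_scale[OF A] tensor_algebra.T_ten[OF A])
qed

lemma comult_kA5_single: "comult kA5 (Poly_Mapping.single g 1) = tens2 kA5 (Poly_Mapping.single g 1) (Poly_Mapping.single g 1)"
proof -
  have "comult kA5 (Poly_Mapping.single g 1) = (\<Sum>h\<in>UNIV. if h = g then tens2 kA5 (Poly_Mapping.single g 1) (Poly_Mapping.single g 1) else 0)"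
    unfolding comult_kA5
    by (rule sum.cong) (auto simp: lookup_single when_def tensor_algebra.tens_scale_simps[OF tensor_algebra_kA5])
  then show ?thesis by (simp add: finite_alt5)
qed

section \<open>Tensor squares of algebra homomorphisms and inverses of twists\<close>

context tensor_algebra
begin

context
  fixes A :: "('k, 'l::ring_1) coalg" and f :: "'h \<Rightarrow> 'l"
  assumes A: "tensor_algebra A" and f: "Vector_Spaces.linear (scal H) (scal A) f"
begin

lemma map_bilin: "bilin tens_scale (\<lambda>x y. tens2 A (f x) (f y))"
  by (intro bilinI tens_scale_vector_space) (simp_all add: lin_simps[OF f] tensor_algebra.ten_simps[OF A])

lemmas tens2_map_simps =
  lift_zero[OF tens_scale_vector_space map_bilin, folded tens2_map_def]
  lift_ten[OF tens_scale_vector_space map_bilin, folded tens2_map_def]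
  lift_add[OF tens_scale_vector_space map_bilin, folded tens2_map_def]
  lift_scale[OF tens_scale_vector_space map_bilin, folded tens2_map_def]

lemmas tens2_map_sum = lift_sum[OF tens_scale_vector_space map_bilin, folded tens2_map_def]

lemma tens2_map_T: "t \<in> T \<Longrightarrow> tens2_map H A f t \<in> tens2_space A UNIV"
proof (induction rule: T_induct)
  case zero
  then show ?case by (simp add: tens2_map_simps tensor_algebra.T_zero[OF A])
next
  case (add x y t)
  then show ?case
    by (simp add: tens2_map_simps tensor_algebra.T_add[OF A] tensor_algebra.T_ten[OF A])
qed

lemma tens2_map_mult:
  assumes mult: "\<And>x y. f (x * y) = f x * f y" and t: "t \<in> T" and u: "u \<in> T"
  shows "tens2_map H A f (tens_mult H t u) = tens_mult A (tens2_map H A f t) (tens2_map H A f u)"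
proof -
  note a = tensor_algebra.tmult_ten[OF A] tensor_algebra.tmult_zero_left[OF A] tensor_algebra.tmult_zero_right[OF A]
    tensor_algebra.tmult_add_left[OF A] tensor_algebra.tmult_add_right[OF A] tensor_algebra.T_ten[OF A] tens2_map_T
  have 1: "tens2_map H A f (tens_mult H (x \<boxtimes> y) u) = tens_mult A (tens2_map H A f (x \<boxtimes> y)) (tens2_map H A f u)" for x y
    using u
  proof (induction rule: T_induct)
    case zero
    then show ?case by (simp add: tens2_map_simps tmult_zero_right a)
  next
    case (add p q u)
    then show ?case by (simp add: tens2_map_simps tmult_add_right tmult_ten a mult)
  qed
  show ?thesis using t
  proof (induction rule: T_induct)
    case zero
    then show ?case using u by (simp add: tens2_map_simps tmult_zero_left a)
  next
    case (add p q t)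
    then show ?case using u by (simp add: tens2_map_simps(3) tmult_add_left a 1)
  qed
qed

end

lemma tens_inverse_eq:
  assumes J: "J \<in> T" "J' \<in> T" "tens_mult H J J' = 1 \<boxtimes> 1" "tens_mult H J' J = 1 \<boxtimes> 1"
  shows "tens_inverse H J = J'"
  unfolding tens_inverse_def
proof (rule the_equality)
  fix I assume I: "I \<in> T \<and> tens_mult H J I = 1 \<boxtimes> 1 \<and> tens_mult H I J = 1 \<boxtimes> 1"
  have "I = tens_mult H I (tens_mult H J J')" using I J(3) by (simp add: tmult_one)
  also have "\<dots> = tens_mult H (tens_mult H I J) J'"
    by (rule tmult_assoc[symmetric]) (use I J in auto)
  also have "\<dots> = J'" using I J by (simp add: tmult_one)
  finally show "I = J'" .
qed (use J in simp)

end

context labelled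
begin

text \<open>\<open>F\<close> is a basis of \<open>H\<close>, so \<pi> extends linearly to an algebra
  isomorphism \<open>f\<close>. It sends the idempotents \<epsilon> to those of the characters,
  hence \<open>J\<close> to the given twist, and on \<open>F\<close> the defining equation of
  \<open>F\<close> is compatibility with the twisted comultiplication.\<close>

lemma hopf_isomorphism:
  fixes \<alpha> :: "((nat \<Rightarrow> nat) \<Rightarrow> 'k) \<Rightarrow> ((nat \<Rightarrow> nat) \<Rightarrow> 'k) \<Rightarrow> 'k"
  assumes al\<alpha>: "\<And>g h. al g h = \<alpha> (chr g) (chr h)"
  shows "hopf_isomorphic H (twisted_alt5_algebra V \<alpha>)"
proof -
  obtain \<pi> where \<pi>: "bij_betw \<pi> F (carrier (alt_group 5))"
    and \<pi>_mult: "\<And>x y. x \<in> F \<Longrightarrow> y \<in> F \<Longrightarrow> \<pi> (x * y) = \<pi> x \<circ> \<pi> y" and \<pi>_\<iota>: "\<And>v. v \<in> V \<Longrightarrow> \<pi> (\<iota> v) = v"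
    by (rule permutation_representation) blast
  define e where "e x = Abs_alt5 (\<pi> x)" for x
  have e_bij: "bij_betw e F UNIV"
  proof -
    have "e = Abs_alt5 \<circ> \<pi>" by (simp add: fun_eq_iff e_def)
    then show ?thesis using bij_betw_trans[OF \<pi> bij_Abs_alt5] by simp
  qed
  have \<pi>C: "\<pi> x \<in> carrier (alt_group 5)" if "x \<in> F" for x using bij_betwE[OF \<pi>] that by blast
  have e_mult: "e (x * y) = e x + e y" if "x \<in> F" "y \<in> F" for x y
    using that by (simp add: e_def plus_alt5_def Abs_alt5_inverse \<pi>C \<pi>_mult alt_group_mult)
  have e_one: "e 1 = 0" using e_mult[OF F_one F_one] add_left_imp_eq[of "e 1" "e 1" 0] by simp
  note ind = F_basis(3)
  have sp: "x \<in> span F" for x by (simp add: F_basis)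
  define f where "f h = (\<Sum>x\<in>F. Poly_Mapping.single (e x) (representation F h x))" for h
  have f_lin: "Vector_Spaces.linear (scal H) (scal kA5) f"
    by (rule linearI[OF vector_space_axioms])
      (simp_all add: tensor_algebra.axioms(1)[OF tensor_algebra_kA5] f_def representation_add[OF ind sp sp] single_add sum.distrib
        representation_scale[OF ind sp] scal_kA5 sum_distrib_left mult_single)
  note f_simps = lin_simps[OF f_lin]
  have fF: "f x = Poly_Mapping.single (e x) 1" if x: "x \<in> F" for x
  proof -
    have "f x = (\<Sum>y\<in>F. if y = x then Poly_Mapping.single (e x) 1 else 0)"
      unfolding f_def by (rule sum.cong) (auto simp: representation_basis[OF ind x])
    then show ?thesis using x F_basis(1) by simp
  qed
  have F_induct: "P h" if "P 0" "\<And>s x y. x \<in> F \<Longrightarrow> P y \<Longrightarrow> P (hscal s x + y)" for P h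
    using sp[of h] by (induction rule: span_induct_alt) (use that in auto)
  have f_bij: "bij f"
  proof -
    define g where "g p = (\<Sum>x\<in>F. hscal (Poly_Mapping.lookup p (e x)) x)" for p
    have "Poly_Mapping.lookup (f h) (e x) = representation F h x" if "x \<in> F" for h x
    proof -
      have "Poly_Mapping.lookup (f h) (e x) = (\<Sum>y\<in>F. if y = x then representation F h x else 0)"
        unfolding f_def lookup_sum
        by (rule sum.cong) (use that e_bij in \<open>auto simp: lookup_single when_def bij_betw_def inj_on_def\<close>)
      then show ?thesis using that F_basis(1) by simp
    qed
    then have gf: "g (f h) = h" for h
      using sum_representation_eq[OF ind sp F_basis(1) order_refl, of h] by (simp add: g_def)
    have fg: "f (g p) = p" for p
    proof -
      have "f (g p) = (\<Sum>x\<in>F. Poly_Mapping.single (e x) (Poly_Mapping.lookup p (e x)))"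
        by (simp add: g_def f_simps fF scal_kA5_single)
      also have "\<dots> = (\<Sum>k\<in>UNIV. Poly_Mapping.single k (Poly_Mapping.lookup p k))"
        by (rule sum.reindex_bij_betw[OF e_bij])
      also have "\<dots> = p"
        by (rule poly_mapping_eqI) (simp add: lookup_sum lookup_single when_def finite_alt5)
      finally show ?thesis .
    qed
    show ?thesis by (rule bij_betw_byWitness[where f' = g]) (auto simp: fg gf)
  qed
  have f_mult: "f (x * y) = f x * f y" for x y
  proof (rule F_induct[of "\<lambda>x. f (x * y) = f x * f y"])
    fix s x z assume x: "x \<in> F" and IH: "f (z * y) = f z * f y"
    have "f (x * y) = f x * f y"
    proof (rule F_induct[of "\<lambda>y. f (x * y) = f x * f y"])
      fix s y w assume y: "y \<in> F" and IH: "f (x * w) = f x * f w"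
      have "f (x * y) = f x * f y" using x y by (simp add: fF F_mult e_mult mult_single)
      then show "f (x * (hscal s y + w)) = f x * f (hscal s y + w)"
        by (simp add: distrib_left scal_mult_right f_simps IH tensor_algebra.scal_mult_right'[OF tensor_algebra_kA5])
    qed (simp add: f_simps)
    then show "f ((hscal s x + z) * y) = f (hscal s x + z) * f y"
      by (simp add: distrib_right scal_mult_left f_simps IH tensor_algebra.scal_mult_left'[OF tensor_algebra_kA5])
  qed (simp add: f_simps)
  have f_one: "f 1 = 1" by (simp add: fF F_one e_one)
  let ?\<Phi> = "tens2_map H kA5 f"
  note \<Phi>_simps = tens2_map_simps[OF tensor_algebra_kA5 f_lin]
  note \<Phi>_mult = tens2_map_mult[OF tensor_algebra_kA5 f_lin f_mult]
  note \<Phi>_T = tens2_map_T[OF tensor_algebra_kA5 f_lin]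
  have f\<epsilon>: "f (\<epsilon> g) = char_idem V (chr g)" for g
  proof -
    have "f (\<epsilon> g) = (\<Sum>h\<in>\<Gamma>. Poly_Mapping.single (e h) (\<beta> g h / 4))"
      by (simp add: \<epsilon>_def f_simps fF \<Gamma>_F scal_kA5_single)
    also have "\<dots> = (\<Sum>w\<in>V. Poly_Mapping.single (e (\<iota> w)) (\<beta> g (\<iota> w) / 4))"
      by (rule sum.reindex_bij_betw[OF \<iota>_bij, symmetric])
    also have "\<dots> = char_idem V (chr g)"
      unfolding char_idem_def
    proof (rule sum.cong[OF refl])
      fix w assume w: "w \<in> V"
      have "w \<in> carrier (alt_group 5)" using subgroup.subset[OF V_subgroup] w by blast
      then have "inv\<^bsub>alt_group 5\<^esub> w = w"
        using V_square[OF w] by (intro group.inv_equality[OF alt_group_is_group]) (simp_all add: alt_group_mult alt_group_one)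
      then show "Poly_Mapping.single (e (\<iota> w)) (\<beta> g (\<iota> w) / 4) =
          Poly_Mapping.single (Abs_alt5 w) (chr g (inv\<^bsub>alt_group 5\<^esub> w) / of_nat (card V))"
        by (simp add: e_def \<pi>_\<iota> w chr_def V_card)
    qed
    finally show ?thesis .
  qed
  have \<Phi>J: "?\<Phi> J = cocycle_twist V \<alpha>"
  proof -
    have "?\<Phi> J = (\<Sum>g\<in>\<Gamma>. \<Sum>h\<in>\<Gamma>. tens_scale (\<alpha> (chr g) (chr h)) (tens2 kA5 (char_idem V (chr g)) (char_idem V (chr h))))"
      by (simp add: J_def diag_def tens2_map_sum[OF tensor_algebra_kA5 f_lin] \<Phi>_simps T_sum f\<epsilon> al\<alpha>)
    also have "\<dots> = cocycle_twist V \<alpha>"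
      unfolding cocycle_twist_def carrier_CG sum.reindex[OF chr_inj] o_def ..
    finally show ?thesis .
  qed
  have inv: "tens_inverse kA5 (cocycle_twist V \<alpha>) = ?\<Phi> J'"
    unfolding \<Phi>J[symmetric]
    by (rule tensor_algebra.tens_inverse_eq[OF tensor_algebra_kA5])
      (simp_all add: \<Phi>_T flip: \<Phi>_mult, simp_all add: J_inv \<Phi>_simps f_one)
  define D where "D p = tens_mult kA5 (tens_mult kA5 (?\<Phi> J') (comult kA5 p)) (?\<Phi> J)" for p
  have D_lin: "D (scal kA5 s p + q) = tens_scale s (D p) + D q" "D 0 = 0" for s p q
    by (simp_all add: tensor_algebra.T_scale[OF tensor_algebra_kA5] tensor_algebra.tmult_in[OF tensor_algebra_kA5] D_def comult_kA5_linear \<Phi>_T tensor_algebra.tmult_add_right[OF tensor_algebra_kA5]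
        tensor_algebra.tmult_add_left[OF tensor_algebra_kA5] tensor_algebra.tmult_scale_right[OF tensor_algebra_kA5]
        tensor_algebra.tmult_scale_left[OF tensor_algebra_kA5] tensor_algebra.tmult_zero_right[OF tensor_algebra_kA5]
        tensor_algebra.tmult_zero_left[OF tensor_algebra_kA5])
  have L: "scal (twisted_alt5_algebra V \<alpha>) = scal kA5" "counit (twisted_alt5_algebra V \<alpha>) = counit kA5"
    "comult (twisted_alt5_algebra V \<alpha>) = D"
    by (simp_all add: twisted_alt5_algebra_def twisted_def D_def[abs_def] inv \<Phi>J)
  have comult: "D (f h) = ?\<Phi> (comult H h)" for h
  proof (rule F_induct[of "\<lambda>h. D (f h) = ?\<Phi> (comult H h)"])
    fix s x y assume x: "x \<in> F" and IH: "D (f y) = ?\<Phi> (comult H y)"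
    have "?\<Phi> (comult H x) = tens_mult kA5 (tens_mult kA5 (?\<Phi> J') (?\<Phi> (x \<boxtimes> x))) (?\<Phi> J)"
      using x by (simp add: F_def \<Phi>_mult)
    also have "?\<Phi> (x \<boxtimes> x) = comult kA5 (f x)" using x by (simp add: \<Phi>_simps fF comult_kA5_single)
    finally have "D (f x) = ?\<Phi> (comult H x)" by (simp add: D_def)
    then show "D (f (hscal s x + y)) = ?\<Phi> (comult H (hscal s x + y))"
      by (simp add: f_simps D_lin IH comult_simps \<Phi>_simps)
  qed (simp add: f_simps D_lin comult_simps \<Phi>_simps)
  have counit: "counit kA5 (f h) = counit H h" for h
  proof (rule F_induct[of "\<lambda>h. counit kA5 (f h) = counit H h"])
    fix s x y assume x: "x \<in> F" and IH: "counit kA5 (f y) = counit H y"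
    have "counit kA5 (f x) = 1"
      using x by (simp add: fF counit_kA5 lookup_single when_def finite_alt5)
    then show "counit kA5 (f (hscal s x + y)) = counit H (hscal s x + y)"
      using x IH by (simp add: f_simps counit_kA5 lookup_add lookup_scal_kA5 sum.distrib counit_simps F_def
          flip: sum_distrib_left)
  qed (simp add: f_simps counit_kA5 counit_simps)
  have "tens2_map H (twisted_alt5_algebra V \<alpha>) f = ?\<Phi>" by (simp add: tens2_map_def L)
  then have "coalg_iso H (twisted_alt5_algebra V \<alpha>) f"
    unfolding coalg_iso_def by (simp add: L f_lin f_bij comult counit)
  then show ?thesis unfolding hopf_isomorphic_def using f_mult f_one by blast
qed

end

section \<open>The initial basis\<close>

lemma linD:
  assumes "Vector_Spaces.linear s t f"
  shows "f (x + y) = f x + f y" "f (s c x) = t c (f x)" "f 0 = 0" "f (sum u I) = (\<Sum>i\<in>I. f (u i))"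
    "vector_space s" "vector_space t"
proof -
  interpret l: Vector_Spaces.linear s t f by fact
  show "f (x + y) = f x + f y" "f (s c x) = t c (f x)" "f 0 = 0" "f (sum u I) = (\<Sum>i\<in>I. f (u i))"
    by (simp_all add: l.add l.scale l.zero l.sum)
  show "vector_space s" "vector_space t" by unfold_locales
qed

lemma bilinear_mapI:
  assumes "vector_space sa" "vector_space sb" "vector_space s"
    "\<And>x y z. f (x + y) z = f x z + f y z" "\<And>x y z. f x (y + z) = f x y + f x z"
    "\<And>c x y. f (sa c x) y = s c (f x y)" "\<And>c x y. f x (sb c y) = s c (f x y)"
  shows "bilinear_map sa sb s f"
  unfolding bilinear_map_def by (intro conjI allI linearI assms)

lemma bilinear_tens_map:
  assumes u: "Vector_Spaces.linear sa s u"
  shows "bilinear_map sa sa tens_scale (\<lambda>a b. tens s s (u a) (u b))"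
proof (rule bilinear_mapI[OF linD(5)[OF u] linD(5)[OF u] tens_scale_vector_space])
  have lin: "B (x + y) z = B x z + B y z" "B z (x + y) = B z x + B z y" "B (s c x) z = c * B x z" "B z (s c x) = c * B z x"
    if "bilinear_map s s (*) B" for B x y z c
    using that unfolding bilinear_map_def by (meson linD(1,2))+
  fix x y z c
  show "tens s s (u (x + y)) (u z) = tens s s (u x) (u z) + tens s s (u y) (u z)"
    "tens s s (u x) (u (y + z)) = tens s s (u x) (u y) + tens s s (u x) (u z)"
    "tens s s (u (sa c x)) (u y) = tens_scale c (tens s s (u x) (u y))"
    "tens s s (u x) (u (sa c y)) = tens_scale c (tens s s (u x) (u y))"
    by (auto simp: fun_eq_iff tens_def tens_scale_def linD(1,2)[OF u] lin plus_fun_apply)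
qed

lemma tens_lift_sum_set:
  assumes s: "vector_space s" and f: "bilinear_map sa sb s f" and I: "finite I"
  shows "tens_lift sa sb f (\<Sum>i\<in>I. tens sa sb (x i) (y i)) = (\<Sum>i\<in>I. f (x i) (y i))"
proof -
  obtain js where js: "set js = I" "distinct js" using finite_distinct_list[OF I] by blast
  have l: "(\<Sum>i\<in>I. F i) = (\<Sum>(v, w)\<leftarrow>map (\<lambda>i. (x i, y i)) js. K v w)"
    if "\<And>i. F i = K (x i) (y i)" for F :: "_ \<Rightarrow> 'z::comm_monoid_add" and K
    using js that by (simp add: sum_list_distinct_conv_sum_set comp_def)
  show ?thesis
    unfolding l[of "\<lambda>i. tens sa sb (x i) (y i)" "tens sa sb", OF refl] l[of "\<lambda>i. f (x i) (y i)" f, OF refl]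
    by (rule tens_lift_sum[OF s f])
qed

lemma tens_lift_zero:
  assumes "vector_space s" "bilinear_map sa sb s f"
  shows "tens_lift sa sb f 0 = 0"
  using tens_lift_sum_set[OF assms, of "{}"] by simp

lemma vector_space_copies: "vector_space s \<Longrightarrow> vector_space (copies_scale s)"
  by (auto simp: vector_space_def copies_scale_def vec_eq_iff)

lemma vector_space_sum_scale: "vector_space s \<Longrightarrow> vector_space t \<Longrightarrow> vector_space (sum_scale s t)"
  by (auto simp: vector_space_def sum_scale_def)

lemma vector_space_matrix: "vector_space matrix_scale"
  by (auto simp: vector_space_def matrix_scale_def vec_eq_iff algebra_simps)

lemma linear_axis:
  fixes s :: "'k::field \<Rightarrow> 'c::ab_group_add \<Rightarrow> 'c"
  assumes s: "vector_space s"
  shows "Vector_Spaces.linear s (copies_scale s) (axis i)"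
proof (rule linearI[OF s vector_space_copies[OF s]])
  interpret vector_space s by fact
  show "axis i (x + y) = axis i x + axis i y" for x y :: 'c by (simp add: vec_eq_iff axis_def)
  show "axis i (s c x) = copies_scale s c (axis i x)" for c x by (simp add: vec_eq_iff axis_def copies_scale_def)
qed

lemma linear_injections:
  assumes s: "vector_space s" and t: "vector_space t"
  shows "Vector_Spaces.linear s (sum_scale s t) (\<lambda>a. (a, 0))" "Vector_Spaces.linear t (sum_scale s t) (\<lambda>a. (0, a))"
proof -
  interpret s: vector_space s by fact
  interpret t: vector_space t by fact
  show "Vector_Spaces.linear s (sum_scale s t) (\<lambda>a. (a, 0))" "Vector_Spaces.linear t (sum_scale s t) (\<lambda>a. (0, a))"
    by (auto intro!: linearI s t vector_space_sum_scale simp: sum_scale_def)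
qed

lemma tens_scale_0_1: "tens_scale 0 t = 0" "tens_scale 1 t = t" "tens_scale c 0 = 0"
  by (simp_all add: tens_scale_def fun_eq_iff zero_fun_apply)

lemma comult_copies_axis:
  fixes C :: "('k::field, 'c::ab_group_add) coalg"
  assumes s: "vector_space (scal C)" and C0: "comult C 0 = 0" and I: "finite I"
    and x: "comult C x = (\<Sum>i\<in>I. tens2 C (p i) (q i))"
  shows "comult (coalg_copies C) (axis (n :: 'n::finite) x) =
    (\<Sum>i\<in>I. tens2 (coalg_copies C :: ('k, 'c ^ 'n) coalg) (axis n (p i)) (axis n (q i)))"
    "comult (coalg_copies C :: ('k, 'c ^ 'n) coalg) 0 = 0"
proof -
  let ?s = "copies_scale (scal C) :: 'k \<Rightarrow> 'c ^ 'n \<Rightarrow> 'c ^ 'n"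
  note b = bilinear_tens_map[OF linear_axis[OF s]]
  note v = tens_scale_vector_space
  have sc: "scal (coalg_copies C :: ('k, 'c ^ 'n) coalg) = ?s" by (simp add: coalg_copies_def Let_def)
  have cm: "comult (coalg_copies C) (y :: 'c ^ 'n) = (\<Sum>i\<in>UNIV. tens2_lift C (\<lambda>a b. tens ?s ?s (axis i a) (axis i b)) (comult C (y $ i)))" for y
    by (simp add: coalg_copies_def Let_def)
  show "comult (coalg_copies C :: ('k, 'c ^ 'n) coalg) 0 = 0"
    unfolding cm by (simp add: C0 tens_lift_zero[OF v b])
  have "comult (coalg_copies C) (axis n x) = (\<Sum>m\<in>UNIV. if m = n then \<Sum>i\<in>I. tens ?s ?s (axis n (p i)) (axis n (q i)) else 0)"
    unfolding cm
    by (rule sum.cong[OF refl]) (auto simp: axis_def[of n x] C0 tens_lift_zero[OF v b] x tens_lift_sum_set[OF v b I])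
  then show "comult (coalg_copies C) (axis (n :: 'n::finite) x) =
    (\<Sum>i\<in>I. tens2 (coalg_copies C :: ('k, 'c ^ 'n) coalg) (axis n (p i)) (axis n (q i)))" by (simp add: sc)
qed

lemma comult_sum_injections:
  fixes C :: "('k::field, 'c::ab_group_add) coalg" and D :: "('k, 'd::ab_group_add) coalg"
  assumes s: "vector_space (scal C)" and t: "vector_space (scal D)" and 0: "comult C 0 = 0" "comult D 0 = 0" and I: "finite I"
  shows "comult C x = (\<Sum>i\<in>I. tens2 C (p i) (q i)) \<Longrightarrow>
      comult (coalg_sum C D) (x, 0) = (\<Sum>i\<in>I. tens2 (coalg_sum C D) (p i, 0) (q i, 0))"
    "comult D y = (\<Sum>i\<in>I. tens2 D (p' i) (q' i)) \<Longrightarrow>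
      comult (coalg_sum C D) (0, y) = (\<Sum>i\<in>I. tens2 (coalg_sum C D) (0, p' i) (0, q' i))"
proof -
  note b = linear_injections[OF s t, THEN bilinear_tens_map]
  note v = tens_scale_vector_space
  show "comult C x = (\<Sum>i\<in>I. tens2 C (p i) (q i)) \<Longrightarrow>
      comult (coalg_sum C D) (x, 0) = (\<Sum>i\<in>I. tens2 (coalg_sum C D) (p i, 0) (q i, 0))"
    "comult D y = (\<Sum>i\<in>I. tens2 D (p' i) (q' i)) \<Longrightarrow>
      comult (coalg_sum C D) (0, y) = (\<Sum>i\<in>I. tens2 (coalg_sum C D) (0, p' i) (0, q' i))"
    by (simp_all add: coalg_sum_def Let_def 0 tens_lift_zero[OF v b(1)] tens_lift_zero[OF v b(2)]
        tens_lift_sum_set[OF v b(1) I] tens_lift_sum_set[OF v b(2) I])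
qed

text \<open>Lifting the inverse of \<open>f\<close> to both tensor factors undoes
  \<open>tens2_map C D f\<close>, so a formula for the comultiplication in \<open>D\<close> can be
  pulled back to \<open>C\<close>.\<close>

lemma comult_of_iso:
  assumes C: "coalgebra C" and f: "coalg_iso C D f" and I: "finite I"
    and x: "comult D (f x) = (\<Sum>i\<in>I. tens2 D (f (p i)) (f (q i)))"
  shows "comult C x = (\<Sum>i\<in>I. tens2 C (p i) (q i))"
proof -
  interpret C: coalgebra C by fact
  have lin: "Vector_Spaces.linear (scal C) (scal D) f" and bij: "bij f"
    and cm: "comult D (f x) = tens2_map C D f (comult C x)" using f by (simp_all add: coalg_iso_def)
  let ?g = "Hilbert_Choice.inv f"
  have gf: "?g (f y) = y" and fg: "f (?g z) = z" for y z
    using bij by (simp_all add: bij_is_inj bij_is_surj surj_f_inv_f)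
  have g: "Vector_Spaces.linear (scal D) (scal C) ?g"
  proof (rule linearI[OF linD(6)[OF lin] linD(5)[OF lin]])
    show "?g (y + z) = ?g y + ?g z" for y z using linD(1)[OF lin, of "?g y" "?g z"] gf fg by metis
    show "?g (scal D c y) = scal C c (?g y)" for c y using linD(2)[OF lin, of c "?g y"] gf fg by metis
  qed
  note v = tens_scale_vector_space
  obtain xs where xs: "comult C x = (\<Sum>(a, b)\<leftarrow>xs. tens2 C a b)"
    using C.comult_in[of x] by (auto simp: tens_space_def)
  have "tens2_map C D f (comult C x) = (\<Sum>(a, b)\<leftarrow>xs. tens2 D (f a) (f b))"
    unfolding tens2_map_def xs by (rule tens_lift_sum[OF v bilinear_tens_map[OF lin]])
  also have "\<dots> = (\<Sum>(a, b)\<leftarrow>map (\<lambda>(a, b). (f a, f b)) xs. tens2 D a b)"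
    by (simp add: comp_def split_def)
  finally have "tens2_lift D (\<lambda>a b. tens2 C (?g a) (?g b)) (comult D (f x)) =
      (\<Sum>(a, b)\<leftarrow>map (\<lambda>(a, b). (f a, f b)) xs. tens2 C (?g a) (?g b))"
    unfolding cm by (simp only: tens_lift_sum[OF v bilinear_tens_map[OF g]])
  also have "\<dots> = comult C x" by (simp add: xs comp_def split_def gf)
  finally show ?thesis
    unfolding x tens_lift_sum_set[OF v bilinear_tens_map[OF g] I] gf by (rule sym)
qed

text \<open>Everything is transported from the model coalgebra: preimages of the unit vectors of
  \<open>k^12\<close> are the group-likes, those of the matrix units are the entries of the
  comatrices.\<close>

lemma exists_cobasis:
  fixes H :: "('k::{alg_closed_field, field_char_0}, 'h::ring_1) coalg"
  assumes hopf: "hopf_algebra H S"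
    and iso: "coalg_isomorphic H
           (coalg_sum (coalg_copies ground_coalg :: ('k, 'k ^ 12) coalg)
                      (coalg_copies matrix_coalg :: ('k, 'k ^ 4 ^ 4 ^ 3) coalg))"
  shows "\<exists>G cc \<gamma> \<kappa>. cobasis H S G cc \<gamma> \<kappa>"
proof -
  interpret hopf_algebra H S by fact
  let ?A = "coalg_copies ground_coalg :: ('k, 'k ^ 12) coalg"
  let ?B = "coalg_copies matrix_coalg :: ('k, 'k ^ 4 ^ 4 ^ 3) coalg"
  let ?M = "coalg_sum ?A ?B"
  obtain f where f: "coalg_iso H ?M f" using iso by (auto simp: coalg_isomorphic_def)
  have lin: "Vector_Spaces.linear (scal H) (scal ?M) f" and bij: "bij f"
    and cu: "counit H x = counit ?M (f x)" for x using f by (simp_all add: coalg_iso_def)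
  have gf: "Hilbert_Choice.inv f (f y) = y" and fg: "f (Hilbert_Choice.inv f z) = z" for y z
    using bij by (simp_all add: bij_is_inj bij_is_surj surj_f_inv_f)
  have scA: "scal ?A = copies_scale (*)" and scB: "scal ?B = copies_scale matrix_scale"
    and scM: "scal ?M = sum_scale (copies_scale (*)) (copies_scale matrix_scale)"
    by (simp_all add: coalg_copies_def coalg_sum_def ground_coalg_def matrix_coalg_def Let_def)
  have vs: "vector_space (scal (ground_coalg :: ('k, 'k) coalg))" "vector_space (scal (matrix_coalg :: ('k, 'k ^ 4 ^ 4) coalg))"
    "vector_space (scal ?A)" "vector_space (scal ?B)"
    unfolding scA scB by (simp_all add: ground_coalg_def matrix_coalg_def field_vector_space vector_space_matrix vector_space_copies)
  have g0: "comult (ground_coalg :: ('k, 'k) coalg) 0 = 0" "comult (matrix_coalg :: ('k, 'k ^ 4 ^ 4) coalg) 0 = 0"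
    by (simp_all add: ground_coalg_def matrix_coalg_def tens_scale_0_1)
  have g1: "comult (ground_coalg :: ('k, 'k) coalg) 1 = (\<Sum>i\<in>{()}. tens2 ground_coalg 1 1)"
    by (simp add: ground_coalg_def tens_scale_0_1)
  have ge: "comult (matrix_coalg :: ('k, 'k ^ 4 ^ 4) coalg) (matrix_unit i j) = (\<Sum>l\<in>UNIV. tens2 matrix_coalg (matrix_unit i l) (matrix_unit l j))" for i j
  proof -
    let ?t = "\<lambda>i j. \<Sum>l\<in>UNIV. tens matrix_scale matrix_scale (matrix_unit i l) (matrix_unit l j) :: ('k, 'k ^ 4 ^ 4, 'k ^ 4 ^ 4) tensor"
    have "comult (matrix_coalg :: ('k, 'k ^ 4 ^ 4) coalg) (matrix_unit i j) =
        (\<Sum>p\<in>UNIV. \<Sum>q\<in>UNIV. if p = i then if q = j then ?t p q else 0 else 0)"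
      unfolding matrix_coalg_def
      by (simp, intro sum.cong refl) (auto simp: matrix_unit_def axis_def tens_scale_0_1)
    also have "\<dots> = ?t i j" by (rule sum2_delta)
    finally show ?thesis by (simp add: matrix_coalg_def)
  qed
  have A1: "comult ?A (axis i 1) = (\<Sum>_\<in>{()}. tens2 ?A (axis i 1) (axis i 1))" for i
    by (rule comult_copies_axis(1)[OF vs(1) g0(1) _ g1]) simp
  have B1: "comult ?B (axis n (matrix_unit i j)) = (\<Sum>l\<in>UNIV. tens2 ?B (axis n (matrix_unit i l)) (axis n (matrix_unit l j)))" for n i j
    by (rule comult_copies_axis(1)[OF vs(2) g0(2) _ ge]) simp
  have A0: "comult ?A 0 = 0" by (rule comult_copies_axis(2)[OF vs(1) g0(1) _ g1]) simp
  have B0: "comult ?B 0 = 0" by (rule comult_copies_axis(2)[OF vs(2) g0(2) _ ge]) simp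
  have M1: "comult ?M (axis i 1, 0) = (\<Sum>_\<in>{()}. tens2 ?M (axis i 1, 0) (axis i 1, 0))" for i
    by (rule comult_sum_injections(1)[OF vs(3,4) A0 B0 _ A1]) simp
  have M2: "comult ?M (0, axis n (matrix_unit i j)) =
      (\<Sum>l\<in>UNIV. tens2 ?M (0, axis n (matrix_unit i l)) (0, axis n (matrix_unit l j)))" for n i j
    by (rule comult_sum_injections(2)[OF vs(3,4) A0 B0 _ B1]) simp
  \<comment> \<open>\<open>cobasis\<close> numbers the blocks by naturals below 3, while the copies
    in the model are indexed by the type \<open>3\<close>.\<close>
  obtain e :: "nat \<Rightarrow> 3" where e: "bij_betw e {..<3} UNIV"
    using ex_bij_betw_nat_finite[of "UNIV :: 3 set"] by (auto simp: atLeast0LessThan)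
  have e_eq: "e m = e n \<longleftrightarrow> m = n" if "m < 3" "n < 3" for m n
    using e that by (auto simp: bij_betw_def inj_on_def)
  define y where "y i = Hilbert_Choice.inv f (axis i 1, 0)" for i
  define z where "z n i j = Hilbert_Choice.inv f (0, axis n (matrix_unit i j))" for n i j
  have fy: "f (y k) = (axis k 1, 0)" and fz: "f (z n i j) = (0, axis n (matrix_unit i j))" for k n i j
    by (simp_all add: y_def z_def fg)
  have y_inj: "y i = y j \<longleftrightarrow> i = j" for i j
    using fy by (metis Pair_inject axis_eq_axis one_neq_zero)
  \<comment> \<open>The coordinate is indexed by the group-like itself: pairing with the coordinate
    vector of g reads off entry i when g = y i.\<close>
  define \<gamma> where "\<gamma> g x = (\<Sum>i\<in>UNIV. fst (f g) $ i * fst (f x) $ i)" for g x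
  define \<kappa> where "\<kappa> m i j x = snd (f x) $ e m $ i $ j" for m i j x
  define cc where "cc m = Mat (z (e m))" for m
  have \<gamma>y: "\<gamma> (y i) x = fst (f x) $ i" for i x
    by (simp add: \<gamma>_def fy axis_def if_distrib[of "\<lambda>x. x * _"] cong: if_cong)
  have mu: "matrix_unit i j $ p $ q = (if p = i \<and> q = j then 1 else 0 :: 'k)" for i j p q :: 4
    by (simp add: matrix_unit_def axis_def)
  have f_simps: "f (u + v) = f u + f v" "f (scal H t u) = sum_scale (copies_scale (*)) (copies_scale matrix_scale) t (f u)" for u v t
    using linD(1,2)[OF lin] by (simp_all add: scM)
  have "cobasis H S (range y) cc \<gamma> \<kappa>"
  proof (intro cobasis.intro cobasis_axioms.intro)
    show "hopf_algebra H S" by (rule hopf)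
    show "finite (range y)" by simp
    show "card (range y) = 12" using y_inj by (subst card_image) (auto simp: inj_on_def)
    show "glike g" if "g \<in> range y" for g
    proof -
      obtain i where i: "g = y i" using \<open>g \<in> range y\<close> by blast
      have "comult H (y i) = (\<Sum>_\<in>{()}. y i \<boxtimes> y i)"
        by (rule comult_of_iso[OF coalgebra_axioms f]) (simp_all only: fy M1 finite.intros)
      moreover have "counit H (y i) = 1"
        by (simp add: cu fy coalg_sum_def coalg_copies_def ground_coalg_def matrix_coalg_def Let_def axis_def)
      ultimately show ?thesis by (simp add: glike_def i)
    qed
    show "comat (cc m)" for m
      unfolding comat_def
    proof (intro conjI allI)
      fix i j
      show "comult H (ent (cc m) i j) = (\<Sum>l\<in>UNIV. ent (cc m) i l \<boxtimes> ent (cc m) l j)"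
        unfolding cc_def ent_Mat by (rule comult_of_iso[OF coalgebra_axioms f]) (simp_all only: fz M2 finite)
      have "(\<Sum>n\<in>UNIV. \<Sum>p\<in>UNIV. axis (e m) (matrix_unit i j) $ n $ p $ p) = (\<Sum>n\<in>UNIV. if n = e m then \<Sum>p\<in>UNIV. matrix_unit i j $ p $ p else (0 :: 'k))"
        by (rule sum.cong) (auto simp: axis_def)
      also have "\<dots> = (if i = j then 1 else 0)"
        by (cases "i = j") (simp_all add: mu, auto intro: sum.neutral)
      finally show "counit H (ent (cc m) i j) = (if i = j then 1 else 0)"
        by (simp add: cc_def cu fz coalg_sum_def coalg_copies_def ground_coalg_def matrix_coalg_def Let_def)
    qed
    show "lin (\<gamma> g)" for g
      by (rule linearI[OF vector_space_axioms field_vector_space])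
        (simp_all add: \<gamma>_def f_simps sum_scale_def copies_scale_def distrib_left sum.distrib sum_distrib_left mult_ac)
    show "lin (\<kappa> m i j)" for m i j
      by (rule linearI[OF vector_space_axioms field_vector_space])
        (simp_all add: \<kappa>_def f_simps sum_scale_def copies_scale_def matrix_scale_def)
    show "\<gamma> g g' = (if g = g' then 1 else 0)" if "g \<in> range y" "g' \<in> range y" for g g'
      using that by (auto simp: \<gamma>y fy y_inj axis_def)
    show "\<gamma> g (ent (cc m) i j) = 0" if "g \<in> range y" for g m i j
      using that by (auto simp: \<gamma>y cc_def fz)
    show "\<kappa> m i j g = 0" if "g \<in> range y" for g m i j
      using that by (auto simp: \<kappa>_def fy)
    show "\<kappa> m i j (ent (cc n) p q) = (if m = n \<and> i = p \<and> j = q then 1 else 0)" if "m < 3" "n < 3" for m n i j p q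
      using e_eq[OF that] by (auto simp: \<kappa>_def cc_def fz axis_def mu)
    show "x = (\<Sum>g\<in>range y. scal H (\<gamma> g x) g) +
      (\<Sum>m<3. \<Sum>i\<in>UNIV. \<Sum>j\<in>UNIV. scal H (\<kappa> m i j x) (ent (cc m) i j))" for x
    proof -
      have "f ((\<Sum>i\<in>UNIV. scal H (fst (f x) $ i) (y i)) +
          (\<Sum>n\<in>UNIV. \<Sum>i\<in>UNIV. \<Sum>j\<in>UNIV. scal H (snd (f x) $ n $ i $ j) (z n i j))) = f x"
      proof -
        have 1: "(\<Sum>i\<in>UNIV. sum_scale (copies_scale (*)) (copies_scale matrix_scale) (fst (f x) $ i) (axis i 1, 0)) = (fst (f x), 0 :: 'k ^ 4 ^ 4 ^ 3)"
        proof (rule prod_eqI)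
          show "fst (\<Sum>i\<in>UNIV. sum_scale (copies_scale (*)) (copies_scale matrix_scale) (fst (f x) $ i) (axis i 1, 0 :: 'k ^ 4 ^ 4 ^ 3)) = fst (fst (f x), 0 :: 'k ^ 4 ^ 4 ^ 3)"
            by (simp add: fst_sum sum_scale_def copies_scale_def vec_eq_iff axis_def if_distrib[of "\<lambda>x. _ * x"] cong: if_cong)
          show "snd (\<Sum>i\<in>UNIV. sum_scale (copies_scale (*)) (copies_scale matrix_scale) (fst (f x) $ i) (axis i 1, 0 :: 'k ^ 4 ^ 4 ^ 3)) = snd (fst (f x), 0 :: 'k ^ 4 ^ 4 ^ 3)"
            by (simp add: snd_sum sum_scale_def copies_scale_def matrix_scale_def vec_eq_iff)
        qed
        have 2: "(\<Sum>n\<in>UNIV. \<Sum>i\<in>UNIV. \<Sum>j\<in>UNIV. sum_scale (copies_scale (*)) (copies_scale matrix_scale)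
            (snd (f x) $ n $ i $ j) (0, axis n (matrix_unit i j))) = (0 :: 'k ^ 12, snd (f x))"
        proof (rule prod_eqI)
          show "fst (\<Sum>n\<in>UNIV. \<Sum>i\<in>UNIV. \<Sum>j\<in>UNIV. sum_scale (copies_scale (*)) (copies_scale matrix_scale)
            (snd (f x) $ n $ i $ j) (0 :: 'k ^ 12, axis n (matrix_unit i j))) = fst (0 :: 'k ^ 12, snd (f x))"
            by (simp add: fst_sum sum_scale_def copies_scale_def vec_eq_iff)
          have "(\<Sum>n\<in>UNIV. \<Sum>i\<in>UNIV. \<Sum>j\<in>UNIV. snd (f x) $ n $ i $ j * axis n (matrix_unit i j) $ m $ p $ q) = snd (f x) $ m $ p $ q" for m p q
          proof -
            have "(\<Sum>i\<in>UNIV. \<Sum>j\<in>UNIV. snd (f x) $ n $ i $ j * axis n (matrix_unit i j) $ m $ p $ q) =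
                (if n = m then snd (f x) $ m $ p $ q else 0)" for n
            proof -
              have "(\<Sum>i\<in>UNIV. \<Sum>j\<in>UNIV. snd (f x) $ n $ i $ j * axis n (matrix_unit i j) $ m $ p $ q) =
                  (\<Sum>i\<in>UNIV. \<Sum>j\<in>UNIV. if i = p then if j = q then (if n = m then snd (f x) $ m $ p $ q else 0) else 0 else 0)"
                by (intro sum.cong refl) (auto simp: axis_def[of n] mu)
              then show ?thesis by (simp only: sum2_delta)
            qed
            then show ?thesis by simp
          qed
          then show "snd (\<Sum>n\<in>UNIV. \<Sum>i\<in>UNIV. \<Sum>j\<in>UNIV. sum_scale (copies_scale (*)) (copies_scale matrix_scale)
            (snd (f x) $ n $ i $ j) (0 :: 'k ^ 12, axis n (matrix_unit i j))) = snd (0 :: 'k ^ 12, snd (f x))"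
            by (simp add: snd_sum sum_scale_def copies_scale_def matrix_scale_def vec_eq_iff)
        qed
        show ?thesis
          unfolding linD(4)[OF lin] f_simps fy fz 1 2 by simp
      qed
      from injD[OF bij_is_inj[OF bij] this] have x: "x = (\<Sum>i\<in>UNIV. scal H (fst (f x) $ i) (y i)) +
          (\<Sum>n\<in>UNIV. \<Sum>i\<in>UNIV. \<Sum>j\<in>UNIV. scal H (snd (f x) $ n $ i $ j) (z n i j))"
        by (rule sym)
      have 3: "(\<Sum>i\<in>UNIV. scal H (fst (f x) $ i) (y i)) = (\<Sum>g\<in>range y. scal H (\<gamma> g x) g)"
        using y_inj by (subst sum.reindex) (auto simp: inj_on_def \<gamma>y)
      have 4: "(\<Sum>n\<in>UNIV. \<Sum>i\<in>UNIV. \<Sum>j\<in>UNIV. scal H (snd (f x) $ n $ i $ j) (z n i j)) =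
          (\<Sum>m<3. \<Sum>i\<in>UNIV. \<Sum>j\<in>UNIV. scal H (\<kappa> m i j x) (ent (cc m) i j))"
        unfolding \<kappa>_def cc_def ent_Mat by (rule sum.reindex_bij_betw[OF e, symmetric])
      from x show ?thesis unfolding 3 4 .
    qed
  qed
  then show ?thesis by blast
qed

theorem proposition5p11:
  fixes H :: "('k::{alg_closed_field, field_char_0}, 'h::ring_1) coalg"
    and S :: "'h \<Rightarrow> 'h"
    and V :: "(nat \<Rightarrow> nat) set"
    and \<alpha> :: "((nat \<Rightarrow> nat) \<Rightarrow> 'k) \<Rightarrow> ((nat \<Rightarrow> nat) \<Rightarrow> 'k) \<Rightarrow> 'k"
  assumes "hopf_algebra H S"
    and "semisimple TYPE('h)"
    and "vector_space.dim (scal H) UNIV = 60"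
    and "coalg_isomorphic H
           (coalg_sum (coalg_copies ground_coalg :: ('k, 'k ^ 12) coalg)
                      (coalg_copies matrix_coalg :: ('k, 'k ^ 4 ^ 4 ^ 3) coalg))"
    and "simple_hopf_algebra H S"
    and "subgroup V (alt_group 5)"
    and "alt5_sub V \<cong> integer_mod_group 2 \<times>\<times> integer_mod_group 2"
    and "nondegenerate_2cocycle (character_group (alt5_sub V)) \<alpha>"
  shows "hopf_isomorphic H (twisted_alt5_algebra V \<alpha>)"
proof -
  obtain G cc \<gamma> \<kappa>' where cobasis: "cobasis H S G cc \<gamma> \<kappa>'"
    using exists_cobasis[OF assms(1,4)] by blast
  obtain a \<kappa> where based: "based H S G (\<lambda>m. cc 0 * sc (a ^ m)) \<gamma> \<kappa> a (cc 0)"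
    using cobasis.exists_based[OF cobasis] by blast
  have four: "four_subgroup V" using assms(6,7) by (simp add: four_subgroup_def)
  interpret matched H S G "\<lambda>m. cc 0 * sc (a ^ m)" \<gamma> \<kappa> a "cc 0" V
    by (intro matched.intro simple_based.intro based simple_based_axioms.intro assms four)
  obtain \<iota> where \<iota>: "bij_betw \<iota> V \<Gamma>" "\<And>v w. v \<in> V \<Longrightarrow> w \<in> V \<Longrightarrow> \<iota> (v \<circ> w) = \<iota> v * \<iota> w"
    using exists_\<iota> by blast
  interpret identified H S G "\<lambda>m. cc 0 * sc (a ^ m)" \<gamma> \<kappa> a "cc 0" V \<iota>
    by unfold_locales (use \<iota> in auto)
  \<comment> \<open>The twist used inside \<open>H\<close> is the given \<alpha>, pulled back along
    \<open>chr\<close>, so no comparison of different twists remains at the end.\<close>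
  interpret labelled H S G "\<lambda>m. cc 0 * sc (a ^ m)" \<gamma> \<kappa> a "cc 0" "\<lambda>g h. \<alpha> (chr g) (chr h)" V \<iota>
    by unfold_locales (use \<iota> assms(3) coc_of_nondegenerate[OF assms(8)] in auto)
  show ?thesis
    by (rule hopf_isomorphism) (rule refl)
qed

end
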